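(* Let $(M_m,g_m)$ be the Schwarzschild manifold with mass $m>0$, with horizon $\Sigma_H$. Let $\Sigma$ be a closed surface bounding a domain with the horizon $\Sigma_H$ in $(M_m,g_m)$. Let $\Sigma^*$ be the unique rotationally symmetric sphere in $(M_m,g_m)$ which encloses with $\Sigma_H$ a domain with the same (signed) volume as $\Sigma$ does. Then $$\mathcal{C}_{g_m}(\Sigma,M_m^\Sigma)\ge\mathcal{C}_{g_m}(\Sigma^*,M_m^{\Sigma^*}),$$ where $M_m^\Sigma\subset M_m$ is the exterior of $\Sigma$, and similarly for $M_m^{\Sigma^*}$, $\Sigma^*$. Equality holds if and only if $\Sigma=\Sigma^*$.
   Context: $M_m:=\mathbb{R}^3\setminus\{0\}$, $g_m:=\left(1+\frac m{2r}\right)^4g_0$, where $r=|x|$ and $g_0$ is the Euclidean metric; the horizon is $\Sigma_H=\{r=m/2\}$. Rotationally symmetric spheres are the coordinate spheres $\{r=r_0\}$, $r_0\in(0,\infty)$. The surface $\Sigma$ is the boundary of a bounded domain $\Omega\subset\mathbb{R}^3$ containing the origin (so $\Sigma$ is homologous to $\Sigma_H$), and $M_m^\Sigma:=M_m\setminus\Omega$. The signed volume bounded between $\Sigma$ and $\Sigma_H$ is $\mathrm{Vol}_{g_m}(\Omega\setminus B_{m/2}(0))-\mathrm{Vol}_{g_m}(B_{m/2}(0)\setminus\Omega)$. Capacity: $\mathcal{C}_{g_m}(\Sigma,M_m^\Sigma):=\frac1{4\pi}\int_{M_m^\Sigma}|\nabla\phi|^2\,dv$, where $\phi$ is the boundary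 capacity potential: $\Delta_{g_m}\phi=0$ on $M_m^\Sigma$, $\phi=1$ on $\Sigma$, $\phi\to0$ as $r\to\infty$. *)

theory Defs
  imports "HOL-Analysis.Analysis"
begin

section \<open>Smooth functions and closed surfaces\<close>

definition partial :: "'n \<Rightarrow> (real ^ 'n \<Rightarrow> real) \<Rightarrow> real ^ 'n \<Rightarrow> real" where
  "partial i f x = frechet_derivative f (at x) (axis i 1)"

text \<open>Only meant for open sets, since \<open>partial\<close> uses the derivative in the ambient space.\<close>

primrec Ck_on :: "nat \<Rightarrow> (real ^ 'n) set \<Rightarrow> (real ^ 'n \<Rightarrow> real) \<Rightarrow> bool" where
  "Ck_on 0 U f \<longleftrightarrow> continuous_on U f"
| "Ck_on (Suc k) U f \<longleftrightarrow> f differentiable_on U \<and> (\<forall>i. Ck_on k U (partial i f))"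

definition smooth_on :: "(real ^ 'n) set \<Rightarrow> (real ^ 'n \<Rightarrow> real) \<Rightarrow> bool" where
  "smooth_on U f \<longleftrightarrow> (\<forall>k. Ck_on k U f)"

text \<open>A compact smooth embedded hypersurface without boundary, given locally as a regular level
  set.  Connectedness is not required.\<close>

definition closed_surface :: "(real ^ 'n) set \<Rightarrow> bool" where
  "closed_surface S \<longleftrightarrow> compact S \<and> S \<noteq> {} \<and>
     (\<forall>p\<in>S. \<exists>U f. open U \<and> p \<in> U \<and> smooth_on U f \<and>
        (\<forall>x\<in>U. \<exists>i. partial i f x \<noteq> 0) \<and> S \<inter> U = {x \<in> U. f x = 0})"


section \<open>Riemannian metrics in a global coordinate chart\<close>

text \<open>A metric is the matrix field \<open>g\<^sub>i\<^sub>j\<close>; the entries of its inverse are \<open>g\<^sup>i\<^sup>j\<close>.\<close>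

type_synonym 'n metric = "real ^ 'n \<Rightarrow> real ^ 'n ^ 'n"

definition vol_density :: "'n::finite metric \<Rightarrow> real ^ 'n \<Rightarrow> real" where
  "vol_density g x = sqrt (det (g x))"

definition vol_measure :: "'n::finite metric \<Rightarrow> (real ^ 'n) measure" where
  "vol_measure g = density lborel (\<lambda>x. ennreal (vol_density g x))"

definition grad_norm_sq :: "'n::finite metric \<Rightarrow> (real ^ 'n \<Rightarrow> real) \<Rightarrow> real ^ 'n \<Rightarrow> real" where
  "grad_norm_sq g \<phi> x =
     (\<Sum>i\<in>UNIV. \<Sum>j\<in>UNIV. matrix_inv (g x) $ i $ j * partial i \<phi> x * partial j \<phi> x)"

definition laplace_beltrami :: "'n::finite metric \<Rightarrow> (real ^ 'n \<Rightarrow> real) \<Rightarrow> real ^ 'n \<Rightarrow> real" where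
  "laplace_beltrami g \<phi> x = (1 / vol_density g x) *
     (\<Sum>i\<in>UNIV. partial i
        (\<lambda>y. vol_density g y * (\<Sum>j\<in>UNIV. matrix_inv (g y) $ i $ j * partial j \<phi> y)) x)"


section \<open>Capacity\<close>

text \<open>Here \<open>E\<close> is the closed exterior region with boundary \<open>\<Sigma>\<close>, so \<open>E - \<Sigma>\<close> is its interior.  The
  conditions determine \<open>\<phi>\<close> on \<open>E\<close> only; its values elsewhere do not affect the capacity.\<close>

definition is_capacity_potential ::
    "3 metric \<Rightarrow> (real ^ 3) set \<Rightarrow> (real ^ 3) set \<Rightarrow> (real ^ 3 \<Rightarrow> real) \<Rightarrow> bool" where
  "is_capacity_potential g \<Sigma> E \<phi> \<longleftrightarrow>
     continuous_on E \<phi> \<and> Ck_on 2 (E - \<Sigma>) \<phi> \<and>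
     (\<forall>x \<in> E - \<Sigma>. laplace_beltrami g \<phi> x = 0) \<and>
     (\<forall>x\<in>\<Sigma>. \<phi> x = 1) \<and> (\<phi> \<longlongrightarrow> 0) at_infinity"

definition capacity_potential ::
    "3 metric \<Rightarrow> (real ^ 3) set \<Rightarrow> (real ^ 3) set \<Rightarrow> real ^ 3 \<Rightarrow> real" where
  "capacity_potential g \<Sigma> E = (SOME \<phi>. is_capacity_potential g \<Sigma> E \<phi>)"

text \<open>Valued in \<open>ennreal\<close>, so that a divergent energy is \<open>\<infinity>\<close> and not \<open>0\<close>.  The surface \<open>\<Sigma>\<close> itself,
  where \<open>\<phi>\<close> need not be differentiable as a function on the ambient space, is a null set.\<close>

definition capacity :: "3 metric \<Rightarrow> (real ^ 3) set \<Rightarrow> (real ^ 3) set \<Rightarrow> ennreal" where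
  "capacity g \<Sigma> E = ennreal (1 / (4 * pi)) *
     (\<integral>\<^sup>+x\<in>E. ennreal (grad_norm_sq g (capacity_potential g \<Sigma> E) x) \<partial>vol_measure g)"


section \<open>The Schwarzschild manifold\<close>

definition schwarzschild_space :: "(real ^ 3) set" where
  "schwarzschild_space = UNIV - {0}"

definition schwarzschild_metric :: "real \<Rightarrow> 3 metric" where
  "schwarzschild_metric m x = (1 + m / (2 * norm x)) ^ 4 *\<^sub>R mat 1"

definition exterior :: "(real ^ 3) set \<Rightarrow> (real ^ 3) set" where
  "exterior \<Omega> = schwarzschild_space - \<Omega>"

text \<open>The volume between the boundary of \<open>\<Omega>\<close> and the horizon \<open>sphere 0 (m / 2)\<close>.  Both terms are
  finite when \<open>\<Omega>\<close> is a bounded neighbourhood of the origin.\<close>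

definition signed_volume :: "real \<Rightarrow> (real ^ 3) set \<Rightarrow> real" where
  "signed_volume m \<Omega> =
     measure (vol_measure (schwarzschild_metric m)) (\<Omega> - ball 0 (m / 2)) -
     measure (vol_measure (schwarzschild_metric m)) (ball 0 (m / 2) - \<Omega>)"

end

theory Submission
  imports Defs "HOL-Real_Asymp.Real_Asymp"
begin

text \<open>
  For \<open>u = 1 + m/(2r)\<close> the substitution \<open>\<psi> = u \<phi>\<close> turns \<open>g\<close>-harmonic functions into Euclidean harmonic ones,
  and expanding \<open>u\<^sup>2 \<bar>\<nabla>\<phi>\<bar>\<^sup>2\<close> shows that the capacity of \<open>\<Sigma>\<close> is its Euclidean capacity plus \<open>m/2\<close>.
  The Euclidean isocapacitary inequality, obtained from the Brunn--Minkowski inequality by rearrangement, bounds it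
  below by \<open>R + m/2\<close>, where \<open>R\<close> is the volume radius of \<open>\<Omega>\<close>; the sphere of radius \<open>r\<close> has
  capacity \<open>r + m/2\<close>.  Since the volume density \<open>u\<^sup>6\<close> decreases with \<open>r\<close>, a domain with the Schwarzschild
  volume of a centred ball has at least its Euclidean volume, with equality only for the ball.  Capacity potentials
  exist by balayage, with barriers from interior touching balls.
\<close>

text \<open>The capacity is the energy of a potential picked by \<open>SOME\<close>, so existence
  precedes every estimate, and the value on a sphere also needs uniqueness. The potential is only
  continuous up to \<open>\<Sigma>\<close>; every integration by parts is therefore done after
  truncating where it is close to 1, and the margin \<open>\<epsilon>\<close> is removed at the end.
  The isocapacitary inequality is reached without coarea formula, perimeter or gradients of
  rearranged functions. The sup-convolution of \<open>V\<close> with the parabola |x|^2/(4s) is at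
  most V + s |grad V|^2 up to a small error, while its level sets contain neighbourhoods of those of
  \<open>V\<close>. Brunn-Minkowski measures how much larger they are, and comparing the integrals
  of the two functions yields the energy. Strictness is inherited from the volume comparison, so no
  rigidity of the isocapacitary inequality enters. The delicate competitor in the equality case is a
  ball with a closed null set removed, such as a slit: it has the volumes of the ball. It is
  excluded because the domain would lie on both sides of the closed surface
  \<open>\<Sigma>\<close>.\<close>

section \<open>Layer cake, Prekopa-Leindler and Brunn-Minkowski inequalities\<close>

lemma nn_integral_layer_cake:
  fixes f :: "'a \<Rightarrow> real"
  assumes "sigma_finite_measure M" and [measurable]: "f \<in> borel_measurable M"
    and "\<And>x. x \<in> space M \<Longrightarrow> 0 \<le> f x"
  shows "(\<integral>\<^sup>+x. ennreal (f x) \<partial>M) =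
    (\<integral>\<^sup>+t. indicator {0<..} t * emeasure M {x\<in>space M. t < f x} \<partial>lborel)"
proof -
  interpret M: sigma_finite_measure M by fact
  interpret pair_sigma_finite M lborel ..
  have "(\<integral>\<^sup>+x. ennreal (f x) \<partial>M) = (\<integral>\<^sup>+x. (\<integral>\<^sup>+t. indicator {0<..<f x} t \<partial>lborel) \<partial>M)"
    by (intro nn_integral_cong) (simp add: assms)
  also have "\<dots> = (\<integral>\<^sup>+x. (\<integral>\<^sup>+t. indicator {0<..} t * (if t < f x then 1 else 0) \<partial>lborel) \<partial>M)"
    by (intro nn_integral_cong) (auto split: split_indicator)
  also have "\<dots> = (\<integral>\<^sup>+t. (\<integral>\<^sup>+x. indicator {0<..} t * (if t < f x then 1 else 0) \<partial>M) \<partial>lborel)"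
    by (rule Fubini'[symmetric]) measurable
  also have "\<dots> = (\<integral>\<^sup>+t. indicator {0<..} t * emeasure M {x\<in>space M. t < f x} \<partial>lborel)"
  proof (intro nn_integral_cong)
    fix t :: real
    have "(\<integral>\<^sup>+x. indicator {0<..} t * (if t < f x then 1 else 0) \<partial>M) =
      (\<integral>\<^sup>+x. indicator {0<..} t * indicator {x\<in>space M. t < f x} x \<partial>M)"
      by (intro nn_integral_cong) (auto split: split_indicator)
    also have "\<dots> = indicator {0<..} t * emeasure M {x\<in>space M. t < f x}"
      by (subst nn_integral_cmult) auto
    finally show "(\<integral>\<^sup>+x. indicator {0<..} t * (if t < f x then 1 else 0) \<partial>M) =
      indicator {0<..} t * emeasure M {x\<in>space M. t < f x}" .
  qed
  finally show ?thesis .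
qed

lemma emeasure_lborel_translate_vimage:
  fixes A :: "'a::euclidean_space set"
  assumes "A \<in> sets borel"
  shows "emeasure lborel ((\<lambda>x. c + x) -` A) = emeasure lborel A"
proof -
  have "emeasure (distr lborel borel ((+) c)) A = emeasure lborel A"
    by (simp add: lborel_distr_plus)
  then show ?thesis
    using assms by (subst (asm) emeasure_distr) auto
qed

text \<open>One-dimensional Brunn-Minkowski. Translating \<open>A\<close> by a point
  \<open>b0\<close> near Inf B and \<open>B\<close> by a point \<open>a0\<close> near Sup A puts
  both copies inside \<open>C\<close>; the part of the first left of a0 + b0 and the part of the
  second right of it do not overlap. Sup and Inf need not be attained, which costs
  \<open>e\<close>.\<close>

lemma emeasure_sum_set_real:
  fixes A B C :: "real set"
  assumes [measurable]: "A \<in> sets borel" "B \<in> sets borel" "C \<in> sets borel"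
    and ne: "A \<noteq> {}" "B \<noteq> {}" and bdd: "bounded A" "bounded B"
    and sub: "\<And>a b. a \<in> A \<Longrightarrow> b \<in> B \<Longrightarrow> a + b \<in> C"
  shows "emeasure lborel A + emeasure lborel B \<le> emeasure lborel C"
proof (rule ennreal_le_epsilon)
  fix e :: real assume e: "0 < e"
  have bd: "bdd_above A" "bdd_below B"
    using bdd by (auto simp: bounded_imp_bdd_above bounded_imp_bdd_below)
  obtain a0 where a0: "a0 \<in> A" "Sup A - e/2 < a0"
    using less_cSup_iff[OF ne(1) bd(1), of "Sup A - e/2"] e by auto
  obtain b0 where b0: "b0 \<in> B" "b0 < Inf B + e/2"
    using cInf_less_iff[OF ne(2) bd(2), of "Inf B + e/2"] e by auto
  have "emeasure lborel A \<le> emeasure lborel ((A \<inter> {..<a0}) \<union> {a0..Sup A})"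
    using cSup_upper[OF _ bd(1)] by (intro emeasure_mono) auto
  also have "\<dots> \<le> emeasure lborel (A \<inter> {..<a0}) + emeasure lborel {a0..Sup A}"
    by (intro emeasure_subadditive) auto
  also have "emeasure lborel {a0..Sup A} \<le> ennreal (e/2)"
    using a0 cSup_upper[OF a0(1) bd(1)] by (simp add: ennreal_leI)
  finally have A: "emeasure lborel A \<le> emeasure lborel (A \<inter> {..<a0}) + ennreal (e/2)"
    by simp
  have "emeasure lborel B \<le> emeasure lborel ((B \<inter> {b0..}) \<union> {Inf B..b0})"
    using cInf_lower[OF _ bd(2)] by (intro emeasure_mono) auto
  also have "\<dots> \<le> emeasure lborel (B \<inter> {b0..}) + emeasure lborel {Inf B..b0}"
    by (intro emeasure_subadditive) auto
  also have "emeasure lborel {Inf B..b0} \<le> ennreal (e/2)"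
    using b0 cInf_lower[OF b0(1) bd(2)] by (simp add: ennreal_leI)
  finally have B: "emeasure lborel B \<le> emeasure lborel (B \<inter> {b0..}) + ennreal (e/2)"
    by simp
  have "emeasure lborel (A \<inter> {..<a0}) \<le> emeasure lborel ((\<lambda>x. b0 + x) -` (C \<inter> {..<a0+b0}))"
    using sub b0 by (intro emeasure_mono) (auto simp: add.commute)
  also have "\<dots> = emeasure lborel (C \<inter> {..<a0+b0})"
    by (intro emeasure_lborel_translate_vimage) auto
  finally have 1: "emeasure lborel (A \<inter> {..<a0}) \<le> emeasure lborel (C \<inter> {..<a0+b0})" .
  have "emeasure lborel (B \<inter> {b0..}) \<le> emeasure lborel ((\<lambda>x. a0 + x) -` (C \<inter> {a0+b0..}))"
    using sub a0 by (intro emeasure_mono) auto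
  also have "\<dots> = emeasure lborel (C \<inter> {a0+b0..})"
    by (intro emeasure_lborel_translate_vimage) auto
  finally have 2: "emeasure lborel (B \<inter> {b0..}) \<le> emeasure lborel (C \<inter> {a0+b0..})" .
  have "emeasure lborel A + emeasure lborel B
      \<le> (emeasure lborel (A \<inter> {..<a0}) + ennreal (e/2)) + (emeasure lborel (B \<inter> {b0..}) + ennreal (e/2))"
    using A B by (intro add_mono)
  also have "\<dots> = emeasure lborel (A \<inter> {..<a0}) + emeasure lborel (B \<inter> {b0..}) + (ennreal (e/2) + ennreal (e/2))"
    by (simp add: ac_simps)
  also have "ennreal (e/2) + ennreal (e/2) = ennreal e"
    using e by (simp flip: ennreal_plus)
  also have "emeasure lborel (A \<inter> {..<a0}) + emeasure lborel (B \<inter> {b0..})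
      \<le> emeasure lborel (C \<inter> {..<a0+b0}) + emeasure lborel (C \<inter> {a0+b0..})"
    using 1 2 by (intro add_mono)
  also have "\<dots> = emeasure lborel ((C \<inter> {..<a0+b0}) \<union> (C \<inter> {a0+b0..}))"
    by (intro plus_emeasure) auto
  also have "(C \<inter> {..<a0+b0}) \<union> (C \<inter> {a0+b0..}) = C"
    by auto
  finally show "emeasure lborel A + emeasure lborel B \<le> emeasure lborel C + ennreal e"
    by (simp add: add_right_mono)
qed

lemma emeasure_lborel_scale_vimage_real:
  fixes A :: "real set"
  assumes [measurable]: "A \<in> sets borel" and c: "c > 0"
  shows "emeasure lborel ((\<lambda>x. x / c) -` A) = ennreal c * emeasure lborel A"
proof -
  have [measurable]: "(\<lambda>x. x / c) -` A \<in> sets borel"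
    using measurable_sets_borel[of "\<lambda>x. x / c" borel A] by simp
  have "emeasure lborel ((\<lambda>x. x / c) -` A) = (\<integral>\<^sup>+x. indicator ((\<lambda>x. x / c) -` A) x \<partial>lborel)"
    by simp
  also have "\<dots> = ennreal \<bar>c\<bar> * (\<integral>\<^sup>+x. indicator ((\<lambda>x. x / c) -` A) (0 + c * x) \<partial>lborel)"
    using c by (intro nn_integral_real_affine) auto
  also have "(\<integral>\<^sup>+x. indicator ((\<lambda>x. x / c) -` A) (0 + c * x) \<partial>lborel) = (\<integral>\<^sup>+x. indicator A x \<partial>lborel)"
    using c by (intro nn_integral_cong) (auto split: split_indicator)
  finally show ?thesis using c by simp
qed

lemma Youngs_inequality_nonneg:
  fixes a b l :: real
  assumes "0 < l" "l < 1" "0 \<le> a" "0 \<le> b"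
  shows "a powr (1 - l) * b powr l \<le> (1 - l) * a + l * b"
  using Youngs_inequality_0[of "1-l" l a b] assms
  by (cases "a = 0 \<or> b = 0") auto

text \<open>Dividing \<open>f\<close> and \<open>g\<close> by their suprema makes the superlevel
  sets of both nonempty at every level t in (0,1), so the one-dimensional sumset inequality applies
  level by level. Integrating in t gives a weighted arithmetic mean of the normalised integrals,
  which dominates the geometric one. \<open>h\<close> is extended-valued because in the induction on
  the dimension it is a partial integral that may be infinite.\<close>

lemma prekopa_leindler_real:
  fixes f g :: "real \<Rightarrow> real" and h :: "real \<Rightarrow> ennreal"
  assumes l: "0 < l" "l < 1"
    and [measurable]: "f \<in> borel_measurable borel" "g \<in> borel_measurable borel"
      "h \<in> borel_measurable borel"
    and f: "\<And>x. 0 \<le> f x" "\<And>x. f x \<le> M * indicator {-N..N} x"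
    and g: "\<And>x. 0 \<le> g x" "\<And>x. g x \<le> M * indicator {-N..N} x"
    and h: "\<And>x y. ennreal (f x powr (1-l) * g y powr l) \<le> h ((1-l) * x + l * y)"
  shows "ennreal (enn2real (\<integral>\<^sup>+x. f x \<partial>lborel) powr (1-l) * enn2real (\<integral>\<^sup>+x. g x \<partial>lborel) powr l)
    \<le> (\<integral>\<^sup>+x. h x \<partial>lborel)"
proof -
  define F where "F = enn2real (\<integral>\<^sup>+x. f x \<partial>lborel)"
  define G where "G = enn2real (\<integral>\<^sup>+x. g x \<partial>lborel)"
  have M0: "M * indicator {-N..N} x \<le> max M 0" for x :: real
    by (auto split: split_indicator)
  show ?thesis
  proof (cases "F = 0 \<or> G = 0")
    case True
    then show ?thesis using l by (auto simp: F_def G_def)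
  next
    case False
    have bf: "bdd_above (range f)"
      by (intro bdd_aboveI[of _ "max M 0"]) (use f M0 order_trans in blast)
    have bg: "bdd_above (range g)"
      by (intro bdd_aboveI[of _ "max M 0"]) (use g M0 order_trans in blast)
    define a where "a = (SUP x. f x)"
    define b where "b = (SUP x. g x)"
    have fa: "f x \<le> a" for x unfolding a_def by (intro cSUP_upper bf) auto
    have gb: "g x \<le> b" for x unfolding b_def by (intro cSUP_upper bg) auto
    have a0: "a > 0"
    proof (rule ccontr)
      assume "\<not> a > 0"
      then have "f x = 0" for x using fa[of x] f(1)[of x] by linarith
      then have "F = 0" by (simp add: F_def)
      with False show False by simp
    qed
    have b0: "b > 0"
    proof (rule ccontr)
      assume "\<not> b > 0"
      then have "g x = 0" for x using gb[of x] g(1)[of x] by linarith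
      then have "G = 0" by (simp add: G_def)
      with False show False by simp
    qed
    define f1 where "f1 x = f x / a" for x
    define g1 where "g1 x = g x / b" for x
    define \<kappa> where "\<kappa> = a powr (1-l) * b powr l"
    have \<kappa>: "\<kappa> > 0" using a0 b0 by (simp add: \<kappa>_def)
    \<comment> \<open>Truncating at 1 makes the rescaled \<open>h\<close> real-valued and loses
      nothing, since only levels below 1 are compared.\<close>
    define k where "k x = enn2real (min (h x / ennreal \<kappa>) 1)" for x
    have [measurable]: "f1 \<in> borel_measurable borel" "g1 \<in> borel_measurable borel"
      "k \<in> borel_measurable borel"
      unfolding f1_def g1_def k_def by measurable
    have f1: "0 \<le> f1 x" "f1 x \<le> 1" for x using f(1) fa a0 by (auto simp: f1_def)
    have g1: "0 \<le> g1 x" "g1 x \<le> 1" for x using g(1) gb b0 by (auto simp: g1_def)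
    have kh: "ennreal \<kappa> * ennreal (k x) \<le> h x" for x
    proof -
      have "ennreal (k x) = min (h x / ennreal \<kappa>) 1"
        unfolding k_def by (intro ennreal_enn2real) (simp add: min_less_iff_disj)
      then have "ennreal \<kappa> * ennreal (k x) \<le> ennreal \<kappa> * (h x / ennreal \<kappa>)"
        by (intro mult_left_mono) auto
      also have "\<dots> = h x"
        using \<kappa> by (simp add: ennreal_times_divide mult.commute[of "ennreal \<kappa>"] ennreal_mult_divide_eq)
      finally show ?thesis .
    qed
    have kk: "t < k ((1-l) * x + l * y)" if "0 < t" "t < 1" "t < f1 x" "t < g1 y" for t x y
    proof -
      have "t = t powr (1-l) * t powr l"
        using that by (simp flip: powr_add)
      also have "\<dots> < f1 x powr (1-l) * g1 y powr l"
        using that l by (intro mult_strict_mono powr_less_mono2) auto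
      finally have 1: "t < f1 x powr (1-l) * g1 y powr l" .
      have "ennreal (f1 x powr (1-l) * g1 y powr l) = ennreal (f x powr (1-l) * g y powr l) / ennreal \<kappa>"
        using \<kappa> a0 b0 f g
        by (simp add: f1_def g1_def \<kappa>_def powr_divide divide_ennreal)
      also have "\<dots> \<le> h ((1-l) * x + l * y) / ennreal \<kappa>"
        by (intro divide_right_mono_ennreal h)
      finally have 2: "ennreal (f1 x powr (1-l) * g1 y powr l) \<le> h ((1-l) * x + l * y) / ennreal \<kappa>" .
      have "ennreal t < min (h ((1-l) * x + l * y) / ennreal \<kappa>) 1"
      proof -
        have "ennreal t < ennreal (f1 x powr (1-l) * g1 y powr l)"
          using 1 that by (intro ennreal_lessI) auto
        then have "ennreal t < h ((1-l) * x + l * y) / ennreal \<kappa>"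
          using 2 by (rule less_le_trans)
        then show ?thesis using that by simp
      qed
      also have "\<dots> = ennreal (k ((1-l) * x + l * y))"
        unfolding k_def by (intro ennreal_enn2real[symmetric]) (simp add: min_less_iff_disj)
      finally show ?thesis using that by (simp add: ennreal_less_iff)
    qed
    \<comment> \<open>The sumset is formed from the dilated level sets, whose measures carry the
      weights 1 - l and l.\<close>
    have lev: "ennreal (1-l) * emeasure lborel {x. t < f1 x} + ennreal l * emeasure lborel {x. t < g1 x}
        \<le> emeasure lborel {x. t < k x}" if t: "0 < t" "t < 1" for t
    proof -
      let ?A = "(\<lambda>x. x / (1-l)) -` {x. t < f1 x}" and ?B = "(\<lambda>x. x / l) -` {x. t < g1 x}"
      obtain x0 where x0: "t * a < f x0"
      proof -
        have "t * a < a" using t a0 by simp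
        then have "t * a < (SUP x. f x)" by (simp add: a_def)
        then show ?thesis using less_cSUP_iff[of UNIV f "t * a"] bf that by blast
      qed
      obtain y0 where y0: "t * b < g y0"
      proof -
        have "t * b < b" using t b0 by simp
        then have "t * b < (SUP x. g x)" by (simp add: b_def)
        then show ?thesis using less_cSUP_iff[of UNIV g "t * b"] bg that by blast
      qed
      have bdA: "bounded ?A"
      proof (rule boundedI[of _ "(1-l) * N"])
        fix x assume "x \<in> ?A"
        then have "f (x/(1-l)) > 0" using t a0 by (auto simp: f1_def dest: less_trans simp: zero_less_divide_iff)
        then have "x/(1-l) \<in> {-N..N}" using f(2)[of "x/(1-l)"] by (auto split: split_indicator_asm)
        then show "norm x \<le> (1-l) * N" using l by (auto simp: field_simps abs_le_iff)
      qed
      have bdB: "bounded ?B"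
      proof (rule boundedI[of _ "l * N"])
        fix x assume "x \<in> ?B"
        then have "g (x/l) > 0" using t b0 by (auto simp: g1_def dest: less_trans simp: zero_less_divide_iff)
        then have "x/l \<in> {-N..N}" using g(2)[of "x/l"] by (auto split: split_indicator_asm)
        then show "norm x \<le> l * N" using l by (auto simp: field_simps abs_le_iff)
      qed
      have "emeasure lborel ?A + emeasure lborel ?B \<le> emeasure lborel {x. t < k x}"
      proof (rule emeasure_sum_set_real)
        show "?A \<in> sets borel" using measurable_sets_borel[of "\<lambda>x. x / (1-l)" borel "{x. t < f1 x}"] by simp
        show "?B \<in> sets borel" using measurable_sets_borel[of "\<lambda>x. x / l" borel "{x. t < g1 x}"] by simp
        have "(1-l) * x0 \<in> ?A" using x0 a0 l by (simp add: f1_def pos_less_divide_eq)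
        then show "?A \<noteq> {}" by blast
        have "l * y0 \<in> ?B" using y0 b0 l by (simp add: g1_def pos_less_divide_eq)
        then show "?B \<noteq> {}" by blast
        fix x y assume "x \<in> ?A" "y \<in> ?B"
        then show "x + y \<in> {x. t < k x}"
          using kk[of t "x/(1-l)" "y/l"] t l by simp
      qed (use bdA bdB in auto)
      then show ?thesis
        using l emeasure_lborel_scale_vimage_real[of "{x. t < f1 x}" "1-l"]
          emeasure_lborel_scale_vimage_real[of "{x. t < g1 x}" l] by (simp del: vimage_Collect_eq)
    qed
    have LC: "(\<integral>\<^sup>+x. ennreal (p x) \<partial>lborel) = (\<integral>\<^sup>+t. indicator {0<..<1} t * emeasure lborel {x. t < p x} \<partial>lborel)"
      if [measurable]: "p \<in> borel_measurable borel" and "\<And>x. 0 \<le> p x" "\<And>x. p x \<le> 1" for p :: "real \<Rightarrow> real"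
    proof -
      have "(\<integral>\<^sup>+x. ennreal (p x) \<partial>lborel) = (\<integral>\<^sup>+t. indicator {0<..} t * emeasure lborel {x. t < p x} \<partial>lborel)"
        using nn_integral_layer_cake[of lborel p] that by (simp add: sigma_finite_lborel)
      also have "\<dots> = (\<integral>\<^sup>+t. indicator {0<..<1} t * emeasure lborel {x. t < p x} \<partial>lborel)"
      proof (intro nn_integral_cong)
        fix t :: real
        have "{x. t < p x} = {}" if "t \<ge> 1" using that \<open>\<And>x. p x \<le> 1\<close> by (auto simp: not_less intro: order_trans)
        then show "indicator {0<..} t * emeasure lborel {x. t < p x} = indicator {0<..<1} t * emeasure lborel {x. t < p x}"
          by (cases "t \<ge> 1") (auto split: split_indicator)
      qed
      finally show ?thesis .
    qed
    have k01: "0 \<le> k x" "k x \<le> 1" for x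
      unfolding k_def using enn2real_mono[of "min (h x / ennreal \<kappa>) 1" 1] by auto
    have mt: "(\<lambda>t. emeasure lborel {x. t < p x}) \<in> borel_measurable lborel"
      if [measurable]: "p \<in> borel_measurable borel" for p :: "real \<Rightarrow> real"
      by measurable
    note [measurable] = mt
    have fin: "(\<integral>\<^sup>+x. f x \<partial>lborel) < \<infinity>" "(\<integral>\<^sup>+x. g x \<partial>lborel) < \<infinity>"
    proof -
      have fi: "(\<integral>\<^sup>+x. ennreal (M * indicator {-N..N} x) \<partial>lborel) < \<infinity>"
      proof -
        have "(\<integral>\<^sup>+x. ennreal (M * indicator {-N..N} x) \<partial>lborel) \<le> (\<integral>\<^sup>+x. ennreal \<bar>M\<bar> * indicator {-N..N} x \<partial>lborel)"
          by (intro nn_integral_mono) (auto split: split_indicator simp: ennreal_leI)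
        also have "\<dots> = ennreal \<bar>M\<bar> * emeasure lborel {-N..N}"
          by (simp add: nn_integral_cmult)
        also have "\<dots> < \<infinity>" using emeasure_lborel_Icc_eq[of "-N" N] by (simp add: ennreal_mult_less_top)
        finally show ?thesis .
      qed
      show "(\<integral>\<^sup>+x. f x \<partial>lborel) < \<infinity>"
        by (rule le_less_trans[OF nn_integral_mono fi]) (simp add: f ennreal_leI)
      show "(\<integral>\<^sup>+x. g x \<partial>lborel) < \<infinity>"
        by (rule le_less_trans[OF nn_integral_mono fi]) (simp add: g ennreal_leI)
    qed
    have Fe: "ennreal F = (\<integral>\<^sup>+x. f x \<partial>lborel)" "ennreal G = (\<integral>\<^sup>+x. g x \<partial>lborel)"
      using fin by (auto simp: F_def G_def)
    have F0: "F \<ge> 0" "G \<ge> 0" by (auto simp: F_def G_def)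
    have F1: "(\<integral>\<^sup>+x. f1 x \<partial>lborel) = ennreal (F / a)"
    proof -
      have "(\<integral>\<^sup>+x. f1 x \<partial>lborel) = (\<integral>\<^sup>+x. ennreal (f x) / ennreal a \<partial>lborel)"
        using a0 f(1) by (intro nn_integral_cong) (simp add: f1_def divide_ennreal)
      also have "\<dots> = (\<integral>\<^sup>+x. ennreal (f x) \<partial>lborel) / ennreal a"
        by (rule nn_integral_divide) measurable
      also have "\<dots> = ennreal (F / a)"
        using a0 F0 by (simp add: Fe[symmetric] divide_ennreal)
      finally show ?thesis .
    qed
    have G1: "(\<integral>\<^sup>+x. g1 x \<partial>lborel) = ennreal (G / b)"
    proof -
      have "(\<integral>\<^sup>+x. g1 x \<partial>lborel) = (\<integral>\<^sup>+x. ennreal (g x) / ennreal b \<partial>lborel)"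
        using b0 g(1) by (intro nn_integral_cong) (simp add: g1_def divide_ennreal)
      also have "\<dots> = (\<integral>\<^sup>+x. ennreal (g x) \<partial>lborel) / ennreal b"
        by (rule nn_integral_divide) measurable
      also have "\<dots> = ennreal (G / b)"
        using b0 F0 by (simp add: Fe[symmetric] divide_ennreal)
      finally show ?thesis .
    qed
    have "ennreal (F powr (1-l) * G powr l) = ennreal (\<kappa> * ((F/a) powr (1-l) * (G/b) powr l))"
      using a0 b0 F0 by (simp add: \<kappa>_def powr_divide)
    also have "\<dots> \<le> ennreal (\<kappa> * ((1-l) * (F/a) + l * (G/b)))"
      using l F0 a0 b0 \<kappa> by (intro ennreal_leI mult_left_mono Youngs_inequality_nonneg) auto
    also have "\<dots> = ennreal \<kappa> * (ennreal (1-l) * ennreal (F/a) + ennreal l * ennreal (G/b))"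
    proof -
      have "ennreal ((1-l) * (F/a) + l * (G/b)) = ennreal ((1-l) * (F/a)) + ennreal (l * (G/b))"
        using l F0 a0 b0 by (intro ennreal_plus) auto
      also have "\<dots> = ennreal (1-l) * ennreal (F/a) + ennreal l * ennreal (G/b)"
        using l F0 a0 b0 by (intro arg_cong2[of _ _ _ _ "(+)"] ennreal_mult) auto
      finally show ?thesis
        using \<kappa> l F0 a0 b0 by (subst ennreal_mult) (auto intro!: add_nonneg_nonneg)
    qed
    also have "ennreal (1-l) * ennreal (F/a) + ennreal l * ennreal (G/b) =
       (\<integral>\<^sup>+t. ennreal (1-l) * (indicator {0<..<1} t * emeasure lborel {x. t < f1 x}) +
             ennreal l * (indicator {0<..<1} t * emeasure lborel {x. t < g1 x}) \<partial>lborel)"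
      unfolding F1[symmetric] G1[symmetric]
      by (subst nn_integral_add) (auto simp: nn_integral_cmult LC[OF _ f1] LC[OF _ g1])
    also have "\<dots> \<le> (\<integral>\<^sup>+t. indicator {0<..<1} t * emeasure lborel {x. t < k x} \<partial>lborel)"
      using lev by (intro nn_integral_mono) (auto split: split_indicator)
    also have "\<dots> = (\<integral>\<^sup>+x. k x \<partial>lborel)"
      by (rule LC[symmetric]) (auto simp: k01)
    also have "ennreal \<kappa> * \<dots> = (\<integral>\<^sup>+x. ennreal \<kappa> * k x \<partial>lborel)"
      by (rule nn_integral_cmult[symmetric]) auto
    also have "\<dots> \<le> (\<integral>\<^sup>+x. h x \<partial>lborel)"
      by (intro nn_integral_mono kh)
    finally show ?thesis unfolding F_def G_def by (simp add: mult_left_mono)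
  qed
qed

text \<open>Induction on the coordinates: the slices at fixed values of the new coordinate obey the
  inequality in the old ones, and this says exactly that the integrals over the slices satisfy the
  hypothesis of the one-dimensional case. The box bound is carried along to keep these integrals
  finite, since \<open>enn2real\<close> turns an infinite integral into 0.\<close>

lemma prekopa_leindler_PiM:
  fixes l N :: real
  assumes l: "0 < l" "l < 1" and "0 \<le> N" and "finite I"
  shows "\<And>(f :: ('i \<Rightarrow> real) \<Rightarrow> real) g h M.
    f \<in> borel_measurable (Pi\<^sub>M I (\<lambda>_. lborel)) \<Longrightarrow> g \<in> borel_measurable (Pi\<^sub>M I (\<lambda>_. lborel)) \<Longrightarrow>
    h \<in> borel_measurable (Pi\<^sub>M I (\<lambda>_. lborel)) \<Longrightarrow>
    (\<And>x. x \<in> space (Pi\<^sub>M I (\<lambda>_. lborel)) \<Longrightarrow> 0 \<le> f x \<and> f x \<le> M * (\<Prod>i\<in>I. indicat_real {-N..N} (x i))) \<Longrightarrow>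
    (\<And>x. x \<in> space (Pi\<^sub>M I (\<lambda>_. lborel)) \<Longrightarrow> 0 \<le> g x \<and> g x \<le> M * (\<Prod>i\<in>I. indicat_real {-N..N} (x i))) \<Longrightarrow>
    (\<And>x y. x \<in> space (Pi\<^sub>M I (\<lambda>_. lborel)) \<Longrightarrow> y \<in> space (Pi\<^sub>M I (\<lambda>_. lborel)) \<Longrightarrow>
      ennreal (f x powr (1-l) * g y powr l) \<le> h (\<lambda>i\<in>I. (1-l) * x i + l * y i)) \<Longrightarrow>
    ennreal (enn2real (\<integral>\<^sup>+x. f x \<partial>Pi\<^sub>M I (\<lambda>_. lborel)) powr (1-l) *
             enn2real (\<integral>\<^sup>+x. g x \<partial>Pi\<^sub>M I (\<lambda>_. lborel)) powr l)
      \<le> (\<integral>\<^sup>+x. h x \<partial>Pi\<^sub>M I (\<lambda>_. lborel))"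
  using \<open>finite I\<close>
proof (induction I)
  case empty
  interpret product_sigma_finite "\<lambda>_::'i. lborel :: real measure"
    by standard
  have sp: "(\<lambda>_. undefined) \<in> space (Pi\<^sub>M {} (\<lambda>_::'i. lborel :: real measure))"
    by (simp add: space_PiM)
  show ?case
    using empty(6)[OF sp sp] empty(4)[OF sp] empty(5)[OF sp]
    by (simp add: nn_integral_empty restrict_def)
next
  case (insert i I)
  interpret product_sigma_finite "\<lambda>_::'i. lborel :: real measure"
    by standard
  interpret PI: sigma_finite_measure "Pi\<^sub>M I (\<lambda>_::'i. lborel :: real measure)"
    by (rule sigma_finite) (use insert in auto)
  interpret PI2: pair_sigma_finite "Pi\<^sub>M I (\<lambda>_::'i. lborel :: real measure)" "lborel :: real measure" ..
  let ?P = "Pi\<^sub>M I (\<lambda>_::'i. lborel :: real measure)"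
  note [measurable] = insert.prems(1-3)
  define F where "F y = enn2real (\<integral>\<^sup>+x. f (x(i := y)) \<partial>?P)" for y
  define G where "G y = enn2real (\<integral>\<^sup>+x. g (x(i := y)) \<partial>?P)" for y
  define H where "H y = (\<integral>\<^sup>+x. h (x(i := y)) \<partial>?P)" for y
  have upd: "x(i := y) \<in> space (Pi\<^sub>M (insert i I) (\<lambda>_. lborel))" if "x \<in> space ?P" for x and y :: real
    using that insert.hyps by (auto simp: space_PiM PiE_def extensional_def)
  have pr: "(\<Prod>j\<in>insert i I. indicat_real {-N..N} ((x(i := y)) j)) =
      indicat_real {-N..N} y * (\<Prod>j\<in>I. indicat_real {-N..N} (x j))" for x y
  proof -
    have "(\<Prod>j\<in>I. indicat_real {-N..N} ((x(i := y)) j)) = (\<Prod>j\<in>I. indicat_real {-N..N} (x j))"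
      using insert.hyps by (intro prod.cong) auto
    then show ?thesis using insert.hyps by simp
  qed
  \<comment> \<open>The slice integrals are again bounded and supported in [-N,N]; the volume
    (2N)^card I of the box enters the bound.\<close>
  have bnd: "(\<integral>\<^sup>+x. p (x(i := y)) \<partial>?P) \<le> ennreal (\<bar>M\<bar> * (2*N) ^ card I * indicat_real {-N..N} y)"
    if p: "\<And>x. x \<in> space (Pi\<^sub>M (insert i I) (\<lambda>_. lborel)) \<Longrightarrow>
       0 \<le> p x \<and> p x \<le> M * (\<Prod>i\<in>insert i I. indicat_real {-N..N} (x i))" for p :: "('i \<Rightarrow> real) \<Rightarrow> real" and y
  proof -
    have "(\<integral>\<^sup>+x. p (x(i := y)) \<partial>?P)
        \<le> (\<integral>\<^sup>+x. ennreal (\<bar>M\<bar> * indicat_real {-N..N} y) * (\<Prod>j\<in>I. ennreal (indicat_real {-N..N} (x j))) \<partial>?P)"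
    proof (intro nn_integral_mono)
      fix x assume x: "x \<in> space ?P"
      have "p (x(i := y)) \<le> M * (indicat_real {-N..N} y * (\<Prod>j\<in>I. indicat_real {-N..N} (x j)))"
        using p[OF upd[OF x]] pr by metis
      also have "\<dots> \<le> \<bar>M\<bar> * (indicat_real {-N..N} y * (\<Prod>j\<in>I. indicat_real {-N..N} (x j)))"
        by (intro mult_right_mono) (auto intro!: mult_nonneg_nonneg prod_nonneg)
      finally show "ennreal (p (x(i := y))) \<le>
          ennreal (\<bar>M\<bar> * indicat_real {-N..N} y) * (\<Prod>j\<in>I. ennreal (indicat_real {-N..N} (x j)))"
        by (simp add: prod_ennreal ennreal_mult'[symmetric] prod_nonneg mult.assoc ennreal_leI)
    qed
    also have "\<dots> = ennreal (\<bar>M\<bar> * indicat_real {-N..N} y) * (\<integral>\<^sup>+x. (\<Prod>j\<in>I. ennreal (indicat_real {-N..N} (x j))) \<partial>?P)"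
      by (intro nn_integral_cmult) measurable
    also have "(\<integral>\<^sup>+x. (\<Prod>j\<in>I. ennreal (indicat_real {-N..N} (x j))) \<partial>?P) = (\<Prod>j\<in>I. \<integral>\<^sup>+t. ennreal (indicat_real {-N..N} t) \<partial>lborel)"
      using insert.hyps by (intro product_nn_integral_prod) auto
    also have "\<dots> = (\<Prod>j\<in>I. ennreal (2*N))"
      using \<open>0 \<le> N\<close> by (intro prod.cong refl) (simp add: ennreal_indicator)
    also have "\<dots> = ennreal ((2*N) ^ card I)"
      using \<open>0 \<le> N\<close> by (simp add: ennreal_power)
    also have "ennreal (\<bar>M\<bar> * indicat_real {-N..N} y) * \<dots> = ennreal (\<bar>M\<bar> * (2*N) ^ card I * indicat_real {-N..N} y)"
      using \<open>0 \<le> N\<close> by (subst ennreal_mult'[symmetric]) (auto simp: ac_simps)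
    finally show ?thesis .
  qed
  have m1: "(\<lambda>y. \<integral>\<^sup>+x. ennreal (f (x(i := y))) \<partial>?P) \<in> borel_measurable lborel"
    "(\<lambda>y. \<integral>\<^sup>+x. ennreal (g (x(i := y))) \<partial>?P) \<in> borel_measurable lborel"
    "H \<in> borel_measurable lborel"
    unfolding H_def by measurable
  have Fe: "ennreal (F y) = (\<integral>\<^sup>+x. f (x(i := y)) \<partial>?P)" for y
    unfolding F_def by (intro ennreal_enn2real le_less_trans[OF bnd[OF insert.prems(4)]]) simp_all
  have Ge: "ennreal (G y) = (\<integral>\<^sup>+x. g (x(i := y)) \<partial>?P)" for y
    unfolding G_def by (intro ennreal_enn2real le_less_trans[OF bnd[OF insert.prems(5)]]) simp_all
  have "ennreal (enn2real (\<integral>\<^sup>+y. F y \<partial>lborel) powr (1-l) * enn2real (\<integral>\<^sup>+y. G y \<partial>lborel) powr l)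
      \<le> (\<integral>\<^sup>+y. H y \<partial>lborel)"
  proof (rule prekopa_leindler_real[OF l])
    show "F \<in> borel_measurable borel" "G \<in> borel_measurable borel" "H \<in> borel_measurable borel"
      using m1 unfolding F_def G_def by auto
    show "0 \<le> F y" "0 \<le> G y" for y by (auto simp: F_def G_def)
    have "ennreal (F y) \<le> ennreal (\<bar>M\<bar> * (2*N) ^ card I * indicat_real {-N..N} y)" for y
      unfolding Fe by (rule bnd[OF insert.prems(4)])
    then show "F y \<le> \<bar>M\<bar> * (2*N) ^ card I * indicat_real {-N..N} y" for y
      using \<open>0 \<le> N\<close> by (subst (asm) ennreal_le_iff) (auto intro!: mult_nonneg_nonneg)
    have "ennreal (G y) \<le> ennreal (\<bar>M\<bar> * (2*N) ^ card I * indicat_real {-N..N} y)" for y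
      unfolding Ge by (rule bnd[OF insert.prems(5)])
    then show "G y \<le> \<bar>M\<bar> * (2*N) ^ card I * indicat_real {-N..N} y" for y
      using \<open>0 \<le> N\<close> by (subst (asm) ennreal_le_iff) (auto intro!: mult_nonneg_nonneg)
    fix a b :: real
    show "ennreal (F a powr (1-l) * G b powr l) \<le> H ((1-l) * a + l * b)"
      unfolding F_def G_def H_def
    proof (rule insert.IH[where M="\<bar>M\<bar>"])
      have B: "0 \<le> p (x(i := y)) \<and> p (x(i := y)) \<le> \<bar>M\<bar> * (\<Prod>j\<in>I. indicat_real {-N..N} (x j))"
        if p: "\<And>x. x \<in> space (Pi\<^sub>M (insert i I) (\<lambda>_. lborel)) \<Longrightarrow>
           0 \<le> p x \<and> p x \<le> M * (\<Prod>i\<in>insert i I. indicat_real {-N..N} (x i))" and x: "x \<in> space ?P"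
         for p :: "('i \<Rightarrow> real) \<Rightarrow> real" and x and y
      proof -
        have "p (x(i := y)) \<le> M * (indicat_real {-N..N} y * (\<Prod>j\<in>I. indicat_real {-N..N} (x j)))"
          using p[OF upd[OF x]] pr by metis
        also have "\<dots> \<le> \<bar>M\<bar> * (1 * (\<Prod>j\<in>I. indicat_real {-N..N} (x j)))"
          by (intro mult_mono) (auto intro!: mult_nonneg_nonneg prod_nonneg split: split_indicator)
        finally show ?thesis using p[OF upd[OF x]] by simp
      qed
      show "0 \<le> f (x(i := a)) \<and> f (x(i := a)) \<le> \<bar>M\<bar> * (\<Prod>j\<in>I. indicat_real {-N..N} (x j))"
        if "x \<in> space ?P" for x by (rule B[OF insert.prems(4) that])
      show "0 \<le> g (x(i := b)) \<and> g (x(i := b)) \<le> \<bar>M\<bar> * (\<Prod>j\<in>I. indicat_real {-N..N} (x j))"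
        if "x \<in> space ?P" for x by (rule B[OF insert.prems(5) that])
      show "(\<lambda>x. f (x(i := a))) \<in> borel_measurable ?P" "(\<lambda>x. g (x(i := b))) \<in> borel_measurable ?P"
        "(\<lambda>x. h (x(i := (1-l) * a + l * b))) \<in> borel_measurable ?P"
        by measurable
      fix x y assume x: "x \<in> space ?P" and y: "y \<in> space ?P"
      have "(\<lambda>j\<in>insert i I. (1-l) * (x(i := a)) j + l * (y(i := b)) j) =
          (\<lambda>j\<in>I. (1-l) * x j + l * y j)(i := (1-l) * a + l * b)"
        using insert.hyps by (auto simp: fun_eq_iff)
      then show "ennreal (f (x(i := a)) powr (1-l) * g (y(i := b)) powr l)
         \<le> h ((\<lambda>j\<in>I. (1-l) * x j + l * y j)(i := (1-l) * a + l * b))"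
        using insert.prems(6)[OF upd[OF x, of a] upd[OF y, of b]] by (simp only:)
    qed
  qed
  also have "(\<integral>\<^sup>+y. H y \<partial>lborel) = (\<integral>\<^sup>+x. h x \<partial>Pi\<^sub>M (insert i I) (\<lambda>_. lborel))"
    unfolding H_def using insert.hyps by (subst product_nn_integral_insert_rev) auto
  also have "(\<integral>\<^sup>+y. F y \<partial>lborel) = (\<integral>\<^sup>+x. f x \<partial>Pi\<^sub>M (insert i I) (\<lambda>_. lborel))"
    unfolding Fe using insert.hyps by (subst product_nn_integral_insert_rev) auto
  also have "(\<integral>\<^sup>+y. G y \<partial>lborel) = (\<integral>\<^sup>+x. g x \<partial>Pi\<^sub>M (insert i I) (\<lambda>_. lborel))"
    unfolding Ge using insert.hyps by (subst product_nn_integral_insert_rev) auto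
  finally show ?case .
qed

text \<open>The functional inequality for indicator functions, carried over from the product measure
  by the coordinate map \<open>T\<close>.\<close>

lemma prekopa_leindler_set:
  fixes A B C :: "'a::euclidean_space set"
  assumes l: "0 < l" "l < 1"
    and [measurable]: "A \<in> sets borel" "B \<in> sets borel" "C \<in> sets borel"
    and bdd: "bounded A" "bounded B"
    and sub: "\<And>a b. a \<in> A \<Longrightarrow> b \<in> B \<Longrightarrow> (1-l) *\<^sub>R a + l *\<^sub>R b \<in> C"
  shows "ennreal (measure lborel A powr (1-l) * measure lborel B powr l) \<le> emeasure lborel C"
proof -
  let ?P = "Pi\<^sub>M (Basis :: 'a set) (\<lambda>_. lborel :: real measure)"
  define T where "T x = (\<Sum>b\<in>Basis. x b *\<^sub>R b :: 'a)" for x :: "'a \<Rightarrow> real"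
  have T[measurable]: "T \<in> measurable ?P borel"
    unfolding T_def by measurable
  have em: "emeasure lborel S = (\<integral>\<^sup>+x. indicator S (T x) \<partial>?P)" if [measurable]: "S \<in> sets borel" for S
  proof -
    have "emeasure lborel S = (\<integral>\<^sup>+x. indicator S x \<partial>distr ?P borel T)"
      unfolding T_def by (subst lborel_eq[symmetric]) simp
    also have "\<dots> = (\<integral>\<^sup>+x. indicator S (T x) \<partial>?P)"
      by (rule nn_integral_distr) measurable
    finally show ?thesis .
  qed
  obtain N where N: "\<And>x. x \<in> A \<union> B \<Longrightarrow> norm x \<le> N" "N > 0"
    using bounded_pos[of "A \<union> B"] bdd by auto
  have Tb: "T x \<bullet> b = x b" if "b \<in> Basis" for x b
    using that by (simp add: T_def inner_sum_left inner_Basis if_distrib cong: if_cong)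
  have bound: "0 \<le> indicat_real S (T x) \<and> indicat_real S (T x) \<le> 1 * (\<Prod>b\<in>Basis. indicat_real {-N..N} (x b))"
    if "S \<subseteq> A \<union> B" for S x
  proof (cases "T x \<in> S")
    case True
    then have "\<bar>x b\<bar> \<le> N" if "b \<in> Basis" for b
      using Basis_le_norm[OF that, of "T x"] N(1)[of "T x"] \<open>S \<subseteq> A \<union> B\<close> Tb[OF that, of x] by auto
    then have "(\<Prod>b\<in>Basis. indicat_real {-N..N} (x b)) = 1"
      by (intro prod.neutral) (auto split: split_indicator simp: abs_le_iff minus_le_iff)
    then show ?thesis by simp
  qed (auto intro!: prod_nonneg)
  have "ennreal (enn2real (\<integral>\<^sup>+x. indicat_real A (T x) \<partial>?P) powr (1-l) *
             enn2real (\<integral>\<^sup>+x. indicat_real B (T x) \<partial>?P) powr l)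
      \<le> (\<integral>\<^sup>+x. indicator C (T x) \<partial>?P)"
  proof (rule prekopa_leindler_PiM[OF l, where M=1 and N=N])
    fix x y assume "x \<in> space ?P" "y \<in> space ?P"
    have "T (\<lambda>i\<in>Basis. (1-l) * x i + l * y i) = (1-l) *\<^sub>R T x + l *\<^sub>R T y"
      unfolding T_def scaleR_sum_right sum.distrib[symmetric]
      by (intro sum.cong) (auto simp: scaleR_add_left)
    then show "ennreal (indicat_real A (T x) powr (1-l) * indicat_real B (T y) powr l)
       \<le> indicator C (T (\<lambda>i\<in>Basis. (1-l) * x i + l * y i))"
      using sub[of "T x" "T y"] by (auto split: split_indicator)
  qed (use N bound in auto)
  then show ?thesis
    by (simp add: ennreal_indicator em[symmetric] measure_def)
qed

text \<open>Rescaling \<open>A\<close> and the ball to equal volume turns the multiplicative inequality into the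
  additive one.\<close>

lemma brunn_minkowski_cball:
  fixes A :: "(real^3) set"
  assumes A: "A \<in> sets borel" "bounded A" "0 < X" "ennreal (4/3*pi * X) \<le> emeasure lborel A" and "a > 0"
    and [measurable]: "C \<in> sets borel"
    and sub: "\<And>x y. x \<in> A \<Longrightarrow> norm y \<le> a \<Longrightarrow> x + y \<in> C"
  shows "ennreal (4/3*pi * (X + 3 * X powr (2/3) * a)) \<le> emeasure lborel C"
proof -
  define c where "c = 4/3*pi"
  have c: "c > 0" by (simp add: c_def)
  define V where "V = measure lborel A"
  have VX: "c * X \<le> V"
  proof -
    have "emeasure lborel A = ennreal V"
      unfolding V_def using emeasure_bounded_finite[OF A(2)] by (simp add: emeasure_eq_ennreal_measure)
    then show ?thesis using A(4) A(3) c unfolding c_def[symmetric]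
      by (metis ennreal_le_iff V_def measure_nonneg)
  qed
  define v where "v = (V / c) powr (1/3)"
  have V0: "V > 0" using VX c A(3) by (smt (verit) mult_pos_pos)
  have v0: "v > 0" using V0 c by (simp add: v_def)
  have v3: "v ^ 3 = V / c"
    using V0 c by (simp add: v_def powr_powr flip: powr_realpow[OF powr_gt_zero[THEN iffD2]])
  have vX: "X powr (1/3) \<le> v"
    unfolding v_def using VX c A(3) by (intro powr_mono2) (auto simp: field_simps)
  \<comment> \<open>With \<open>v\<close> the volume radius of \<open>A\<close>, this weight makes
    A/(1-l) and the ball of radius a/l both have the volume of a ball of radius v + a, so the
    geometric mean is that volume too.\<close>
  define l where "l = a / (v + a)"
  have l: "0 < l" "l < 1" "1 - l = v / (v + a)"
    using v0 \<open>a > 0\<close> by (auto simp: l_def field_simps)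
  have scale_sets: "(*\<^sub>R) s ` S \<in> sets borel" if "s > 0" "S \<in> sets borel" for s and S :: "(real^3) set"
  proof -
    have "(*\<^sub>R) s ` S = (\<lambda>x. (1/s) *\<^sub>R x) -` S"
      using that by (auto simp: image_iff intro!: bexI[of _ "(1/s) *\<^sub>R _"])
    then show ?thesis
      using measurable_sets_borel[of "\<lambda>x. (1/s) *\<^sub>R x" borel S] that by simp
  qed
  have scale: "measure lborel ((*\<^sub>R) s ` S) = s ^ 3 * measure lborel S"
    if "s > 0" "S \<in> sets borel" for s and S :: "(real^3) set"
    using measure_lebesgue_affine[of s "0::real^3" S] that scale_sets[OF that] by (simp add: measure_completion)
  let ?A = "(*\<^sub>R) (1 / (1-l)) ` A" and ?B = "(*\<^sub>R) (1 / l) ` cball (0::real^3) a"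
  have "ennreal (measure lborel ?A powr (1-l) * measure lborel ?B powr l) \<le> emeasure lborel C"
  proof (rule prekopa_leindler_set)
    show "?A \<in> sets borel" "?B \<in> sets borel" "bounded ?A" "bounded ?B"
      using l A v0 \<open>a > 0\<close> by (auto intro!: scale_sets bounded_scaling)
    fix x y assume "x \<in> ?A" "y \<in> ?B"
    then obtain x' y' where "x = (1/(1-l)) *\<^sub>R x'" "x' \<in> A" "y = (1/l) *\<^sub>R y'" "y' \<in> cball 0 a"
      by blast
    then show "(1-l) *\<^sub>R x + l *\<^sub>R y \<in> C"
      using l(1,2) sub[of x' y'] v0 \<open>a > 0\<close> by simp
  qed (use l in auto)
  also have "measure lborel ?A = c * (v + a) ^ 3"
  proof -
    have "measure lborel ?A = (1/(1-l))^3 * V"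
      unfolding V_def by (rule scale) (use l A v0 \<open>a > 0\<close> in auto)
    also have "\<dots> = ((v+a)/v)^3 * (c * v^3)"
      using v3 c l(3) by simp
    also have "\<dots> = c * (v+a)^3" using v0 by (simp add: field_simps)
    finally show ?thesis .
  qed
  also have "measure lborel ?B = c * (v + a) ^ 3"
  proof -
    have "measure lborel ?B = (1/l)^3 * measure lborel (cball (0::real^3) a)"
      by (rule scale) (use l in auto)
    also have "measure lborel (cball (0::real^3) a) = c * a ^ 3"
      using content_cball[of a "0::real^3"] \<open>a > 0\<close> by (simp add: c_def unit_ball_vol_3)
    also have "(1/l)^3 * (c * a^3) = c * (v+a)^3"
      using \<open>a > 0\<close> by (simp add: l_def field_simps)
    finally show ?thesis .
  qed
  also have "(c * (v + a) ^ 3) powr (1-l) * (c * (v + a) ^ 3) powr l = c * (v + a) ^ 3"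
    using c v0 \<open>a > 0\<close> by (simp flip: powr_add)
  finally have 1: "ennreal (c * (v + a) ^ 3) \<le> emeasure lborel C" .
  have "X = (X powr (1/3)) ^ 3"
    using A(3) by (simp add: powr_powr flip: powr_realpow[OF powr_gt_zero[THEN iffD2]])
  moreover have "X powr (2/3) = (X powr (1/3)) ^ 2"
    using A(3) by (simp add: powr_powr flip: powr_realpow[OF powr_gt_zero[THEN iffD2]])
  ultimately have "X + 3 * X powr (2/3) * a = (X powr (1/3)) ^ 3 + 3 * (X powr (1/3))^2 * a"
    by metis
  also have "\<dots> \<le> v ^ 3 + 3 * v^2 * a"
    using vX \<open>a > 0\<close> by (intro add_mono mult_mono power_mono) auto
  \<comment> \<open>The terms of order a^2 and a^3 are dropped; only the first-order growth of the
    volume is used later.\<close>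
  also have "\<dots> \<le> (v + a)^3"
    using v0 \<open>a > 0\<close> by (simp add: power3_eq_cube power2_eq_square algebra_simps)
  finally have "c * (X + 3 * X powr (2/3) * a) \<le> c * (v + a)^3"
    using c by simp
  then show ?thesis using 1 unfolding c_def by (meson ennreal_leI order_trans)
qed

section \<open>Comparison of decreasing rearrangements\<close>

text \<open>Rewrites the volume of a level set as a length in the variable X, so that the layer-cake
  integral becomes a double integral in t and X.\<close>

lemma nn_integral_Ioc_ennreal_le:
  assumes "c > 0" "y < \<infinity>"
  shows "y = ennreal c * (\<integral>\<^sup>+X. indicator {0<..} X * (if ennreal (c * X) \<le> y then 1 else 0) \<partial>lborel)"
proof -
  obtain r where r: "y = ennreal r" "r \<ge> 0" using assms(2) by (cases y) auto
  have "(\<integral>\<^sup>+X. indicator {0<..} X * (if ennreal (c * X) \<le> y then 1 else 0) \<partial>lborel) =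
      (\<integral>\<^sup>+X. indicator {0<..r/c} X \<partial>lborel)"
    using assms(1) r by (intro nn_integral_cong) (auto split: split_indicator simp: field_simps)
  also have "\<dots> = ennreal (r / c)"
    using assms r by simp
  also have "ennreal c * \<dots> = y"
    using assms r by (simp flip: ennreal_mult)
  finally show ?thesis by simp
qed

text \<open>The decreasing rearrangement of \<open>f\<close>, in the coordinate \<open>X = \<rho>\<^sup>3\<close> of balls of radius \<open>\<rho>\<close>
  when \<open>c = 4\<pi>/3\<close>.\<close>

definition decr_rearr :: "real \<Rightarrow> ('a::euclidean_space \<Rightarrow> real) \<Rightarrow> real \<Rightarrow> ennreal" where
  "decr_rearr c f X =
    emeasure lborel {t. 0 < t \<and> ennreal (c * X) \<le> emeasure lborel {x. t < f x}}"

lemma decr_rearr_sets [measurable]: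
  fixes f :: "'a::euclidean_space \<Rightarrow> real"
  assumes [measurable]: "f \<in> borel_measurable borel"
  shows "{t. 0 < t \<and> ennreal (c * X) \<le> emeasure lborel {x. t < f x}} \<in> sets borel"
proof -
  have [measurable]: "(\<lambda>t. emeasure lborel {x. t < f x}) \<in> borel_measurable borel"
    by measurable
  show ?thesis by measurable
qed

lemma borel_measurable_decr_rearr [measurable]:
  fixes f :: "'a::euclidean_space \<Rightarrow> real"
  assumes [measurable]: "f \<in> borel_measurable borel"
  shows "decr_rearr c f \<in> borel_measurable borel"
proof -
  have [measurable]: "(\<lambda>t. emeasure lborel {x. t < f x}) \<in> borel_measurable borel"
    by measurable
  show ?thesis unfolding decr_rearr_def[abs_def] by measurable
qed

text \<open>Equimeasurability, by exchanging the level t and the volume coordinate X in the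
  layer-cake double integral.\<close>

lemma nn_integral_decr_rearr:
  fixes f :: "'a::euclidean_space \<Rightarrow> real"
  assumes [measurable]: "f \<in> borel_measurable borel" and "\<And>x. 0 \<le> f x" and c: "c > 0"
    and fin: "\<And>t. t > 0 \<Longrightarrow> emeasure lborel {x. t < f x} < \<infinity>"
  shows "(\<integral>\<^sup>+x. f x \<partial>lborel) = ennreal c * (\<integral>\<^sup>+X. indicator {0<..} X * decr_rearr c f X \<partial>lborel)"
proof -
  have [measurable]: "(\<lambda>t. emeasure lborel {x. t < f x}) \<in> borel_measurable borel"
    by measurable
  have "(\<integral>\<^sup>+x. f x \<partial>lborel) = (\<integral>\<^sup>+t. indicator {0<..} t * emeasure lborel {x. t < f x} \<partial>lborel)"
    using nn_integral_layer_cake[of lborel f] assms by (simp add: sigma_finite_lborel)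
  also have "\<dots> = (\<integral>\<^sup>+t. ennreal c * (\<integral>\<^sup>+X. indicator {0<..} t * (indicator {0<..} X *
      (if ennreal (c * X) \<le> emeasure lborel {x. t < f x} then 1 else 0)) \<partial>lborel) \<partial>lborel)"
  proof (intro nn_integral_cong)
    fix t :: real
    show "indicator {0<..} t * emeasure lborel {x. t < f x} =
       ennreal c * (\<integral>\<^sup>+X. indicator {0<..} t * (indicator {0<..} X *
      (if ennreal (c * X) \<le> emeasure lborel {x. t < f x} then 1 else 0)) \<partial>lborel)"
    proof (cases "t > 0")
      case True
      then show ?thesis
        using nn_integral_Ioc_ennreal_le[OF c fin[OF True]] by simp
    qed simp
  qed
  also have "\<dots> = ennreal c * (\<integral>\<^sup>+t. (\<integral>\<^sup>+X. indicator {0<..} t * (indicator {0<..} X *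
      (if ennreal (c * X) \<le> emeasure lborel {x. t < f x} then 1 else 0)) \<partial>lborel) \<partial>lborel)"
    by (rule nn_integral_cmult) measurable
  also have "(\<integral>\<^sup>+t. (\<integral>\<^sup>+X. indicator {0<..} t * (indicator {0<..} X *
      (if ennreal (c * X) \<le> emeasure lborel {x. t < f x} then 1 else 0)) \<partial>lborel) \<partial>lborel) =
    (\<integral>\<^sup>+X. (\<integral>\<^sup>+t. indicator {0<..} t * (indicator {0<..} X *
      (if ennreal (c * X) \<le> emeasure lborel {x. t < f x} then 1 else 0)) \<partial>lborel) \<partial>lborel)"
    by (rule lborel_pair.Fubini') measurable
  also have "\<dots> = (\<integral>\<^sup>+X. indicator {0<..} X * decr_rearr c f X \<partial>lborel)"
  proof (intro nn_integral_cong)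
    fix X :: real
    have "(\<integral>\<^sup>+t. indicator {0<..} t * (indicator {0<..} X *
      (if ennreal (c * X) \<le> emeasure lborel {x. t < f x} then 1 else 0)) \<partial>lborel) =
      (\<integral>\<^sup>+t. indicator {0<..} X * indicator {t. 0 < t \<and> ennreal (c * X) \<le> emeasure lborel {x. t < f x}} t \<partial>lborel)"
      by (intro nn_integral_cong) (auto split: split_indicator)
    then show "(\<integral>\<^sup>+t. indicator {0<..} t * (indicator {0<..} X *
      (if ennreal (c * X) \<le> emeasure lborel {x. t < f x} then 1 else 0)) \<partial>lborel) = indicator {0<..} X * decr_rearr c f X"
      unfolding decr_rearr_def by (simp add: nn_integral_cmult)
  qed
  finally show ?thesis .
qed

text \<open>Let v and w be the decreasing rearrangements of \<open>V\<close> and \<open>W\<close>.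
  Then v(X) <= w(X + d) + p(X) beyond \<open>X1\<close> by \<open>rel\<close>, v <= T everywhere,
  and w >= T up to X1 + d by \<open>top\<close>. The shift by \<open>d\<close> opens a gap of length
  \<open>d\<close> in which w still has height \<open>T\<close>; integrated, this is the extra term
  on the left.\<close>

lemma nn_integral_level_shift:
  fixes V W :: "'a::euclidean_space \<Rightarrow> real"
  assumes [measurable]: "V \<in> borel_measurable borel" "W \<in> borel_measurable borel"
      "p \<in> borel_measurable borel"
    and c: "c > 0" and "0 \<le> d" "0 < X1" "0 < T"
    and V: "\<And>x. 0 \<le> V x" "\<And>x. V x \<le> T" and W: "\<And>x. 0 \<le> W x"
    and finV: "\<And>t. t > 0 \<Longrightarrow> emeasure lborel {x. t < V x} < \<infinity>"
    and finW: "\<And>t. t > 0 \<Longrightarrow> emeasure lborel {x. t < W x} < \<infinity>"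
    and p: "\<And>X. X > X1 \<Longrightarrow> 0 \<le> p X"
    and rel: "\<And>X t. X1 < X \<Longrightarrow> p X < t \<Longrightarrow> ennreal (c * X) \<le> emeasure lborel {x. t < V x} \<Longrightarrow>
       ennreal (c * (X + d)) \<le> emeasure lborel {x. t - p X < W x}"
    and top: "\<And>t. 0 < t \<Longrightarrow> t < T \<Longrightarrow> ennreal (c * (X1 + d)) \<le> emeasure lborel {x. t < W x}"
  shows "(\<integral>\<^sup>+x. V x \<partial>lborel) + ennreal (c * d * T)
    \<le> (\<integral>\<^sup>+x. W x \<partial>lborel) + ennreal c * (\<integral>\<^sup>+X. indicator {X1<..} X * ennreal (p X) \<partial>lborel)"
proof -
  define J where "J = (\<integral>\<^sup>+X. indicator {X1<..} X * decr_rearr c W (X + d) \<partial>lborel)"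
  define P where "P = (\<integral>\<^sup>+X. indicator {X1<..} X * ennreal (p X) \<partial>lborel)"
  have VT: "decr_rearr c V X \<le> ennreal T" if "X > 0" for X
  proof -
    have "decr_rearr c V X \<le> emeasure lborel {0<..T}"
      unfolding decr_rearr_def
    proof (intro emeasure_mono subsetI)
      fix t assume t: "t \<in> {t. 0 < t \<and> ennreal (c * X) \<le> emeasure lborel {x. t < V x}}"
      have "{x. t < V x} \<noteq> {}"
      proof
        assume "{x. t < V x} = {}"
        then have "ennreal (c * X) \<le> 0" using t by auto
        then show False using c that by (simp add: ennreal_eq_0_iff mult_le_0_iff)
      qed
      then show "t \<in> {0<..T}" using t V(2) by (auto intro: less_imp_le less_le_trans)
    qed auto
    then show ?thesis using \<open>0 < T\<close> by simp
  qed
  have VW: "decr_rearr c V X \<le> decr_rearr c W (X + d) + ennreal (p X)" if X: "X > X1" for X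
  proof -
    let ?S = "{t. 0 < t \<and> ennreal (c * X) \<le> emeasure lborel {x. t < V x}}"
    let ?S' = "{t. 0 < t \<and> ennreal (c * (X+d)) \<le> emeasure lborel {x. t < W x}}"
    have "decr_rearr c V X \<le> emeasure lborel ({0<..p X} \<union> (\<lambda>t. - p X + t) -` ?S')"
      unfolding decr_rearr_def
      using rel[OF X] measurable_sets_borel[of "\<lambda>t. - p X + t" borel ?S']
      by (intro emeasure_mono) auto
    also have "\<dots> \<le> emeasure lborel {0<..p X} + emeasure lborel ((\<lambda>t. - p X + t) -` ?S')"
      using measurable_sets_borel[of "\<lambda>t. - p X + t" borel ?S'] by (intro emeasure_subadditive) auto
    also have "emeasure lborel ((\<lambda>t. - p X + t) -` ?S') = decr_rearr c W (X + d)"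
      unfolding decr_rearr_def by (rule emeasure_lborel_translate_vimage) measurable
    also have "emeasure lborel {0<..p X} = ennreal (p X)"
      using p[OF X] by simp
    finally show ?thesis by (simp add: add.commute)
  qed
  have WT: "ennreal T \<le> decr_rearr c W X" if "X \<le> X1 + d" for X
  proof -
    have "emeasure lborel {0<..<T} \<le> decr_rearr c W X"
      unfolding decr_rearr_def
    proof (intro emeasure_mono subsetI)
      fix t assume t: "t \<in> {0<..<T}"
      have "ennreal (c * X) \<le> ennreal (c * (X1 + d))"
        using c that by (intro ennreal_leI) simp
      also have "\<dots> \<le> emeasure lborel {x. t < W x}"
        using top t by simp
      finally show "t \<in> {t. 0 < t \<and> ennreal (c * X) \<le> emeasure lborel {x. t < W x}}"
        using t by simp
    qed measurable
    then show ?thesis using \<open>0 < T\<close> by simp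
  qed
  have "(\<integral>\<^sup>+x. V x \<partial>lborel) = ennreal c * (\<integral>\<^sup>+X. indicator {0<..} X * decr_rearr c V X \<partial>lborel)"
    by (rule nn_integral_decr_rearr) (use V c finV in auto)
  also have "(\<integral>\<^sup>+X. indicator {0<..} X * decr_rearr c V X \<partial>lborel) \<le>
     (\<integral>\<^sup>+X. ennreal T * indicator {0<..X1} X + (indicator {X1<..} X * decr_rearr c W (X + d) +
        indicator {X1<..} X * ennreal (p X)) \<partial>lborel)"
  proof (intro nn_integral_mono)
    fix X
    show "indicator {0<..} X * decr_rearr c V X \<le>
      ennreal T * indicator {0<..X1} X + (indicator {X1<..} X * decr_rearr c W (X + d) +
        indicator {X1<..} X * ennreal (p X))"
      using VT[of X] VW[of X] \<open>0 < X1\<close> by (auto split: split_indicator)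
  qed
  also have "\<dots> = ennreal T * ennreal X1 + (J + P)"
    unfolding J_def P_def using \<open>0 < X1\<close>
    by (simp add: nn_integral_add nn_integral_cmult_indicator)
  finally have 1: "(\<integral>\<^sup>+x. V x \<partial>lborel) \<le> ennreal c * (ennreal T * ennreal X1 + (J + P))"
    by (simp add: mult_left_mono)
  \<comment> \<open>Substituting X + d for X makes room for the interval up to X1 + d, where the
    rearrangement of \<open>W\<close> is at least \<open>T\<close>.\<close>
  have J: "J = (\<integral>\<^sup>+X. indicator {X1+d<..} X * decr_rearr c W X \<partial>lborel)"
    unfolding J_def
    by (subst nn_integral_real_affine[of _ 1 d]) (auto intro!: nn_integral_cong split: split_indicator simp: add.commute)
  have "ennreal T * ennreal (X1 + d) + J =
     (\<integral>\<^sup>+X. ennreal T * indicator {0<..X1+d} X + indicator {X1+d<..} X * decr_rearr c W X \<partial>lborel)"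
    using \<open>0 < X1\<close> \<open>0 \<le> d\<close> by (simp add: J nn_integral_add nn_integral_cmult_indicator)
  also have "\<dots> \<le> (\<integral>\<^sup>+X. indicator {0<..} X * decr_rearr c W X \<partial>lborel)"
  proof (intro nn_integral_mono)
    fix X show "ennreal T * indicator {0<..X1+d} X + indicator {X1+d<..} X * decr_rearr c W X
       \<le> indicator {0<..} X * decr_rearr c W X"
      using WT[of X] \<open>0 < X1\<close> \<open>0 \<le> d\<close> by (auto split: split_indicator)
  qed
  finally have "ennreal c * (ennreal T * ennreal (X1 + d) + J)
      \<le> ennreal c * (\<integral>\<^sup>+X. indicator {0<..} X * decr_rearr c W X \<partial>lborel)"
    by (rule mult_left_mono) simp
  also have "\<dots> = (\<integral>\<^sup>+x. W x \<partial>lborel)"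
    by (rule nn_integral_decr_rearr[symmetric]) (use W c finW in auto)
  finally have 2: "ennreal c * (ennreal T * ennreal (X1 + d) + J) \<le> (\<integral>\<^sup>+x. W x \<partial>lborel)" .
  have cdT: "ennreal (c * d * T) = ennreal c * (ennreal T * ennreal d)"
    using c \<open>0 \<le> d\<close> \<open>0 < T\<close> by (simp add: ennreal_mult[symmetric] ac_simps)
  have Xd: "ennreal (X1 + d) = ennreal X1 + ennreal d"
    using \<open>0 < X1\<close> \<open>0 \<le> d\<close> by (simp add: ennreal_plus)
  have "(\<integral>\<^sup>+x. V x \<partial>lborel) + ennreal (c * d * T) \<le>
      ennreal c * (ennreal T * ennreal X1 + (J + P)) + ennreal c * (ennreal T * ennreal d)"
    unfolding cdT using 1 by (rule add_right_mono)
  also have "\<dots> = ennreal c * (ennreal T * ennreal (X1 + d) + J) + ennreal c * P"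
    unfolding Xd by (simp add: distrib_left ac_simps)
  also have "\<dots> \<le> (\<integral>\<^sup>+x. W x \<partial>lborel) + ennreal c * P"
    using 2 by (rule add_right_mono)
  finally show ?thesis unfolding P_def .
qed

text \<open>The exponent -4/3 arises from squaring the neighbourhood radius, which is proportional
  to X^(-2/3).\<close>

lemma nn_integral_powr_tail:
  assumes "k \<ge> 0" "X1 > 0"
  shows "(\<integral>\<^sup>+X. indicator {X1<..} X * ennreal (k * X powr (-4/3)) \<partial>lborel)
    \<le> ennreal (3 * k * X1 powr (-1/3))"
proof -
  let ?F = "\<lambda>X. - 3 * k * X powr (-1/3)"
  have "(\<integral>\<^sup>+X. indicator {X1<..} X * ennreal (k * X powr (-4/3)) \<partial>lborel)
      \<le> (\<integral>\<^sup>+X. ennreal (k * X powr (-4/3)) * indicator {X1..} X \<partial>lborel)"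
    by (intro nn_integral_mono) (auto split: split_indicator)
  also have "\<dots> = ennreal (0 - ?F X1)"
  proof (rule nn_integral_FTC_atLeast)
    fix x assume "X1 \<le> x"
    then have "x > 0" using assms by simp
    then show "(?F has_real_derivative k * x powr (-4/3)) (at x)"
      by (auto intro!: derivative_eq_intros simp: algebra_simps)
  next
    have "((\<lambda>X. X powr (-1/3)) \<longlongrightarrow> 0) (at_top :: real filter)"
      by (rule tendsto_neg_powr) (auto simp: filterlim_ident)
    then show "(?F \<longlongrightarrow> 0) at_top"
      by (rule tendsto_mult_right_zero)
  qed (use assms in auto)
  finally show ?thesis by simp
qed

section \<open>Lower bound for the Euclidean Dirichlet energy\<close>

text \<open>\<open>W\<close> dominates the sup-convolution of \<open>V\<close> with the parabola
  |x|^2/(4s), so the superlevel set of \<open>W\<close> at t - a^2/(4s) contains the a-neighbourhood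
  of that of \<open>V\<close> at t. The radius a = s lam X^(-2/3) makes the Brunn-Minkowski gain 3
  X^(2/3) a equal to the constant 3 s lam, as \<open>nn_integral_level_shift\<close> requires. The
  integral of W - V is s times the perturbed energy; dividing by s leaves the lower bound 3 c lam T
  - (3/4) c lam^2 / R1 with c = 4 pi/3.\<close>

lemma dirichlet_energy_lower_bound_aux:
  fixes V :: "real^3 \<Rightarrow> real" and G :: "real^3 \<Rightarrow> real^3"
  assumes der: "\<And>x. (V has_derivative (\<lambda>h. G x \<bullet> h)) (at x)"
    and cont: "continuous_on UNIV G"
    and N: "N > 0" "\<And>x. N \<le> norm x \<Longrightarrow> V x = 0"
    and V: "\<And>x. 0 \<le> V x" "\<And>x. V x \<le> T" and T: "T > 0"
    and R: "0 < R1" "R1 < R" "ennreal (4/3*pi * R^3) \<le> emeasure lborel {x. V x = T}"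
    and L: "L > 0" "\<And>x. norm (G x) \<le> L"
    and \<omega>: "\<omega> > 0"
  shows "ennreal (4 * pi * T\<^sup>2 * R1) \<le>
    (\<integral>\<^sup>+x. indicator (cball 0 (N+1)) x * ennreal ((norm (G x) + \<omega>)\<^sup>2) \<partial>lborel)"
proof -
  define B where "B = cball (0::real^3) (N+1)"
  define c where "c = 4/3*pi"
  \<comment> \<open>The maximiser of 3 c lam T - (3/4) c lam^2 / R1; the maximum is 3 c T^2 R1 = 4
    pi T^2 R1.\<close>
  define lam where "lam = 2 * T * R1"
  have lam: "lam > 0" using T R by (simp add: lam_def)
  have c: "c > 0" by (simp add: c_def)
  have contV: "continuous_on UNIV V"
    using der by (meson continuous_at_imp_continuous_on has_derivative_continuous)
  have [measurable]: "V \<in> borel_measurable borel" "G \<in> borel_measurable borel" "B \<in> sets borel"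
    using contV cont by (auto intro: borel_measurable_continuous_onI simp: B_def)
  have ub: "V y - V x \<le> norm (x - y) * g"
    if "convex S" "x \<in> S" "y \<in> S" "\<And>z. z \<in> S \<Longrightarrow> norm (G z) \<le> g" for S x y g
  proof -
    have "norm (V y - V x) \<le> g * norm (y - x)"
    proof (rule differentiable_bound[OF \<open>convex S\<close>])
      fix z assume "z \<in> S"
      show "(V has_derivative (\<lambda>h. G z \<bullet> h)) (at z within S)"
        using der has_derivative_at_withinI by blast
      have g: "norm (G z) \<le> g" using that(4) \<open>z \<in> S\<close> .
      show "onorm (\<lambda>h. G z \<bullet> h) \<le> g"
      proof (rule onorm_le)
        fix h
        have "norm (G z \<bullet> h) \<le> norm (G z) * norm h" by (simp add: Cauchy_Schwarz_ineq2)
        also have "\<dots> \<le> g * norm h" using g by (intro mult_right_mono) auto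
        finally show "norm (G z \<bullet> h) \<le> g * norm h" .
      qed
    qed (use that in auto)
    then show ?thesis by (simp add: norm_minus_commute mult.commute)
  qed
  have "uniformly_continuous_on (cball 0 (N+2)) G"
    by (intro compact_uniformly_continuous continuous_on_subset[OF cont]) auto
  then obtain \<delta>0 where \<delta>0: "\<delta>0 > 0"
    "\<And>x y. x \<in> cball 0 (N+2) \<Longrightarrow> y \<in> cball 0 (N+2) \<Longrightarrow> dist y x < \<delta>0 \<Longrightarrow> dist (G y) (G x) < \<omega>"
    using \<omega> unfolding uniformly_continuous_on_def by metis
  define \<delta> where "\<delta> = min \<delta>0 1"
  have \<delta>: "\<delta> > 0" "\<delta> \<le> 1" "\<delta> \<le> \<delta>0" using \<delta>0 by (auto simp: \<delta>_def)
  \<comment> \<open>The first bound lets the parabola beat the Lipschitz constant \<open>L\<close>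
    at distances of at least \<open>\<delta>\<close>. The second keeps the plateau {V = T}, of
    volume at least c R^3, large enough to contain the volume c (R1^3 + 3 s lam) needed at the top
    levels; this is why \<open>R1\<close> is smaller than \<open>R\<close>.\<close>
  define s where "s = min (\<delta> / (8 * L)) ((R^3 - R1^3) / (3 * lam))"
  have R3: "R1^3 < R^3" using R by (intro power_strict_mono) auto
  have s: "s > 0" using \<delta> L R3 lam by (simp add: s_def)
  have "s \<le> \<delta> / (8 * L)" by (simp add: s_def)
  then have sL: "4 * s * L < \<delta>" using L \<delta> by (simp add: field_simps)
  have "s \<le> (R^3 - R1^3) / (3 * lam)" by (simp add: s_def)
  then have sR: "R1^3 + 3 * s * lam \<le> R^3" using lam by (simp add: field_simps)
  \<comment> \<open>\<open>\<omega>\<close> absorbs the oscillation of \<open>G\<close> over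
    distances below \<open>\<delta>\<close>. \<open>B\<close> reaches one unit beyond the support of
    \<open>V\<close>, and \<delta> <= 1, so points within \<open>\<delta>\<close> of a point outside
    \<open>B\<close> have V = 0.\<close>
  define W where "W x = V x + s * (norm (G x) + \<omega>)\<^sup>2 * indicator B x" for x
  have VW: "V x \<le> W x" for x using s by (simp add: W_def)
  \<comment> \<open>\<open>W\<close> lies above the sup-convolution. For close points the mean value
    inequality with slope at most |G x| + \<omega> is split by Young's inequality; for distant
    points the global Lipschitz bound is already below the parabola.\<close>
  have key: "V y - (norm (x - y))\<^sup>2 / (4 * s) \<le> W x" for x y
  proof (cases "norm (x - y) < \<delta>")
    case True
    show ?thesis
    proof (cases "x \<in> B")
      case xB: True
      define g where "g = norm (G x) + \<omega>"
      have "V y - V x \<le> norm (x - y) * g"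
      proof (rule ub[of "ball x \<delta>"])
        fix z assume z: "z \<in> ball x \<delta>"
        have "norm z \<le> norm x + norm (x - z)" by (metis norm_minus_commute norm_triangle_sub)
        then have "z \<in> cball 0 (N+2)" "x \<in> cball 0 (N+2)" using z xB \<delta> by (auto simp: B_def dist_norm)
        then have "dist (G z) (G x) < \<omega>" using \<delta>0(2) z \<delta> by (auto simp: dist_commute)
        then show "norm (G z) \<le> g" unfolding g_def
          by (smt (verit) dist_norm norm_triangle_ineq2)
      qed (use True \<delta> in \<open>auto simp: dist_norm\<close>)
      moreover have "norm (x - y) * g \<le> s * g\<^sup>2 + (norm (x - y))\<^sup>2 / (4 * s)"
      proof -
        have "0 \<le> (norm (x - y) - 2 * s * g)\<^sup>2 / (4 * s)" using s by simp
        also have "\<dots> = s * g\<^sup>2 + (norm (x - y))\<^sup>2 / (4 * s) - norm (x - y) * g"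
          using s by (simp add: field_simps power2_eq_square)
        finally show ?thesis by simp
      qed
      ultimately show ?thesis using xB by (simp add: W_def g_def)
    next
      case False
      have "norm x \<le> norm y + norm (x - y)" by (simp add: norm_triangle_sub)
      then have "N \<le> norm y" using False True \<delta> by (simp add: B_def)
      then have "V y = 0" using N by simp
      moreover have "0 \<le> (norm (x - y))\<^sup>2 / (4 * s)" using s by simp
      ultimately show ?thesis using VW[of x] V(1)[of x] by linarith
    qed
  next
    case False
    have "V y - V x \<le> norm (x - y) * L"
      by (rule ub[of UNIV]) (use L in auto)
    also have "\<dots> \<le> norm (x - y) * (norm (x - y) / (4 * s))"
      using False sL s by (intro mult_left_mono) (auto simp: field_simps)
    finally show ?thesis using VW[of x] by (simp add: power2_eq_square)
  qed
  define p where "p X = s * lam\<^sup>2 / 4 * X powr (-4/3)" for X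
  have "(\<integral>\<^sup>+x. V x \<partial>lborel) + ennreal (c * (3 * s * lam) * T)
    \<le> (\<integral>\<^sup>+x. W x \<partial>lborel) + ennreal c * (\<integral>\<^sup>+X. indicator {R1^3<..} X * ennreal (p X) \<partial>lborel)"
  proof (rule nn_integral_level_shift)
    show "p \<in> borel_measurable borel" "W \<in> borel_measurable borel" unfolding p_def[abs_def] W_def[abs_def] by measurable
    show "0 \<le> W x" for x using VW V(1) order_trans by blast
    have Wsub: "{x. t < W x} \<subseteq> B" "{x. t < V x} \<subseteq> B" if "t > 0" for t
    proof -
      have "W x = 0 \<and> V x = 0" if "x \<notin> B" for x
        using that N by (auto simp: W_def B_def)
      then show "{x. t < W x} \<subseteq> B" "{x. t < V x} \<subseteq> B" using \<open>t > 0\<close> by force+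
    qed
    have fB: "emeasure lborel B < \<infinity>" unfolding B_def by (rule emeasure_lborel_cball_finite)
    show "emeasure lborel {x. t < V x} < \<infinity>" "emeasure lborel {x. t < W x} < \<infinity>" if "t > 0" for t
      by (rule le_less_trans[OF emeasure_mono fB]; use Wsub[OF that] in simp)+
    fix X t assume X: "R1^3 < X" and t: "p X < t" and le: "ennreal (c * X) \<le> emeasure lborel {x. t < V x}"
    have X0: "X > 0" using X R by (meson less_trans zero_less_power)
    have p0: "p X \<ge> 0" using s by (simp add: p_def)
    define a where "a = s * lam * X powr (-2/3)"
    have a: "a > 0" using s lam X0 by (simp add: a_def)
    have aa: "a\<^sup>2 / (4 * s) = p X"
    proof -
      have "(X powr (-2/3))\<^sup>2 = X powr (-2/3 + -2/3)" by (simp only: power2_eq_square powr_add)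
      then have "(X powr (-2/3))\<^sup>2 = X powr (-4/3)" by simp
      then show ?thesis using s by (simp add: a_def p_def power_mult_distrib) (simp add: power2_eq_square)
    qed
    have "X powr (2/3) * X powr (-2/3) = 1" using X0 by (simp flip: powr_add)
    then have "X + 3 * s * lam = X + 3 * X powr (2/3) * a" by (simp add: a_def)
    also have "ennreal (4/3*pi * (X + 3 * X powr (2/3) * a)) \<le> emeasure lborel {x. t - p X < W x}"
    proof (rule brunn_minkowski_cball)
      show "{x. t < V x} \<in> sets borel" "{x. t - p X < W x} \<in> sets borel"
        unfolding W_def[abs_def] by measurable
      show "bounded {x. t < V x}"
        using Wsub(2)[of t] t p0 bounded_subset[of B] by (auto simp: B_def)
      show "ennreal (4/3*pi * X) \<le> emeasure lborel {x. t < V x}" using le by (simp add: c_def)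
      fix x y :: "real^3" assume "x \<in> {x. t < V x}" "norm y \<le> a"
      moreover have "(norm y)\<^sup>2 / (4 * s) \<le> a\<^sup>2 / (4 * s)"
        using \<open>norm y \<le> a\<close> s by (intro divide_right_mono power_mono) auto
      ultimately show "x + y \<in> {x. t - p X < W x}"
        using key[of x "x + y"] aa by simp
    qed (use X0 a in auto)
    finally show "ennreal (c * (X + 3 * s * lam)) \<le> emeasure lborel {x. t - p X < W x}"
      by (simp add: c_def)
  next
    fix t assume t: "0 < t" "t < T"
    have "ennreal (c * (R1^3 + 3 * s * lam)) \<le> ennreal (4/3*pi * R^3)"
      using sR c unfolding c_def by (intro ennreal_leI mult_left_mono) auto
    also have "\<dots> \<le> emeasure lborel {x. V x = T}" by fact
    also have "\<dots> \<le> emeasure lborel {x. t < W x}"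
      using t VW by (intro emeasure_mono) (auto simp: W_def[abs_def] intro: less_le_trans)
    finally show "ennreal (c * (R1^3 + 3 * s * lam)) \<le> emeasure lborel {x. t < W x}" .
  qed (use c s lam T V R in \<open>auto simp: p_def\<close>)
  also have "(\<integral>\<^sup>+X. indicator {R1^3<..} X * ennreal (p X) \<partial>lborel) \<le>
      ennreal (3 * (s * lam\<^sup>2 / 4) * (R1^3) powr (-1/3))"
    unfolding p_def by (rule nn_integral_powr_tail) (use s R in auto)
  also have "(R1^3) powr (-1/3) = 1 / R1"
  proof -
    have "R1^3 = R1 powr 3" using R by simp
    then have "(R1^3) powr (-1/3) = R1 powr (-1)" by (simp only: powr_powr) simp
    then show ?thesis using R by (simp add: powr_neg_one)
  qed
  also have "(\<integral>\<^sup>+x. W x \<partial>lborel) = (\<integral>\<^sup>+x. V x \<partial>lborel) +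
     ennreal s * (\<integral>\<^sup>+x. indicator B x * ennreal ((norm (G x) + \<omega>)\<^sup>2) \<partial>lborel)"
  proof -
    have "(\<integral>\<^sup>+x. W x \<partial>lborel) = (\<integral>\<^sup>+x. ennreal (V x) + ennreal s * (indicator B x * ennreal ((norm (G x) + \<omega>)\<^sup>2)) \<partial>lborel)"
      using s V(1) by (intro nn_integral_cong) (auto simp: W_def ennreal_mult split: split_indicator)
    also have "\<dots> = (\<integral>\<^sup>+x. V x \<partial>lborel) +
        (\<integral>\<^sup>+x. ennreal s * (indicator B x * ennreal ((norm (G x) + \<omega>)\<^sup>2)) \<partial>lborel)"
      by (rule nn_integral_add) auto
    also have "(\<integral>\<^sup>+x. ennreal s * (indicator B x * ennreal ((norm (G x) + \<omega>)\<^sup>2)) \<partial>lborel) =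
       ennreal s * (\<integral>\<^sup>+x. indicator B x * ennreal ((norm (G x) + \<omega>)\<^sup>2) \<partial>lborel)"
      by (rule nn_integral_cmult) measurable
    finally show ?thesis .
  qed
  finally have *: "(\<integral>\<^sup>+x. V x \<partial>lborel) + ennreal (c * (3 * s * lam) * T)
    \<le> (\<integral>\<^sup>+x. V x \<partial>lborel) + ennreal s * (\<integral>\<^sup>+x. indicator B x * ennreal ((norm (G x) + \<omega>)\<^sup>2) \<partial>lborel) +
      ennreal c * ennreal (3 * (s * lam\<^sup>2 / 4) * (1 / R1))"
    by (simp add: mult_left_mono add_left_mono)
  have "(\<integral>\<^sup>+x. V x \<partial>lborel) \<le> (\<integral>\<^sup>+x. ennreal T * indicator B x \<partial>lborel)"
  proof (intro nn_integral_mono)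
    fix x show "ennreal (V x) \<le> ennreal T * indicator B x"
      using V(2)[of x] N(2)[of x] by (auto split: split_indicator simp: B_def ennreal_leI)
  qed
  also have "\<dots> < \<infinity>"
    using emeasure_lborel_cball_finite[of "0::real^3" "N+1"] by (simp add: B_def nn_integral_cmult_indicator ennreal_mult_less_top)
  \<comment> \<open>The integral of \<open>V\<close> stands on both sides and can be cancelled only
    because it is finite.\<close>
  finally have Vfin: "(\<integral>\<^sup>+x. V x \<partial>lborel) \<noteq> \<infinity>" by simp
  define I where "I = (\<integral>\<^sup>+x. indicator B x * ennreal ((norm (G x) + \<omega>)\<^sup>2) \<partial>lborel)"
  have "ennreal (c * (3 * s * lam) * T) \<le> ennreal s * I + ennreal c * ennreal (3 * (s * lam\<^sup>2 / 4) * (1 / R1))"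
    using * Vfin unfolding I_def[symmetric] add.assoc by (simp add: ennreal_add_left_cancel_le)
  moreover have "ennreal c * ennreal (3 * (s * lam\<^sup>2 / 4) * (1 / R1)) = ennreal (c * (3 * (s * lam\<^sup>2 / 4) * (1 / R1)))"
    using c by (intro ennreal_mult'[symmetric]) auto
  ultimately have le: "ennreal (c * (3 * s * lam) * T) \<le> ennreal s * I + ennreal (c * (3 * (s * lam\<^sup>2 / 4) * (1 / R1)))"
    by (simp only:)
  have "ennreal (4 * pi * T\<^sup>2 * R1) \<le> I"
  proof (cases I)
    case (real i)
    have "c * (3 * s * lam) * T \<le> s * i + c * (3 * (s * lam\<^sup>2 / 4) * (1 / R1))"
      using le real s c R by (simp flip: ennreal_mult ennreal_plus)
    then have "s * (8 * pi * T\<^sup>2 * R1) \<le> s * (i + 4 * pi * T\<^sup>2 * R1)"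
      using R by (simp add: c_def lam_def power2_eq_square field_simps)
    then have "8 * pi * T\<^sup>2 * R1 \<le> i + 4 * pi * T\<^sup>2 * R1"
      using s by simp
    then have "4 * pi * T\<^sup>2 * R1 \<le> i" by linarith
    then show ?thesis unfolding real by (rule ennreal_leI)
  qed simp
  then show ?thesis by (simp add: I_def B_def)
qed

text \<open>Removes \<open>\<omega>\<close> and the gap between \<open>R1\<close> and
  \<open>R\<close>. If the energy i were below 4 pi T^2 R, some R1 < R would still satisfy i < 4 pi
  T^2 R1, and an \<open>\<omega>\<close> whose contribution over the ball of radius N + 1 is smaller
  than the difference would contradict the preceding lemma.\<close>

theorem dirichlet_energy_lower_bound:
  fixes V :: "real^3 \<Rightarrow> real" and G :: "real^3 \<Rightarrow> real^3"
  assumes der: "\<And>x. (V has_derivative (\<lambda>h. G x \<bullet> h)) (at x)"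
    and cont: "continuous_on UNIV G"
    and N: "N > 0" "\<And>x. N \<le> norm x \<Longrightarrow> V x = 0"
    and V: "\<And>x. 0 \<le> V x" "\<And>x. V x \<le> T" and T: "T > 0"
    and R: "0 < R" "ennreal (4/3*pi * R^3) \<le> emeasure lborel {x. V x = T}"
  shows "ennreal (4 * pi * T\<^sup>2 * R) \<le> (\<integral>\<^sup>+x. ennreal ((norm (G x))\<^sup>2) \<partial>lborel)"
proof (rule ccontr)
  assume "\<not> ?thesis"
  then have lt: "(\<integral>\<^sup>+x. ennreal ((norm (G x))\<^sup>2) \<partial>lborel) < ennreal (4 * pi * T\<^sup>2 * R)" by simp
  then obtain i where i: "(\<integral>\<^sup>+x. ennreal ((norm (G x))\<^sup>2) \<partial>lborel) = ennreal i" "i \<ge> 0"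
    by (cases "(\<integral>\<^sup>+x. ennreal ((norm (G x))\<^sup>2) \<partial>lborel)") auto
  have iR: "i < 4 * pi * T\<^sup>2 * R" using lt i by (simp add: ennreal_less_iff)
  have [measurable]: "G \<in> borel_measurable borel"
    using cont by (auto intro: borel_measurable_continuous_onI)
  have G0: "G x = 0" if "norm x > N" for x
  proof -
    have "((\<lambda>_. 0::real) has_derivative (\<lambda>h. G x \<bullet> h)) (at x)"
    proof (rule has_derivative_transform_within_open[OF der[of x]])
      show "open {x::real^3. N < norm x}" by (intro open_Collect_less continuous_intros)
    qed (use that N in auto)
    then have "(\<lambda>h. G x \<bullet> h) = (\<lambda>h. 0)"
      using has_derivative_unique has_derivative_const by blast
    then have "G x \<bullet> G x = 0" by metis
    then show ?thesis by simp
  qed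
  have "compact (G ` cball 0 N)"
    by (intro compact_continuous_image continuous_on_subset[OF cont]) auto
  then obtain L where L: "L > 0" "\<And>x. x \<in> cball 0 N \<Longrightarrow> norm (G x) \<le> L"
    using bounded_pos[of "G ` cball 0 N"] by (auto dest: compact_imp_bounded)
  have GL: "norm (G x) \<le> L" for x
    using L(1) L(2)[of x] G0[of x] by (cases "norm x \<le> N") auto
  define m where "m = measure lborel (cball (0::real^3) (N+1))"
  have m: "emeasure lborel (cball (0::real^3) (N+1)) = ennreal m"
    unfolding m_def using emeasure_lborel_cball_finite[of "0::real^3" "N+1"] by (simp add: emeasure_eq_ennreal_measure)
  define R1 where "R1 = (max 0 (i / (4 * pi * T\<^sup>2)) + R) / 2"
  have iR': "i / (4 * pi * T\<^sup>2) < R" using iR T by (simp add: field_simps)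
  have R1: "0 < R1" "R1 < R" "i / (4 * pi * T\<^sup>2) < R1"
    using R iR' by (auto simp: R1_def)
  have iR1: "i < 4 * pi * T\<^sup>2 * R1" using R1(3) T by (simp add: field_simps)
  \<comment> \<open>The perturbation raises the integral by at most \<omega> (2 L + 1) m. The
    summand 1 keeps the divisor positive, and the factor 2 makes the resulting inequality
    strict.\<close>
  define \<omega> where "\<omega> = min 1 ((4 * pi * T\<^sup>2 * R1 - i) / (2 * ((2 * L + 1) * m + 1)))"
  have m0: "m \<ge> 0" by (simp add: m_def)
  have den: "(2 * L + 1) * m + 1 > 0" using L m0 by (simp add: add_nonneg_pos)
  have \<omega>: "\<omega> > 0" "\<omega> \<le> 1" using iR1 den by (auto simp: \<omega>_def)
  have "\<omega> \<le> (4 * pi * T\<^sup>2 * R1 - i) / (2 * ((2 * L + 1) * m + 1))" by (simp add: \<omega>_def)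
  then have "2 * (\<omega> * ((2 * L + 1) * m + 1)) \<le> 4 * pi * T\<^sup>2 * R1 - i"
    using den by (subst (asm) pos_le_divide_eq) (auto simp: algebra_simps)
  moreover have "\<omega> * ((2 * L + 1) * m + 1) > 0" using \<omega> den by simp
  ultimately have small: "i + \<omega> * ((2 * L + 1) * m + 1) < 4 * pi * T\<^sup>2 * R1" by linarith
  have "ennreal (4 * pi * T\<^sup>2 * R1) \<le>
    (\<integral>\<^sup>+x. indicator (cball 0 (N+1)) x * ennreal ((norm (G x) + \<omega>)\<^sup>2) \<partial>lborel)"
    using der cont N V T R1(1,2) R(2) L(1) GL \<omega>(1) by (rule dirichlet_energy_lower_bound_aux)
  also have "\<dots> \<le> (\<integral>\<^sup>+x. ennreal ((norm (G x))\<^sup>2) + ennreal (\<omega> * (2 * L + 1)) * indicator (cball 0 (N+1)) x \<partial>lborel)"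
  proof (intro nn_integral_mono)
    fix x :: "real^3"
    have "(norm (G x) + \<omega>)\<^sup>2 = (norm (G x))\<^sup>2 + \<omega> * (2 * norm (G x) + \<omega>)"
      by (simp add: power2_eq_square algebra_simps)
    also have "\<dots> \<le> (norm (G x))\<^sup>2 + \<omega> * (2 * L + 1)"
      using \<omega> GL[of x] by (intro add_left_mono mult_left_mono) auto
    finally have "ennreal ((norm (G x) + \<omega>)\<^sup>2) \<le> ennreal ((norm (G x))\<^sup>2) + ennreal (\<omega> * (2 * L + 1))"
      using \<omega> L by (simp add: ennreal_leI flip: ennreal_plus)
    then show "indicator (cball 0 (N+1)) x * ennreal ((norm (G x) + \<omega>)\<^sup>2) \<le>
        ennreal ((norm (G x))\<^sup>2) + ennreal (\<omega> * (2 * L + 1)) * indicator (cball 0 (N+1)) x"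
      by (auto split: split_indicator)
  qed
  also have "\<dots> = ennreal i + ennreal (\<omega> * (2 * L + 1)) * ennreal m"
    by (subst nn_integral_add) (auto simp: nn_integral_cmult_indicator i m intro!: borel_measurable_times_ennreal borel_measurable_indicator)
  also have "\<dots> = ennreal (i + \<omega> * (2 * L + 1) * m)"
    using i \<omega> L m0 by (simp flip: ennreal_mult ennreal_plus)
  finally have "4 * pi * T\<^sup>2 * R1 \<le> i + \<omega> * (2 * L + 1) * m"
    using i \<omega> L m0 by (subst (asm) ennreal_le_iff) auto
  then show False using small \<omega> by (simp add: algebra_simps)
qed

section \<open>Integration by parts and radial integrals\<close>

lemma lborel_integral_translate:
  fixes f :: "'a::euclidean_space \<Rightarrow> real"
  assumes [measurable]: "f \<in> borel_measurable borel"
  shows "(\<integral>x. f (c + x) \<partial>lborel) = (\<integral>x. f x \<partial>lborel)"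
    and "integrable lborel (\<lambda>x. f (c + x)) \<longleftrightarrow> integrable lborel f"
proof -
  have "(\<integral>x. f (c + x) \<partial>lborel) = (\<integral>x. f x \<partial>distr lborel borel ((+) c))"
    by (subst integral_distr) auto
  then show "(\<integral>x. f (c + x) \<partial>lborel) = (\<integral>x. f x \<partial>lborel)"
    by (simp add: lborel_distr_plus)
  have "integrable lborel (\<lambda>x. f (c + x)) \<longleftrightarrow> integrable (distr lborel borel ((+) c)) f"
    by (subst integrable_distr_eq) auto
  then show "integrable lborel (\<lambda>x. f (c + x)) \<longleftrightarrow> integrable lborel f"
    by (simp add: lborel_distr_plus)
qed

lemma integrable_lborel_bounded_support:
  fixes f :: "'a::euclidean_space \<Rightarrow> real"
  assumes [measurable]: "f \<in> borel_measurable borel"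
    and "\<And>x. \<bar>f x\<bar> \<le> M" and "\<And>x. norm x > N \<Longrightarrow> f x = 0"
  shows "integrable lborel f"
proof (rule Bochner_Integration.integrable_bound)
  have "integrable lborel (indicator (cball (0::'a) N) :: 'a \<Rightarrow> real)"
    using emeasure_lborel_cball_finite[of "0::'a" N] by (intro integrable_real_indicator) auto
  then show "integrable lborel (\<lambda>x::'a. M * indicat_real (cball 0 N) x)"
    by (intro integrable_mult_right)
  have "norm (f x) \<le> norm (M * indicat_real (cball 0 N) x)" for x
    using assms(2)[of x] assms(3)[of x] by (cases "norm x \<le> N") auto
  then show "AE x in lborel. norm (f x) \<le> norm (M * indicat_real (cball 0 N) x)" by simp
qed simp

text \<open>Difference quotients integrate to zero by translation invariance.\<close>

lemma integral_directional_derivative_eq_0: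
  fixes f :: "'a::euclidean_space \<Rightarrow> real"
  assumes der: "\<And>x. (f has_derivative D x) (at x)"
    and [measurable]: "(\<lambda>x. D x e) \<in> borel_measurable borel"
    and M: "\<And>x. \<bar>D x e\<bar> \<le> M"
    and N: "\<And>x. norm x > N \<Longrightarrow> f x = 0"
  shows "(\<integral>x. D x e \<partial>lborel) = 0"
proof -
  have contf: "continuous_on UNIV f"
    using der by (meson continuous_at_imp_continuous_on has_derivative_continuous)
  then have [measurable]: "f \<in> borel_measurable borel"
    by (rule borel_measurable_continuous_onI)
  define t where "t n = inverse (real (Suc n))" for n
  have t: "t n > 0" "t n \<le> 1" for n by (auto simp: t_def field_simps)
  define g where "g n x = (f (t n *\<^sub>R e + x) - f x) / t n" for n x
  have line: "((\<lambda>s. f (x + s *\<^sub>R e)) has_real_derivative D (x + s *\<^sub>R e) e) (at s)" for x s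
  proof -
    have lin: "linear (D (x + s *\<^sub>R e))"
      using der has_derivative_linear by blast
    have "((\<lambda>s. f (x + s *\<^sub>R e)) has_derivative (\<lambda>h. D (x + s *\<^sub>R e) (h *\<^sub>R e))) (at s)"
      by (rule has_derivative_compose[OF _ der]) (auto intro!: derivative_eq_intros)
    moreover have "(\<lambda>h. D (x + s *\<^sub>R e) (h *\<^sub>R e)) = (*) (D (x + s *\<^sub>R e) e)"
      using lin by (simp add: fun_eq_iff linear_scale mult.commute)
    ultimately show ?thesis
      unfolding has_field_derivative_def by (simp only:)
  qed
  \<comment> \<open>By the mean value theorem a difference quotient is a derivative at an
    intermediate point, so the bound \<open>M\<close> serves as the dominating constant.\<close>
  have gM: "\<bar>g n x\<bar> \<le> M" for n x
  proof -
    obtain z where z: "f (x + t n *\<^sub>R e) - f (x + 0 *\<^sub>R e) = (t n - 0) * D (x + z *\<^sub>R e) e"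
      using MVT2[OF t(1)[of n], of "\<lambda>s. f (x + s *\<^sub>R e)" "\<lambda>s. D (x + s *\<^sub>R e) e"] line by blast
    then have "g n x = D (x + z *\<^sub>R e) e"
      using t(1)[of n] by (simp add: g_def add.commute)
    then show ?thesis using M by simp
  qed
  have g0: "g n x = 0" if "norm x > \<bar>N\<bar> + norm e" for n x
  proof -
    have "norm x \<le> norm (t n *\<^sub>R e + x) + norm (t n *\<^sub>R e)"
      by (metis add.commute norm_triangle_sub add_diff_cancel_left' norm_minus_commute)
    also have "norm (t n *\<^sub>R e) \<le> norm e"
      using t[of n] by (simp add: mult_left_le_one_le)
    finally have "norm (t n *\<^sub>R e + x) > N" using that by simp
    moreover have "norm x > N" using that by (smt (verit) norm_ge_zero)
    ultimately show ?thesis using N by (simp add: g_def)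
  qed
  have intf: "integrable lborel f"
  proof -
    have "compact (f ` cball 0 N)"
      by (intro compact_continuous_image continuous_on_subset[OF contf]) auto
    then obtain B where B: "B > 0" "\<And>x. x \<in> cball 0 N \<Longrightarrow> \<bar>f x\<bar> \<le> B"
      using bounded_pos[of "f ` cball 0 N"] by (auto dest: compact_imp_bounded)
    have "\<bar>f x\<bar> \<le> B" for x
      using B N[of x] by (cases "norm x \<le> N") auto
    then show ?thesis by (intro integrable_lborel_bounded_support[of _ B N] N) auto
  qed
  have "(\<lambda>n. \<integral>x. g n x \<partial>lborel) \<longlonglongrightarrow> (\<integral>x. D x e \<partial>lborel)"
  proof (rule integral_dominated_convergence)
    let ?w = "\<lambda>x::'a. M * indicat_real (cball 0 (\<bar>N\<bar> + norm e)) x"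
    have "M \<ge> 0" using gM[of 0 0] by simp
    have [measurable]: "cball (0::'a) r \<in> sets borel" for r by simp
    show "integrable lborel ?w"
      using \<open>M \<ge> 0\<close> by (intro integrable_lborel_bounded_support[of _ M "\<bar>N\<bar> + norm e"]) (auto split: split_indicator)
    show "AE x in lborel. norm (g n x) \<le> ?w x" for n
    proof (intro AE_I2)
      fix x
      show "norm (g n x) \<le> ?w x"
        using gM[of n x] g0[of x n] by (cases "norm x \<le> \<bar>N\<bar> + norm e") auto
    qed
    show "AE x in lborel. (\<lambda>n. g n x) \<longlonglongrightarrow> D x e"
    proof (intro AE_I2)
      fix x
      have "((\<lambda>h. (f (x + (0 + h) *\<^sub>R e) - f (x + 0 *\<^sub>R e)) / h) \<longlongrightarrow> D (x + 0 *\<^sub>R e) e) (at 0)"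
        using line[of x 0] unfolding DERIV_def .
      moreover have "filterlim t (at 0) sequentially"
        unfolding filterlim_at using t(1) LIMSEQ_inverse_real_of_nat
        by (auto simp: t_def[abs_def] intro!: always_eventually)
      ultimately have "(\<lambda>n. (f (x + (0 + t n) *\<^sub>R e) - f (x + 0 *\<^sub>R e)) / t n) \<longlonglongrightarrow> D (x + 0 *\<^sub>R e) e"
        by (rule filterlim_compose)
      then show "(\<lambda>n. g n x) \<longlonglongrightarrow> D x e"
        by (simp add: g_def add.commute)
    qed
  qed (auto simp: g_def)
  moreover have "(\<integral>x. g n x \<partial>lborel) = 0" for n
    unfolding g_def using intf lborel_integral_translate[of f "t n *\<^sub>R e"] by simp
  ultimately show ?thesis using LIMSEQ_unique[of "\<lambda>_. 0" "\<integral>x. D x e \<partial>lborel" 0] by simp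
qed

text \<open>Polar coordinates for radial functions without a surface measure: both sides agree on
  the half-lines {..a}, where the left one is the volume of a ball, and half-lines generate the
  Borel sets.\<close>

lemma distr_norm_lborel:
  "distr lborel borel (norm :: real^3 \<Rightarrow> real) =
     density lborel (\<lambda>s. ennreal (4 * pi * s\<^sup>2) * indicator {0..} s)"
proof (rule measure_eqI_generator_eq[where E="range atMost" and \<Omega>=UNIV and A="\<lambda>i. {..real i}"])
  show "Int_stable (range (atMost :: real \<Rightarrow> real set))"
    by (auto simp: Int_stable_def)
  show "sets (distr lborel borel (norm :: real^3 \<Rightarrow> real)) = sigma_sets UNIV (range atMost)"
    using borel_eq_atMost by (metis (no_types, lifting) sets_distr sets_measure_of subset_UNIV Pow_UNIV)
  then show "sets (density lborel (\<lambda>s. ennreal (4 * pi * s\<^sup>2) * indicator {0..} s)) = sigma_sets UNIV (range atMost)"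
    by simp
  show "range (\<lambda>i. {..real i}) \<subseteq> range atMost" by auto
  show "(\<Union>i. {..real i}) = UNIV" by (auto simp: real_arch_simple)
  have e: "emeasure (distr lborel borel (norm :: real^3 \<Rightarrow> real)) {..a} = emeasure lborel (cball (0::real^3) a)" for a
    by (subst emeasure_distr) (auto intro!: arg_cong[where f="emeasure lborel"])
  show "emeasure (distr lborel borel (norm :: real^3 \<Rightarrow> real)) {..real i} \<noteq> \<infinity>" for i
    using e emeasure_lborel_cball_finite[of "0::real^3" "real i"] by simp
  fix S :: "real set" assume "S \<in> range atMost"
  then obtain a where S: "S = {..a}" by auto
  show "emeasure (distr lborel borel (norm :: real^3 \<Rightarrow> real)) S =
     emeasure (density lborel (\<lambda>s. ennreal (4 * pi * s\<^sup>2) * indicator {0..} s)) S"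
  proof (cases "a \<ge> 0")
    case True
    have "emeasure (density lborel (\<lambda>s. ennreal (4 * pi * s\<^sup>2) * indicator {0..} s)) S =
       (\<integral>\<^sup>+s. ennreal (4 * pi * s\<^sup>2) * indicator {0..a} s \<partial>lborel)"
      unfolding S by (subst emeasure_density) (auto intro!: nn_integral_cong split: split_indicator)
    also have "\<dots> = ennreal (4/3 * pi * a^3 - 4/3 * pi * 0^3)"
      by (rule nn_integral_FTC_Icc[OF _ _ _ True])
        (auto intro!: derivative_eq_intros simp: power2_eq_square)
    finally show ?thesis
      unfolding S e using emeasure_cball[OF True, of "0::real^3"] by (simp add: unit_ball_vol_3)
  next
    case False
    have "ennreal (4 * pi * s\<^sup>2) * indicator {0..} s * indicator S s = 0" for s
      using False by (auto simp: S split: split_indicator)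
    moreover have "emeasure (density lborel (\<lambda>s. ennreal (4 * pi * s\<^sup>2) * indicator {0..} s)) S =
        (\<integral>\<^sup>+s. ennreal (4 * pi * s\<^sup>2) * indicator {0..} s * indicator S s \<partial>lborel)"
      by (rule emeasure_density) (auto simp: S)
    ultimately have "emeasure (density lborel (\<lambda>s. ennreal (4 * pi * s\<^sup>2) * indicator {0..} s)) S = 0"
      by (simp only: nn_integral_const) simp
    then show ?thesis using False unfolding S e by simp
  qed
qed auto

lemma nn_integral_radial:
  assumes [measurable]: "f \<in> borel_measurable borel"
  shows "(\<integral>\<^sup>+x. f (norm (x::real^3)) \<partial>lborel) =
    (\<integral>\<^sup>+s. ennreal (4 * pi * s\<^sup>2) * indicator {0..} s * f s \<partial>lborel)"
proof -
  have "(\<integral>\<^sup>+x. f (norm (x::real^3)) \<partial>lborel) = (\<integral>\<^sup>+s. f s \<partial>distr lborel borel (norm :: real^3 \<Rightarrow> real))"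
    by (subst nn_integral_distr) auto
  also have "\<dots> = (\<integral>\<^sup>+s. ennreal (4 * pi * s\<^sup>2) * indicator {0..} s * f s \<partial>lborel)"
    unfolding distr_norm_lborel by (subst nn_integral_density) auto
  finally show ?thesis .
qed

section \<open>A continuously differentiable positive part\<close>

lemma DERIV_pos_part_sq: "((\<lambda>t::real. (max t 0)\<^sup>2) has_real_derivative 2 * max t 0) (at t)"
proof -
  consider "t > 0" | "t < 0" | "t = 0" by linarith
  then show ?thesis
  proof cases
    case 1
    have "((\<lambda>t::real. t\<^sup>2) has_real_derivative 2 * t) (at t)"
      by (auto intro!: derivative_eq_intros)
    then have "((\<lambda>t::real. (max t 0)\<^sup>2) has_real_derivative 2 * t) (at t)"
      by (rule has_field_derivative_transform_within_open[of _ _ _ "{0<..}"]) (use 1 in auto)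
    then show ?thesis using 1 by simp
  next
    case 2
    have "((\<lambda>t::real. 0) has_real_derivative 0) (at t)" by simp
    then have "((\<lambda>t::real. (max t 0)\<^sup>2) has_real_derivative 0) (at t)"
      by (rule has_field_derivative_transform_within_open[of _ _ _ "{..<0}"]) (use 2 in auto)
    then show ?thesis using 2 by simp
  next
    case 3
    have "((\<lambda>h::real. (max h 0)\<^sup>2 / h) \<longlongrightarrow> 0) (at 0)"
    proof (rule Lim_null_comparison)
      show "\<forall>\<^sub>F h::real in at 0. norm ((max h 0)\<^sup>2 / h) \<le> \<bar>h\<bar>"
        by (intro always_eventually) (auto simp: power2_eq_square max_def)
      show "(abs \<longlongrightarrow> (0::real)) (at 0)"
        by (intro tendsto_eq_intros) auto
    qed
    then show ?thesis using 3 by (simp add: DERIV_def)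
  qed
qed

text \<open>A C^1 and 1-Lipschitz substitute for the positive part, too small by at most
  \<open>k\<close> and exactly 0 for t <= 0. The exact zero makes truncated functions locally
  constant near the domain and zero far away.\<close>

definition soft_pos :: "real \<Rightarrow> real \<Rightarrow> real" where
  "soft_pos k t = sqrt ((max t 0)\<^sup>2 + k\<^sup>2) - k"

definition soft_pos' :: "real \<Rightarrow> real \<Rightarrow> real" where
  "soft_pos' k t = max t 0 / sqrt ((max t 0)\<^sup>2 + k\<^sup>2)"

lemma soft_pos:
  assumes k: "k > 0"
  shows "(soft_pos k has_real_derivative soft_pos' k t) (at t)"
    and "0 \<le> soft_pos' k t" "soft_pos' k t \<le> 1" "t \<le> 0 \<Longrightarrow> soft_pos k t = 0" "t \<le> 0 \<Longrightarrow> soft_pos' k t = 0"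
    and "t - k \<le> soft_pos k t" "s \<le> t \<Longrightarrow> soft_pos k s \<le> soft_pos k t" "0 \<le> soft_pos k t"
    and "continuous_on S (soft_pos' k)"
proof -
  have p: "(max t 0)\<^sup>2 + k\<^sup>2 > 0" for t :: real using k by (simp add: add_nonneg_pos)
  show "(soft_pos k has_real_derivative soft_pos' k t) (at t)"
  proof -
    have "((\<lambda>t. (max t 0)\<^sup>2 + k\<^sup>2) has_real_derivative 2 * max t 0 + 0) (at t)"
      by (intro DERIV_add DERIV_pos_part_sq DERIV_const)
    from DERIV_diff[OF DERIV_chain2[OF DERIV_real_sqrt[OF p[of t]] this] DERIV_const[of k]]
    show ?thesis
      by (simp add: soft_pos_def[abs_def] soft_pos'_def field_simps)
  qed
  show "0 \<le> soft_pos' k t" by (simp add: soft_pos'_def)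
  have "max t 0 \<le> sqrt ((max t 0)\<^sup>2 + k\<^sup>2)"
    by (intro real_le_rsqrt) simp
  then show "soft_pos' k t \<le> 1"
    using p[of t] by (simp add: soft_pos'_def)
  show "t \<le> 0 \<Longrightarrow> soft_pos k t = 0" "t \<le> 0 \<Longrightarrow> soft_pos' k t = 0"
    using k by (simp_all add: soft_pos_def soft_pos'_def max_def)
  show "t - k \<le> soft_pos k t"
    using \<open>max t 0 \<le> _\<close> k unfolding soft_pos_def by linarith
  show mono: "soft_pos k s \<le> soft_pos k t" if "s \<le> t" for s t
    using that by (auto simp: soft_pos_def intro!: power_mono)
  show "0 \<le> soft_pos k t"
    using mono[of "min t 0" t] k by (simp add: soft_pos_def min_def max_def split: if_splits)
  show "continuous_on S (soft_pos' k)"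
    unfolding soft_pos'_def[abs_def] using p
    by (intro continuous_intros) (auto simp: less_imp_neq[symmetric])
qed

lemma continuous_bounded_support:
  fixes g :: "'a::euclidean_space \<Rightarrow> real"
  assumes "continuous_on UNIV g" "\<And>x. norm x > N \<Longrightarrow> g x = 0"
  shows "\<exists>M. \<forall>x. \<bar>g x\<bar> \<le> M" and "g \<in> borel_measurable borel" and "integrable lborel g"
proof -
  show m[measurable]: "g \<in> borel_measurable borel"
    using assms(1) by (rule borel_measurable_continuous_onI)
  have "compact (g ` cball 0 N)"
    by (intro compact_continuous_image continuous_on_subset[OF assms(1)]) auto
  then obtain B where B: "B > 0" "\<And>x. x \<in> cball 0 N \<Longrightarrow> \<bar>g x\<bar> \<le> B"
    using bounded_pos[of "g ` cball 0 N"] by (auto dest: compact_imp_bounded)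
  have "\<bar>g x\<bar> \<le> B" for x
    using B assms(2)[of x] by (cases "norm x \<le> N") auto
  then show "\<exists>M. \<forall>x. \<bar>g x\<bar> \<le> M" "integrable lborel g"
    by (auto intro!: integrable_lborel_bounded_support[of _ B N] assms(2))
qed

lemma has_derivative_norm_inner:
  fixes x :: "'a::real_inner"
  assumes "x \<noteq> 0"
  shows "(norm has_derivative (\<lambda>h. x \<bullet> h / norm x)) (at x)"
  using has_derivative_norm[OF assms]
  by (rule has_derivative_eq_rhs) (simp add: fun_eq_iff sgn_div_norm inner_commute divide_inverse)

lemma has_derivative_radial:
  fixes x :: "'a::real_inner"
  assumes "x \<noteq> 0" "(f has_real_derivative f') (at (norm x))"
  shows "((\<lambda>x. f (norm x)) has_derivative (\<lambda>h. f' / norm x * (x \<bullet> h))) (at x)"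
  using has_derivative_compose[OF has_derivative_norm_inner[OF assms(1)] assms(2)[unfolded has_field_derivative_def]]
  by (rule has_derivative_eq_rhs) (simp add: fun_eq_iff)

section \<open>Weighted Dirichlet energy\<close>

text \<open>With \<open>b = m/2\<close> the conformal factor is \<open>u = 1 + b/r\<close>, and \<open>schwarz_field\<close> is \<open>-\<nabla>u/u\<close>.
  Its divergence equals its squared length because \<open>u\<close> is harmonic.\<close>

definition schwarz_field :: "real \<Rightarrow> real^3 \<Rightarrow> real^3" where
  "schwarz_field b x = (b / ((norm x)\<^sup>2 * (norm x + b))) *\<^sub>R x"

definition schwarz_field_deriv :: "real \<Rightarrow> real^3 \<Rightarrow> real^3 \<Rightarrow> real^3" where
  "schwarz_field_deriv b x h =
    (- b * (3 * norm x + 2 * b) / ((norm x)^4 * (norm x + b)\<^sup>2) * (x \<bullet> h)) *\<^sub>R x +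
    (b / ((norm x)\<^sup>2 * (norm x + b))) *\<^sub>R h"

lemma has_derivative_schwarz_field:
  assumes "x \<noteq> 0" "b > 0"
  shows "(schwarz_field b has_derivative schwarz_field_deriv b x) (at x)"
proof -
  let ?k' = "- b * (3 * (norm x)\<^sup>2 + 2 * b * norm x) / ((norm x)\<^sup>2 * (norm x + b))\<^sup>2"
  have r: "norm x > 0" using assms by simp
  have "norm x + b \<noteq> 0" using r assms by linarith
  then have "((\<lambda>r. b / (r\<^sup>2 * (r + b))) has_real_derivative ?k') (at (norm x))"
  proof -
    have "((\<lambda>r. r\<^sup>2 * (r + b)) has_real_derivative 3 * (norm x)\<^sup>2 + 2 * b * norm x) (at (norm x))"
      by (auto intro!: derivative_eq_intros simp: power2_eq_square algebra_simps)
    moreover have "(norm x)\<^sup>2 * (norm x + b) \<noteq> 0" using r \<open>norm x + b \<noteq> 0\<close> by simp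
    ultimately show ?thesis
      using DERIV_divide[OF DERIV_const[of b]] by (fastforce simp: power2_eq_square)
  qed
  from has_derivative_scaleR[OF has_derivative_radial[OF assms(1) this] has_derivative_ident]
  have "(schwarz_field b has_derivative
     (\<lambda>h. (b / ((norm x)\<^sup>2 * (norm x + b))) *\<^sub>R h + (?k' / norm x * (x \<bullet> h)) *\<^sub>R x)) (at x)"
    unfolding schwarz_field_def[abs_def] .
  moreover have "?k' / norm x = - b * (3 * norm x + 2 * b) / ((norm x)^4 * (norm x + b)\<^sup>2)"
    using r \<open>norm x + b \<noteq> 0\<close> by (simp add: divide_simps) (simp add: power2_eq_square power4_eq_xxxx algebra_simps)
  ultimately show ?thesis
    unfolding schwarz_field_deriv_def[abs_def] add.commute[of "_ *\<^sub>R x"] by (simp only:)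
qed

lemma div_schwarz_field:
  assumes "x \<noteq> 0" "b > 0"
  shows "(\<Sum>i\<in>Basis. schwarz_field_deriv b x i \<bullet> i) = (norm (schwarz_field b x))\<^sup>2"
proof -
  have r: "norm x > 0" using assms by simp
  have rb: "norm x + b \<noteq> 0" using r assms by linarith
  define c where "c = - b * (3 * norm x + 2 * b) / ((norm x)^4 * (norm x + b)\<^sup>2)"
  define k where "k = b / ((norm x)\<^sup>2 * (norm x + b))"
  have "(\<Sum>i\<in>Basis. schwarz_field_deriv b x i \<bullet> i) = (\<Sum>i\<in>Basis. c * ((x \<bullet> i) * (x \<bullet> i)) + k)"
    unfolding schwarz_field_deriv_def c_def[symmetric] k_def[symmetric]
    by (intro sum.cong) (auto simp: inner_add_left)
  also have "\<dots> = c * (norm x)\<^sup>2 + 3 * k"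
    by (simp add: sum.distrib sum_distrib_left[symmetric] euclidean_inner[symmetric] power2_norm_eq_inner)
  also have "\<dots> = (k * norm x)\<^sup>2"
    using r rb unfolding c_def k_def
    by (simp add: divide_simps) (simp add: power2_eq_square power4_eq_xxxx algebra_simps)
  finally show ?thesis unfolding schwarz_field_def k_def[symmetric] by (simp add: power_mult_distrib)
qed

lemma schwarz_field_inner:
  assumes "x \<noteq> 0" shows "schwarz_field b x \<bullet> x = b / (norm x + b)"
  using assms by (simp add: schwarz_field_def dot_square_norm)

text \<open>Finite total energy of the field, which controls the error terms of order
  \<open>\<epsilon>\<close> in the weighted bound.\<close>

lemma nn_integral_schwarz_field:
  assumes "b > 0"
  shows "(\<integral>\<^sup>+x. ennreal ((norm (schwarz_field b x))\<^sup>2) \<partial>lborel) \<le> ennreal (4 * pi * b)"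
proof -
  have "(\<integral>\<^sup>+x. ennreal ((norm (schwarz_field b x))\<^sup>2) \<partial>lborel) =
     (\<integral>\<^sup>+x. ennreal ((b / ((norm x)\<^sup>2 * (norm x + b)) * norm x)\<^sup>2) \<partial>(lborel :: (real^3) measure))"
    using assms by (intro nn_integral_cong) (simp add: schwarz_field_def power_mult_distrib power_divide)
  also have "\<dots> = (\<integral>\<^sup>+s. ennreal (4 * pi * s\<^sup>2) * indicator {0..} s * ennreal ((b / (s\<^sup>2 * (s + b)) * s)\<^sup>2) \<partial>lborel)"
    by (rule nn_integral_radial) measurable
  also have "\<dots> \<le> (\<integral>\<^sup>+s. ennreal (4 * pi * b\<^sup>2 / (s + b)\<^sup>2) * indicator {0..} s \<partial>lborel)"
  proof (intro nn_integral_mono)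
    fix s :: real
    have "4 * pi * s\<^sup>2 * (b / (s\<^sup>2 * (s + b)) * s)\<^sup>2 = 4 * pi * b\<^sup>2 / (s + b)\<^sup>2" if "s > 0"
      using that assms by (simp add: divide_simps power2_eq_square)
    \<comment> \<open>At s = 0 the left side vanishes by the convention for division by 0.\<close>
    then have "4 * pi * s\<^sup>2 * (b / (s\<^sup>2 * (s + b)) * s)\<^sup>2 \<le> 4 * pi * b\<^sup>2 / (s + b)\<^sup>2" if "s \<ge> 0"
      using that assms by (cases "s = 0") auto
    then show "ennreal (4 * pi * s\<^sup>2) * indicator {0..} s * ennreal ((b / (s\<^sup>2 * (s + b)) * s)\<^sup>2)
       \<le> ennreal (4 * pi * b\<^sup>2 / (s + b)\<^sup>2) * indicator {0..} s"
      by (auto split: split_indicator simp: ennreal_mult'[symmetric] intro!: ennreal_leI)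
  qed
  also have "\<dots> = ennreal (0 - (- 4 * pi * b\<^sup>2 / (0 + b)))"
  proof (rule nn_integral_FTC_atLeast)
    show "((\<lambda>s. - 4 * pi * b\<^sup>2 / (s + b)) has_real_derivative 4 * pi * b\<^sup>2 / (x + b)\<^sup>2) (at x)" if "0 \<le> x" for x
      using that assms by (auto intro!: derivative_eq_intros simp: power2_eq_square)
    show "((\<lambda>s. - 4 * pi * b\<^sup>2 / (s + b)) \<longlongrightarrow> 0) at_top" by real_asymp
  qed auto
  finally show ?thesis using assms by (simp add: power2_eq_square mult.assoc)
qed

text \<open>What the energy estimate knows of a potential: boundary value 1, decay at infinity, and
  a continuous gradient off the closure. The estimate is one for arbitrary competitors in the
  variational problem.\<close>

locale exterior_function =
  fixes b :: real and \<Omega> :: "(real^3) set" and \<phi> :: "real^3 \<Rightarrow> real" and G\<phi> :: "real^3 \<Rightarrow> real^3"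
  assumes b: "b > 0" and open_\<Omega>: "open \<Omega>" and bdd: "bounded \<Omega>" and zero: "0 \<in> \<Omega>"
    and cont: "continuous_on (- \<Omega>) \<phi>"
    and der: "\<And>x. x \<notin> closure \<Omega> \<Longrightarrow> (\<phi> has_derivative (\<lambda>h. G\<phi> x \<bullet> h)) (at x)"
    and contG: "continuous_on (- closure \<Omega>) G\<phi>"
    and bd: "\<And>x. x \<in> frontier \<Omega> \<Longrightarrow> \<phi> x = 1"
    and lim: "(\<phi> \<longlongrightarrow> 0) at_infinity"
begin

text \<open>Chosen so that 1 - w = u (1 - \<phi>) with u = 1 + b/|x|. It is 1 on the frontier and
  tends to 0, hence competes for the Euclidean capacity, and u grad \<phi> = Gw - (1 - w) Y where Y
  is \<open>schwarz_field b\<close>.\<close>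

definition w :: "real^3 \<Rightarrow> real" where
  "w x = (if x \<in> closure \<Omega> then 1 else (1 + b / norm x) * \<phi> x - b / norm x)"

text \<open>The gradient of \<open>w\<close> off the closure. The value 0 on the closure is a
  convention, as \<open>w\<close> may fail to be differentiable on the frontier.\<close>

definition Gw :: "real^3 \<Rightarrow> real^3" where
  "Gw x = (if x \<in> closure \<Omega> then 0
     else (1 + b / norm x) *\<^sub>R G\<phi> x + ((1 - \<phi> x) * (b / (norm x)^3)) *\<^sub>R x)"

lemma compact_K: "compact (closure \<Omega>)"
  using bdd by simp

lemma not_K_nonzero: "x \<notin> closure \<Omega> \<Longrightarrow> x \<noteq> 0"
  using zero closure_subset by blast

lemma continuous_w: "continuous_on UNIV w"
proof -
  have "continuous_on (closure \<Omega> \<union> - \<Omega>)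
     (\<lambda>x. if x \<in> closure \<Omega> then 1 else (1 + b / norm x) * \<phi> x - b / norm x)"
  proof (rule continuous_on_cases)
    show "closed (- \<Omega>)" using open_\<Omega> by (simp add: closed_Compl)
    show "continuous_on (- \<Omega>) (\<lambda>x. (1 + b / norm x) * \<phi> x - b / norm x)"
      using zero by (intro continuous_intros cont) auto
    show "\<forall>x. x \<in> closure \<Omega> \<and> x \<notin> closure \<Omega> \<or> x \<in> - \<Omega> \<and> x \<in> closure \<Omega> \<longrightarrow>
         1 = (1 + b / norm x) * \<phi> x - b / norm x"
    proof (intro allI impI)
      fix x assume "x \<in> closure \<Omega> \<and> x \<notin> closure \<Omega> \<or> x \<in> - \<Omega> \<and> x \<in> closure \<Omega>"
      then have "x \<in> frontier \<Omega>" using open_\<Omega> by (auto simp: frontier_def interior_open)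
      then show "1 = (1 + b / norm x) * \<phi> x - b / norm x" using bd by simp
    qed
  qed auto
  moreover have "closure \<Omega> \<union> - \<Omega> = UNIV" using closure_subset by blast
  ultimately show ?thesis unfolding w_def[abs_def] by simp
qed

lemma w_measurable [measurable]: "w \<in> borel_measurable borel"
  using continuous_w by (rule borel_measurable_continuous_onI)

lemma open_D: "open (- closure \<Omega>)" by (rule open_Compl) simp

lemma has_derivative_w:
  assumes x: "x \<notin> closure \<Omega>"
  shows "(w has_derivative (\<lambda>h. Gw x \<bullet> h)) (at x)"
proof -
  have x0: "x \<noteq> 0" using not_K_nonzero[OF x] .
  have "((\<lambda>r. b / r) has_real_derivative - b / (norm x)\<^sup>2) (at (norm x))"
    using x0 by (auto intro!: derivative_eq_intros simp: power2_eq_square)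
  from has_derivative_radial[OF x0 this]
  have q: "((\<lambda>x. b / norm x) has_derivative (\<lambda>h. - b / (norm x)\<^sup>2 / norm x * (x \<bullet> h))) (at x)" .
  have "((\<lambda>x. (1 + b / norm x) * \<phi> x - b / norm x) has_derivative (\<lambda>h. Gw x \<bullet> h)) (at x)"
    by (rule has_derivative_eq_rhs[OF has_derivative_diff[OF has_derivative_mult[OF has_derivative_add[OF has_derivative_const q] der[OF x]] q]])
      (use x in \<open>auto simp: Gw_def fun_eq_iff inner_add_left algebra_simps power2_eq_square power3_eq_cube divide_simps\<close>)
  then show ?thesis
    by (rule has_derivative_transform_within_open[OF _ open_D]) (use x in \<open>auto simp: w_def\<close>)
qed

lemma continuous_Gw: "continuous_on (- closure \<Omega>) Gw"
proof -
  have "continuous_on (- closure \<Omega>) \<phi>"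
    using cont by (rule continuous_on_subset) (use closure_subset in blast)
  then have "continuous_on (- closure \<Omega>) (\<lambda>x. (1 + b / norm x) *\<^sub>R G\<phi> x + ((1 - \<phi> x) * (b / (norm x)^3)) *\<^sub>R x)"
    using not_K_nonzero by (intro continuous_intros contG) auto
  then show ?thesis
    by (rule continuous_on_eq) (simp add: Gw_def)
qed

lemma Gw_measurable [measurable]: "Gw \<in> borel_measurable borel"
proof -
  have "(\<lambda>x. if x \<in> - closure \<Omega> then Gw x else 0) \<in> borel_measurable borel"
    by (rule borel_measurable_continuous_on_if) (use continuous_Gw in auto)
  moreover have "(\<lambda>x. if x \<in> - closure \<Omega> then Gw x else 0) = Gw"
    by (auto simp: Gw_def)
  ultimately show ?thesis by simp
qed

lemma tendsto_w: "(w \<longlongrightarrow> 0) at_infinity"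
proof -
  have q: "((\<lambda>x::real^3. b / norm x) \<longlongrightarrow> 0) at_infinity"
    by (intro tendsto_divide_0[OF tendsto_const] filterlim_at_infinity_imp_norm_at_top[THEN filterlim_at_top_imp_at_infinity] filterlim_ident)
  have "((\<lambda>x. (1 + b / norm x) * \<phi> x - b / norm x) \<longlongrightarrow> (1 + 0) * 0 - 0) at_infinity"
    by (intro tendsto_intros q lim)
  moreover have "\<forall>\<^sub>F x in at_infinity. (1 + b / norm x) * \<phi> x - b / norm x = w x"
  proof -
    obtain B where "\<And>x. x \<in> closure \<Omega> \<Longrightarrow> norm x \<le> B"
      using compact_imp_bounded[OF compact_K] by (auto simp: bounded_iff)
    then have "x \<notin> closure \<Omega>" if "norm x \<ge> B + 1" for x using that by force
    then show ?thesis
      unfolding eventually_at_infinity by (intro exI[of _ "B+1"]) (auto simp: w_def)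
  qed
  ultimately show ?thesis by (simp add: tendsto_cong)
qed

text \<open>The Euclidean bound for a C^1 truncation of \<open>w\<close> from both ends. The inner
  \<open>soft_pos\<close> flattens the values above 1 - \<epsilon>, so nothing is differentiated at
  the frontier; the outer one removes the values near 0, giving compact support. The truncation is
  constant on \<open>\<Omega>\<close>, at a height of at least 1 - 4 \<epsilon>.\<close>

lemma energy_truncated:
  assumes \<epsilon>: "0 < \<epsilon>" "\<epsilon> < 1/8" and \<rho>: "0 < \<rho>" "\<And>x. \<rho> \<le> norm x \<Longrightarrow> \<bar>w x\<bar> < \<epsilon>"
    and R: "0 < R" "ennreal (4/3*pi * R^3) \<le> emeasure lborel \<Omega>"
  shows "ennreal (4 * pi * (1 - 4 * \<epsilon>)\<^sup>2 * R) \<le>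
    (\<integral>\<^sup>+x. indicator {x. w x < 1 - \<epsilon> \<and> norm x < \<rho>} x * ennreal ((norm (Gw x))\<^sup>2) \<partial>lborel)"
proof -
  define A where "A x = 1 - \<epsilon> - w x" for x
  \<comment> \<open>Where |w| < \<epsilon>, \<open>A\<close> exceeds 1 - 2 \<epsilon> and
    \<open>soft_pos\<close> loses at most \<epsilon>; the constant 1 - 3 \<epsilon> therefore makes
    \<open>C\<close> negative there.\<close>
  define C where "C x = 1 - 3 * \<epsilon> - soft_pos \<epsilon> (A x)" for x
  define V where "V x = soft_pos \<epsilon> (C x)" for x
  define G where "G x = (soft_pos' \<epsilon> (C x) * soft_pos' \<epsilon> (A x)) *\<^sub>R Gw x" for x
  define T where "T = soft_pos \<epsilon> (1 - 3 * \<epsilon>)"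
  have T: "1 - 4 * \<epsilon> \<le> T" unfolding T_def using soft_pos(6)[OF \<epsilon>(1), of "1 - 3 * \<epsilon>"] by simp
  then have T0: "T > 0" using \<epsilon> by linarith
  note sp = soft_pos[OF \<epsilon>(1)]
  have openU: "open {x. 1 - \<epsilon> < w x}"
    using continuous_w by (intro open_Collect_less) (auto intro: continuous_intros)
  have KU: "closure \<Omega> \<subseteq> {x. 1 - \<epsilon> < w x}" using \<epsilon> by (auto simp: w_def)
  have contAC: "continuous_on UNIV A" "continuous_on UNIV C"
  proof -
    show A: "continuous_on UNIV A" unfolding A_def by (intro continuous_intros continuous_w)
    have "continuous_on UNIV (soft_pos \<epsilon>)"
      using sp(1) by (meson DERIV_continuous continuous_at_imp_continuous_on)
    then have "continuous_on UNIV (\<lambda>x. soft_pos \<epsilon> (A x))"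
      using A continuous_on_compose2 by blast
    then show "continuous_on UNIV C" unfolding C_def by (intro continuous_intros)
  qed
  have "ennreal (4 * pi * T\<^sup>2 * R) \<le> (\<integral>\<^sup>+x. ennreal ((norm (G x))\<^sup>2) \<partial>lborel)"
  proof (rule dirichlet_energy_lower_bound)
    show "(V has_derivative (\<lambda>h. G x \<bullet> h)) (at x)" for x
    proof (cases "x \<in> closure \<Omega>")
      case False
      have "(A has_derivative (\<lambda>h. - (Gw x \<bullet> h))) (at x)"
        unfolding A_def[abs_def] using has_derivative_w[OF False] by (auto intro!: derivative_eq_intros)
      from has_derivative_compose[OF this sp(1)[unfolded has_field_derivative_def]]
      have "(C has_derivative (\<lambda>h. soft_pos' \<epsilon> (A x) * (Gw x \<bullet> h))) (at x)"
        unfolding C_def[abs_def] by (auto intro!: derivative_eq_intros)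
      from has_derivative_compose[OF this sp(1)[unfolded has_field_derivative_def]]
      show ?thesis
        unfolding V_def[abs_def] by (rule has_derivative_eq_rhs) (simp add: G_def fun_eq_iff)
    next
      case True
      \<comment> \<open>On the open set {w > 1 - \<epsilon>}, which contains the closure,
        \<open>V\<close> is constantly \<open>T\<close>; its derivative is 0 even at points where
        \<open>w\<close> has none.\<close>
      have "((\<lambda>_. T) has_derivative (\<lambda>h. G x \<bullet> h)) (at x)"
        using True by (simp add: G_def Gw_def)
      then show ?thesis
        by (rule has_derivative_transform_within_open[OF _ openU])
          (use True KU sp(4) in \<open>auto simp: V_def T_def C_def A_def\<close>)
    qed
    have "continuous_on (- closure \<Omega>) G"
      unfolding G_def
      by (intro continuous_intros continuous_Gw continuous_on_compose2[OF sp(9)[of UNIV]] continuous_on_subset[OF contAC(1)] continuous_on_subset[OF contAC(2)]) auto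
    moreover have "continuous_on {x. 1 - \<epsilon> < w x} G"
      by (rule continuous_on_eq[of _ "\<lambda>_. 0"]) (auto simp: G_def A_def sp(5))
    ultimately have "continuous_on (- closure \<Omega> \<union> {x. 1 - \<epsilon> < w x}) G"
      using openU open_D by (intro continuous_on_open_Un)
    moreover have "- closure \<Omega> \<union> {x. 1 - \<epsilon> < w x} = UNIV" using KU by blast
    ultimately show "continuous_on UNIV G" by simp
    show "V x = 0" if "\<rho> \<le> norm x" for x
      using \<rho>(2)[OF that] sp(6)[of "A x"] by (auto simp: V_def C_def A_def intro!: sp(4))
    show "0 \<le> V x" for x by (simp add: V_def sp(8))
    show "V x \<le> T" for x unfolding V_def T_def C_def using sp(8)[of "A x"] by (intro sp(7)) simp
    have "V x = T" if "x \<in> \<Omega>" for x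
      using that closure_subset[of \<Omega>] KU \<epsilon> by (auto simp: V_def T_def C_def A_def sp(4) w_def)
    then have "\<Omega> \<subseteq> {x. V x = T}" by auto
    moreover have "{x. V x = T} \<in> sets borel"
    proof -
      have "V \<in> borel_measurable borel"
      proof (rule borel_measurable_continuous_onI)
        have "continuous_on UNIV (soft_pos \<epsilon>)"
          using sp(1) by (meson DERIV_continuous continuous_at_imp_continuous_on)
        then show "continuous_on UNIV V" unfolding V_def
          using contAC(2) continuous_on_compose2 by blast
      qed
      then show ?thesis by measurable
    qed
    ultimately have "emeasure lborel \<Omega> \<le> emeasure lborel {x. V x = T}"
      by (intro emeasure_mono) auto
    then show "ennreal (4/3*pi * R^3) \<le> emeasure lborel {x. V x = T}"
      using R(2) by (rule order_trans[rotated])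
  qed (use \<rho> T0 R in auto)
  also have "\<dots> \<le> (\<integral>\<^sup>+x. indicator {x. w x < 1 - \<epsilon> \<and> norm x < \<rho>} x * ennreal ((norm (Gw x))\<^sup>2) \<partial>lborel)"
  proof (intro nn_integral_mono)
    fix x
    show "ennreal ((norm (G x))\<^sup>2) \<le> indicator {x. w x < 1 - \<epsilon> \<and> norm x < \<rho>} x * ennreal ((norm (Gw x))\<^sup>2)"
    proof (cases "w x < 1 - \<epsilon> \<and> norm x < \<rho>")
      case True
      have "0 \<le> soft_pos' \<epsilon> (C x) * soft_pos' \<epsilon> (A x)" "soft_pos' \<epsilon> (C x) * soft_pos' \<epsilon> (A x) \<le> 1"
        using sp(2,3) by (auto intro: mult_le_one)
      then have "norm (G x) \<le> norm (Gw x)"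
        by (simp add: G_def mult_left_le_one_le)
      then have "(norm (G x))\<^sup>2 \<le> (norm (Gw x))\<^sup>2" by (intro power_mono) auto
      then show ?thesis using True by (simp add: ennreal_leI)
    next
      case False
      have "G x = 0"
      proof (cases "w x < 1 - \<epsilon>")
        case True
        then have "\<bar>w x\<bar> < \<epsilon>" using False \<rho>(2)[of x] by auto
        then have "C x \<le> 0" using sp(6)[of "A x"] by (simp add: C_def A_def)
        then show ?thesis by (simp add: G_def sp(5))
      next
        case False
        then have "A x \<le> 0" by (simp add: A_def)
        then show ?thesis by (simp add: G_def sp(5))
      qed
      then show ?thesis by simp
    qed
  qed
  finally have "ennreal (4 * pi * T\<^sup>2 * R) \<le> \<dots>" .
  moreover have "4 * pi * (1 - 4 * \<epsilon>)\<^sup>2 * R \<le> 4 * pi * T\<^sup>2 * R"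
    using T \<epsilon> R by (intro mult_mono power_mono) auto
  ultimately show ?thesis by (meson ennreal_leI order_trans)
qed

end

section \<open>The flux at infinity and the weighted energy bound\<close>

context exterior_function
begin

definition trunc :: "real \<Rightarrow> real^3 \<Rightarrow> real" where
  "trunc \<epsilon> x = max (1 - \<epsilon> - w x) 0"

text \<open>The outer square makes it C^1; its gradient -(4/\<rho>^2) (1 - |x|^2/\<rho>^2) x inside
  the ball of radius \<rho> is the factor that appears in \<open>Q\<close> below.\<close>

definition cutoff :: "real \<Rightarrow> real^3 \<Rightarrow> real" where
  "cutoff \<rho> x = (max (1 - (norm x)\<^sup>2 / \<rho>\<^sup>2) 0)\<^sup>2"

lemma trunc_eq_0: "1 - \<epsilon> < w x \<Longrightarrow> trunc \<epsilon> x = 0"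
  by (simp add: trunc_def)

lemma cutoff_eq_0: "\<rho> > 0 \<Longrightarrow> norm x > \<rho> \<Longrightarrow> cutoff \<rho> x = 0"
  by (simp add: cutoff_def field_simps max_def power_mono)

lemma open_trunc: "open {x. 1 - \<epsilon> < w x}"
  using continuous_w by (intro open_Collect_less) (auto intro: continuous_intros)

lemma closure_subset_trunc: "\<epsilon> > 0 \<Longrightarrow> closure \<Omega> \<subseteq> {x. 1 - \<epsilon> < w x}"
  by (auto simp: w_def)

lemma continuous_trunc: "continuous_on S (trunc \<epsilon>)"
  unfolding trunc_def[abs_def] by (intro continuous_intros continuous_on_subset[OF continuous_w]) auto

lemma continuous_cutoff: "continuous_on S (cutoff \<rho>)"
  unfolding cutoff_def[abs_def] by (cases "\<rho> = 0") (auto intro!: continuous_intros)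

text \<open>The complement of the closure and {w > 1 - \<epsilon>} are open and cover the space, so
  continuity can be checked on each; no matching along the frontier is involved.\<close>

lemma continuous_on_UNIV_trunc_cases:
  fixes f :: "real^3 \<Rightarrow> 'b::real_normed_vector"
  assumes "\<epsilon> > 0" "continuous_on (- closure \<Omega>) f" "\<And>x. 1 - \<epsilon> < w x \<Longrightarrow> f x = 0"
  shows "continuous_on UNIV f"
proof -
  have "continuous_on {x. 1 - \<epsilon> < w x} f"
    by (rule continuous_on_eq[of _ "\<lambda>_. 0"]) (auto simp: assms)
  then have "continuous_on (- closure \<Omega> \<union> {x. 1 - \<epsilon> < w x}) f"
    using assms open_trunc open_D by (intro continuous_on_open_Un)
  moreover have "- closure \<Omega> \<union> {x. 1 - \<epsilon> < w x} = UNIV"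
    using closure_subset_trunc[OF assms(1)] by blast
  ultimately show ?thesis by simp
qed

lemma continuous_schwarz_field: "continuous_on (- closure \<Omega>) (schwarz_field b)"
proof -
  have "(norm x)\<^sup>2 * (norm x + b) \<noteq> 0" if "x \<notin> closure \<Omega>" for x
    using not_K_nonzero[OF that] b by (simp add: add_nonneg_eq_0_iff)
  then show ?thesis
    unfolding schwarz_field_def[abs_def] by (intro continuous_intros) auto
qed

lemma continuous_schwarz_field_deriv: "continuous_on (- closure \<Omega>) (\<lambda>x. schwarz_field_deriv b x h)"
proof -
  have "(norm x)\<^sup>2 * (norm x + b) \<noteq> 0" "norm x ^ 4 * (norm x + b)\<^sup>2 \<noteq> 0" if "x \<notin> closure \<Omega>" for x
    using not_K_nonzero[OF that] b by (simp_all add: add_nonneg_eq_0_iff)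
  then show ?thesis
    unfolding schwarz_field_deriv_def by (intro continuous_intros) auto
qed

text \<open>The divergence theorem for the compactly supported field
  \<open>cutoff * trunc\<^sup>2 * schwarz_field\<close>.\<close>

lemma flux_identity:
  assumes \<epsilon>: "\<epsilon> > 0" and \<rho>: "\<rho> > 0"
  defines "P \<equiv> \<lambda>x. cutoff \<rho> x * ((trunc \<epsilon> x)\<^sup>2 * (norm (schwarz_field b x))\<^sup>2 - 2 * trunc \<epsilon> x * (Gw x \<bullet> schwarz_field b x))"
    and "Q \<equiv> \<lambda>x. (trunc \<epsilon> x)\<^sup>2 * (4 / \<rho>\<^sup>2 * max (1 - (norm x)\<^sup>2 / \<rho>\<^sup>2) 0) * (x \<bullet> schwarz_field b x)"
  shows "integrable lborel P" "integrable lborel Q" "(\<integral>x. P x \<partial>lborel) = (\<integral>x. Q x \<partial>lborel)"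
proof -
  let ?Y = "schwarz_field b" and ?a = "trunc \<epsilon>" and ?\<eta> = "cutoff \<rho>"
  define \<mu> where "\<mu> x = 4 / \<rho>\<^sup>2 * max (1 - (norm x)\<^sup>2 / \<rho>\<^sup>2) 0" for x :: "real^3"
  \<comment> \<open>\<open>S\<close> is the gradient of the scalar factor cutoff times trunc^2, and
    \<open>D i x\<close> is the derivative of the i-th component of the field. Since div Y = |Y|^2,
    the diagonal sum of \<open>D\<close> is P - Q.\<close>
  define S where "S x = (- (?a x)\<^sup>2 * \<mu> x) *\<^sub>R x - (2 * ?\<eta> x * ?a x) *\<^sub>R Gw x" for x
  define D where "D i x h = (if x \<in> closure \<Omega> then 0 else
      (S x \<bullet> h) * (?Y x \<bullet> i) + ?\<eta> x * (?a x)\<^sup>2 * (schwarz_field_deriv b x h \<bullet> i))" for i x h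
  have \<mu>0: "\<mu> x = 0" if "norm x > \<rho>" for x
    using that \<rho> by (simp add: \<mu>_def field_simps max_def power_mono)
  have cont\<mu>: "continuous_on T \<mu>" for T
    unfolding \<mu>_def[abs_def] using \<rho> by (intro continuous_intros) auto
  have contS: "continuous_on (- closure \<Omega>) S"
    unfolding S_def[abs_def] by (intro continuous_intros continuous_trunc continuous_cutoff cont\<mu> continuous_Gw)
  have contP: "continuous_on UNIV P"
    unfolding P_def
    by (rule continuous_on_UNIV_trunc_cases[OF \<epsilon>])
      (auto intro!: continuous_intros continuous_trunc continuous_cutoff continuous_Gw continuous_schwarz_field simp: trunc_eq_0)
  have contQ: "continuous_on UNIV Q"
    unfolding Q_def \<mu>_def[symmetric]
    by (rule continuous_on_UNIV_trunc_cases[OF \<epsilon>])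
      (auto intro!: continuous_intros continuous_trunc cont\<mu> continuous_schwarz_field simp: trunc_eq_0)
  show intP: "integrable lborel P"
    by (rule continuous_bounded_support(3)[OF contP, of \<rho>]) (simp add: P_def cutoff_eq_0[OF \<rho>])
  show intQ: "integrable lborel Q"
    by (rule continuous_bounded_support(3)[OF contQ, of \<rho>]) (use \<mu>0 in \<open>auto simp: Q_def \<mu>_def\<close>)
  have S0: "S x = 0" if "1 - \<epsilon> < w x \<or> norm x > \<rho>" for x
    using that \<mu>0 cutoff_eq_0[OF \<rho>, of x] by (auto simp: S_def trunc_eq_0)
  have contD: "continuous_on UNIV (\<lambda>x. D i x i)" for i
  proof (rule continuous_on_UNIV_trunc_cases[OF \<epsilon>])
    have "continuous_on (- closure \<Omega>) (\<lambda>x. (S x \<bullet> i) * (?Y x \<bullet> i) + ?\<eta> x * (?a x)\<^sup>2 * (schwarz_field_deriv b x i \<bullet> i))"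
      by (intro continuous_intros contS continuous_schwarz_field continuous_trunc continuous_cutoff continuous_schwarz_field_deriv)
    then show "continuous_on (- closure \<Omega>) (\<lambda>x. D i x i)"
      by (rule continuous_on_eq) (simp add: D_def)
    show "D i x i = 0" if "1 - \<epsilon> < w x" for x
      using that S0[of x] by (simp add: D_def trunc_eq_0)
  qed
  have D0: "D i x i = 0" if "norm x > \<rho>" for i x
    using that S0[of x] cutoff_eq_0[OF \<rho>, of x] by (simp add: D_def)
  have derf: "((\<lambda>x. ?\<eta> x * (?a x)\<^sup>2 * (?Y x \<bullet> i)) has_derivative D i x) (at x)" for i x
  proof (cases "x \<in> closure \<Omega>")
    case True
    have "((\<lambda>_. 0) has_derivative D i x) (at x)"
      using True by (simp add: D_def[abs_def])
    then show ?thesis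
      by (rule has_derivative_transform_within_open[OF _ open_trunc[of \<epsilon>]])
        (use True closure_subset_trunc[OF \<epsilon>] in \<open>auto simp: trunc_eq_0\<close>)
  next
    case False
    have x0: "x \<noteq> 0" using not_K_nonzero[OF False] .
    have "((\<lambda>x. 1 - \<epsilon> - w x) has_derivative (\<lambda>h. - (Gw x \<bullet> h))) (at x)"
      using has_derivative_w[OF False] by (auto intro!: derivative_eq_intros)
    from has_derivative_compose[OF this DERIV_pos_part_sq[unfolded has_field_derivative_def]]
    have a: "((\<lambda>x. (?a x)\<^sup>2) has_derivative (\<lambda>h. 2 * ?a x * - (Gw x \<bullet> h))) (at x)"
      unfolding trunc_def .
    have "((\<lambda>x. 1 - (norm x)\<^sup>2 / \<rho>\<^sup>2) has_derivative (\<lambda>h. - (2 / \<rho>\<^sup>2 * (x \<bullet> h)))) (at x)"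
    proof -
      have "((\<lambda>r. 1 - r\<^sup>2 / \<rho>\<^sup>2) has_real_derivative - (2 * norm x / \<rho>\<^sup>2)) (at (norm x))"
        using \<rho> by (auto intro!: derivative_eq_intros simp: divide_simps power4_eq_xxxx power2_eq_square)
      from has_derivative_radial[OF x0 this] show ?thesis
        by (rule has_derivative_eq_rhs) (use x0 in \<open>simp add: fun_eq_iff\<close>)
    qed
    from has_derivative_compose[OF this DERIV_pos_part_sq[unfolded has_field_derivative_def]]
    have \<eta>: "(?\<eta> has_derivative (\<lambda>h. - \<mu> x * (x \<bullet> h))) (at x)"
      unfolding cutoff_def[abs_def] by (rule has_derivative_eq_rhs) (simp add: \<mu>_def fun_eq_iff)
    have Y: "((\<lambda>x. ?Y x \<bullet> i) has_derivative (\<lambda>h. schwarz_field_deriv b x h \<bullet> i)) (at x)"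
      using has_derivative_schwarz_field[OF x0 b] by (rule has_derivative_inner_left)
    show ?thesis
      by (rule has_derivative_eq_rhs[OF has_derivative_mult[OF has_derivative_mult[OF \<eta> a] Y]])
        (use False in \<open>simp add: D_def S_def fun_eq_iff inner_diff_left algebra_simps\<close>)
  qed
  have int0: "(\<integral>x. D i x i \<partial>lborel) = 0" for i
  proof -
    obtain M where "\<And>x. \<bar>D i x i\<bar> \<le> M"
      using continuous_bounded_support(1)[OF contD[of i] D0] by blast
    then show ?thesis
      using continuous_bounded_support(2)[OF contD[of i] D0]
      by (intro integral_directional_derivative_eq_0[OF derf, where N=\<rho>]) (auto simp: cutoff_eq_0[OF \<rho>])
  qed
  have sumD: "(\<Sum>i\<in>Basis. D i x i) = P x - Q x" for x
  proof (cases "x \<in> closure \<Omega>")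
    case True
    then show ?thesis using closure_subset_trunc[OF \<epsilon>] by (auto simp: D_def P_def Q_def trunc_eq_0)
  next
    case False
    have "(\<Sum>i\<in>Basis. D i x i) = (\<Sum>i\<in>Basis. (S x \<bullet> i) * (?Y x \<bullet> i)) +
        ?\<eta> x * (?a x)\<^sup>2 * (\<Sum>i\<in>Basis. schwarz_field_deriv b x i \<bullet> i)"
      using False by (simp add: D_def sum.distrib sum_distrib_left)
    also have "\<dots> = S x \<bullet> ?Y x + ?\<eta> x * (?a x)\<^sup>2 * (norm (?Y x))\<^sup>2"
      using div_schwarz_field[OF not_K_nonzero[OF False] b] by (simp add: euclidean_inner[symmetric])
    also have "\<dots> = P x - Q x"
      by (simp add: S_def P_def Q_def \<mu>_def inner_diff_left algebra_simps)
    finally show ?thesis .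
  qed
  have "(\<integral>x. P x \<partial>lborel) - (\<integral>x. Q x \<partial>lborel) = (\<integral>x. (\<Sum>i\<in>Basis. D i x i) \<partial>lborel)"
    using intP intQ by (simp add: sumD)
  also have "\<dots> = (\<Sum>i\<in>Basis. (\<integral>x. D i x i \<partial>lborel))"
    using continuous_bounded_support(3)[OF contD D0] by (intro Bochner_Integration.integral_sum)
  finally show "(\<integral>x. P x \<partial>lborel) = (\<integral>x. Q x \<partial>lborel)" by (simp add: int0)
qed

text \<open>Beyond \<open>\<rho>1\<close> the truncation is at least 1 - 2 \<epsilon>, the inner
  product of x and Y is b/(|x| + b), and s^2/(s + b) >= s - b reduces the radial integral to that of
  a polynomial with antiderivative \<open>H\<close>. Since H \<rho> / \<rho>^2 tends to 1/4 as
  \<rho> grows, the bound tends to (1 - 2 \<epsilon>)^2 4 pi b.\<close>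

lemma flux_lower_bound:
  assumes \<epsilon>: "0 < \<epsilon>" "\<epsilon> < 1/8" and \<rho>1: "b \<le> \<rho>1" "\<And>x. \<rho>1 \<le> norm x \<Longrightarrow> \<bar>w x\<bar> < \<epsilon>" and \<rho>: "\<rho>1 < \<rho>"
  defines "Q \<equiv> \<lambda>x. (trunc \<epsilon> x)\<^sup>2 * (4 / \<rho>\<^sup>2 * max (1 - (norm x)\<^sup>2 / \<rho>\<^sup>2) 0) * (x \<bullet> schwarz_field b x)"
    and "H \<equiv> \<lambda>s. s\<^sup>2 / 2 - b * s - s^4 / (4 * \<rho>\<^sup>2) + b * s^3 / (3 * \<rho>\<^sup>2)"
  shows "(1 - 2 * \<epsilon>)\<^sup>2 * (16 * pi * b / \<rho>\<^sup>2) * (H \<rho> - H \<rho>1) \<le> (\<integral>x. Q x \<partial>lborel)"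
proof -
  have \<rho>0: "\<rho> > 0" "\<rho>1 > 0" using \<rho> \<rho>1 b by auto
  have Q0: "Q x \<ge> 0" for x
    unfolding Q_def using \<rho>0 b schwarz_field_inner[of x b]
    by (cases "x = 0") (auto intro!: mult_nonneg_nonneg simp: inner_commute)
  define c where "c = (1 - 2 * \<epsilon>)\<^sup>2 * (4 / \<rho>\<^sup>2)"
  have c0: "c \<ge> 0" by (simp add: c_def)
  have "ennreal ((1 - 2 * \<epsilon>)\<^sup>2 * (16 * pi * b / \<rho>\<^sup>2) * (H \<rho> - H \<rho>1)) = ennreal (c * 4 * pi * b * H \<rho> - c * 4 * pi * b * H \<rho>1)"
    by (simp add: c_def algebra_simps diff_divide_distrib)
  also have "\<dots> = (\<integral>\<^sup>+s. ennreal (c * 4 * pi * b * ((1 - s\<^sup>2 / \<rho>\<^sup>2) * (s - b))) * indicator {\<rho>1..\<rho>} s \<partial>lborel)"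
  proof (rule nn_integral_FTC_Icc[symmetric])
    fix s assume s: "s \<in> {\<rho>1..\<rho>}"
    have "(H has_real_derivative (1 - s\<^sup>2 / \<rho>\<^sup>2) * (s - b)) (at s)"
    proof -
      define k where "k = 1 / \<rho>\<^sup>2"
      have H: "H = (\<lambda>s. s\<^sup>2 / 2 - b * s - k * s^4 / 4 + k * b * s^3 / 3)"
        by (simp add: H_def k_def mult.commute[of "\<rho>\<^sup>2"])
      have "(1 - s\<^sup>2 / \<rho>\<^sup>2) * (s - b) = (1 - k * s\<^sup>2) * (s - b)" by (simp add: k_def)
      then show ?thesis
        unfolding H by (auto intro!: derivative_eq_intros simp: power2_eq_square power3_eq_cube algebra_simps)
    qed
    then show "((\<lambda>s. c * 4 * pi * b * H s) has_real_derivative c * 4 * pi * b * ((1 - s\<^sup>2 / \<rho>\<^sup>2) * (s - b))) (at s)"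
      by (rule DERIV_cmult)
    have "s\<^sup>2 / \<rho>\<^sup>2 \<le> 1" using s \<rho>0 by (simp add: power_mono)
    then show "0 \<le> c * 4 * pi * b * ((1 - s\<^sup>2 / \<rho>\<^sup>2) * (s - b))"
      using s \<rho>1 b c0 by (intro mult_nonneg_nonneg) auto
  qed (use \<rho> in auto)
  also have "\<dots> \<le> (\<integral>\<^sup>+s. ennreal (4 * pi * s\<^sup>2) * indicator {0..} s *
      (ennreal (c * (max (1 - s\<^sup>2 / \<rho>\<^sup>2) 0 * (b / (s + b)))) * indicator {\<rho>1..} s) \<partial>lborel)"
  proof (intro nn_integral_mono)
    fix s
    show "ennreal (c * 4 * pi * b * ((1 - s\<^sup>2 / \<rho>\<^sup>2) * (s - b))) * indicator {\<rho>1..\<rho>} s \<le>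
       ennreal (4 * pi * s\<^sup>2) * indicator {0..} s * (ennreal (c * (max (1 - s\<^sup>2 / \<rho>\<^sup>2) 0 * (b / (s + b)))) * indicator {\<rho>1..} s)"
    proof (cases "s \<in> {\<rho>1..\<rho>}")
      case True
      define k where "k = 1 - s\<^sup>2 / \<rho>\<^sup>2"
      have k: "k \<ge> 0" using True \<rho>0 by (simp add: k_def power_mono)
      have s: "s > 0" using True \<rho>0 by auto
      have "s - b \<le> s\<^sup>2 / (s + b)"
        using s b by (simp add: field_simps power2_eq_square)
      then have "c * 4 * pi * b * (k * (s - b)) \<le> c * 4 * pi * b * (k * (s\<^sup>2 / (s + b)))"
        using c0 b k by (intro mult_left_mono) auto
      also have "\<dots> = 4 * pi * s\<^sup>2 * (c * (max k 0 * (b / (s + b))))"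
        using k by simp
      finally show ?thesis
        using True s unfolding k_def by (simp add: ennreal_mult'[symmetric] ennreal_leI)
    qed simp
  qed
  also have "\<dots> = (\<integral>\<^sup>+x. ennreal (c * (max (1 - (norm x)\<^sup>2 / \<rho>\<^sup>2) 0 * (b / (norm x + b)))) * indicator {\<rho>1..} (norm (x::real^3)) \<partial>lborel)"
    by (rule nn_integral_radial[symmetric]) measurable
  also have "\<dots> \<le> (\<integral>\<^sup>+x. ennreal (Q x) \<partial>lborel)"
  proof (intro nn_integral_mono)
    fix x :: "real^3"
    show "ennreal (c * (max (1 - (norm x)\<^sup>2 / \<rho>\<^sup>2) 0 * (b / (norm x + b)))) * indicator {\<rho>1..} (norm x) \<le> ennreal (Q x)"
    proof (cases "\<rho>1 \<le> norm x")
      case True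
      then have x0: "x \<noteq> 0" using \<rho>0 by auto
      have "1 - 2 * \<epsilon> \<le> trunc \<epsilon> x" using \<rho>1(2)[OF True] by (auto simp: trunc_def)
      then have "(1 - 2 * \<epsilon>)\<^sup>2 \<le> (trunc \<epsilon> x)\<^sup>2" using \<epsilon> by (intro power_mono) auto
      then have "(1 - 2 * \<epsilon>)\<^sup>2 * ((4 / \<rho>\<^sup>2 * max (1 - (norm x)\<^sup>2 / \<rho>\<^sup>2) 0) * (b / (norm x + b)))
          \<le> (trunc \<epsilon> x)\<^sup>2 * ((4 / \<rho>\<^sup>2 * max (1 - (norm x)\<^sup>2 / \<rho>\<^sup>2) 0) * (b / (norm x + b)))"
        using b by (intro mult_right_mono) (auto intro!: mult_nonneg_nonneg)
      moreover have "x \<bullet> schwarz_field b x = b / (norm x + b)"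
        using schwarz_field_inner[OF x0] by (simp add: inner_commute)
      ultimately have "c * (max (1 - (norm x)\<^sup>2 / \<rho>\<^sup>2) 0 * (b / (norm x + b))) \<le> Q x"
        unfolding c_def Q_def by (simp only: mult.assoc)
      then show ?thesis using True by (simp add: ennreal_leI)
    qed simp
  qed
  also have "\<dots> = ennreal (\<integral>x. Q x \<partial>lborel)"
    using flux_identity(2)[OF \<epsilon>(1) \<rho>0(1)] Q0 unfolding Q_def by (intro nn_integral_eq_integral) auto
  finally show ?thesis
    by (subst (asm) ennreal_le_iff) (auto intro!: Bochner_Integration.integral_nonneg Q0)
qed


text \<open>The identity u grad \<phi> = Gw - (1 - w) Y with 1 - w replaced by its truncation; the
  defect is \<epsilon> Y.\<close>

lemma Gw_minus_trunc:
  assumes "w x < 1 - \<epsilon>" and that: "x \<notin> closure \<Omega>"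
  shows "Gw x - trunc \<epsilon> x *\<^sub>R schwarz_field b x = (1 + b / norm x) *\<^sub>R G\<phi> x + \<epsilon> *\<^sub>R schwarz_field b x"
proof -
  have r: "norm x > 0" "norm x + b \<noteq> 0" using not_K_nonzero[OF that] b by (auto simp: add_nonneg_eq_0_iff)
  have tr: "trunc \<epsilon> x = (1 - w x) - \<epsilon>" using assms by (simp add: trunc_def)
  have "(1 - w x) * (b / ((norm x)\<^sup>2 * (norm x + b))) = (1 - \<phi> x) * (b / (norm x)^3)"
    using that r by (simp add: w_def divide_simps) (simp add: power2_eq_square power3_eq_cube algebra_simps)
  then have "(1 - w x) *\<^sub>R schwarz_field b x = ((1 - \<phi> x) * (b / (norm x)^3)) *\<^sub>R x"
    by (simp add: schwarz_field_def)
  then show ?thesis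
    using that by (simp add: tr Gw_def scaleR_diff_left algebra_simps)
qed

text \<open>With div Y = |Y|^2, the square |Gw - (1 - w) Y|^2 expands to |Gw|^2 + div ((1 - w)^2 Y).
  The first term contributes the Euclidean bound 4 pi R. The flux of the second vanishes on the
  frontier, where w = 1, and at infinity it is that of b x/|x|^3, namely 4 pi b. The proof carries
  this out with truncation and cutoff, lets \<open>\<rho>\<close> tend to infinity for fixed
  \<open>\<epsilon>\<close>, and then \<open>\<epsilon>\<close> to 0.\<close>

theorem weighted_energy_lower_bound:
  assumes R: "0 < R" "ennreal (4/3*pi * R^3) \<le> emeasure lborel \<Omega>"
  shows "ennreal (4 * pi * (R + b)) \<le>
    (\<integral>\<^sup>+x. indicator (- closure \<Omega>) x * ennreal ((1 + b / norm x)\<^sup>2 * (norm (G\<phi> x))\<^sup>2) \<partial>lborel)"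
    (is "_ \<le> ?J")
proof (cases ?J)
  case (real j)
  have m\<phi>: "(\<lambda>x. indicator (- closure \<Omega>) x *\<^sub>R G\<phi> x) \<in> borel_measurable borel"
    by (rule borel_measurable_continuous_on_indicator[OF _ contG]) auto
  have mJ: "(\<lambda>x. indicator (- closure \<Omega>) x * ennreal ((1 + b / norm x)\<^sup>2 * (norm (G\<phi> x))\<^sup>2)) \<in> borel_measurable lborel"
  proof -
    have eq: "(\<lambda>x. ennreal ((1 + b / norm x)\<^sup>2 * (norm (indicat_real (- closure \<Omega>) x *\<^sub>R G\<phi> x))\<^sup>2)) =
       (\<lambda>x. indicator (- closure \<Omega>) x * ennreal ((1 + b / norm x)\<^sup>2 * (norm (G\<phi> x))\<^sup>2))"
      by (auto simp: fun_eq_iff split: split_indicator)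
    show ?thesis
      unfolding eq[symmetric] using m\<phi> by measurable
  qed
  have mY[measurable]: "schwarz_field b \<in> borel_measurable borel"
    unfolding schwarz_field_def[abs_def] by measurable
  have step: "4 * pi * (1 - 4 * \<epsilon>)\<^sup>2 * R + (1 - 2 * \<epsilon>)\<^sup>2 * (4 * pi * b) \<le> (1 + \<epsilon>) * j + (\<epsilon> + \<epsilon>\<^sup>2) * (4 * pi * b)"
    if \<epsilon>: "0 < \<epsilon>" "\<epsilon> < 1/8" for \<epsilon>
  proof -
    have "\<forall>\<^sub>F x in at_infinity. dist (w x) 0 < \<epsilon>"
      using tendsto_w \<epsilon>(1) by (rule tendstoD)
    then obtain \<rho>0 where \<rho>0: "\<And>x. \<rho>0 \<le> norm x \<Longrightarrow> \<bar>w x\<bar> < \<epsilon>"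
      unfolding eventually_at_infinity by auto
    define \<rho>1 where "\<rho>1 = max \<rho>0 b"
    have \<rho>1: "b \<le> \<rho>1" "\<rho>1 > 0" "\<And>x. \<rho>1 \<le> norm x \<Longrightarrow> \<bar>w x\<bar> < \<epsilon>"
      using \<rho>0 b by (auto simp: \<rho>1_def)
    define H where "H \<rho> s = s\<^sup>2 / 2 - b * s - s^4 / (4 * \<rho>\<^sup>2) + b * s^3 / (3 * \<rho>\<^sup>2)" for \<rho> s :: real
    define F where "F \<rho> = (1 - \<rho>1\<^sup>2 / \<rho>\<^sup>2)\<^sup>2 * (4 * pi * (1 - 4 * \<epsilon>)\<^sup>2 * R) +
       (1 - 2 * \<epsilon>)\<^sup>2 * (16 * pi * b / \<rho>\<^sup>2) * (H \<rho> \<rho> - H \<rho> \<rho>1)" for \<rho>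
    have F: "F \<rho> \<le> (1 + \<epsilon>) * j + (\<epsilon> + \<epsilon>\<^sup>2) * (4 * pi * b)" if \<rho>: "\<rho> > \<rho>1" for \<rho>
    proof -
      have \<rho>p: "\<rho> > 0" using \<rho> \<rho>1 by simp
      let ?Y = "schwarz_field b" and ?a = "trunc \<epsilon>"
      define P where "P x = cutoff \<rho> x * ((?a x)\<^sup>2 * (norm (?Y x))\<^sup>2 - 2 * ?a x * (Gw x \<bullet> ?Y x))" for x
      define Q where "Q x = (?a x)\<^sup>2 * (4 / \<rho>\<^sup>2 * max (1 - (norm x)\<^sup>2 / \<rho>\<^sup>2) 0) * (x \<bullet> ?Y x)" for x
      define B where "B x = indicat_real {x. w x < 1 - \<epsilon>} x * (cutoff \<rho> x * (norm (Gw x))\<^sup>2)" for x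
      define A where "A x = indicat_real {x. w x < 1 - \<epsilon>} x * (cutoff \<rho> x * (norm (Gw x - ?a x *\<^sub>R ?Y x))\<^sup>2)" for x
      have [measurable]: "cutoff \<rho> \<in> borel_measurable borel" "?a \<in> borel_measurable borel"
        using continuous_cutoff continuous_trunc by (auto intro: borel_measurable_continuous_onI)
      have [measurable]: "A \<in> borel_measurable borel" "B \<in> borel_measurable borel"
        unfolding A_def[abs_def] B_def[abs_def] by measurable
      have \<eta>: "0 \<le> cutoff \<rho> x" "cutoff \<rho> x \<le> 1" for x
        using \<rho>p by (auto simp: cutoff_def intro!: power_le_one)
      have PQ: "integrable lborel P" "integrable lborel Q" "(\<integral>x. P x \<partial>lborel) = (\<integral>x. Q x \<partial>lborel)"
        using flux_identity[OF \<epsilon>(1) \<rho>p] unfolding P_def[abs_def] Q_def[abs_def] by auto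
      \<comment> \<open>The expanded square: \<open>P\<close> collects the cross term and the term
        in |Y|^2, and its integral equals that of the flux term \<open>Q\<close>.\<close>
      have AB: "A x = B x + P x" for x
      proof (cases "w x < 1 - \<epsilon>")
        case True
        have "(norm (Gw x - ?a x *\<^sub>R ?Y x))\<^sup>2 = (norm (Gw x))\<^sup>2 + ((?a x)\<^sup>2 * (norm (?Y x))\<^sup>2 - 2 * ?a x * (Gw x \<bullet> ?Y x))"
          unfolding power2_norm_eq_inner by (simp add: inner_diff_left inner_diff_right inner_commute power2_eq_square algebra_simps)
        then have "A x = cutoff \<rho> x * ((norm (Gw x))\<^sup>2 + ((?a x)\<^sup>2 * (norm (?Y x))\<^sup>2 - 2 * ?a x * (Gw x \<bullet> ?Y x)))"
          using True by (simp add: A_def)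
        then show ?thesis using True by (simp add: B_def P_def distrib_left)
      next
        case False
        then have "?a x = 0" by (simp add: trunc_def)
        then show ?thesis using False by (simp add: A_def B_def P_def)
      qed
      \<comment> \<open>\<open>Gw\<close> may be unbounded near the frontier. \<open>B\<close>
        vanishes off a compact set disjoint from the closure of \<open>\<Omega>\<close>, and there
        \<open>Gw\<close> is bounded.\<close>
      have intB: "integrable lborel B"
      proof -
        let ?C = "cball 0 \<rho> \<inter> {x. w x \<le> 1 - \<epsilon>}"
        have "closed {x. w x \<le> 1 - \<epsilon>}"
          using continuous_w by (intro closed_Collect_le) (auto intro: continuous_intros)
        then have "compact ?C" by (intro compact_Int_closed) auto
        moreover have "?C \<subseteq> - closure \<Omega>" using closure_subset_trunc[OF \<epsilon>(1)] by force
        ultimately have "compact (Gw ` ?C)"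
          using continuous_Gw continuous_on_subset compact_continuous_image by blast
        then obtain M where M: "M > 0" "\<And>x. x \<in> ?C \<Longrightarrow> norm (Gw x) \<le> M"
          using bounded_pos[of "Gw ` ?C"] by (auto dest: compact_imp_bounded)
        have "\<bar>B x\<bar> \<le> M\<^sup>2" for x
        proof (cases "x \<in> ?C")
          case True
          then have "cutoff \<rho> x * (norm (Gw x))\<^sup>2 \<le> 1 * M\<^sup>2"
            using M \<eta>[of x] by (intro mult_mono power_mono) auto
          then show ?thesis using \<eta>[of x] by (auto simp: B_def split: split_indicator)
        next
          case False
          then have "B x = 0" using cutoff_eq_0[OF \<rho>p, of x] by (auto simp: B_def split: split_indicator)
          then show ?thesis by simp
        qed
        then show ?thesis
          using cutoff_eq_0[OF \<rho>p] by (intro integrable_lborel_bounded_support[of B "M\<^sup>2" \<rho>]) (auto simp: B_def)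
      qed
      have AB0: "0 \<le> A x" "0 \<le> B x" for x using \<eta>[of x] by (auto simp: A_def B_def)
      have intA: "integrable lborel A" and intA_eq: "(\<integral>x. A x \<partial>lborel) = (\<integral>x. B x \<partial>lborel) + (\<integral>x. Q x \<partial>lborel)"
        using intB PQ unfolding AB[abs_def] by auto
      \<comment> \<open>On the ball of radius \<open>\<rho>1\<close>, which carries the truncated
        Euclidean energy, the cutoff is at least (1 - \<rho>1^2/\<rho>^2)^2, and this tends to
        1.\<close>
      have low: "(1 - \<rho>1\<^sup>2 / \<rho>\<^sup>2)\<^sup>2 * (4 * pi * (1 - 4 * \<epsilon>)\<^sup>2 * R) \<le> (\<integral>x. B x \<partial>lborel)"
      proof -
        have q: "0 \<le> 1 - \<rho>1\<^sup>2 / \<rho>\<^sup>2" using \<rho> \<rho>1 by (simp add: power_mono)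
        have "ennreal ((1 - \<rho>1\<^sup>2 / \<rho>\<^sup>2)\<^sup>2 * (4 * pi * (1 - 4 * \<epsilon>)\<^sup>2 * R)) =
          ennreal ((1 - \<rho>1\<^sup>2 / \<rho>\<^sup>2)\<^sup>2) * ennreal (4 * pi * (1 - 4 * \<epsilon>)\<^sup>2 * R)"
          by (rule ennreal_mult') simp
        also have "\<dots> \<le> ennreal ((1 - \<rho>1\<^sup>2 / \<rho>\<^sup>2)\<^sup>2) *
           (\<integral>\<^sup>+x. indicator {x. w x < 1 - \<epsilon> \<and> norm x < \<rho>1} x * ennreal ((norm (Gw x))\<^sup>2) \<partial>lborel)"
          by (intro mult_left_mono energy_truncated[OF \<epsilon> \<rho>1(2,3) R]) auto
        also have "\<dots> = (\<integral>\<^sup>+x. ennreal ((1 - \<rho>1\<^sup>2 / \<rho>\<^sup>2)\<^sup>2) *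
            (indicator {x. w x < 1 - \<epsilon> \<and> norm x < \<rho>1} x * ennreal ((norm (Gw x))\<^sup>2)) \<partial>lborel)"
          by (rule nn_integral_cmult[symmetric]) measurable
        also have "\<dots> \<le> (\<integral>\<^sup>+x. ennreal (B x) \<partial>lborel)"
        proof (intro nn_integral_mono)
          fix x
          show "ennreal ((1 - \<rho>1\<^sup>2 / \<rho>\<^sup>2)\<^sup>2) *
            (indicator {x. w x < 1 - \<epsilon> \<and> norm x < \<rho>1} x * ennreal ((norm (Gw x))\<^sup>2)) \<le> ennreal (B x)"
          proof (cases "w x < 1 - \<epsilon> \<and> norm x < \<rho>1")
            case True
            have "(norm x)\<^sup>2 / \<rho>\<^sup>2 \<le> \<rho>1\<^sup>2 / \<rho>\<^sup>2"
              using True by (intro divide_right_mono power_mono) auto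
            then have "(1 - \<rho>1\<^sup>2 / \<rho>\<^sup>2)\<^sup>2 \<le> cutoff \<rho> x"
              unfolding cutoff_def using q by (intro power_mono) auto
            then have "(1 - \<rho>1\<^sup>2 / \<rho>\<^sup>2)\<^sup>2 * (norm (Gw x))\<^sup>2 \<le> B x"
              using True by (simp add: B_def mult_right_mono)
            then show ?thesis
              using True by (simp add: ennreal_mult'[symmetric] ennreal_leI)
          qed simp
        qed
        also have "\<dots> = ennreal (\<integral>x. B x \<partial>lborel)"
          using intB AB0 by (intro nn_integral_eq_integral) auto
        finally show ?thesis
          by (subst (asm) ennreal_le_iff) (auto intro!: Bochner_Integration.integral_nonneg AB0)
      qed
      have "ennreal (\<integral>x. A x \<partial>lborel) = (\<integral>\<^sup>+x. ennreal (A x) \<partial>lborel)"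
        using intA AB0 by (intro nn_integral_eq_integral[symmetric]) auto
      also have "\<dots> \<le> (\<integral>\<^sup>+x. ennreal (1 + \<epsilon>) * (indicator (- closure \<Omega>) x * ennreal ((1 + b / norm x)\<^sup>2 * (norm (G\<phi> x))\<^sup>2)) +
           ennreal (\<epsilon> + \<epsilon>\<^sup>2) * ennreal ((norm (?Y x))\<^sup>2) \<partial>lborel)"
      proof (intro nn_integral_mono)
        fix x
        show "ennreal (A x) \<le> ennreal (1 + \<epsilon>) * (indicator (- closure \<Omega>) x * ennreal ((1 + b / norm x)\<^sup>2 * (norm (G\<phi> x))\<^sup>2)) +
           ennreal (\<epsilon> + \<epsilon>\<^sup>2) * ennreal ((norm (?Y x))\<^sup>2)"
        proof (cases "w x < 1 - \<epsilon>")
          case True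
          then have x: "x \<notin> closure \<Omega>" using closure_subset_trunc[OF \<epsilon>(1)] by force
          define p q where "p = norm ((1 + b / norm x) *\<^sub>R G\<phi> x)" and "q = norm (?Y x)"
          have pq: "p \<ge> 0" "q \<ge> 0" by (auto simp: p_def q_def)
          have "norm (Gw x - ?a x *\<^sub>R ?Y x) \<le> p + \<epsilon> * q"
            unfolding Gw_minus_trunc[OF True x] p_def q_def using \<epsilon> norm_triangle_ineq
            by (metis abs_of_pos norm_scaleR)
          then have "(norm (Gw x - ?a x *\<^sub>R ?Y x))\<^sup>2 \<le> (p + \<epsilon> * q)\<^sup>2"
            by (intro power_mono) auto
          also have "\<dots> \<le> (1 + \<epsilon>) * p\<^sup>2 + (\<epsilon> + \<epsilon>\<^sup>2) * q\<^sup>2"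
          proof -
            have "0 \<le> \<epsilon> * (p - q)\<^sup>2" using \<epsilon> by simp
            then show ?thesis by (simp add: power2_eq_square algebra_simps)
          qed
          finally have "(norm (Gw x - ?a x *\<^sub>R ?Y x))\<^sup>2 \<le> (1 + \<epsilon>) * p\<^sup>2 + (\<epsilon> + \<epsilon>\<^sup>2) * q\<^sup>2" .
          moreover have "A x \<le> (norm (Gw x - ?a x *\<^sub>R ?Y x))\<^sup>2"
            using True \<eta>[of x] by (simp add: A_def mult_left_le_one_le)
          ultimately have "A x \<le> (1 + \<epsilon>) * p\<^sup>2 + (\<epsilon> + \<epsilon>\<^sup>2) * q\<^sup>2" by simp
          also have "p\<^sup>2 = (1 + b / norm x)\<^sup>2 * (norm (G\<phi> x))\<^sup>2"
            by (simp add: p_def power_mult_distrib)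
          finally have "ennreal (A x) \<le> ennreal ((1 + \<epsilon>) * ((1 + b / norm x)\<^sup>2 * (norm (G\<phi> x))\<^sup>2) + (\<epsilon> + \<epsilon>\<^sup>2) * q\<^sup>2)"
            by (rule ennreal_leI)
          also have "\<dots> = ennreal (1 + \<epsilon>) * ennreal ((1 + b / norm x)\<^sup>2 * (norm (G\<phi> x))\<^sup>2) + ennreal (\<epsilon> + \<epsilon>\<^sup>2) * ennreal (q\<^sup>2)"
            using \<epsilon> by (simp add: ennreal_plus ennreal_mult')
          finally show ?thesis using x by (simp add: q_def)
        next
          case False
          then show ?thesis by (simp add: A_def)
        qed
      qed
      also have "\<dots> = ennreal (1 + \<epsilon>) * ?J + ennreal (\<epsilon> + \<epsilon>\<^sup>2) * (\<integral>\<^sup>+x. ennreal ((norm (?Y x))\<^sup>2) \<partial>lborel)"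
        using mJ by (subst nn_integral_add) (auto simp: nn_integral_cmult)
      also have "\<dots> \<le> ennreal (1 + \<epsilon>) * ennreal j + ennreal (\<epsilon> + \<epsilon>\<^sup>2) * ennreal (4 * pi * b)"
        unfolding real(2) using nn_integral_schwarz_field[OF b] by (intro add_left_mono mult_left_mono) auto
      also have "\<dots> = ennreal ((1 + \<epsilon>) * j + (\<epsilon> + \<epsilon>\<^sup>2) * (4 * pi * b))"
        using \<epsilon> b real by (simp flip: ennreal_mult ennreal_plus)
      finally have "(\<integral>x. A x \<partial>lborel) \<le> (1 + \<epsilon>) * j + (\<epsilon> + \<epsilon>\<^sup>2) * (4 * pi * b)"
        using \<epsilon> b real by (subst (asm) ennreal_le_iff) auto
      moreover have "(1 - 2 * \<epsilon>)\<^sup>2 * (16 * pi * b / \<rho>\<^sup>2) * (H \<rho> \<rho> - H \<rho> \<rho>1) \<le> (\<integral>x. Q x \<partial>lborel)"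
        using flux_lower_bound[OF \<epsilon> \<rho>1(1,3) \<rho>] unfolding Q_def H_def by blast
      ultimately show ?thesis
        using low intA_eq unfolding F_def by linarith
    qed
    have "(F \<longlongrightarrow> 4 * pi * (1 - 4 * \<epsilon>)\<^sup>2 * R + (1 - 2 * \<epsilon>)\<^sup>2 * (4 * pi * b)) at_top"
    proof -
      have 1: "((\<lambda>\<rho>::real. (1 - \<rho>1\<^sup>2 / \<rho>\<^sup>2)\<^sup>2) \<longlongrightarrow> 1) at_top" by real_asymp
      have 2: "((\<lambda>\<rho>::real. (1 / \<rho>\<^sup>2) * (H \<rho> \<rho> - H \<rho> \<rho>1)) \<longlongrightarrow> 1/4) at_top"
        unfolding H_def by real_asymp
      have "((\<lambda>\<rho>. (1 - \<rho>1\<^sup>2 / \<rho>\<^sup>2)\<^sup>2 * (4 * pi * (1 - 4 * \<epsilon>)\<^sup>2 * R) +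
          ((1 - 2 * \<epsilon>)\<^sup>2 * (16 * pi * b)) * ((1 / \<rho>\<^sup>2) * (H \<rho> \<rho> - H \<rho> \<rho>1))) \<longlongrightarrow>
         1 * (4 * pi * (1 - 4 * \<epsilon>)\<^sup>2 * R) + ((1 - 2 * \<epsilon>)\<^sup>2 * (16 * pi * b)) * (1/4)) at_top"
        by (intro tendsto_intros 1 2)
      then show ?thesis by (simp add: F_def[abs_def] ac_simps)
    qed
    then show ?thesis
    proof (rule tendsto_upperbound)
      show "\<forall>\<^sub>F \<rho> in at_top. F \<rho> \<le> (1 + \<epsilon>) * j + (\<epsilon> + \<epsilon>\<^sup>2) * (4 * pi * b)"
        using eventually_gt_at_top[of \<rho>1] by eventually_elim (rule F)
    qed simp
  qed
  have "4 * pi * (1 - 4 * 0)\<^sup>2 * R + (1 - 2 * 0)\<^sup>2 * (4 * pi * b) \<le> (1 + 0) * j + (0 + 0\<^sup>2) * (4 * pi * b)"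
  proof (rule tendsto_le[where F="at_right (0::real)"])
    show "((\<lambda>\<epsilon>. (1 + \<epsilon>) * j + (\<epsilon> + \<epsilon>\<^sup>2) * (4 * pi * b)) \<longlongrightarrow> (1 + 0) * j + (0 + 0\<^sup>2) * (4 * pi * b)) (at_right 0)"
      by (intro tendsto_intros)
    show "((\<lambda>\<epsilon>. 4 * pi * (1 - 4 * \<epsilon>)\<^sup>2 * R + (1 - 2 * \<epsilon>)\<^sup>2 * (4 * pi * b)) \<longlongrightarrow>
        4 * pi * (1 - 4 * 0)\<^sup>2 * R + (1 - 2 * 0)\<^sup>2 * (4 * pi * b)) (at_right 0)"
      by (intro tendsto_intros)
    show "\<forall>\<^sub>F \<epsilon> in at_right 0. 4 * pi * (1 - 4 * \<epsilon>)\<^sup>2 * R + (1 - 2 * \<epsilon>)\<^sup>2 * (4 * pi * b) \<le> (1 + \<epsilon>) * j + (\<epsilon> + \<epsilon>\<^sup>2) * (4 * pi * b)"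
    proof -
      have "\<forall>\<^sub>F \<epsilon> in at_right (0::real). \<epsilon> \<in> {0<..<1/8}"
        by (rule eventually_at_right_real) simp
      then show ?thesis by (rule eventually_mono) (use step in auto)
    qed
  qed simp
  then show ?thesis
    unfolding real(2) by (intro ennreal_leI) (simp add: algebra_simps)
qed simp

end

section \<open>Superharmonic functions\<close>

text \<open>Twice differentiable functions are handled through a gradient field and its derivative; the
  Laplacian is the trace of the latter.\<close>

definition trace_op :: "('a::euclidean_space \<Rightarrow> 'a) \<Rightarrow> real" where
  "trace_op L = (\<Sum>i\<in>Basis. L i \<bullet> i)"

text \<open>The fields are required on a whole ball and the second derivative is required to be
  continuous, so that harmonicity also yields \<open>Ck_on 2\<close>.\<close>

definition harmonic_at :: "('a::euclidean_space \<Rightarrow> real) \<Rightarrow> 'a \<Rightarrow> bool" where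
  "harmonic_at f x \<longleftrightarrow> (\<exists>e>0. \<exists>G H. \<forall>y\<in>ball x e.
     (f has_derivative (\<lambda>h. G y \<bullet> h)) (at y) \<and> (G has_derivative H y) (at y) \<and>
     trace_op (H y) = 0 \<and> (\<forall>h. isCont (\<lambda>z. H z h) y))"

text \<open>Superharmonicity in the viscosity sense: no function touching \<open>v\<close> from below has positive
  Laplacian at the contact point.\<close>

definition superharmonic_at :: "('a::euclidean_space \<Rightarrow> real) \<Rightarrow> 'a \<Rightarrow> bool" where
  "superharmonic_at v x \<longleftrightarrow> (\<forall>p G H e. e > 0 \<longrightarrow>
     (\<forall>y\<in>ball x e. (p has_derivative (\<lambda>h. G y \<bullet> h)) (at y)) \<longrightarrow> (G has_derivative H) (at x) \<longrightarrow>
     (\<forall>y\<in>ball x e. v x - p x \<le> v y - p y) \<longrightarrow> trace_op H \<le> 0)"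

text \<open>Second derivative test along the line x + t h: if H h had negative inner product with h,
  the slope would be 0 at t = 0 and negative just after, so \<open>f\<close> would drop below its
  minimum.\<close>

lemma second_derivative_nonneg:
  fixes f :: "'a::euclidean_space \<Rightarrow> real"
  assumes e: "e > 0" and G: "\<And>y. y \<in> ball x e \<Longrightarrow> (f has_derivative (\<lambda>h. G y \<bullet> h)) (at y)"
    and H: "(G has_derivative H) (at x)" and min: "\<And>y. y \<in> ball x e \<Longrightarrow> f x \<le> f y"
  shows "0 \<le> H h \<bullet> h"
proof (rule ccontr)
  assume neg: "\<not> ?thesis"
  define d where "d = e / (norm h + 1)"
  have d: "d > 0" using e by (simp add: d_def add_nonneg_pos)
  have inb: "x + t *\<^sub>R h \<in> ball x e" if "\<bar>t\<bar> < d" for t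
  proof -
    have "\<bar>t\<bar> * norm h \<le> \<bar>t\<bar> * (norm h + 1)" by (intro mult_left_mono) auto
    also have "\<dots> < e" using that by (simp add: d_def pos_less_divide_eq add_nonneg_pos)
    finally show ?thesis by (simp add: dist_norm)
  qed
  have \<phi>': "((\<lambda>t. f (x + t *\<^sub>R h)) has_real_derivative G (x + t *\<^sub>R h) \<bullet> h) (at t)" if "\<bar>t\<bar> < d" for t
  proof -
    have "((\<lambda>t. x + t *\<^sub>R h) has_derivative (\<lambda>k. k *\<^sub>R h)) (at t)"
      by (auto intro!: derivative_eq_intros)
    from has_derivative_compose[OF this G[OF inb[OF that]]]
    have "((\<lambda>t. f (x + t *\<^sub>R h)) has_derivative (\<lambda>k. G (x + t *\<^sub>R h) \<bullet> (k *\<^sub>R h))) (at t)" .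
    then show ?thesis
      unfolding has_field_derivative_def by (rule has_derivative_eq_rhs) (simp add: fun_eq_iff mult.commute)
  qed
  have \<psi>: "((\<lambda>t. G (x + t *\<^sub>R h) \<bullet> h) has_real_derivative H h \<bullet> h) (at 0)"
  proof -
    have l: "((\<lambda>t. x + t *\<^sub>R h) has_derivative (\<lambda>k. k *\<^sub>R h)) (at 0)"
      by (auto intro!: derivative_eq_intros)
    have "(G has_derivative H) (at (x + 0 *\<^sub>R h))" using H by simp
    from has_derivative_inner_left[OF has_derivative_compose[OF l this]]
    have "((\<lambda>t. G (x + t *\<^sub>R h) \<bullet> h) has_derivative (\<lambda>k. H (k *\<^sub>R h) \<bullet> h)) (at 0)" .
    then show ?thesis
      unfolding has_field_derivative_def
      by (rule has_derivative_eq_rhs) (simp add: fun_eq_iff mult.commute linear_scale[OF has_derivative_linear[OF H]])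
  qed
  have "G (x + 0 *\<^sub>R h) \<bullet> h = 0"
  proof (rule DERIV_local_min[OF \<phi>'[of 0]])
    show "\<forall>y. \<bar>0 - y\<bar> < d \<longrightarrow> f (x + 0 *\<^sub>R h) \<le> f (x + y *\<^sub>R h)"
      using min inb by simp
  qed (use d in auto)
  then have G0: "G x \<bullet> h = 0" by simp
  obtain d' where d': "d' > 0" "\<And>t. 0 < t \<Longrightarrow> t < d' \<Longrightarrow> G (x + t *\<^sub>R h) \<bullet> h < 0"
    using DERIV_neg_dec_right[OF \<psi>] neg G0 by auto
  define t where "t = min d d' / 2"
  have t: "0 < t" "t < d" "t < d'" using d d' by (auto simp: t_def)
  obtain z where z: "0 < z" "z < t" "f (x + t *\<^sub>R h) - f (x + 0 *\<^sub>R h) = (t - 0) * (G (x + z *\<^sub>R h) \<bullet> h)"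
    using MVT2[OF t(1), of "\<lambda>t. f (x + t *\<^sub>R h)" "\<lambda>t. G (x + t *\<^sub>R h) \<bullet> h"] \<phi>' t by force
  have "G (x + z *\<^sub>R h) \<bullet> h < 0" using d' z t by simp
  then have "t * (G (x + z *\<^sub>R h) \<bullet> h) < 0" using t(1) by (rule mult_pos_neg[rotated])
  then have "f (x + t *\<^sub>R h) < f x" using z(3) by simp
  moreover have "f x \<le> f (x + t *\<^sub>R h)" using min inb t by simp
  ultimately show False by simp
qed

lemma trace_op_diff: "trace_op (\<lambda>h. A h - B h) = trace_op A - trace_op B"
  by (simp add: trace_op_def inner_diff_left sum_subtractf)

lemma trace_op_add: "trace_op (\<lambda>h. A h + B h) = trace_op A + trace_op B"
  by (simp add: trace_op_def inner_add_left sum.distrib)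

lemma trace_op_scale: "trace_op (\<lambda>h. c *\<^sub>R A h) = c * trace_op A"
  by (simp add: trace_op_def sum_distrib_left)

lemma trace_op_id: "trace_op (\<lambda>h. h :: 'a::euclidean_space) = DIM('a)"
  by (simp add: trace_op_def)

lemma trace_op_outer: "trace_op (\<lambda>h. (a \<bullet> h) *\<^sub>R b) = a \<bullet> b"
  by (simp add: trace_op_def euclidean_inner[symmetric])

lemma harmonic_at_cong:
  assumes "harmonic_at f x" "open S" "x \<in> S" "\<And>y. y \<in> S \<Longrightarrow> f y = g y"
  shows "harmonic_at g x"
proof -
  obtain e G H where e: "e > 0" and GH: "\<And>y. y \<in> ball x e \<Longrightarrow>
     (f has_derivative (\<lambda>h. G y \<bullet> h)) (at y) \<and> (G has_derivative H y) (at y) \<and>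
     trace_op (H y) = 0 \<and> (\<forall>h. isCont (\<lambda>z. H z h) y)"
    using assms(1) unfolding harmonic_at_def by blast
  obtain d where d: "d > 0" "ball x d \<subseteq> S" using assms(2,3) open_contains_ball by blast
  have "(g has_derivative (\<lambda>h. G y \<bullet> h)) (at y)" if "y \<in> ball x (min e d)" for y
  proof (rule has_derivative_transform_within_open[of f _ _ _ S])
    show "(f has_derivative (\<lambda>h. G y \<bullet> h)) (at y)" using GH that by simp
    show "y \<in> S" using d that by auto
  qed (use assms in auto)
  then show ?thesis
    unfolding harmonic_at_def using e d GH by (intro exI[of _ "min e d"] conjI exI[of _ G] exI[of _ H]) auto
qed

lemma harmonic_at_superharmonic_at:
  assumes "harmonic_at f x"
  shows "superharmonic_at f x"
  unfolding superharmonic_at_def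
proof (intro allI impI)
  fix p Gp Hp e
  assume e: "(e::real) > 0" and p: "\<forall>y\<in>ball x e. (p has_derivative (\<lambda>h. Gp y \<bullet> h)) (at y)"
    "(Gp has_derivative Hp) (at x)" and min: "\<forall>y\<in>ball x e. f x - p x \<le> f y - p y"
  obtain d G H where d: "d > 0" and GH: "\<And>y. y \<in> ball x d \<Longrightarrow>
     (f has_derivative (\<lambda>h. G y \<bullet> h)) (at y) \<and> (G has_derivative H y) (at y) \<and> trace_op (H y) = 0"
    using assms unfolding harmonic_at_def by blast
  have "0 \<le> (H x h - Hp h) \<bullet> h" for h
  proof (rule second_derivative_nonneg)
    show "((\<lambda>y. f y - p y) has_derivative (\<lambda>h. (G y - Gp y) \<bullet> h)) (at y)" if "y \<in> ball x (min d e)" for y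
      unfolding inner_diff_left using GH p(1) that by (intro has_derivative_diff) auto
    show "((\<lambda>y. G y - Gp y) has_derivative (\<lambda>h. H x h - Hp h)) (at x)"
      using GH p(2) d by (intro has_derivative_diff) auto
  qed (use d e min in auto)
  then have "0 \<le> trace_op (\<lambda>h. H x h - Hp h)"
    unfolding trace_op_def by (intro sum_nonneg) auto
  then show "trace_op Hp \<le> 0" using GH[of x] d by (simp add: trace_op_diff)
qed

text \<open>A function that touches v' from below at x also touches v from below there. This is how
  minima of harmonic functions, and functions modified on part of the space only, are seen to be
  superharmonic.\<close>

lemma superharmonic_at_touching:
  assumes "superharmonic_at v x" "v x = v' x" "e > 0" "\<And>y. y \<in> ball x e \<Longrightarrow> v' y \<le> v y"
  shows "superharmonic_at v' x"
  unfolding superharmonic_at_def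
proof (intro allI impI)
  fix p G H d
  assume d: "(d::real) > 0" and p: "\<forall>y\<in>ball x d. (p has_derivative (\<lambda>h. G y \<bullet> h)) (at y)"
    "(G has_derivative H) (at x)" and min: "\<forall>y\<in>ball x d. v' x - p x \<le> v' y - p y"
  have "\<forall>y\<in>ball x (min d e). v x - p x \<le> v y - p y"
    using min assms(2,4) by force
  moreover have "\<forall>y\<in>ball x (min d e). (p has_derivative (\<lambda>h. G y \<bullet> h)) (at y)" using p by simp
  moreover have "min d e > 0" using d assms(3) by simp
  ultimately show "trace_op H \<le> 0"
    using assms(1)[unfolded superharmonic_at_def, THEN spec[of _ p], THEN spec[of _ G], THEN spec[of _ H],
        THEN spec[of _ "min d e"]] p(2) by blast
qed

text \<open>If h exceeds v somewhere, v - h - \<epsilon> |y|^2 has its minimum over \<open>C\<close>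
  at a point of \<open>U\<close>. There h + \<epsilon> |y|^2 touches v from below, up to a constant,
  with the positive Laplacian 2 \<epsilon> times the dimension.\<close>

lemma superharmonic_comparison:
  fixes v h :: "'a::euclidean_space \<Rightarrow> real"
  assumes C: "compact C" and U: "open U" "U \<subseteq> C"
    and cont: "continuous_on C v" "continuous_on C h"
    and v: "\<And>x. x \<in> U \<Longrightarrow> superharmonic_at v x" and h: "\<And>x. x \<in> U \<Longrightarrow> harmonic_at h x"
    and bd: "\<And>x. x \<in> C - U \<Longrightarrow> h x \<le> v x" and "x \<in> C"
  shows "h x \<le> v x"
proof (rule ccontr)
  assume neg: "\<not> h x \<le> v x"
  define \<delta> where "\<delta> = h x - v x"
  have \<delta>: "\<delta> > 0" using neg by (simp add: \<delta>_def)
  obtain B where B: "B > 0" "\<And>y. y \<in> C \<Longrightarrow> norm y \<le> B"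
    using compact_imp_bounded[OF C] bounded_pos by blast
  \<comment> \<open>As |y| <= B on \<open>C\<close>, the perturbation is at most half of the defect
    \<open>\<delta>\<close>, so v < h still holds at the minimum point and places it in
    \<open>U\<close>.\<close>
  define \<epsilon> where "\<epsilon> = \<delta> / (2 * B\<^sup>2)"
  have \<epsilon>: "\<epsilon> > 0" using \<delta> B by (simp add: \<epsilon>_def)
  define g where "g y = v y - h y - \<epsilon> * (y \<bullet> y)" for y
  obtain z where z: "z \<in> C" "\<And>y. y \<in> C \<Longrightarrow> g z \<le> g y"
    using continuous_attains_inf[OF C, of g] \<open>x \<in> C\<close> cont unfolding g_def
    by (force intro!: continuous_intros)
  have "g z \<le> g x" using z \<open>x \<in> C\<close> by blast
  also have "g x \<le> - \<delta>" using \<epsilon> by (simp add: g_def \<delta>_def)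
  finally have "v z - h z \<le> - \<delta> + \<epsilon> * (z \<bullet> z)" by (simp add: g_def)
  also have "\<epsilon> * (z \<bullet> z) \<le> \<epsilon> * B\<^sup>2"
    using B(2)[OF z(1)] \<epsilon> by (simp add: power2_norm_eq_inner[symmetric] power_mono)
  also have "\<epsilon> * B\<^sup>2 = \<delta> / 2" using B by (simp add: \<epsilon>_def)
  finally have "v z < h z" using \<delta> by simp
  then have zU: "z \<in> U" using bd[of z] z by force
  obtain e where e: "e > 0" "ball z e \<subseteq> U" using U zU open_contains_ball by blast
  obtain d G H where d: "d > 0" and GH: "\<And>y. y \<in> ball z d \<Longrightarrow>
     (h has_derivative (\<lambda>k. G y \<bullet> k)) (at y) \<and> (G has_derivative H y) (at y) \<and> trace_op (H y) = 0"
    using h[OF zU] unfolding harmonic_at_def by blast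
  have "trace_op (\<lambda>k. H z k + (2 * \<epsilon>) *\<^sub>R k) \<le> 0"
  proof (rule v[OF zU, unfolded superharmonic_at_def, rule_format])
    show "min d e > 0" using d e by simp
    show "((\<lambda>y. h y + \<epsilon> * (y \<bullet> y)) has_derivative (\<lambda>k. (G y + (2 * \<epsilon>) *\<^sub>R y) \<bullet> k)) (at y)"
      if "y \<in> ball z (min d e)" for y
    proof -
      have "((\<lambda>y. y \<bullet> y) has_derivative (\<lambda>k. y \<bullet> k + k \<bullet> y)) (at y)"
        by (rule has_derivative_inner[OF has_derivative_ident has_derivative_ident])
      from has_derivative_add[OF conjunct1[OF GH] has_derivative_mult_right[OF this, of \<epsilon>]]
      show ?thesis using that
        by (force elim!: has_derivative_eq_rhs simp: inner_add_left inner_commute algebra_simps)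
    qed
    show "((\<lambda>y. G y + (2 * \<epsilon>) *\<^sub>R y) has_derivative (\<lambda>k. H z k + (2 * \<epsilon>) *\<^sub>R k)) (at z)"
      using GH d by (intro has_derivative_add has_derivative_scaleR_right has_derivative_ident) auto
    show "v z - (h z + \<epsilon> * (z \<bullet> z)) \<le> v y - (h y + \<epsilon> * (y \<bullet> y))" if "y \<in> ball z (min d e)" for y
    proof -
      have "y \<in> C" using that e(2) U(2) by auto
      then show ?thesis using z(2)[of y] by (simp add: g_def)
    qed
  qed
  then have "2 * \<epsilon> * DIM('a) \<le> 0"
    using GH[of z] d by (simp add: trace_op_add trace_op_scale trace_op_id)
  then show False using \<epsilon> by (simp add: mult_le_0_iff)
qed

lemma harmonic_at_const: "harmonic_at (\<lambda>_. c) x"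
proof -
  have "((\<lambda>_. c) has_derivative (\<lambda>h. 0 \<bullet> h)) (at y)" for y :: 'a
    by simp
  moreover have "trace_op (\<lambda>_::'a. 0) = 0" by (simp add: trace_op_def)
  ultimately show ?thesis
    unfolding harmonic_at_def
    by (intro exI[of _ 1] conjI exI[of _ "\<lambda>_. 0"] exI[of _ "\<lambda>_ _. 0"]) (simp_all del: inner_zero_left)
qed

text \<open>Transfers Poisson integrals from the unit ball to arbitrary balls.\<close>

lemma harmonic_at_affine:
  fixes f :: "'a::euclidean_space \<Rightarrow> real"
  assumes "harmonic_at f ((x - a) /\<^sub>R r)" "r > 0"
  shows "harmonic_at (\<lambda>y. f ((y - a) /\<^sub>R r)) x"
proof -
  obtain e G H where e: "e > 0" and GH: "\<And>y. y \<in> ball ((x - a) /\<^sub>R r) e \<Longrightarrow>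
     (f has_derivative (\<lambda>h. G y \<bullet> h)) (at y) \<and> (G has_derivative H y) (at y) \<and>
     trace_op (H y) = 0 \<and> (\<forall>h. isCont (\<lambda>z. H z h) y)"
    using assms(1) unfolding harmonic_at_def by blast
  define A where "A y = (y - a) /\<^sub>R r" for y
  have inb: "A y \<in> ball ((x - a) /\<^sub>R r) e" if "y \<in> ball x (r * e)" for y
  proof -
    have "dist ((x - a) /\<^sub>R r) (A y) = dist x y / r"
      using assms(2) unfolding A_def dist_norm scaleR_diff_right[symmetric] by (simp add: divide_inverse)
    then show ?thesis using that assms(2) by (simp add: pos_divide_less_eq mult.commute)
  qed
  have A': "(A has_derivative (\<lambda>h. h /\<^sub>R r)) (at y)" for y
    unfolding A_def[abs_def] by (auto intro!: derivative_eq_intros)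
  have contA: "isCont A y" for y using A' has_derivative_continuous by blast
  have "((\<lambda>y. f (A y)) has_derivative (\<lambda>h. (G (A y) /\<^sub>R r) \<bullet> h)) (at y) \<and>
     ((\<lambda>y. G (A y) /\<^sub>R r) has_derivative (\<lambda>h. H (A y) (h /\<^sub>R r) /\<^sub>R r)) (at y) \<and>
     trace_op (\<lambda>h. H (A y) (h /\<^sub>R r) /\<^sub>R r) = 0 \<and> (\<forall>h. isCont (\<lambda>z. H (A z) (h /\<^sub>R r) /\<^sub>R r) y)"
    if "y \<in> ball x (r * e)" for y
  proof (intro conjI allI)
    note g = GH[OF inb[OF that]]
    show "((\<lambda>y. f (A y)) has_derivative (\<lambda>h. (G (A y) /\<^sub>R r) \<bullet> h)) (at y)"
      using has_derivative_compose[OF A' conjunct1[OF g]] by simp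
    have H': "(G has_derivative H (A y)) (at (A y))" using g by blast
    show "((\<lambda>y. G (A y) /\<^sub>R r) has_derivative (\<lambda>h. H (A y) (h /\<^sub>R r) /\<^sub>R r)) (at y)"
      by (intro has_derivative_scaleR_right has_derivative_compose[OF A' H'])
    have lin: "linear (H (A y))" using H' by (rule has_derivative_linear)
    show "trace_op (\<lambda>h. H (A y) (h /\<^sub>R r) /\<^sub>R r) = 0"
      using g by (simp add: trace_op_scale linear_scale[OF lin])
    show "isCont (\<lambda>z. H (A z) (h /\<^sub>R r) /\<^sub>R r) y" for h
    proof -
      have "isCont (\<lambda>z. H z (h /\<^sub>R r)) (A y)" using g by blast
      from isCont_o2[OF contA this] show ?thesis by (intro continuous_intros)
    qed
  qed
  then show ?thesis
    unfolding harmonic_at_def A_def[symmetric] using e assms(2)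
    by (intro exI[of _ "r * e"] conjI exI[of _ "\<lambda>y. G (A y) /\<^sub>R r"] exI[of _ "\<lambda>y h. H (A y) (h /\<^sub>R r) /\<^sub>R r"])
      (simp_all del: inner_scaleR_left)
qed

lemma harmonic_at_isCont: "harmonic_at f x \<Longrightarrow> isCont f x"
  unfolding harmonic_at_def by (metis centre_in_ball has_derivative_continuous)

section \<open>Differentiation and continuity under the integral sign\<close>

text \<open>The normalised remainders are bounded by 2 K through the mean value inequality, so
  dominated convergence applies along every sequence tending to x.\<close>

lemma has_derivative_integral:
  fixes F :: "'a::euclidean_space \<Rightarrow> 'z \<Rightarrow> 'b::euclidean_space"
  assumes M: "finite_measure M" and U: "open U" "x \<in> U"
    and F: "\<And>y z. y \<in> U \<Longrightarrow> ((\<lambda>y. F y z) has_derivative F' y z) (at y)"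
    and meas: "\<And>y. y \<in> U \<Longrightarrow> F y \<in> borel_measurable M" "\<And>h. (\<lambda>z. F' x z h) \<in> borel_measurable M"
    and K: "\<And>y z h. y \<in> U \<Longrightarrow> norm (F' y z h) \<le> K * norm h"
    and B: "\<And>y z. y \<in> U \<Longrightarrow> norm (F y z) \<le> B"
  shows "((\<lambda>y. \<integral>z. F y z \<partial>M) has_derivative (\<lambda>h. \<integral>z. F' x z h \<partial>M)) (at x)"
proof -
  interpret finite_measure M by fact
  have intF: "integrable M (F y)" if "y \<in> U" for y
    by (rule integrable_const_bound[of _ B]) (use B meas that in auto)
  have intF': "integrable M (\<lambda>z. F' x z h)" for h
    by (rule integrable_const_bound[of _ "K * norm h"]) (use K meas U in auto)
  have lin: "linear (F' x z)" for z using F[OF U(2)] has_derivative_linear by blast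
  have bl: "bounded_linear (\<lambda>h. \<integral>z. F' x z h \<partial>M)"
  proof (rule linear_conv_bounded_linear[THEN iffD1], rule linearI)
    show "(\<integral>z. F' x z (a + b) \<partial>M) = (\<integral>z. F' x z a \<partial>M) + (\<integral>z. F' x z b \<partial>M)" for a b
      using intF' by (simp add: linear_add[OF lin])
    show "(\<integral>z. F' x z (c *\<^sub>R a) \<partial>M) = c *\<^sub>R (\<integral>z. F' x z a \<partial>M)" for c a
      by (simp add: linear_scale[OF lin])
  qed
  obtain e where e: "e > 0" "ball x e \<subseteq> U" using U open_contains_ball by blast
  have "((\<lambda>y. ((\<integral>z. F y z \<partial>M) - (\<integral>z. F x z \<partial>M) - (\<integral>z. F' x z (y - x) \<partial>M)) /\<^sub>R norm (y - x)) \<longlongrightarrow> 0) (at x)"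
    unfolding tendsto_at_iff_sequentially comp_def
  proof (intro allI impI)
    fix X assume X: "\<forall>i. X i \<in> UNIV - {x}" "X \<longlonglongrightarrow> x"
    have "\<forall>\<^sub>F n in sequentially. X n \<in> ball x e"
      using X(2) e(1) by (intro topological_tendstoD) auto
    then obtain N where N: "\<And>n. n \<ge> N \<Longrightarrow> X n \<in> ball x e" unfolding eventually_sequentially by blast
    \<comment> \<open>Dropping the first \<open>N\<close> terms keeps the sequence in the ball where
      the bounds hold; \<open>LIMSEQ_offset\<close> restores them at the end.\<close>
    define Y where "Y n = X (n + N)" for n
    have Y: "Y n \<in> ball x e" "Y n \<noteq> x" "Y n \<in> U" for n using N[of "n+N"] X(1) e by (auto simp: Y_def)
    have Yx: "Y \<longlonglongrightarrow> x" unfolding Y_def using X(2) by (rule LIMSEQ_ignore_initial_segment)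
    define s where "s n z = (F (Y n) z - F x z - F' x z (Y n - x)) /\<^sub>R norm (Y n - x)" for n z
    have "(\<lambda>n. \<integral>z. s n z \<partial>M) \<longlonglongrightarrow> (\<integral>z. 0 \<partial>M)"
    proof (rule integral_dominated_convergence[where w="\<lambda>_. 2 * K"])
      show "(s n) \<in> borel_measurable M" for n
        unfolding s_def using meas Y U by (intro borel_measurable_scaleR borel_measurable_diff) auto
      show "integrable M (\<lambda>_. 2 * K)" by simp
      show "AE z in M. (\<lambda>n. s n z) \<longlonglongrightarrow> 0"
      proof (intro AE_I2)
        fix z
        have "((\<lambda>y. (F y z - F x z - F' x z (y - x)) /\<^sub>R norm (y - x)) \<longlongrightarrow> 0) (at x)"
          using F[OF U(2), of z] by (simp add: has_derivative_at_within)
        then show "(\<lambda>n. s n z) \<longlonglongrightarrow> 0"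
          unfolding tendsto_at_iff_sequentially comp_def s_def using Y Yx by auto
      qed
      show "AE z in M. norm (s n z) \<le> 2 * K" for n
      proof (intro AE_I2)
        fix z
        have "norm (F (Y n) z - F x z) \<le> K * norm (Y n - x)"
        proof (rule differentiable_bound[of "ball x e"])
          show "((\<lambda>y. F y z) has_derivative F' y z) (at y within ball x e)" if "y \<in> ball x e" for y
            using F[of y z] that e has_derivative_at_withinI by blast
          show "onorm (F' y z) \<le> K" if "y \<in> ball x e" for y
            using K[of y z] that e by (intro onorm_le) auto
        qed (use Y e in auto)
        moreover have "norm (F' x z (Y n - x)) \<le> K * norm (Y n - x)" using K U by blast
        moreover have "norm (F (Y n) z - F x z - F' x z (Y n - x)) \<le> norm (F (Y n) z - F x z) + norm (F' x z (Y n - x))"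
          by (rule norm_triangle_ineq4)
        ultimately have "norm (F (Y n) z - F x z - F' x z (Y n - x)) \<le> 2 * K * norm (Y n - x)"
          by linarith
        then show "norm (s n z) \<le> 2 * K"
          using Y(2)[of n] by (simp add: s_def divide_inverse[symmetric] mult.commute[of "inverse _"] pos_divide_le_eq)
      qed
    qed simp
    moreover have "(\<integral>z. s n z \<partial>M) =
       ((\<integral>z. F (Y n) z \<partial>M) - (\<integral>z. F x z \<partial>M) - (\<integral>z. F' x z (Y n - x) \<partial>M)) /\<^sub>R norm (Y n - x)" for n
      unfolding s_def using intF[OF Y(3)] intF[OF U(2)] intF' by simp
    ultimately have "(\<lambda>n. ((\<integral>z. F (X (n + N)) z \<partial>M) - (\<integral>z. F x z \<partial>M) - (\<integral>z. F' x z (X (n + N) - x) \<partial>M)) /\<^sub>R norm (X (n + N) - x)) \<longlonglongrightarrow> 0"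
      by (simp add: Y_def)
    then show "(\<lambda>n. ((\<integral>z. F (X n) z \<partial>M) - (\<integral>z. F x z \<partial>M) - (\<integral>z. F' x z (X n - x) \<partial>M)) /\<^sub>R norm (X n - x)) \<longlonglongrightarrow> 0"
      by (rule LIMSEQ_offset)
  qed
  with bl show ?thesis by (simp add: has_derivative_at_within)
qed

lemma isCont_integral:
  fixes F :: "'a::euclidean_space \<Rightarrow> 'z \<Rightarrow> 'b::euclidean_space"
  assumes M: "finite_measure M" and U: "open U" "x \<in> U"
    and F: "\<And>z. isCont (\<lambda>y. F y z) x"
    and meas: "\<And>y. y \<in> U \<Longrightarrow> F y \<in> borel_measurable M"
    and B: "\<And>y z. y \<in> U \<Longrightarrow> norm (F y z) \<le> B"
  shows "isCont (\<lambda>y. \<integral>z. F y z \<partial>M) x"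
  unfolding continuous_at_sequentially comp_def
proof (intro allI impI)
  interpret finite_measure M by fact
  fix X assume X: "X \<longlonglongrightarrow> x"
  have "\<forall>\<^sub>F n in sequentially. X n \<in> U" using X U by (intro topological_tendstoD) auto
  then obtain N where N: "\<And>n. n \<ge> N \<Longrightarrow> X n \<in> U" unfolding eventually_sequentially by blast
  have "(\<lambda>n. \<integral>z. F (X (n + N)) z \<partial>M) \<longlonglongrightarrow> (\<integral>z. F x z \<partial>M)"
  proof (rule integral_dominated_convergence[where w="\<lambda>_. B"])
    show "AE z in M. (\<lambda>n. F (X (n + N)) z) \<longlonglongrightarrow> F x z"
    proof (intro AE_I2)
      fix z
      have "(\<lambda>n. F (X n) z) \<longlonglongrightarrow> F x z"
        using F[of z] X unfolding continuous_at_sequentially comp_def by blast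
      then show "(\<lambda>n. F (X (n + N)) z) \<longlonglongrightarrow> F x z" by (rule LIMSEQ_ignore_initial_segment)
    qed
  qed (use meas N U B in auto)
  then show "(\<lambda>n. \<integral>z. F (X n) z \<partial>M) \<longlonglongrightarrow> (\<integral>z. F x z \<partial>M)" by (rule LIMSEQ_offset)
qed

section \<open>The Poisson kernel\<close>

text \<open>For \<open>\<bar>y\<bar> = 1\<close> the Poisson kernel \<open>(1 - \<bar>x\<bar>\<^sup>2)/\<bar>x - y\<bar>\<^sup>3\<close> equals
  \<open>- 1/\<bar>z\<bar> - 2 (y \<bullet> z)/\<bar>z\<bar>\<^sup>3\<close> with \<open>z = x - y\<close>; both terms are harmonic in \<open>x\<close>.\<close>

definition inv_dist :: "'a::real_normed_vector \<Rightarrow> 'a \<Rightarrow> real" where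
  "inv_dist y x = inverse (norm (x - y))"

definition inv_dist_hess :: "real^3 \<Rightarrow> real^3 \<Rightarrow> real^3 \<Rightarrow> real^3" where
  "inv_dist_hess y x h = (3 * inv_dist y x ^ 5 * ((x - y) \<bullet> h)) *\<^sub>R (x - y) - (inv_dist y x ^ 3) *\<^sub>R h"

definition dipole :: "real^3 \<Rightarrow> real^3 \<Rightarrow> real" where
  "dipole y x = (y \<bullet> (x - y)) * inv_dist y x ^ 3"

definition dipole_grad :: "real^3 \<Rightarrow> real^3 \<Rightarrow> real^3" where
  "dipole_grad y x = (inv_dist y x ^ 3) *\<^sub>R y - (3 * (y \<bullet> (x - y)) * inv_dist y x ^ 5) *\<^sub>R (x - y)"

definition dipole_hess :: "real^3 \<Rightarrow> real^3 \<Rightarrow> real^3 \<Rightarrow> real^3" where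
  "dipole_hess y x h = (- 3 * inv_dist y x ^ 5 * ((x - y) \<bullet> h)) *\<^sub>R y
     - (3 * inv_dist y x ^ 5 * (y \<bullet> h)) *\<^sub>R (x - y)
     - (3 * (y \<bullet> (x - y)) * inv_dist y x ^ 5) *\<^sub>R h
     + (15 * (y \<bullet> (x - y)) * inv_dist y x ^ 7 * ((x - y) \<bullet> h)) *\<^sub>R (x - y)"

lemma has_derivative_inv_dist_power:
  fixes x y :: "'a::real_inner"
  assumes "x \<noteq> y"
  shows "((\<lambda>x. inv_dist y x ^ k) has_derivative (\<lambda>h. - real k * inv_dist y x ^ (k + 2) * ((x - y) \<bullet> h))) (at x)"
proof -
  have r: "norm (x - y) \<noteq> 0" using assms by simp
  have "(norm has_derivative (\<lambda>h. h \<bullet> sgn (x - y))) (at (x - y))"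
    using assms by (intro has_derivative_norm) auto
  moreover have "((\<lambda>x. x - y) has_derivative (\<lambda>h. h)) (at x)"
    by (auto intro!: derivative_eq_intros)
  ultimately have n: "((\<lambda>x. norm (x - y)) has_derivative (\<lambda>h. h \<bullet> sgn (x - y))) (at x)"
    using has_derivative_compose[of "\<lambda>x. x - y"] by blast
  have "((\<lambda>r. inverse r ^ k) has_real_derivative - real k * inverse (norm (x - y)) ^ (k + 1)) (at (norm (x - y)))"
  proof (cases k)
    case (Suc j)
    then show ?thesis
      by (intro DERIV_cong[OF DERIV_power[OF DERIV_inverse[OF r]]]) (simp add: algebra_simps)
  qed simp
  from has_derivative_compose[OF n this[unfolded has_field_derivative_def]]
  show ?thesis
    unfolding inv_dist_def
  proof (rule has_derivative_eq_rhs)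
    have "h \<bullet> sgn (x - y) = inverse (norm (x - y)) * ((x - y) \<bullet> h)" for h
      unfolding sgn_div_norm inner_scaleR_right by (simp only: inner_commute)
    then show "(\<lambda>h. - real k * inverse (norm (x - y)) ^ (k + 1) * (h \<bullet> sgn (x - y))) =
        (\<lambda>h. - real k * inverse (norm (x - y)) ^ (k + 2) * ((x - y) \<bullet> h))"
      by (simp only: fun_eq_iff) simp
  qed
qed

lemma has_derivative_inv_dist:
  fixes x y :: "real^3"
  assumes "x \<noteq> y"
  shows "(inv_dist y has_derivative (\<lambda>h. (- (inv_dist y x ^ 3) *\<^sub>R (x - y)) \<bullet> h)) (at x)"
    and "((\<lambda>x. - (inv_dist y x ^ 3) *\<^sub>R (x - y)) has_derivative inv_dist_hess y x) (at x)"
    and "trace_op (inv_dist_hess y x) = 0"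
proof -
  show "(inv_dist y has_derivative (\<lambda>h. (- (inv_dist y x ^ 3) *\<^sub>R (x - y)) \<bullet> h)) (at x)"
    using has_derivative_inv_dist_power[OF assms, of 1]
    by (simp add: numeral_3_eq_3)
  have id: "((\<lambda>x. x - y) has_derivative (\<lambda>h. h)) (at x)"
    by (auto intro!: derivative_eq_intros)
  from has_derivative_minus[OF has_derivative_scaleR[OF has_derivative_inv_dist_power[OF assms, of 3] id]]
  have "((\<lambda>x. - (inv_dist y x ^ 3 *\<^sub>R (x - y))) has_derivative inv_dist_hess y x) (at x)"
    by (rule has_derivative_eq_rhs) (simp add: fun_eq_iff inv_dist_hess_def)
  then show "((\<lambda>x. - (inv_dist y x ^ 3) *\<^sub>R (x - y)) has_derivative inv_dist_hess y x) (at x)" by simp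
  have one: "inv_dist y x ^ 2 * ((x - y) \<bullet> (x - y)) = 1"
    using assms by (simp add: inv_dist_def power2_norm_eq_inner[symmetric] field_simps)
  have e: "inv_dist_hess y x = (\<lambda>h. (3 * inv_dist y x ^ 5) *\<^sub>R (((x - y) \<bullet> h) *\<^sub>R (x - y)) - inv_dist y x ^ 3 *\<^sub>R h)"
    by (auto simp: inv_dist_hess_def)
  have "trace_op (inv_dist_hess y x) = 3 * inv_dist y x ^ 3 * (inv_dist y x ^ 2 * ((x - y) \<bullet> (x - y))) - 3 * inv_dist y x ^ 3"
    unfolding e trace_op_diff trace_op_scale trace_op_outer trace_op_id
    by (simp add: power_numeral_reduce)
  then show "trace_op (inv_dist_hess y x) = 0" unfolding one by simp
qed

lemma has_derivative_dipole:
  fixes x y :: "real^3"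
  assumes "x \<noteq> y"
  shows "(dipole y has_derivative (\<lambda>h. dipole_grad y x \<bullet> h)) (at x)"
    and "(dipole_grad y has_derivative dipole_hess y x) (at x)"
    and "trace_op (dipole_hess y x) = 0"
proof -
  have id: "((\<lambda>x. x - y) has_derivative (\<lambda>h. h)) (at x)"
    by (auto intro!: derivative_eq_intros)
  have yi: "((\<lambda>x. y \<bullet> (x - y)) has_derivative (\<lambda>h. y \<bullet> h)) (at x)"
    by (rule has_derivative_inner_right[OF id])
  from has_derivative_mult[OF yi has_derivative_inv_dist_power[OF assms, of 3]]
  show "(dipole y has_derivative (\<lambda>h. dipole_grad y x \<bullet> h)) (at x)"
    unfolding dipole_def[abs_def]
    by (rule has_derivative_eq_rhs) (simp add: fun_eq_iff dipole_grad_def inner_diff_left algebra_simps)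
  have a: "((\<lambda>x. (inv_dist y x ^ 3) *\<^sub>R y) has_derivative (\<lambda>h. (- 3 * inv_dist y x ^ 5 * ((x - y) \<bullet> h)) *\<^sub>R y)) (at x)"
    using has_derivative_scaleR_left[OF has_derivative_inv_dist_power[OF assms, of 3]] by simp
  have b: "((\<lambda>x. 3 * (y \<bullet> (x - y)) * inv_dist y x ^ 5) has_derivative
      (\<lambda>h. 3 * (y \<bullet> (x - y)) * (- 5 * inv_dist y x ^ 7 * ((x - y) \<bullet> h)) + 3 * (y \<bullet> h) * inv_dist y x ^ 5)) (at x)"
    using has_derivative_mult[OF has_derivative_mult_right[OF yi, of 3] has_derivative_inv_dist_power[OF assms, of 5]] by simp
  from has_derivative_diff[OF a has_derivative_scaleR[OF b id]]
  show "(dipole_grad y has_derivative dipole_hess y x) (at x)"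
    unfolding dipole_grad_def[abs_def]
    by (rule has_derivative_eq_rhs) (simp add: fun_eq_iff dipole_hess_def algebra_simps)
  have one: "inv_dist y x ^ 2 * ((x - y) \<bullet> (x - y)) = 1"
    using assms by (simp add: inv_dist_def power2_norm_eq_inner[symmetric] field_simps)
  let ?n = "inv_dist y x" and ?z = "x - y"
  have e: "dipole_hess y x = (\<lambda>h. (((- 3 * ?n ^ 5) *\<^sub>R ((?z \<bullet> h) *\<^sub>R y) - (3 * ?n ^ 5) *\<^sub>R ((y \<bullet> h) *\<^sub>R ?z))
      - (3 * (y \<bullet> ?z) * ?n ^ 5) *\<^sub>R h) + (15 * (y \<bullet> ?z) * ?n ^ 7) *\<^sub>R ((?z \<bullet> h) *\<^sub>R ?z))"
    by (auto simp: dipole_hess_def)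
  have "trace_op (dipole_hess y x) = - 15 * ?n ^ 5 * (y \<bullet> ?z) + 15 * (y \<bullet> ?z) * ?n ^ 5 * (?n ^ 2 * (?z \<bullet> ?z))"
    unfolding e trace_op_diff trace_op_add trace_op_scale trace_op_outer trace_op_id inner_commute[of ?z y]
    by (simp add: power_numeral_reduce algebra_simps)
  then show "trace_op (dipole_hess y x) = 0" unfolding one by simp
qed

lemma isCont_inv_dist: "x \<noteq> y \<Longrightarrow> isCont (inv_dist y) x"
  unfolding inv_dist_def by (intro continuous_intros) auto

lemma harmonic_at_inv_dist:
  fixes x y :: "real^3"
  assumes "x \<noteq> y"
  shows "harmonic_at (\<lambda>x. c * inv_dist y x) x"
proof -
  have "dist x y > 0" using assms by simp
  moreover have "((\<lambda>x. c * inv_dist y x) has_derivative (\<lambda>h. (c *\<^sub>R (- (inv_dist y z ^ 3) *\<^sub>R (z - y))) \<bullet> h)) (at z) \<and>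
    ((\<lambda>z. c *\<^sub>R (- (inv_dist y z ^ 3) *\<^sub>R (z - y))) has_derivative (\<lambda>h. c *\<^sub>R inv_dist_hess y z h)) (at z) \<and>
    trace_op (\<lambda>h. c *\<^sub>R inv_dist_hess y z h) = 0 \<and> (\<forall>h. isCont (\<lambda>z. c *\<^sub>R inv_dist_hess y z h) z)"
    if "z \<in> ball x (dist x y)" for z
  proof (intro conjI allI)
    have z: "z \<noteq> y" using that by auto
    show "((\<lambda>x. c * inv_dist y x) has_derivative (\<lambda>h. (c *\<^sub>R (- (inv_dist y z ^ 3) *\<^sub>R (z - y))) \<bullet> h)) (at z)"
      using has_derivative_mult_right[OF has_derivative_inv_dist(1)[OF z], of c] by (simp add: mult.assoc)
    show "((\<lambda>z. c *\<^sub>R (- (inv_dist y z ^ 3) *\<^sub>R (z - y))) has_derivative (\<lambda>h. c *\<^sub>R inv_dist_hess y z h)) (at z)"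
      by (intro has_derivative_scaleR_right has_derivative_inv_dist z)
    show "trace_op (\<lambda>h. c *\<^sub>R inv_dist_hess y z h) = 0"
      by (simp add: trace_op_scale has_derivative_inv_dist(3)[OF z])
    show "isCont (\<lambda>z. c *\<^sub>R inv_dist_hess y z h) z" for h
      unfolding inv_dist_hess_def by (intro continuous_intros isCont_inv_dist z)
  qed
  ultimately show ?thesis
    unfolding harmonic_at_def
    by (intro exI[of _ "dist x y"] conjI exI[of _ "\<lambda>z. c *\<^sub>R (- (inv_dist y z ^ 3) *\<^sub>R (z - y))"]
        exI[of _ "\<lambda>z h. c *\<^sub>R inv_dist_hess y z h"] ballI) blast+
qed

text \<open>The value at 0 is an arbitrary unit vector, so that \<open>dir\<close> always lands on
  the sphere; the origin is a null set for the measure below.\<close>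

definition dir :: "real^3 \<Rightarrow> real^3" where
  "dir z = (if z = 0 then axis 1 1 else sgn z)"

text \<open>Pushing this measure forward under \<open>dir\<close> gives the normalised surface measure of the
  sphere.\<close>

definition ball_measure :: "(real^3) measure" where
  "ball_measure = uniform_measure lborel (cball 0 1)"

definition poisson_kernel :: "real^3 \<Rightarrow> real^3 \<Rightarrow> real" where
  "poisson_kernel y x = - inv_dist y x - 2 * dipole y x"

definition poisson_grad :: "real^3 \<Rightarrow> real^3 \<Rightarrow> real^3" where
  "poisson_grad y x = (inv_dist y x ^ 3) *\<^sub>R (x - y) - 2 *\<^sub>R dipole_grad y x"

definition poisson_hess :: "real^3 \<Rightarrow> real^3 \<Rightarrow> real^3 \<Rightarrow> real^3" where
  "poisson_hess y x h = - inv_dist_hess y x h - 2 *\<^sub>R dipole_hess y x h"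

definition poisson_unit :: "(real^3 \<Rightarrow> real) \<Rightarrow> real^3 \<Rightarrow> real" where
  "poisson_unit f x = (\<integral>z. f (dir z) * poisson_kernel (dir z) x \<partial>ball_measure)"

lemma norm_dir [simp]: "norm (dir z) = 1"
  by (simp add: dir_def norm_sgn)

lemma dir_measurable [measurable]: "dir \<in> borel_measurable borel"
  unfolding dir_def[abs_def] sgn_div_norm by measurable

lemma sets_ball_measure [simp, measurable_cong]: "sets ball_measure = sets borel"
  by (simp add: ball_measure_def)

lemma space_ball_measure [simp]: "space ball_measure = UNIV"
  by (simp add: ball_measure_def)

lemma emeasure_ball_measure: "A \<in> sets borel \<Longrightarrow>
    emeasure ball_measure A = emeasure lborel (cball 0 1 \<inter> A) / emeasure lborel (cball (0::real^3) 1)"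
  unfolding ball_measure_def by (intro emeasure_uniform_measure) auto

lemma emeasure_ball_measure_UNIV: "emeasure ball_measure UNIV = 1"
proof -
  have "emeasure lborel (cball (0::real^3) 1) = ennreal (4/3*pi)"
    using emeasure_cball[of 1 "0::real^3"] by (simp add: unit_ball_vol_3)
  then show ?thesis
    by (simp add: emeasure_ball_measure divide_ennreal)
qed

lemma finite_ball_measure: "finite_measure ball_measure"
  by standard (simp add: emeasure_ball_measure_UNIV)

lemma measure_ball_measure_UNIV: "measure ball_measure UNIV = 1"
  by (simp add: measure_def emeasure_ball_measure_UNIV)

lemma AE_ball_measure_nonzero: "AE z in ball_measure. z \<noteq> 0"
  unfolding ball_measure_def using AE_lborel_singleton[of "0::real^3"]
  by (intro AE_uniform_measureI) auto

lemma lborel_distr_orthogonal: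
  fixes T :: "real^3 \<Rightarrow> real^3"
  assumes T: "orthogonal_transformation T"
  shows "distr lborel borel T = lborel"
proof (rule lborel_eqI[symmetric])
  have contT: "continuous_on UNIV T"
    using T by (intro linear_continuous_on) (simp add: orthogonal_transformation_linear linear_linear)
  have [measurable]: "T \<in> borel_measurable borel"
    using contT by (rule borel_measurable_continuous_onI)
  fix l u :: "real^3" assume le: "\<And>b. b \<in> Basis \<Longrightarrow> l \<bullet> b \<le> u \<bullet> b"
  have inv: "orthogonal_transformation (inv T)"
    using T by (rule orthogonal_transformation_inv)
  have vi: "T -` box l u = inv T ` box l u"
    using T by (simp add: bij_vimage_eq_inv_image orthogonal_transformation_bij)
  have "emeasure (distr lborel borel T) (box l u) = emeasure lborel (T -` box l u)"
    by (subst emeasure_distr) auto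
  also have "\<dots> = emeasure lebesgue (inv T ` box l u)"
    unfolding vi[symmetric] by (simp add: measurable_sets_borel[of T borel])
  also have "\<dots> = ennreal (measure lebesgue (inv T ` box l u))"
    by (rule emeasure_eq_measure2) (rule measurable_orthogonal_image[OF inv lmeasurable_box])
  also have "\<dots> = ennreal (measure lebesgue (box l u))"
    using measure_orthogonal_image[OF inv lmeasurable_box] by simp
  also have "\<dots> = emeasure lebesgue (box l u)"
    by (rule emeasure_eq_measure2[OF lmeasurable_box, symmetric])
  also have "\<dots> = (\<Prod>b\<in>Basis. (u - l) \<bullet> b)"
    using le by simp
  finally show "emeasure (distr lborel borel T) (box l u) = (\<Prod>b\<in>Basis. (u - l) \<bullet> b)" .
qed simp

lemma ball_measure_distr_orthogonal:
  assumes T: "orthogonal_transformation T"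
  shows "distr ball_measure borel T = ball_measure"
proof (rule measure_eqI)
  have contT: "continuous_on UNIV T"
    using T by (intro linear_continuous_on) (simp add: orthogonal_transformation_linear linear_linear)
  have mT[measurable]: "T \<in> borel_measurable borel"
    using contT by (rule borel_measurable_continuous_onI)
  fix A assume "A \<in> sets (distr ball_measure borel T)"
  then have [measurable]: "A \<in> sets borel" by simp
  have TA[measurable]: "T -` A \<in> sets borel" using measurable_sets_borel[OF mT] by simp
  have "T -` (cball 0 1 \<inter> A) = cball 0 1 \<inter> T -` A"
    using T by (auto simp: orthogonal_transformation_norm)
  then have "emeasure lborel (cball 0 1 \<inter> T -` A) = emeasure (distr lborel borel T) (cball 0 1 \<inter> A)"
    by (subst emeasure_distr) auto
  then have "emeasure lborel (cball 0 1 \<inter> T -` A) = emeasure lborel (cball 0 1 \<inter> A)"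
    by (simp add: lborel_distr_orthogonal[OF T])
  then show "emeasure (distr ball_measure borel T) A = emeasure ball_measure A"
    by (subst emeasure_distr) (auto simp: emeasure_ball_measure)
qed simp

lemma poisson_kernel_eq:
  assumes "norm y = 1" "x \<noteq> y"
  shows "poisson_kernel y x = (1 - (norm x)\<^sup>2) * inv_dist y x ^ 3"
proof -
  have one: "inv_dist y x ^ 2 * ((x - y) \<bullet> (x - y)) = 1"
    using assms by (simp add: inv_dist_def power2_norm_eq_inner[symmetric] field_simps)
  have yy: "y \<bullet> y = 1" using assms by (simp add: power2_norm_eq_inner[symmetric])
  have h: "1 - (norm x)\<^sup>2 = - ((x - y) \<bullet> (x - y)) - 2 * (y \<bullet> (x - y))"
    by (simp add: power2_norm_eq_inner inner_diff_left inner_diff_right inner_commute yy)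
  have alg: "(- q - 2 * s) * n ^ 3 = - n * (n ^ 2 * q) - 2 * (s * n ^ 3)" for q s n :: real
    by (simp add: power2_eq_square power3_eq_cube algebra_simps)
  show ?thesis
    unfolding h alg one poisson_kernel_def dipole_def by simp
qed

lemma poisson_kernel_measurable [measurable]:
  "(\<lambda>y. poisson_kernel y x) \<in> borel_measurable borel"
  "(\<lambda>y. poisson_grad y x) \<in> borel_measurable borel"
  "(\<lambda>y. poisson_hess y x h) \<in> borel_measurable borel"
  unfolding poisson_kernel_def poisson_grad_def poisson_hess_def dipole_def dipole_grad_def
    dipole_hess_def inv_dist_hess_def inv_dist_def by measurable

lemma has_derivative_poisson:
  assumes "x \<noteq> y"
  shows "(poisson_kernel y has_derivative (\<lambda>h. poisson_grad y x \<bullet> h)) (at x)"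
    and "(poisson_grad y has_derivative poisson_hess y x) (at x)"
    and "trace_op (poisson_hess y x) = 0"
proof -
  show "(poisson_kernel y has_derivative (\<lambda>h. poisson_grad y x \<bullet> h)) (at x)"
    unfolding poisson_kernel_def[abs_def]
    by (rule has_derivative_eq_rhs[OF has_derivative_diff[OF has_derivative_minus[OF has_derivative_inv_dist(1)[OF assms]]
        has_derivative_mult_right[OF has_derivative_dipole(1)[OF assms], of 2]]])
      (simp add: fun_eq_iff poisson_grad_def inner_diff_left)
  have "((\<lambda>x. - (- (inv_dist y x ^ 3) *\<^sub>R (x - y)) - 2 *\<^sub>R dipole_grad y x) has_derivative
      (\<lambda>h. - inv_dist_hess y x h - 2 *\<^sub>R dipole_hess y x h)) (at x)"
    by (intro has_derivative_diff has_derivative_minus has_derivative_scaleR_right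
        has_derivative_inv_dist(2) has_derivative_dipole(2) assms)
  then show "(poisson_grad y has_derivative poisson_hess y x) (at x)"
    unfolding poisson_grad_def[abs_def] poisson_hess_def[abs_def] by simp
  have "trace_op (poisson_hess y x) = - 1 * trace_op (inv_dist_hess y x) - 2 * trace_op (dipole_hess y x)"
    unfolding poisson_hess_def[abs_def] trace_op_diff trace_op_scale[symmetric] by simp
  then show "trace_op (poisson_hess y x) = 0"
    by (simp add: has_derivative_inv_dist(3)[OF assms] has_derivative_dipole(3)[OF assms])
qed

lemma isCont_poisson_hess: "x \<noteq> y \<Longrightarrow> isCont (\<lambda>z. poisson_hess y z h) x"
  unfolding poisson_hess_def dipole_hess_def inv_dist_hess_def
  by (intro continuous_intros isCont_inv_dist)

text \<open>For |x| <= r < 1 the singularity is never met, so continuity on compact products gives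
  uniform bounds. For the Hessian, the vector h runs over the unit sphere and general h follow by
  homogeneity.\<close>

lemma poisson_bounds:
  assumes "r < 1"
  obtains B where "B > 0" "\<And>x y. norm x \<le> r \<Longrightarrow> norm y = 1 \<Longrightarrow> \<bar>poisson_kernel y x\<bar> \<le> B"
    "\<And>x y. norm x \<le> r \<Longrightarrow> norm y = 1 \<Longrightarrow> norm (poisson_grad y x) \<le> B"
    "\<And>x y h. norm x \<le> r \<Longrightarrow> norm y = 1 \<Longrightarrow> norm (poisson_hess y x h) \<le> B * norm h"
proof -
  let ?S = "cball 0 r \<times> sphere 0 1 :: ((real^3) \<times> (real^3)) set"
  let ?S' = "cball 0 r \<times> sphere 0 1 \<times> sphere 0 1 :: ((real^3) \<times> (real^3) \<times> (real^3)) set"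
  have cS: "compact ?S" "compact ?S'" by (intro compact_Times compact_cball compact_sphere)+
  have ne: "fst p \<noteq> snd p" if "p \<in> ?S" for p using that assms by auto
  have ne': "fst p \<noteq> fst (snd p)" if "p \<in> ?S'" for p using that assms by auto
  have c0: "continuous_on ?S (\<lambda>p. inv_dist (snd p) (fst p))"
    unfolding inv_dist_def using ne by (intro continuous_intros) auto
  have c0': "continuous_on ?S' (\<lambda>p. inv_dist (fst (snd p)) (fst p))"
    unfolding inv_dist_def using ne' by (intro continuous_intros) auto
  have "continuous_on ?S (\<lambda>p. poisson_kernel (snd p) (fst p))"
    unfolding poisson_kernel_def dipole_def by (intro continuous_intros c0)
  then obtain B1 where B1: "\<And>p. p \<in> ?S \<Longrightarrow> \<bar>poisson_kernel (snd p) (fst p)\<bar> \<le> B1"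
    using compact_imp_bounded[OF compact_continuous_image[OF _ cS(1)]] by (force simp: bounded_iff)
  have "continuous_on ?S (\<lambda>p. poisson_grad (snd p) (fst p))"
    unfolding poisson_grad_def dipole_grad_def by (intro continuous_intros c0)
  then obtain B2 where B2: "\<And>p. p \<in> ?S \<Longrightarrow> norm (poisson_grad (snd p) (fst p)) \<le> B2"
    using compact_imp_bounded[OF compact_continuous_image[OF _ cS(1)]] by (force simp: bounded_iff)
  have "continuous_on ?S' (\<lambda>p. poisson_hess (fst (snd p)) (fst p) (snd (snd p)))"
    unfolding poisson_hess_def dipole_hess_def inv_dist_hess_def by (intro continuous_intros c0')
  then obtain B3 where B3: "\<And>p. p \<in> ?S' \<Longrightarrow> norm (poisson_hess (fst (snd p)) (fst p) (snd (snd p))) \<le> B3"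
    using compact_imp_bounded[OF compact_continuous_image[OF _ cS(2)]] by (force simp: bounded_iff)
  define B where "B = max (max B1 B2) (max B3 1)"
  show ?thesis
  proof (rule that[of B])
    show "B > 0" by (simp add: B_def)
    fix x y :: "real^3" assume xy: "norm x \<le> r" "norm y = 1"
    then have p: "(x, y) \<in> ?S" by simp
    show "\<bar>poisson_kernel y x\<bar> \<le> B" using B1[OF p] by (simp add: B_def)
    show "norm (poisson_grad y x) \<le> B" using B2[OF p] by (simp add: B_def)
    fix h :: "real^3"
    have "x \<noteq> y" using xy assms by auto
    then have lin: "linear (poisson_hess y x)"
      using has_derivative_poisson(2) has_derivative_linear by blast
    show "norm (poisson_hess y x h) \<le> B * norm h"
    proof (cases "h = 0")
      case True
      then show ?thesis using linear_0[OF lin] by simp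
    next
      case False
      have "h = norm h *\<^sub>R sgn h" using False by (simp add: sgn_div_norm)
      then have "poisson_hess y x h = norm h *\<^sub>R poisson_hess y x (sgn h)"
        using linear_scale[OF lin] by metis
      moreover have "norm (poisson_hess y x (sgn h)) \<le> B"
        using B3[of "(x, y, sgn h)"] xy False by (simp add: norm_sgn B_def)
      then have "norm h * norm (poisson_hess y x (sgn h)) \<le> norm h * B" by (intro mult_left_mono) auto
      ultimately show ?thesis by (simp add: mult.commute)
    qed
  qed
qed

lemma poisson_kernel_nonneg:
  assumes "norm y = 1" "norm x < 1" shows "poisson_kernel y x \<ge> 0"
proof -
  have "x \<noteq> y" using assms by auto
  moreover have "(norm x)\<^sup>2 \<le> 1" using assms by (simp add: power_le_one)
  ultimately show ?thesis
    using poisson_kernel_eq[OF assms(1)] by (simp add: inv_dist_def)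
qed

lemma integrable_poisson:
  assumes [measurable]: "f \<in> borel_measurable borel" and "\<And>y. norm y = 1 \<Longrightarrow> \<bar>f y\<bar> \<le> M" and "norm x < 1"
  shows "integrable ball_measure (\<lambda>z. f (dir z) * poisson_kernel (dir z) x)"
proof -
  interpret finite_measure ball_measure by (rule finite_ball_measure)
  obtain B where B: "B > 0" "\<And>y. norm y = 1 \<Longrightarrow> \<bar>poisson_kernel y x\<bar> \<le> B"
    using poisson_bounds[OF assms(3)] by (metis order_refl)
  show ?thesis
  proof (rule integrable_const_bound[of _ "M * B"])
    show "AE z in ball_measure. norm (f (dir z) * poisson_kernel (dir z) x) \<le> M * B"
    proof (intro AE_I2)
      fix z
      show "norm (f (dir z) * poisson_kernel (dir z) x) \<le> M * B"
        unfolding real_norm_def abs_mult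
        using assms(2)[of "dir z"] B(2)[of "dir z"] by (intro mult_mono) auto
    qed
  qed measurable
qed

text \<open>Two differentiations under the integral; the trace passes inside, where it vanishes
  because the kernel is harmonic in x.\<close>

lemma harmonic_poisson_unit:
  assumes [measurable]: "f \<in> borel_measurable borel" and M: "\<And>y. norm y = 1 \<Longrightarrow> \<bar>f y\<bar> \<le> M"
    and x0: "norm x0 < 1"
  shows "harmonic_at (poisson_unit f) x0"
proof -
  interpret finite_measure ball_measure by (rule finite_ball_measure)
  define r where "r = (1 + norm x0) / 2"
  have r: "norm x0 < r" "r < 1" using x0 by (auto simp: r_def)
  obtain B where B: "B > 0" "\<And>x y. norm x \<le> r \<Longrightarrow> norm y = 1 \<Longrightarrow> \<bar>poisson_kernel y x\<bar> \<le> B"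
    "\<And>x y. norm x \<le> r \<Longrightarrow> norm y = 1 \<Longrightarrow> norm (poisson_grad y x) \<le> B"
    "\<And>x y h. norm x \<le> r \<Longrightarrow> norm y = 1 \<Longrightarrow> norm (poisson_hess y x h) \<le> B * norm h"
    using poisson_bounds[OF r(2)] by blast
  have M0: "M \<ge> 0" using M[of "axis 1 1"] by (simp add: norm_axis_1)
  let ?U = "ball (0::real^3) r"
  have ne: "x \<noteq> dir z" if "x \<in> ?U" for x z using that r norm_dir[of z] by (metis mem_ball_0 less_trans less_irrefl)
  define G where "G x = (\<integral>z. f (dir z) *\<^sub>R poisson_grad (dir z) x \<partial>ball_measure)" for x
  define H where "H x h = (\<integral>z. f (dir z) *\<^sub>R poisson_hess (dir z) x h \<partial>ball_measure)" for x h
  have bnd: "\<bar>f (dir z) * poisson_kernel (dir z) x\<bar> \<le> M * B"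
    "norm (f (dir z) *\<^sub>R poisson_grad (dir z) x) \<le> M * B"
    "norm (f (dir z) *\<^sub>R poisson_hess (dir z) x h) \<le> M * B * norm h" if "x \<in> ?U" for x z h
  proof -
    have x: "norm x \<le> r" using that by simp
    show "\<bar>f (dir z) * poisson_kernel (dir z) x\<bar> \<le> M * B"
      unfolding abs_mult using M[of "dir z"] B(2)[OF x, of "dir z"] by (intro mult_mono) auto
    show "norm (f (dir z) *\<^sub>R poisson_grad (dir z) x) \<le> M * B"
      unfolding norm_scaleR using M[of "dir z"] B(3)[OF x, of "dir z"] M0 by (intro mult_mono) auto
    show "norm (f (dir z) *\<^sub>R poisson_hess (dir z) x h) \<le> M * B * norm h"
      unfolding norm_scaleR mult.assoc using M[of "dir z"] B(4)[OF x, of "dir z" h] M0 by (intro mult_mono) auto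
  qed
  have intG: "integrable ball_measure (\<lambda>z. f (dir z) *\<^sub>R poisson_grad (dir z) x)" if "x \<in> ?U" for x
    by (rule integrable_const_bound[of _ "M * B"]) (use bnd(2)[OF that] in auto)
  have intH: "integrable ball_measure (\<lambda>z. f (dir z) *\<^sub>R poisson_hess (dir z) x h)" if "x \<in> ?U" for x h
    by (rule integrable_const_bound[of _ "M * B * norm h"]) (use bnd(3)[OF that] in auto)
  have d1: "(poisson_unit f has_derivative (\<lambda>h. G x \<bullet> h)) (at x)" if x: "x \<in> ?U" for x
  proof -
    have "((\<lambda>x. \<integral>z. f (dir z) * poisson_kernel (dir z) x \<partial>ball_measure) has_derivative
       (\<lambda>h. \<integral>z. f (dir z) * (poisson_grad (dir z) x \<bullet> h) \<partial>ball_measure)) (at x)"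
    proof (rule has_derivative_integral[OF finite_ball_measure open_ball x, where K="M * B" and B="M * B"])
      fix y z h assume y: "y \<in> ?U"
      show "((\<lambda>x. f (dir z) * poisson_kernel (dir z) x) has_derivative (\<lambda>h. f (dir z) * (poisson_grad (dir z) y \<bullet> h))) (at y)"
        by (intro has_derivative_mult_right has_derivative_poisson ne[OF y])
      have "norm (f (dir z) *\<^sub>R poisson_grad (dir z) y \<bullet> h) \<le> norm (f (dir z) *\<^sub>R poisson_grad (dir z) y) * norm h"
        unfolding real_norm_def by (rule Cauchy_Schwarz_ineq2)
      also have "\<dots> \<le> M * B * norm h" using bnd(2)[OF y] by (intro mult_right_mono) auto
      finally show "norm (f (dir z) * (poisson_grad (dir z) y \<bullet> h)) \<le> M * B * norm h" by simp
      show "norm (f (dir z) * poisson_kernel (dir z) y) \<le> M * B" using bnd(1)[OF y] by simp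
    qed measurable
    moreover have "(\<integral>z. f (dir z) * (poisson_grad (dir z) x \<bullet> h) \<partial>ball_measure) = G x \<bullet> h" for h
      unfolding G_def using intG[OF x] by (subst integral_inner_left[symmetric]) auto
    ultimately show ?thesis unfolding poisson_unit_def[abs_def] by simp
  qed
  have d2: "(G has_derivative H x) (at x)" if x: "x \<in> ?U" for x
    unfolding G_def[abs_def] H_def[abs_def]
  proof (rule has_derivative_integral[OF finite_ball_measure open_ball x, where K="M * B" and B="M * B"])
    fix y z h assume y: "y \<in> ?U"
    show "((\<lambda>x. f (dir z) *\<^sub>R poisson_grad (dir z) x) has_derivative (\<lambda>h. f (dir z) *\<^sub>R poisson_hess (dir z) y h)) (at y)"
      by (intro has_derivative_scaleR_right has_derivative_poisson ne[OF y])
    show "norm (f (dir z) *\<^sub>R poisson_hess (dir z) y h) \<le> M * B * norm h" using bnd(3)[OF y] .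
    show "norm (f (dir z) *\<^sub>R poisson_grad (dir z) y) \<le> M * B" using bnd(2)[OF y] .
  qed measurable
  have d3: "trace_op (H x) = 0" if x: "x \<in> ?U" for x
  proof -
    have "trace_op (H x) = (\<Sum>i\<in>Basis. \<integral>z. (f (dir z) *\<^sub>R poisson_hess (dir z) x i) \<bullet> i \<partial>ball_measure)"
      unfolding trace_op_def H_def using intH[OF x] by (intro sum.cong refl integral_inner_left[symmetric]) auto
    also have "\<dots> = (\<integral>z. (\<Sum>i\<in>Basis. (f (dir z) *\<^sub>R poisson_hess (dir z) x i) \<bullet> i) \<partial>ball_measure)"
      using intH[OF x] by (intro Bochner_Integration.integral_sum[symmetric] integrable_inner_left) auto
    also have "\<dots> = (\<integral>z. f (dir z) * trace_op (poisson_hess (dir z) x) \<partial>ball_measure)"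
      by (simp add: trace_op_def sum_distrib_left)
    also have "\<dots> = 0" by (simp add: has_derivative_poisson(3)[OF ne[OF x]])
    finally show ?thesis .
  qed
  have d4: "isCont (\<lambda>z. H z h) x" if x: "x \<in> ?U" for x h
    unfolding H_def
  proof (rule isCont_integral[OF finite_ball_measure open_ball x, where B="M * B * norm h"])
    show "isCont (\<lambda>y. f (dir z) *\<^sub>R poisson_hess (dir z) y h) x" for z
      by (intro continuous_intros isCont_poisson_hess ne[OF x])
    show "norm (f (dir z) *\<^sub>R poisson_hess (dir z) y h) \<le> M * B * norm h" if "y \<in> ?U" for y z
      using bnd(3)[OF that] .
  qed measurable
  have "r - norm x0 > 0" using r by simp
  moreover have "ball x0 (r - norm x0) \<subseteq> ?U"
    by (auto simp: dist_norm) (metis add.commute less_diff_eq norm_minus_commute norm_triangle_sub order_le_less_trans)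
  ultimately show ?thesis
    unfolding harmonic_at_def using d1 d2 d3 d4
    by (intro exI[of _ "r - norm x0"] conjI exI[of _ G] exI[of _ H] ballI) blast+
qed

text \<open>The integral is not evaluated. It is invariant under rotations, hence constant on each
  sphere about 0, and comparison with that constant in both directions identifies it with the value
  1 at the centre.\<close>

lemma poisson_unit_one:
  assumes x: "norm x < 1"
  shows "poisson_unit (\<lambda>_. 1) x = 1"
proof -
  let ?p = "poisson_unit (\<lambda>_. 1)"
  have harm: "harmonic_at ?p z" if "norm z < 1" for z
    by (rule harmonic_poisson_unit[OF _ _ that, of _ 1]) auto
  have p0: "?p 0 = 1"
  proof -
    have "poisson_kernel (dir z) 0 = 1" for z
    proof -
      have "dir z \<noteq> 0" using norm_dir[of z] by (metis norm_zero zero_neq_one)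
      then show ?thesis using poisson_kernel_eq[of "dir z" 0] by (simp add: inv_dist_def)
    qed
    then show ?thesis by (simp add: poisson_unit_def measure_ball_measure_UNIV)
  qed
  have inv: "?p (T z) = ?p z" if T: "orthogonal_transformation T" for T z
  proof -
    have [measurable]: "T \<in> borel_measurable borel"
      using T by (intro borel_measurable_continuous_onI linear_continuous_on)
        (simp add: orthogonal_transformation_linear linear_linear)
    have lin: "linear T" using T by (rule orthogonal_transformation_linear)
    have ker: "poisson_kernel (T y) (T x) = poisson_kernel y x" for x y
    proof -
      have "T x - T y = T (x - y)" using lin by (simp add: linear_diff)
      then show ?thesis
        using T unfolding poisson_kernel_def dipole_def inv_dist_def
        by (simp add: orthogonal_transformation_norm) (simp add: orthogonal_transformation_def)
    qed
    have dT: "dir (T y) = T (dir y)" if "y \<noteq> 0" for y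
    proof -
      have "T y \<noteq> 0" using that T orthogonal_transformation_norm[OF T, of y] by (metis norm_eq_zero)
      then show ?thesis using that lin T
        by (simp add: dir_def sgn_div_norm orthogonal_transformation_norm linear_scale)
    qed
    have "?p (T z) = (\<integral>y. poisson_kernel (dir y) (T z) \<partial>distr ball_measure borel T)"
      by (simp add: poisson_unit_def ball_measure_distr_orthogonal[OF T])
    also have "\<dots> = (\<integral>y. poisson_kernel (dir (T y)) (T z) \<partial>ball_measure)"
      by (rule integral_distr) measurable
    also have "\<dots> = (\<integral>y. poisson_kernel (dir y) z \<partial>ball_measure)"
    proof (rule integral_cong_AE)
      show "AE y in ball_measure. poisson_kernel (dir (T y)) (T z) = poisson_kernel (dir y) z"
        using AE_ball_measure_nonzero by eventually_elim (simp add: dT ker)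
    qed measurable
    finally show ?thesis by (simp add: poisson_unit_def)
  qed
  show ?thesis
  proof (cases "x = 0")
    case False
    define r where "r = norm x"
    have r: "r > 0" "r < 1" using False x by (auto simp: r_def)
    have sph: "?p z = ?p x" if "norm z = r" for z
    proof -
      obtain T where "orthogonal_transformation T" "T x = z"
        using orthogonal_transformation_exists[of x z] \<open>norm z = r\<close> by (auto simp: r_def)
      then show ?thesis using inv[of T x] by simp
    qed
    have cont: "continuous_on (cball 0 r) ?p"
      using harm r by (intro continuous_at_imp_continuous_on) (auto intro!: harmonic_at_isCont)
    have "?p 0 \<le> ?p x"
      by (rule superharmonic_comparison[where C="cball 0 r" and U="ball 0 r" and v="\<lambda>_. ?p x"])
        (use r harm sph cont in \<open>auto intro!: harmonic_at_superharmonic_at harmonic_at_const\<close>)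
    moreover have "?p x \<le> ?p 0"
      by (rule superharmonic_comparison[where C="cball 0 r" and U="ball 0 r" and h="\<lambda>_. ?p x"])
        (use r harm sph cont in \<open>auto intro!: harmonic_at_superharmonic_at harmonic_at_const\<close>)
    ultimately show ?thesis using p0 by simp
  qed (simp add: p0)
qed

lemma poisson_unit_mono:
  assumes [measurable]: "f \<in> borel_measurable borel" "g \<in> borel_measurable borel"
    and "\<And>y. norm y = 1 \<Longrightarrow> \<bar>f y\<bar> \<le> M" "\<And>y. norm y = 1 \<Longrightarrow> \<bar>g y\<bar> \<le> M"
    and le: "\<And>y. norm y = 1 \<Longrightarrow> f y \<le> g y" and x: "norm x < 1"
  shows "poisson_unit f x \<le> poisson_unit g x"
  unfolding poisson_unit_def
  by (intro integral_mono integrable_poisson[where M=M] mult_right_mono poisson_kernel_nonneg) (use assms in auto)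

text \<open>Stated for measurable boundary values, because the pointwise limit of the sweeping
  process is not known to be continuous when this is applied.\<close>

lemma poisson_unit_tendsto:
  assumes [measurable]: "\<And>n. f n \<in> borel_measurable borel" "g \<in> borel_measurable borel"
    and M: "\<And>n y. norm y = 1 \<Longrightarrow> \<bar>f n y\<bar> \<le> M"
    and lim: "\<And>y. norm y = 1 \<Longrightarrow> (\<lambda>n. f n y) \<longlonglongrightarrow> g y" and x: "norm x < 1"
  shows "(\<lambda>n. poisson_unit (f n) x) \<longlonglongrightarrow> poisson_unit g x"
  unfolding poisson_unit_def
proof (rule integral_dominated_convergence[where w="\<lambda>z. M * poisson_kernel (dir z) x"])
  show "integrable ball_measure (\<lambda>z. M * poisson_kernel (dir z) x)"
    using integrable_poisson[of "\<lambda>_. M" "\<bar>M\<bar>" x] x by simp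
  show "AE z in ball_measure. norm (f n (dir z) * poisson_kernel (dir z) x) \<le> M * poisson_kernel (dir z) x" for n
    using M poisson_kernel_nonneg[OF norm_dir x] by (auto simp: abs_mult intro!: AE_I2 mult_right_mono)
  show "AE z in ball_measure. (\<lambda>n. f n (dir z) * poisson_kernel (dir z) x) \<longlonglongrightarrow> g (dir z) * poisson_kernel (dir z) x"
    by (auto intro!: AE_I2 tendsto_intros lim)
qed measurable

text \<open>The kernel is an approximate identity: it is nonnegative with total mass 1, the
  oscillation of \<open>f\<close> near \<open>p\<close> is below e/4, and the kernel is small at
  points far from \<open>p\<close>.\<close>

lemma poisson_unit_boundary:
  assumes f: "continuous_on UNIV f" and B: "\<And>y. \<bar>f y\<bar> \<le> B" and p: "norm p = 1" and e: "e > 0"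
  obtains d where "d > 0" "\<And>x. norm x < 1 \<Longrightarrow> dist x p < d \<Longrightarrow> \<bar>poisson_unit f x - f p\<bar> < e"
proof -
  have [measurable]: "f \<in> borel_measurable borel" using f by (rule borel_measurable_continuous_onI)
  have B0: "B \<ge> 0" using B[of 0] by simp
  obtain d1 where d1: "d1 > 0" "\<And>y. dist y p < d1 \<Longrightarrow> \<bar>f y - f p\<bar> < e / 4"
    using f e unfolding continuous_on_iff by (metis UNIV_I dist_real_def zero_less_divide_iff zero_less_numeral)
  \<comment> \<open>Bound for the far part per unit of \<open>d\<close>: |f - f p| <= 2 B, and the
    kernel is at most 2 d (2/d1)^3, because 1 - |x|^2 <= 2 d and the far points are at distance at
    least d1/2 from x.\<close>
  define K where "K = 2 * B * (2 * (2 / d1) ^ 3)"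
  have K: "K \<ge> 0" using B0 d1 by (simp add: K_def)
  define d where "d = min (d1 / 2) (e / (4 * (K + 1)))"
  have d: "d > 0" using d1 e K by (auto simp: d_def)
  have d2: "d \<le> d1 / 2" unfolding d_def by (rule min.cobounded1)
  have "d \<le> e / (4 * (K + 1))" by (simp add: d_def)
  then have dK: "d * (K + 1) \<le> e / 4" using K by (simp add: pos_le_divide_eq mult.commute mult.left_commute)
  show ?thesis
  proof (rule that[OF d])
    fix x :: "real^3" assume x: "norm x < 1" and xp: "dist x p < d"
    have one: "integrable ball_measure (\<lambda>z. poisson_kernel (dir z) x)" "(\<integral>z. poisson_kernel (dir z) x \<partial>ball_measure) = 1"
      using integrable_poisson[of "\<lambda>_. 1" 1 x] poisson_unit_one[OF x] x by (auto simp: poisson_unit_def)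
    have intf: "integrable ball_measure (\<lambda>z. f (dir z) * poisson_kernel (dir z) x)"
      by (rule integrable_poisson[OF _ B x]) simp
    interpret finite_measure ball_measure by (rule finite_ball_measure)
    have pt: "\<bar>(f (dir z) - f p) * poisson_kernel (dir z) x\<bar> \<le> e / 4 * poisson_kernel (dir z) x + K * d" for z
    proof (cases "dist (dir z) p < d1")
      case True
      have "\<bar>f (dir z) - f p\<bar> * poisson_kernel (dir z) x \<le> e / 4 * poisson_kernel (dir z) x"
        using d1(2)[OF True] poisson_kernel_nonneg[OF norm_dir x] by (intro mult_right_mono) auto
      then show ?thesis using poisson_kernel_nonneg[OF norm_dir x, of z] K d by (simp add: abs_mult add_increasing2)
    next
      case False
      have far: "d1 / 2 \<le> norm (x - dir z)"
      proof -
        have "dist (dir z) p \<le> dist (dir z) x + dist x p" by (rule dist_triangle)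
        then show ?thesis using False xp d2 by (simp add: dist_norm norm_minus_commute)
      qed
      have "x \<noteq> dir z" using far d1 by auto
      then have "poisson_kernel (dir z) x = (1 - (norm x)\<^sup>2) * inv_dist (dir z) x ^ 3"
        by (intro poisson_kernel_eq) auto
      also have "\<dots> \<le> (2 * d) * (2 / d1) ^ 3"
      proof (intro mult_mono power_mono)
        have "norm p - norm x \<le> norm (p - x)" by (rule norm_triangle_ineq2)
        then have "1 - norm x \<le> dist x p" using p by (simp add: dist_norm norm_minus_commute)
        then have le: "1 - norm x \<le> d" using xp by (meson less_imp_le order_trans)
        have "1 - (norm x)\<^sup>2 = (1 - norm x) * (1 + norm x)" by (simp add: power2_eq_square algebra_simps)
        also have "\<dots> \<le> (1 - norm x) * 2" using x by (intro mult_left_mono) auto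
        also have "\<dots> \<le> 2 * d" using le by simp
        finally show "1 - (norm x)\<^sup>2 \<le> 2 * d" .
        show "inv_dist (dir z) x \<le> 2 / d1"
        proof -
          have "inverse (norm (x - dir z)) \<le> inverse (d1 / 2)"
            using far d1(1) by (intro le_imp_inverse_le) auto
          then show ?thesis by (simp add: inv_dist_def)
        qed
      qed (use d d1 in \<open>auto simp: inv_dist_def\<close>)
      finally have "poisson_kernel (dir z) x \<le> 2 * d * (2 / d1) ^ 3" .
      moreover have "\<bar>f (dir z) - f p\<bar> \<le> 2 * B"
        using B[of "dir z"] B[of p] by linarith
      ultimately have "\<bar>f (dir z) - f p\<bar> * poisson_kernel (dir z) x \<le> (2 * B) * (2 * d * (2 / d1) ^ 3)"
        using poisson_kernel_nonneg[OF norm_dir x] B0 by (intro mult_mono) auto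
      moreover have "(2 * B) * (2 * d * (2 / d1) ^ 3) = K * d" by (simp add: K_def)
      moreover have "0 \<le> e / 4 * poisson_kernel (dir z) x"
        using poisson_kernel_nonneg[OF norm_dir x, of z] e by simp
      moreover have "\<bar>(f (dir z) - f p) * poisson_kernel (dir z) x\<bar> = \<bar>f (dir z) - f p\<bar> * poisson_kernel (dir z) x"
        using poisson_kernel_nonneg[OF norm_dir x, of z] by (simp add: abs_mult)
      ultimately show ?thesis by linarith
    qed
    have "poisson_unit f x - f p = (\<integral>z. (f (dir z) - f p) * poisson_kernel (dir z) x \<partial>ball_measure)"
      unfolding poisson_unit_def using intf one by (simp add: left_diff_distrib)
    also have "\<bar>\<dots>\<bar> \<le> (\<integral>z. \<bar>(f (dir z) - f p) * poisson_kernel (dir z) x\<bar> \<partial>ball_measure)"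
      by (rule integral_abs_bound)
    also have "\<dots> \<le> (\<integral>z. e / 4 * poisson_kernel (dir z) x + K * d \<partial>ball_measure)"
      using intf one pt by (intro integral_mono) (auto simp: left_diff_distrib)
    also have "\<dots> = e / 4 + K * d"
      using one by (simp add: measure_ball_measure_UNIV)
    also have "K * d \<le> d * (K + 1)" using d by (simp add: algebra_simps)
    also have "\<dots> \<le> e / 4" by (rule dK)
    finally show "\<bar>poisson_unit f x - f p\<bar> < e" using e by simp
  qed
qed

section \<open>Poisson modification on a ball and Poincare's balayage\<close>

definition sweep :: "real^3 \<Rightarrow> real \<Rightarrow> (real^3 \<Rightarrow> real) \<Rightarrow> real^3 \<Rightarrow> real" where
  "sweep a \<rho> f x = (if x \<in> ball a \<rho> then poisson_unit (\<lambda>y. f (a + \<rho> *\<^sub>R y)) ((x - a) /\<^sub>R \<rho>) else f x)"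

lemma norm_rescale:
  fixes x a :: "'a::real_normed_vector"
  assumes "\<rho> > 0" shows "norm ((x - a) /\<^sub>R \<rho>) = dist a x / \<rho>"
  using assms by (simp add: dist_norm norm_minus_commute divide_inverse)

lemma harmonic_sweep:
  assumes [measurable]: "f \<in> borel_measurable borel" and M: "\<And>y. \<bar>f y\<bar> \<le> M" and "\<rho> > 0" and x: "x \<in> ball a \<rho>"
  shows "harmonic_at (sweep a \<rho> f) x"
proof -
  have "norm ((x - a) /\<^sub>R \<rho>) < 1"
    unfolding norm_rescale[OF \<open>\<rho> > 0\<close>] using x \<open>\<rho> > 0\<close> by simp
  then have "harmonic_at (poisson_unit (\<lambda>y. f (a + \<rho> *\<^sub>R y))) ((x - a) /\<^sub>R \<rho>)"
    by (intro harmonic_poisson_unit[of _ M]) (use M in auto)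
  from harmonic_at_affine[OF this \<open>\<rho> > 0\<close>] show ?thesis
    by (rule harmonic_at_cong[OF _ open_ball x]) (simp add: sweep_def)
qed

lemma sweep_bounds:
  assumes [measurable]: "f \<in> borel_measurable borel" and f: "\<And>y. 0 \<le> f y" "\<And>y. f y \<le> 1" and "\<rho> > 0"
  shows "0 \<le> sweep a \<rho> f x" "sweep a \<rho> f x \<le> 1"
proof -
  have "0 \<le> sweep a \<rho> f x \<and> sweep a \<rho> f x \<le> 1"
  proof (cases "x \<in> ball a \<rho>")
    case True
    have n: "norm ((x - a) /\<^sub>R \<rho>) < 1"
      unfolding norm_rescale[OF \<open>\<rho> > 0\<close>] using True \<open>\<rho> > 0\<close> by simp
    have "poisson_unit (\<lambda>_. 0) ((x - a) /\<^sub>R \<rho>) \<le> poisson_unit (\<lambda>y. f (a + \<rho> *\<^sub>R y)) ((x - a) /\<^sub>R \<rho>)"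
      by (intro poisson_unit_mono[where M=1] n) (use f in auto)
    moreover have "poisson_unit (\<lambda>y. f (a + \<rho> *\<^sub>R y)) ((x - a) /\<^sub>R \<rho>) \<le> poisson_unit (\<lambda>_. 1) ((x - a) /\<^sub>R \<rho>)"
      by (intro poisson_unit_mono[where M=1] n) (use f in auto)
    ultimately show ?thesis
      using True poisson_unit_one[OF n] by (simp add: sweep_def) (simp add: poisson_unit_def)
  qed (use f in \<open>simp add: sweep_def\<close>)
  then show "0 \<le> sweep a \<rho> f x" "sweep a \<rho> f x \<le> 1" by auto
qed

lemma continuous_sweep:
  assumes f: "continuous_on UNIV f" and M: "\<And>y. \<bar>f y\<bar> \<le> M" and "\<rho> > 0"
  shows "continuous_on UNIV (sweep a \<rho> f)"
proof (intro continuous_at_imp_continuous_on ballI)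
  fix x :: "real^3"
  have m: "f \<in> borel_measurable borel" using f by (rule borel_measurable_continuous_onI)
  have cf: "isCont f x" using f by (simp add: continuous_on_eq_continuous_at)
  consider "dist a x < \<rho>" | "dist a x > \<rho>" | "dist a x = \<rho>" by linarith
  then show "isCont (sweep a \<rho> f) x"
  proof cases
    case 1
    then show ?thesis using harmonic_sweep[OF m M \<open>\<rho> > 0\<close>, of x a] harmonic_at_isCont by simp
  next
    case 2
    have "\<forall>\<^sub>F y in nhds x. f y = sweep a \<rho> f y"
    proof -
      have "\<forall>\<^sub>F y in nhds x. y \<in> - cball a \<rho>"
        using 2 by (intro eventually_nhds_in_open open_Compl) auto
      then show ?thesis by eventually_elim (auto simp: sweep_def)
    qed
    then show ?thesis using cf isCont_cong by blast
  next
    case 3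
    define p where "p = (x - a) /\<^sub>R \<rho>"
    have p: "norm p = 1" unfolding p_def norm_rescale[OF \<open>\<rho> > 0\<close>] using 3 \<open>\<rho> > 0\<close> by simp
    have xp: "a + \<rho> *\<^sub>R p = x" using \<open>\<rho> > 0\<close> by (simp add: p_def)
    show ?thesis
      unfolding continuous_at_eps_delta
    proof (intro allI impI)
      fix e :: real assume e: "e > 0"
      have "continuous_on UNIV (\<lambda>y. f (a + \<rho> *\<^sub>R y))"
        by (intro continuous_on_compose2[OF f] continuous_intros) auto
      then obtain d where d: "d > 0" "\<And>y. norm y < 1 \<Longrightarrow> dist y p < d \<Longrightarrow>
          \<bar>poisson_unit (\<lambda>y. f (a + \<rho> *\<^sub>R y)) y - f (a + \<rho> *\<^sub>R p)\<bar> < e"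
        using poisson_unit_boundary[of "\<lambda>y. f (a + \<rho> *\<^sub>R y)" M p e] M p e by metis
      obtain d' where d': "d' > 0" "\<And>y. dist y x < d' \<Longrightarrow> dist (f y) (f x) < e"
        using cf e unfolding continuous_at_eps_delta by metis
      have sx: "sweep a \<rho> f x = f x" using 3 by (simp add: sweep_def)
      have "dist (sweep a \<rho> f y) (sweep a \<rho> f x) < e" if y: "dist y x < min d' (\<rho> * d)" for y
      proof (cases "y \<in> ball a \<rho>")
        case True
        have "norm ((y - a) /\<^sub>R \<rho>) < 1" unfolding norm_rescale[OF \<open>\<rho> > 0\<close>] using True \<open>\<rho> > 0\<close> by simp
        moreover have "dist ((y - a) /\<^sub>R \<rho>) p < d"
        proof -
          have "dist ((y - a) /\<^sub>R \<rho>) p = dist y x / \<rho>"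
            using \<open>\<rho> > 0\<close> unfolding p_def dist_norm scaleR_diff_right[symmetric] by (simp add: divide_inverse)
          then show ?thesis using y \<open>\<rho> > 0\<close> by (simp add: pos_divide_less_eq mult.commute)
        qed
        ultimately show ?thesis using d(2)[of "(y - a) /\<^sub>R \<rho>"] True unfolding sx xp by (simp add: sweep_def dist_real_def)
      next
        case False
        then show ?thesis using d'(2)[of y] y unfolding sx by (simp add: sweep_def)
      qed
      then show "\<exists>d>0. \<forall>x'. dist x' x < d \<longrightarrow> dist (sweep a \<rho> f x') (sweep a \<rho> f x) < e"
        using d d' \<open>\<rho> > 0\<close> by (intro exI[of _ "min d' (\<rho> * d)"]) auto
    qed
  qed
qed

lemma sweep_le:
  assumes f: "continuous_on UNIV f" and M: "\<And>y. \<bar>f y\<bar> \<le> M" and "\<rho> > 0"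
    and sup: "\<And>x. x \<in> ball a \<rho> \<Longrightarrow> superharmonic_at f x"
  shows "sweep a \<rho> f x \<le> f x"
proof (cases "x \<in> ball a \<rho>")
  case True
  have m: "f \<in> borel_measurable borel" using f by (rule borel_measurable_continuous_onI)
  show ?thesis
  proof (rule superharmonic_comparison[where C="cball a \<rho>" and U="ball a \<rho>"])
    show "continuous_on (cball a \<rho>) f" "continuous_on (cball a \<rho>) (sweep a \<rho> f)"
      using f continuous_sweep[OF assms(1-3)] continuous_on_subset by blast+
    show "harmonic_at (sweep a \<rho> f) x" if "x \<in> ball a \<rho>" for x
      by (rule harmonic_sweep[OF m M \<open>\<rho> > 0\<close> that])
  qed (use sup True in \<open>auto simp: sweep_def\<close>)
qed (simp add: sweep_def)

text \<open>A harmonic minorant survives the modification; this preserves the lower barriers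
  throughout the balayage.\<close>

lemma sweep_ge:
  assumes f: "continuous_on UNIV f" and M: "\<And>y. \<bar>f y\<bar> \<le> M" and "\<rho> > 0"
    and b: "\<And>x. x \<in> cball a \<rho> \<Longrightarrow> harmonic_at b x" "\<And>x. x \<in> cball a \<rho> \<Longrightarrow> b x \<le> f x"
    and "x \<in> ball a \<rho>"
  shows "b x \<le> sweep a \<rho> f x"
proof (rule superharmonic_comparison[where C="cball a \<rho>" and U="ball a \<rho>"])
  have m: "f \<in> borel_measurable borel" using f by (rule borel_measurable_continuous_onI)
  show "continuous_on (cball a \<rho>) b"
    using b(1) by (intro continuous_at_imp_continuous_on ballI harmonic_at_isCont)
  show "continuous_on (cball a \<rho>) (sweep a \<rho> f)"
    using continuous_sweep[OF assms(1-3)] continuous_on_subset by blast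
  show "superharmonic_at (sweep a \<rho> f) x" if "x \<in> ball a \<rho>" for x
    by (rule harmonic_at_superharmonic_at[OF harmonic_sweep[OF m M \<open>\<rho> > 0\<close> that]])
qed (use assms in \<open>auto simp: sweep_def\<close>)

text \<open>Inside the ball the result is harmonic. At all other points, those of the sphere
  included, it agrees with f and lies below f nearby, so it is superharmonic by touching.\<close>

lemma superharmonic_sweep:
  assumes f: "continuous_on UNIV f" and M: "\<And>y. \<bar>f y\<bar> \<le> M" and "\<rho> > 0"
    and sup: "\<And>x. x \<in> ball a \<rho> \<Longrightarrow> superharmonic_at f x" and "superharmonic_at f x"
  shows "superharmonic_at (sweep a \<rho> f) x"
proof (cases "x \<in> ball a \<rho>")
  case True
  have m: "f \<in> borel_measurable borel" using f by (rule borel_measurable_continuous_onI)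
  show ?thesis by (rule harmonic_at_superharmonic_at[OF harmonic_sweep[OF m M \<open>\<rho> > 0\<close> True]])
next
  case False
  show ?thesis
    by (rule superharmonic_at_touching[OF \<open>superharmonic_at f x\<close>, of _ 1])
      (use False sweep_le[OF f M \<open>\<rho> > 0\<close> sup] in \<open>auto simp: sweep_def\<close>)
qed

text \<open>Poincare's balayage: sweeping out the balls of a countable cover of the complement of \<open>K\<close>,
  each infinitely often, makes the superharmonic function \<open>min 1 (R/r)\<close> decrease to a harmonic one.\<close>

theorem exterior_harmonic_exists:
  fixes K :: "(real^3) set"
  assumes K: "compact K" and R: "R > 0" "K \<subseteq> cball 0 R"
  obtains w where "\<And>x. x \<notin> K \<Longrightarrow> harmonic_at w x" "\<And>x. 0 \<le> w x" "\<And>x. w x \<le> 1"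
    "\<And>x. w x \<le> R / max R (norm x)"
    "\<And>c \<rho> x. 0 < \<rho> \<Longrightarrow> ball c \<rho> \<subseteq> K \<Longrightarrow> x \<notin> K \<Longrightarrow> \<rho> / norm (x - c) \<le> w x"
proof -
  define I where "I = {(a, \<rho>) | a \<rho>. \<rho> > 0 \<and> cball a \<rho> \<subseteq> - K}"
  define F where "F = (\<lambda>(a, \<rho>). ball a \<rho>) ` I"
  have opD: "open (- K)" using K by (intro open_Compl compact_imp_closed)
  have UF: "\<Union>F = - K"
  proof
    show "\<Union>F \<subseteq> - K" unfolding F_def I_def using ball_subset_cball by fastforce
    show "- K \<subseteq> \<Union>F"
    proof
      fix x assume "x \<in> - K"
      then obtain e where "e > 0" "cball x e \<subseteq> - K" using opD open_contains_cball by blast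
      then have "(x, e) \<in> I" "x \<in> ball x e" by (auto simp: I_def)
      then show "x \<in> \<Union>F" unfolding F_def by blast
    qed
  qed
  have "\<And>S. S \<in> F \<Longrightarrow> open S" by (auto simp: F_def)
  then obtain F' where F': "F' \<subseteq> F" "countable F'" "\<Union>F' = \<Union>F" using Lindelof by metis
  obtain I' where I': "countable I'" "I' \<subseteq> I" "F' = (\<lambda>(a, \<rho>). ball a \<rho>) ` I'"
    using F'(1,2) unfolding F_def by (metis countable_subset_image)
  have "- K \<noteq> {}"
  proof
    assume "- K = {}"
    then have "K = UNIV" by blast
    then show False using K not_bounded_UNIV compact_imp_bounded by metis
  qed
  then have "I' \<noteq> {}" using UF F' I'(3) by auto
  define c where "c = from_nat_into I'"
  have c: "range c = I'" unfolding c_def by (rule range_from_nat_into[OF \<open>I' \<noteq> {}\<close> I'(1)])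
  \<comment> \<open>The first component of \<open>prod_decode\<close> takes every value infinitely
    often.\<close>
  define e where "e n = c (fst (prod_decode n))" for n
  have e: "e n \<in> I" for n using c I'(2) by (auto simp: e_def)
  define v where "v = rec_nat (\<lambda>x. R / max R (norm x)) (\<lambda>n. sweep (fst (e n)) (snd (e n)))"
  have v0: "v 0 x = R / max R (norm x)" for x by (simp add: v_def)
  have vS: "v (Suc n) = sweep (fst (e n)) (snd (e n)) (v n)" for n by (simp add: v_def)
  have ball: "snd (e n) > 0" "cball (fst (e n)) (snd (e n)) \<subseteq> - K" for n
    using e[of n] by (auto simp: I_def)
  have v0_le: "v 0 y \<le> 1" for y
  proof -
    have "R \<le> max R (norm y)" "0 < max R (norm y)" using R by auto
    then show ?thesis by (simp add: v0 pos_divide_le_eq)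
  qed
  \<comment> \<open>The initial function is the minimum of the functions 1 and R/|x|, one of which
    touches it from above at each point.\<close>
  have v0_sup: "superharmonic_at (v 0) x" for x
  proof (cases "norm x \<le> R")
    case True
    show ?thesis
      by (rule superharmonic_at_touching[OF harmonic_at_superharmonic_at[OF harmonic_at_const[of 1]], of _ _ 1])
        (use True R v0_le in \<open>auto simp: v0\<close>)
  next
    case False
    then have x0: "x \<noteq> 0" using R by auto
    show ?thesis
    proof (rule superharmonic_at_touching[OF harmonic_at_superharmonic_at[OF harmonic_at_inv_dist[OF x0, of R]]])
      show "norm x > 0" using x0 by simp
      show "R * inv_dist 0 x = v 0 x" using False by (simp add: v0 inv_dist_def divide_inverse)
      fix y assume "y \<in> ball x (norm x)"
      then have "y \<noteq> 0" by auto
      then show "v 0 y \<le> R * inv_dist 0 y"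
        using R by (auto simp: v0 inv_dist_def divide_inverse intro!: mult_left_mono le_imp_inverse_le)
    qed
  qed
  have v: "continuous_on UNIV (v n) \<and> (\<forall>x. 0 \<le> v n x \<and> v n x \<le> 1) \<and> (\<forall>x. x \<notin> K \<longrightarrow> superharmonic_at (v n) x)" for n
  proof (induction n)
    case 0
    have "continuous_on UNIV (v 0)"
      unfolding v0[abs_def] using R by (intro continuous_intros) (auto simp: max_def)
    moreover have "0 \<le> v 0 x" for x using R by (simp add: v0)
    ultimately show ?case using v0_sup v0_le by blast
  next
    case (Suc n)
    have m: "v n \<in> borel_measurable borel" using Suc by (intro borel_measurable_continuous_onI) auto
    have M: "\<bar>v n x\<bar> \<le> 1" for x using Suc by (simp add: abs_le_iff)
    have "superharmonic_at (v (Suc n)) x" if "x \<notin> K" for x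
      unfolding vS
    proof (rule superharmonic_sweep[OF _ M ball(1)])
      show "superharmonic_at (v n) z" if "z \<in> ball (fst (e n)) (snd (e n))" for z
      proof -
        have "z \<notin> K" using that ball(2)[of n] by (auto simp: subset_iff)
        then show ?thesis using Suc by blast
      qed
    qed (use Suc that in auto)
    then show ?case
      unfolding vS using continuous_sweep[OF _ M ball(1)] sweep_bounds[OF m _ _ ball(1)] Suc by auto
  qed
  have vm: "v n \<in> borel_measurable borel" for n using v by (intro borel_measurable_continuous_onI) auto
  have vM: "\<bar>v n x\<bar> \<le> 1" for n x using v[of n] by auto
  have dec: "v (Suc n) x \<le> v n x" for n x
    unfolding vS
  proof (rule sweep_le[OF _ vM ball(1)])
    fix z assume "z \<in> ball (fst (e n)) (snd (e n))"
    then have "z \<notin> K" using ball(2)[of n] by (auto simp: subset_iff)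
    then show "superharmonic_at (v n) z" using v by blast
  qed (use v in auto)
  have decseq: "decseq (\<lambda>n. v n x)" for x using dec by (intro decseq_SucI)
  define w where "w x = lim (\<lambda>n. v n x)" for x
  have lim: "(\<lambda>n. v n x) \<longlonglongrightarrow> w x" for x
  proof -
    have "convergent (\<lambda>n. v n x)"
      using decseq_convergent[OF decseq, of 0 x] v unfolding convergent_def by metis
    then show ?thesis unfolding w_def by (simp add: convergent_LIMSEQ_iff)
  qed
  have wm: "w \<in> borel_measurable borel"
    by (rule borel_measurable_LIMSEQ_real[OF lim vm])
  have w01: "0 \<le> w x" "w x \<le> 1" for x
    using v by (auto intro!: LIMSEQ_le_const[OF lim] LIMSEQ_le_const2[OF lim])
  have wv: "w x \<le> v n x" for n x by (rule decseq_ge[OF decseq lim])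
  \<comment> \<open>Pass to the limit along the times X k at which this ball is swept: the iterate
    after the sweep is the Poisson integral of the one before, and both converge to the
    corresponding expressions in \<open>w\<close>.\<close>
  have w_sweep: "w z = sweep a \<rho> w z" if "(a, \<rho>) \<in> I'" "z \<in> ball a \<rho>" for a \<rho> z
  proof -
    have "(a, \<rho>) \<in> range c" using c that(1) by simp
    then obtain j where j: "c j = (a, \<rho>)" by (metis rangeE)
    define X where "X k = prod_encode (j, k)" for k
    have Xe: "e (X k) = (a, \<rho>)" for k by (simp add: e_def X_def j)
    have Xk: "filterlim X at_top sequentially"
      by (rule filterlim_at_top_mono[OF filterlim_ident]) (simp add: X_def le_prod_encode_2)
    have \<rho>: "\<rho> > 0" using that I'(2) by (auto simp: I_def)
    have n: "norm ((z - a) /\<^sub>R \<rho>) < 1" unfolding norm_rescale[OF \<rho>] using that(2) \<rho> by simp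
    have 1: "(\<lambda>k. v (Suc (X k)) z) \<longlonglongrightarrow> w z"
      using filterlim_compose[OF LIMSEQ_Suc[OF lim] Xk] by simp
    have [measurable]: "v n \<in> borel_measurable borel" "w \<in> borel_measurable borel" for n using vm wm by auto
    have "(\<lambda>k. poisson_unit (\<lambda>y. v (X k) (a + \<rho> *\<^sub>R y)) ((z - a) /\<^sub>R \<rho>)) \<longlonglongrightarrow> poisson_unit (\<lambda>y. w (a + \<rho> *\<^sub>R y)) ((z - a) /\<^sub>R \<rho>)"
    proof (rule poisson_unit_tendsto[where M=1, OF _ _ _ _ n])
      show "(\<lambda>k. v (X k) (a + \<rho> *\<^sub>R y)) \<longlonglongrightarrow> w (a + \<rho> *\<^sub>R y)" for y
        using filterlim_compose[OF lim Xk] by simp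
      show "(\<lambda>y. v (X k) (a + \<rho> *\<^sub>R y)) \<in> borel_measurable borel"
        "(\<lambda>y. w (a + \<rho> *\<^sub>R y)) \<in> borel_measurable borel" for k by measurable
    qed (use vM in auto)
    then have 2: "(\<lambda>k. v (Suc (X k)) z) \<longlonglongrightarrow> sweep a \<rho> w z"
      using that(2) by (simp add: vS Xe sweep_def)
    show ?thesis using LIMSEQ_unique[OF 1 2] .
  qed
  show ?thesis
  proof (rule that[of w])
    show "harmonic_at w x" if "x \<notin> K" for x
    proof -
      have "x \<in> \<Union>F'" using that UF F'(3) by simp
      then obtain a \<rho> where a: "(a, \<rho>) \<in> I'" "x \<in> ball a \<rho>" using I'(3) by auto
      have "harmonic_at (sweep a \<rho> w) x"
        by (rule harmonic_sweep[OF wm, of 1]) (use w01 a I'(2) in \<open>auto simp: I_def abs_le_iff intro: order_trans[of _ 0]\<close>)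
      then show ?thesis by (rule harmonic_at_cong[OF _ open_ball a(2)]) (simp add: w_sweep[OF a(1)])
    qed
    show "0 \<le> w x" "w x \<le> 1" for x by (rule w01)+
    show "w x \<le> R / max R (norm x)" for x using wv[of x 0] by (simp add: v0)
    fix q \<rho> x assume \<rho>: "(0::real) < \<rho>" and sub: "ball q \<rho> \<subseteq> K" and x: "x \<notin> K"
    have qK: "q \<in> K" using sub \<rho> by auto
    have far: "norm (y - q) \<ge> \<rho>" if "y \<notin> K" for y
      using sub that by (force simp: dist_norm norm_minus_commute)
    define b where "b y = \<rho> * inv_dist q y" for y
    have b: "b y = \<rho> / norm (y - q)" for y by (simp add: b_def inv_dist_def divide_inverse)
    have bh: "harmonic_at b y" if "y \<notin> K" for y
      unfolding b_def[abs_def] using that qK by (intro harmonic_at_inv_dist) auto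
    \<comment> \<open>The rescaled fundamental solution of a ball inside \<open>K\<close> is a lower
      barrier: it starts below the initial function, and each sweep keeps it below.\<close>
    have "b y \<le> v n y" if "y \<notin> K" for n y
      using that
    proof (induction n arbitrary: y)
      case 0
      \<comment> \<open>Since the ball lies in \<open>cball 0 R\<close>, |q| + \<rho> <= R; together
        with |y - q| >= \<rho> this gives both \<rho> |y| <= R |y - q| and \<rho> R <= R |y -
        q|.\<close>
      have yq: "norm (y - q) \<ge> \<rho>" using far 0 by simp
      have "ball q \<rho> \<subseteq> cball 0 R" using sub R by auto
      then have qR: "norm q + \<rho> \<le> R" using \<rho> by (auto simp: ball_subset_cball_iff)
      have "norm y \<le> norm (y - q) + norm q" by (metis add.commute norm_triangle_sub)
      then have "\<rho> * norm y \<le> \<rho> * norm (y - q) + \<rho> * norm q"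
        using \<rho> by (simp add: distrib_left[symmetric])
      also have "\<rho> * norm q \<le> norm (y - q) * norm q" using yq by (intro mult_right_mono) auto
      also have "norm (y - q) * norm q \<le> norm (y - q) * (R - \<rho>)" using qR by (intro mult_left_mono) auto
      finally have 1: "\<rho> * norm y \<le> R * norm (y - q)" by (simp add: algebra_simps)
      have 2: "\<rho> * R \<le> R * norm (y - q)" using yq R by (simp add: mult.commute)
      have "\<rho> * max R (norm y) \<le> R * norm (y - q)" using 1 2 by (simp add: max_def)
      moreover have B: "norm (y - q) > 0" using yq \<rho> by linarith
      moreover have A: "max R (norm y) > 0" using R by simp
      ultimately show ?case
        unfolding b v0 by (simp only: pos_le_divide_eq[OF A] times_divide_eq_left pos_divide_le_eq[OF B])
    next
      case (Suc n)
      show ?case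
      proof (cases "y \<in> ball (fst (e n)) (snd (e n))")
        case True
        show ?thesis
          unfolding vS by (rule sweep_ge[OF _ vM ball(1) _ _ True]) (use v bh Suc.IH ball(2) in \<open>auto simp: subset_iff\<close>)
      next
        case False
        then show ?thesis unfolding vS using Suc by (simp add: sweep_def)
      qed
    qed
    then have "b x \<le> w x" using x by (intro LIMSEQ_le_const[OF lim]) auto
    then show "\<rho> / norm (x - q) \<le> w x" by (simp add: b)
  qed
qed

section \<open>Closed surfaces\<close>

text \<open>All that matters of a local defining function: \<open>f\<close> has a gradient field that is
  nonzero at \<open>p\<close> and Lipschitz there, and \<open>S\<close> is locally the zero set.\<close>

definition local_defining :: "(real^3) set \<Rightarrow> (real^3) set \<Rightarrow> (real^3 \<Rightarrow> real) \<Rightarrow> (real^3 \<Rightarrow> real^3) \<Rightarrow> bool" where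
  "local_defining S U f G \<longleftrightarrow> open U \<and> S \<inter> U = {x \<in> U. f x = 0} \<and>
     (\<forall>x\<in>U. (f has_derivative (\<lambda>h. G x \<bullet> h)) (at x) \<and> G x \<noteq> 0 \<and> G differentiable (at x))"

definition grad_vec :: "(real^'n \<Rightarrow> real) \<Rightarrow> real^'n \<Rightarrow> real^'n" where
  "grad_vec f x = (\<chi> i. partial i f x)"

lemma has_derivative_grad_vec:
  fixes f :: "real^'n \<Rightarrow> real"
  assumes "f differentiable (at x)"
  shows "(f has_derivative (\<lambda>h. grad_vec f x \<bullet> h)) (at x)"
proof -
  have d: "(f has_derivative frechet_derivative f (at x)) (at x)"
    using assms by (simp add: frechet_derivative_works)
  then have lin: "linear (frechet_derivative f (at x))" by (rule has_derivative_linear)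
  have "frechet_derivative f (at x) h = grad_vec f x \<bullet> h" for h
  proof -
    have "frechet_derivative f (at x) h = frechet_derivative f (at x) (\<Sum>i\<in>UNIV. h $ i *\<^sub>R axis i 1)"
      by (simp only: basis_expansion[of h, unfolded scalar_mult_eq_scaleR])
    also have "\<dots> = (\<Sum>i\<in>UNIV. h $ i * partial i f x)"
      by (simp add: linear_sum[OF lin] linear_scale[OF lin] partial_def)
    also have "\<dots> = grad_vec f x \<bullet> h"
      by (simp add: grad_vec_def inner_vec_def mult.commute)
    finally show ?thesis .
  qed
  then have "frechet_derivative f (at x) = (\<lambda>h. grad_vec f x \<bullet> h)" by (rule ext)
  then show ?thesis using d by simp
qed

lemma partial_eq:
  fixes f :: "real^'n \<Rightarrow> real"
  assumes "(f has_derivative (\<lambda>h. g \<bullet> h)) (at x)"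
  shows "partial i f x = g $ i"
proof -
  have "frechet_derivative f (at x) = (\<lambda>h. g \<bullet> h)"
    using frechet_derivative_at[OF assms] by simp
  then show ?thesis by (simp add: partial_def inner_axis)
qed

lemma differentiable_vec_lambda:
  fixes F :: "'n::finite \<Rightarrow> real^'m \<Rightarrow> real"
  assumes "\<And>i. F i differentiable (at x)"
  shows "(\<lambda>x. \<chi> i. F i x) differentiable (at x)"
  using assms by (subst differentiable_componentwise_within) (auto simp: Basis_vec_def inner_axis)

lemma closed_surface_local_defining:
  assumes "closed_surface S" "p \<in> S"
  obtains U f G where "p \<in> U" "local_defining S U f G"
proof -
  obtain U f where U: "open U" "p \<in> U" "smooth_on U f" "\<forall>x\<in>U. \<exists>i. partial i f x \<noteq> 0"
    "S \<inter> U = {x \<in> U. f x = 0}"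
    using assms unfolding closed_surface_def by blast
  have C2: "Ck_on 2 U f" using U(3) unfolding smooth_on_def by blast
  have d1: "f differentiable (at x)" if "x \<in> U" for x
    using C2 U(1) that by (simp add: numeral_2_eq_2 differentiable_on_eq_differentiable_at)
  have d2: "partial i f differentiable (at x)" if "x \<in> U" for x i
    using C2 U(1) that by (simp add: numeral_2_eq_2 differentiable_on_eq_differentiable_at)
  have "local_defining S U f (grad_vec f)"
    unfolding local_defining_def
  proof (intro conjI ballI)
    fix x assume x: "x \<in> U"
    show "(f has_derivative (\<lambda>h. grad_vec f x \<bullet> h)) (at x)"
      by (rule has_derivative_grad_vec[OF d1[OF x]])
    show "grad_vec f x \<noteq> 0"
      using U(4) x by (auto simp: grad_vec_def vec_eq_iff)
    show "grad_vec f differentiable (at x)"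
      unfolding grad_vec_def[abs_def] by (intro differentiable_vec_lambda d2 x)
  qed (use U in auto)
  then show ?thesis using that U(2) by blast
qed

text \<open>Near \<open>p\<close> both sides of \<open>S\<close> contain a ball touching \<open>S\<close> at \<open>p\<close>, and every nearby point off
  \<open>S\<close> is joined to one of the two balls by a segment along the normal that avoids \<open>S\<close>.\<close>

lemma local_defining_sides:
  assumes L: "local_defining S U f G" and p: "p \<in> S" "p \<in> U" and e: "e > 0"
  obtains n t d where "norm n = 1" "t > 0" "d > 0" "ball p d \<subseteq> U" "t < e" "d < e"
    "ball (p + t *\<^sub>R n) t \<subseteq> {x \<in> U. f x > 0}" "ball (p - t *\<^sub>R n) t \<subseteq> {x \<in> U. f x < 0}"
    "\<And>x. x \<in> ball p d \<Longrightarrow> f x > 0 \<Longrightarrow> closed_segment x (x + t *\<^sub>R n) \<subseteq> {x \<in> U. f x > 0}"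
    "\<And>x. x \<in> ball p d \<Longrightarrow> f x < 0 \<Longrightarrow> closed_segment x (x - t *\<^sub>R n) \<subseteq> {x \<in> U. f x < 0}"
    "\<And>x. x \<in> ball p d \<Longrightarrow> x + t *\<^sub>R n \<in> ball (p + t *\<^sub>R n) t" "\<And>x. x \<in> ball p d \<Longrightarrow> x - t *\<^sub>R n \<in> ball (p - t *\<^sub>R n) t"
proof -
  have opU: "open U" and SU: "S \<inter> U = {x \<in> U. f x = 0}"
    and der: "\<And>x. x \<in> U \<Longrightarrow> (f has_derivative (\<lambda>h. G x \<bullet> h)) (at x)"
    and G0: "\<And>x. x \<in> U \<Longrightarrow> G x \<noteq> 0" and dG: "\<And>x. x \<in> U \<Longrightarrow> G differentiable (at x)"
    using L unfolding local_defining_def by auto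
  have fp: "f p = 0" using SU p by blast
  define g where "g = norm (G p)"
  have g: "g > 0" using G0[OF p(2)] by (simp add: g_def)
  define n where "n = G p /\<^sub>R g"
  have n: "norm n = 1" "G p = g *\<^sub>R n" using g by (auto simp: n_def g_def)
  obtain G' where G': "(G has_derivative G') (at p)" using dG[OF p(2)] unfolding differentiable_def by blast
  obtain K where K: "K > 0" "\<And>h. norm (G' h) \<le> norm h * K"
    using bounded_linear.pos_bounded[OF has_derivative_bounded_linear[OF G']] by blast
  obtain d0 where d0: "d0 > 0" "\<And>y. norm (y - p) < d0 \<Longrightarrow> norm (G y - G p - G' (y - p)) \<le> 1 * norm (y - p)"
    using G' unfolding has_derivative_at_alt by (metis zero_less_one)
  have lip: "norm (G y - G p) \<le> (K + 1) * norm (y - p)" if "norm (y - p) < d0" for y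
  proof -
    have "norm (G y - G p) \<le> norm (G y - G p - G' (y - p)) + norm (G' (y - p))"
      by (metis diff_add_cancel norm_triangle_ineq)
    also have "\<dots> \<le> 1 * norm (y - p) + norm (y - p) * K"
      using d0(2)[OF that] K(2) by (intro add_mono) auto
    finally show ?thesis by (simp add: algebra_simps)
  qed
  obtain d1 where d1: "d1 > 0" "ball p d1 \<subseteq> U" using opU p open_contains_ball by blast
  \<comment> \<open>At distance below 3 t from \<open>p\<close>, the field \<open>G\<close> differs
    from G p by less than g, hence keeps a positive component along the normal. In the touching
    balls |y - p|^2 is less than 2 t times the normal component, so the quadratic Taylor error stays
    below the linear term.\<close>
  define t where "t = min (min (d0 / 4) (d1 / 4)) (min (e / 2) (g / (8 * (K + 1))))"
  have t0: "t > 0" using d0 d1 e g K by (simp add: t_def)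
  have te: "t \<le> e / 2" unfolding t_def by (intro min.coboundedI2 min.cobounded1)
  have t: "t > 0" "t \<le> d0 / 4" "t \<le> d1 / 4" "t < e"
  proof -
    show "t \<le> d0 / 4" unfolding t_def by (intro min.coboundedI1 min.cobounded1)
    show "t \<le> d1 / 4" unfolding t_def by (intro min.coboundedI1 min.cobounded2)
    show "t < e" using te e by linarith
  qed (rule t0)
  have tK: "8 * (K + 1) * t \<le> g"
  proof -
    have "t \<le> g / (8 * (K + 1))" by (simp add: t_def)
    then show ?thesis using K by (simp add: pos_le_divide_eq mult.commute)
  qed
  have near: "y \<in> U" "norm (y - p) < d0" if "norm (y - p) < 3 * t" for y
    using that t d1 d0 by (auto simp: subset_iff dist_norm norm_minus_commute)
  have Gn: "G y \<bullet> n > 0" if "norm (y - p) < 3 * t" for y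
  proof -
    have "norm (G y - G p) \<le> (K + 1) * (3 * t)"
    proof -
      have "(K + 1) * norm (y - p) \<le> (K + 1) * (3 * t)" using that K by (intro mult_left_mono) auto
      then show ?thesis using lip[OF near(2)[OF that]] by linarith
    qed
    also have "\<dots> < g" using tK g t K by (simp add: algebra_simps)
    finally have "norm (G y - G p) < g" .
    moreover have "\<bar>(G y - G p) \<bullet> n\<bar> \<le> norm (G y - G p) * norm n" by (rule Cauchy_Schwarz_ineq2)
    moreover have "G p \<bullet> n = g" using n by (simp add: dot_square_norm)
    ultimately show ?thesis using n(1) by (simp add: inner_diff_left abs_le_iff)
  qed
  have taylor: "\<bar>f y - g * (n \<bullet> (y - p))\<bar> \<le> (K + 1) * (norm (y - p))\<^sup>2" if y: "norm (y - p) < 3 * t" for y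
  proof -
    define r where "r = norm (y - p)"
    have sub: "norm (z - p) \<le> r" if "z \<in> cball p r" for z using that by (simp add: dist_norm norm_minus_commute)
    have "norm ((f y - G p \<bullet> y) - (f p - G p \<bullet> p)) \<le> ((K + 1) * r) * norm (y - p)"
    proof (rule differentiable_bound[OF convex_cball[of p r]])
      fix z assume z: "z \<in> cball p r"
      have zt: "norm (z - p) < 3 * t" using sub[OF z] y by (simp add: r_def)
      have "((\<lambda>z. f z - G p \<bullet> z) has_derivative (\<lambda>h. G z \<bullet> h - G p \<bullet> h)) (at z)"
        by (intro has_derivative_diff der near(1)[OF zt] has_derivative_inner_right has_derivative_ident)
      then show "((\<lambda>z. f z - G p \<bullet> z) has_derivative (\<lambda>h. (G z - G p) \<bullet> h)) (at z within cball p r)"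
        unfolding inner_diff_left by (rule has_derivative_at_withinI)
      show "onorm (\<lambda>h. (G z - G p) \<bullet> h) \<le> (K + 1) * r"
      proof (rule onorm_le)
        fix h
        have "norm ((G z - G p) \<bullet> h) \<le> norm (G z - G p) * norm h"
          unfolding real_norm_def by (rule Cauchy_Schwarz_ineq2)
        also have "\<dots> \<le> ((K + 1) * r) * norm h"
        proof (intro mult_right_mono)
          have "(K + 1) * norm (z - p) \<le> (K + 1) * r" using sub[OF z] K by (intro mult_left_mono) auto
          then show "norm (G z - G p) \<le> (K + 1) * r" using lip[OF near(2)[OF zt]] by linarith
        qed simp
        finally show "norm ((G z - G p) \<bullet> h) \<le> (K + 1) * r * norm h" .
      qed
    qed (auto simp: r_def dist_norm norm_minus_commute)
    then show ?thesis
      using fp n by (simp add: inner_diff_right r_def power2_eq_square algebra_simps)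
  qed
  \<comment> \<open>The sign \<open>s\<close> treats the balls on the two sides of \<open>S\<close>
    at once.\<close>
  have inball: "norm (y - p) < 2 * t \<and> 2 * t * (s * (n \<bullet> (y - p))) > (norm (y - p))\<^sup>2"
    if y: "y \<in> ball (p + (s * t) *\<^sub>R n) t" and s: "s = 1 \<or> s = -1" for y and s :: real
  proof
    have "norm (y - p) \<le> norm (y - (p + (s * t) *\<^sub>R n)) + norm ((s * t) *\<^sub>R n)"
      by (metis add_diff_cancel_left' diff_add_cancel diff_diff_add norm_triangle_ineq)
    also have "norm (y - (p + (s * t) *\<^sub>R n)) < t" using y by (simp add: dist_norm norm_minus_commute)
    also have "norm ((s * t) *\<^sub>R n) = t" using s t n by auto
    finally show "norm (y - p) < 2 * t" by simp
    have "norm ((y - p) - (s * t) *\<^sub>R n) < t" using y by (simp add: dist_norm norm_minus_commute diff_diff_add)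
    then have "(norm ((y - p) - (s * t) *\<^sub>R n))\<^sup>2 < t\<^sup>2" by (intro power_strict_mono) auto
    moreover have "(norm ((y - p) - (s * t) *\<^sub>R n))\<^sup>2 = (norm (y - p))\<^sup>2 - 2 * t * (s * (n \<bullet> (y - p))) + t\<^sup>2"
    proof -
      have "n \<bullet> n = 1" using n by (simp add: dot_square_norm)
      moreover have "s * s = 1" using s by auto
      ultimately show ?thesis
        unfolding power2_norm_eq_inner inner_diff_left inner_diff_right inner_scaleR_left inner_scaleR_right
        by (simp add: inner_commute power2_eq_square algebra_simps)
    qed
    ultimately show "2 * t * (s * (n \<bullet> (y - p))) > (norm (y - p))\<^sup>2" by simp
  qed
  have sgnball: "y \<in> U \<and> s * f y > 0" if y: "y \<in> ball (p + (s * t) *\<^sub>R n) t" and s: "s = 1 \<or> s = -1" for y and s :: real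
  proof
    have ib: "norm (y - p) < 2 * t" "2 * t * (s * (n \<bullet> (y - p))) > (norm (y - p))\<^sup>2" using inball[OF y s] by auto
    have y3: "norm (y - p) < 3 * t" using ib t by simp
    show "y \<in> U" by (rule near(1)[OF y3])
    define a where "a = s * (n \<bullet> (y - p))"
    have "\<bar>s * f y - g * a\<bar> \<le> (K + 1) * (norm (y - p))\<^sup>2"
      using taylor[OF y3] s by (auto simp: a_def abs_minus_commute)
    moreover have "(K + 1) * (norm (y - p))\<^sup>2 \<le> (K + 1) * (2 * t * a)"
      using ib(2) K by (intro mult_left_mono) (auto simp: a_def)
    ultimately have "s * f y \<ge> g * a - (K + 1) * (2 * t * a)" by linarith
    then have "s * f y \<ge> (g - 2 * (K + 1) * t) * a" by (simp add: algebra_simps)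
    moreover have "0 < g - 2 * (K + 1) * t" using tK t K g by (simp add: algebra_simps)
    moreover have "a > 0"
    proof -
      have "0 < 2 * t * a" using ib(2) zero_le_power2[of "norm (y - p)"] unfolding a_def by linarith
      then show ?thesis using t by (simp add: zero_less_mult_iff)
    qed
    ultimately have "0 < (g - 2 * (K + 1) * t) * a" by simp
    then show "s * f y > 0" using \<open>(g - 2 * (K + 1) * t) * a \<le> s * f y\<close> by linarith
  qed
  \<comment> \<open>\<open>f\<close> is nondecreasing along the normal, so moving away from
    \<open>S\<close> in the appropriate direction preserves its sign.\<close>
  have seg: "x + \<tau> *\<^sub>R n \<in> U \<and> (0 \<le> \<tau> \<longrightarrow> f x \<le> f (x + \<tau> *\<^sub>R n)) \<and> (\<tau> \<le> 0 \<longrightarrow> f (x + \<tau> *\<^sub>R n) \<le> f x)"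
    if x: "x \<in> ball p t" and \<tau>: "\<bar>\<tau>\<bar> \<le> t" for x \<tau>
  proof -
    have nx: "norm (x + \<sigma> *\<^sub>R n - p) < 3 * t" if "\<bar>\<sigma>\<bar> \<le> t" for \<sigma>
    proof -
      have "norm (x + \<sigma> *\<^sub>R n - p) \<le> norm (x - p) + norm (\<sigma> *\<^sub>R n)"
        by (metis add_diff_eq diff_add_eq norm_triangle_ineq)
      also have "\<dots> < t + t" using x that n by (simp add: dist_norm norm_minus_commute add_less_le_mono)
      finally show ?thesis using t by simp
    qed
    have line: "((\<lambda>\<sigma>. f (x + \<sigma> *\<^sub>R n)) has_real_derivative G (x + \<sigma> *\<^sub>R n) \<bullet> n) (at \<sigma>)" if "\<bar>\<sigma>\<bar> \<le> t" for \<sigma>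
    proof -
      have "((\<lambda>\<sigma>. x + \<sigma> *\<^sub>R n) has_derivative (\<lambda>k. k *\<^sub>R n)) (at \<sigma>)"
        by (auto intro!: derivative_eq_intros)
      from has_derivative_compose[OF this der[OF near(1)[OF nx[OF that]]]]
      show ?thesis unfolding has_field_derivative_def
        by (rule has_derivative_eq_rhs) (simp add: fun_eq_iff mult.commute)
    qed
    have mono: "f (x + a *\<^sub>R n) \<le> f (x + b *\<^sub>R n)" if "a \<le> b" "\<bar>a\<bar> \<le> t" "\<bar>b\<bar> \<le> t" for a b
    proof (rule DERIV_nonneg_imp_nondecreasing[OF that(1)])
      fix \<sigma> assume "a \<le> \<sigma>" "\<sigma> \<le> b"
      then have "\<bar>\<sigma>\<bar> \<le> t" using that by linarith
      then show "\<exists>y. ((\<lambda>\<sigma>. f (x + \<sigma> *\<^sub>R n)) has_real_derivative y) (at \<sigma>) \<and> 0 \<le> y"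
        using line Gn[OF nx] by (meson less_imp_le)
    qed
    show ?thesis using near(1)[OF nx[OF \<tau>]] mono[of 0 \<tau>] mono[of \<tau> 0] \<tau> by auto
  qed
  show ?thesis
  proof (rule that[of n t t])
    show "ball p t \<subseteq> U"
    proof
      fix x assume "x \<in> ball p t"
      then show "x \<in> U" using seg[of x 0] t by auto
    qed
    show "ball (p + t *\<^sub>R n) t \<subseteq> {x \<in> U. f x > 0}" using sgnball[of _ 1] by auto
    show "ball (p - t *\<^sub>R n) t \<subseteq> {x \<in> U. f x < 0}" using sgnball[of _ "-1"] by auto
    show "closed_segment x (x + t *\<^sub>R n) \<subseteq> {x \<in> U. f x > 0}" if "x \<in> ball p t" "f x > 0" for x
    proof
      fix y assume "y \<in> closed_segment x (x + t *\<^sub>R n)"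
      then obtain u where u: "0 \<le> u" "u \<le> 1" "y = x + (u * t) *\<^sub>R n"
        by (auto simp: closed_segment_def algebra_simps)
      have ut: "0 \<le> u * t" "\<bar>u * t\<bar> \<le> t" using u t by (auto simp: abs_mult mult_left_le_one_le)
      show "y \<in> {x \<in> U. f x > 0}" using seg[OF that(1) ut(2)] ut(1) that(2) u(3) by auto
    qed
    show "closed_segment x (x - t *\<^sub>R n) \<subseteq> {x \<in> U. f x < 0}" if "x \<in> ball p t" "f x < 0" for x
    proof
      fix y assume "y \<in> closed_segment x (x - t *\<^sub>R n)"
      then obtain u where u: "0 \<le> u" "u \<le> 1" "y = x + (- (u * t)) *\<^sub>R n"
        by (auto simp: closed_segment_def algebra_simps)
      have ut: "- (u * t) \<le> 0" "\<bar>- (u * t)\<bar> \<le> t" using u t by (auto simp: abs_mult mult_left_le_one_le)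
      show "y \<in> {x \<in> U. f x < 0}" using seg[OF that(1) ut(2)] ut(1) that(2) u(3) by auto
    qed
  qed (use n t in \<open>auto simp: dist_norm\<close>)
qed

lemma connected_side:
  assumes "connected C" "C \<inter> frontier \<Omega> = {}" "C \<inter> \<Omega> \<noteq> {}"
  shows "C \<subseteq> \<Omega>"
  using connected_Int_frontier[OF assms(1), of \<Omega>] assms by blast

text \<open>A point of \<open>\<Omega>\<close> near \<open>p\<close> lies off \<open>S\<close>,
  hence on one of its two sides. The segment from it together with the touching ball on that side is
  connected and misses the frontier, so the ball lies in \<open>\<Omega>\<close>. Such balls provide
  the barriers for the boundary values of the potential.\<close>

lemma touching_ball:
  fixes S \<Omega> :: "(real^3) set"
  assumes S: "closed_surface S" "S = frontier \<Omega>" "open \<Omega>" and p: "p \<in> S"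
  obtains c t where "t > 0" "ball c t \<subseteq> \<Omega>" "norm (p - c) = t"
proof -
  obtain U f G where U: "p \<in> U" "local_defining S U f G" using closed_surface_local_defining[OF S(1) p] .
  have SU: "S \<inter> U = {x \<in> U. f x = 0}" using U(2) by (simp add: local_defining_def)
  obtain n t d where n: "norm n = 1" and t: "t > 0" "d > 0" and dU: "ball p d \<subseteq> U"
    and b: "ball (p + t *\<^sub>R n) t \<subseteq> {x \<in> U. f x > 0}" "ball (p - t *\<^sub>R n) t \<subseteq> {x \<in> U. f x < 0}"
    and s: "\<And>x. x \<in> ball p d \<Longrightarrow> f x > 0 \<Longrightarrow> closed_segment x (x + t *\<^sub>R n) \<subseteq> {x \<in> U. f x > 0}"
      "\<And>x. x \<in> ball p d \<Longrightarrow> f x < 0 \<Longrightarrow> closed_segment x (x - t *\<^sub>R n) \<subseteq> {x \<in> U. f x < 0}"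
    and e: "\<And>x. x \<in> ball p d \<Longrightarrow> x + t *\<^sub>R n \<in> ball (p + t *\<^sub>R n) t" "\<And>x. x \<in> ball p d \<Longrightarrow> x - t *\<^sub>R n \<in> ball (p - t *\<^sub>R n) t"
    by (rule local_defining_sides[OF U(2) p U(1) zero_less_one]) blast
  have "p \<in> closure \<Omega>" using p S(2) by (simp add: frontier_def)
  then obtain x where x: "x \<in> \<Omega>" "x \<in> ball p d"
    using t(2) unfolding closure_approachable by (auto simp: dist_commute)
  have off: "C \<inter> frontier \<Omega> = {}" if "C \<subseteq> {x \<in> U. f x > 0} \<or> C \<subseteq> {x \<in> U. f x < 0}" for C
  proof (rule equals0I)
    fix z assume z: "z \<in> C \<inter> frontier \<Omega>"
    then have "z \<in> U" "f z \<noteq> 0" using that by auto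
    then show False using z SU S(2) by auto
  qed
  have cU: "connected (closed_segment a b \<union> ball c t)" if "b \<in> ball c t" for a b c :: "real^3"
    using that by (intro connected_Un) (auto intro: convex_connected)
  consider "f x > 0" | "f x < 0" | "f x = 0" by linarith
  then show ?thesis
  proof cases
    case 1
    have "closed_segment x (x + t *\<^sub>R n) \<union> ball (p + t *\<^sub>R n) t \<subseteq> \<Omega>"
    proof (rule connected_side[OF cU[OF e(1)[OF x(2)]]])
      have "closed_segment x (x + t *\<^sub>R n) \<union> ball (p + t *\<^sub>R n) t \<subseteq> {x \<in> U. f x > 0}"
        using s(1)[OF x(2) 1] b(1) by (rule Un_least)
      then show "(closed_segment x (x + t *\<^sub>R n) \<union> ball (p + t *\<^sub>R n) t) \<inter> frontier \<Omega> = {}"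
        using off by blast
      show "(closed_segment x (x + t *\<^sub>R n) \<union> ball (p + t *\<^sub>R n) t) \<inter> \<Omega> \<noteq> {}"
        using x(1) ends_in_segment(1)[of x "x + t *\<^sub>R n"] by blast
    qed
    then show ?thesis using that[of t "p + t *\<^sub>R n"] t n by auto
  next
    case 2
    have "closed_segment x (x - t *\<^sub>R n) \<union> ball (p - t *\<^sub>R n) t \<subseteq> \<Omega>"
    proof (rule connected_side[OF cU[OF e(2)[OF x(2)]]])
      have "closed_segment x (x - t *\<^sub>R n) \<union> ball (p - t *\<^sub>R n) t \<subseteq> {x \<in> U. f x < 0}"
        using s(2)[OF x(2) 2] b(2) by (rule Un_least)
      then show "(closed_segment x (x - t *\<^sub>R n) \<union> ball (p - t *\<^sub>R n) t) \<inter> frontier \<Omega> = {}"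
        using off by blast
      show "(closed_segment x (x - t *\<^sub>R n) \<union> ball (p - t *\<^sub>R n) t) \<inter> \<Omega> \<noteq> {}"
        using x(1) ends_in_segment(1)[of x "x - t *\<^sub>R n"] by blast
    qed
    then show ?thesis using that[of t "p - t *\<^sub>R n"] t n by auto
  next
    case 3
    then have xS: "x \<in> S" using SU x dU by blast
    then show ?thesis using x(1) S(2,3) by (simp add: frontier_def interior_open)
  qed
qed

section \<open>Signs on the two sides of a surface and separation\<close>

lemma local_defining_subset:
  assumes "local_defining S U f G" "open V" "V \<subseteq> U"
  shows "local_defining S V f G"
  using assms unfolding local_defining_def by blast

lemma sgn_constant_connected:
  fixes f :: "'a::topological_space \<Rightarrow> real"
  assumes "connected C" "continuous_on C f" "\<And>x. x \<in> C \<Longrightarrow> f x \<noteq> 0" "x \<in> C" "y \<in> C"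
  shows "sgn (f x) = sgn (f y)"
proof (rule ccontr)
  assume ne: "sgn (f x) \<noteq> sgn (f y)"
  have "connected (f ` C)" using assms by (intro connected_continuous_image)
  moreover have "f x \<in> f ` C" "f y \<in> f ` C" using assms by auto
  moreover have "f x < 0 \<and> 0 < f y \<or> f y < 0 \<and> 0 < f x"
    using ne assms(3)[OF assms(4)] assms(3)[OF assms(5)] by (auto simp: sgn_if split: if_splits)
  ultimately have "0 \<in> f ` C"
    using connectedD_interval[of "f ` C" "f x" "f y" 0] connectedD_interval[of "f ` C" "f y" "f x" 0] by fastforce
  then show False using assms(3) by auto
qed

text \<open>The points near \<open>x\<close> on one side of \<open>S\<close>, as seen by
  \<open>f\<close>, are linked through a touching ball, so f' has a constant sign there. If the
  signs on the two sides agreed, f' would have a local extremum at \<open>x\<close>, against its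
  nonzero gradient.\<close>

lemma local_defining_sgn:
  assumes L: "local_defining S U f G" "local_defining S U' f' G'" and x: "x \<in> S" "x \<in> U" "x \<in> U'"
  obtains e c where "e > 0" "c = 1 \<or> c = (-1::real)" "\<And>y. y \<in> ball x e - S \<Longrightarrow> sgn (f' y) = c * sgn (f y)"
proof -
  have opn: "open U" "open U'" using L by (auto simp: local_defining_def)
  define V where "V = U \<inter> U'"
  have V: "open V" "x \<in> V" using opn x by (auto simp: V_def)
  have LV: "local_defining S V f G" by (rule local_defining_subset[OF L(1) V(1)]) (simp add: V_def)
  have zero: "S \<inter> V = {x \<in> V. f x = 0}" "S \<inter> V = {x \<in> V. f' x = 0}"
    using L unfolding local_defining_def V_def by blast+
  have cont': "continuous_on V f'"
    using L(2) unfolding local_defining_def V_def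
    by (intro continuous_at_imp_continuous_on) (meson IntD2 has_derivative_continuous)
  obtain n t d where n: "norm n = 1" and t: "t > 0" "d > 0" and dV: "ball x d \<subseteq> V"
    and b: "ball (x + t *\<^sub>R n) t \<subseteq> {y \<in> V. f y > 0}" "ball (x - t *\<^sub>R n) t \<subseteq> {y \<in> V. f y < 0}"
    and s: "\<And>y. y \<in> ball x d \<Longrightarrow> f y > 0 \<Longrightarrow> closed_segment y (y + t *\<^sub>R n) \<subseteq> {y \<in> V. f y > 0}"
      "\<And>y. y \<in> ball x d \<Longrightarrow> f y < 0 \<Longrightarrow> closed_segment y (y - t *\<^sub>R n) \<subseteq> {y \<in> V. f y < 0}"
    and e: "\<And>y. y \<in> ball x d \<Longrightarrow> y + t *\<^sub>R n \<in> ball (x + t *\<^sub>R n) t" "\<And>y. y \<in> ball x d \<Longrightarrow> y - t *\<^sub>R n \<in> ball (x - t *\<^sub>R n) t"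
    by (rule local_defining_sides[OF LV x(1) V(2) zero_less_one]) blast
  have cU: "connected (closed_segment a b \<union> ball c t)" if "b \<in> ball c t" for a b c :: "real^3"
    using that by (intro connected_Un) (auto intro: convex_connected)
  have nz: "f' y \<noteq> 0" if "y \<in> V" "f y \<noteq> 0" for y using that zero by blast
  have side: "sgn (f' a) = sgn (f' b)"
    if "connected C" "C \<subseteq> {y \<in> V. f y > 0} \<or> C \<subseteq> {y \<in> V. f y < 0}" "a \<in> C" "b \<in> C" for C a b
  proof (rule sgn_constant_connected[OF that(1) _ _ that(3,4)])
    show "continuous_on C f'" using cont' that(2) by (intro continuous_on_subset[OF cont']) auto
    show "f' y \<noteq> 0" if "y \<in> C" for y
      using \<open>C \<subseteq> _ \<or> C \<subseteq> _\<close> that nz[of y] by force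
  qed
  have pos: "sgn (f' y) = sgn (f' (x + t *\<^sub>R n))" if y: "y \<in> ball x d" "f y > 0" for y
  proof (rule side[OF cU[OF e(1)[OF y(1)]]])
    show "closed_segment y (y + t *\<^sub>R n) \<union> ball (x + t *\<^sub>R n) t \<subseteq> {y \<in> V. f y > 0} \<or>
       closed_segment y (y + t *\<^sub>R n) \<union> ball (x + t *\<^sub>R n) t \<subseteq> {y \<in> V. f y < 0}"
      using Un_least[OF s(1)[OF y] b(1)] by blast
  qed (use t in auto)
  have neg: "sgn (f' y) = sgn (f' (x - t *\<^sub>R n))" if y: "y \<in> ball x d" "f y < 0" for y
  proof (rule side[OF cU[OF e(2)[OF y(1)]]])
    show "closed_segment y (y - t *\<^sub>R n) \<union> ball (x - t *\<^sub>R n) t \<subseteq> {y \<in> V. f y > 0} \<or>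
       closed_segment y (y - t *\<^sub>R n) \<union> ball (x - t *\<^sub>R n) t \<subseteq> {y \<in> V. f y < 0}"
      using Un_least[OF s(2)[OF y] b(2)] by blast
  qed (use t in auto)
  define cp where "cp = sgn (f' (x + t *\<^sub>R n))"
  define cm where "cm = sgn (f' (x - t *\<^sub>R n))"
  have "x + t *\<^sub>R n \<in> {y \<in> V. f y > 0}" "x - t *\<^sub>R n \<in> {y \<in> V. f y < 0}"
    using subsetD[OF b(1), of "x + t *\<^sub>R n"] subsetD[OF b(2), of "x - t *\<^sub>R n"] t by simp_all
  then have c1: "cp = 1 \<or> cp = -1" "cm = 1 \<or> cm = -1"
    using nz by (auto simp: cp_def cm_def sgn_if)
  have "cp \<noteq> cm"
  proof
    assume eq: "cp = cm"
    have fx: "f' x = 0" using zero(2) x V by blast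
    have same: "0 \<le> cp * f' y" if y: "y \<in> ball x d" for y
    proof -
      consider "f y > 0" | "f y < 0" | "f y = 0" by linarith
      then show ?thesis
      proof cases
        case 1
        then have "cp * f' y = \<bar>f' y\<bar>" using pos[OF y] by (simp add: cp_def abs_sgn mult.commute)
        then show ?thesis by simp
      next
        case 2
        then have "cp * f' y = \<bar>f' y\<bar>" using neg[OF y] eq by (simp add: cm_def abs_sgn mult.commute)
        then show ?thesis by simp
      next
        case 3
        have "y \<in> V" using dV y by blast
        then have "f' y = 0" using zero 3 by blast
        then show ?thesis by simp
      qed
    qed
    have d1: "(f' has_derivative (\<lambda>h. G' x \<bullet> h)) (at x)" and G0: "G' x \<noteq> 0"
      using L(2) x unfolding local_defining_def by auto
    have "(\<forall>y\<in>ball x d. f' y \<le> f' x) \<or> (\<forall>y\<in>ball x d. f' x \<le> f' y)"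
      using c1(1)
    proof
      assume "cp = 1"
      then have "\<forall>y\<in>ball x d. f' x \<le> f' y" using same fx by simp
      then show ?thesis ..
    next
      assume "cp = - 1"
      then have "\<forall>y\<in>ball x d. f' y \<le> f' x" using same fx by simp
      then show ?thesis ..
    qed
    then have "(\<lambda>h. G' x \<bullet> h) = (\<lambda>h. 0)"
      using t by (intro differential_zero_maxmin[OF _ open_ball d1]) auto
    then have "G' x \<bullet> G' x = 0" by metis
    then show False using G0 by simp
  qed
  then have cm: "cm = - cp" using c1 by auto
  show ?thesis
  proof (rule that[of d cp])
    fix y assume y: "y \<in> ball x d - S"
    then have "f y \<noteq> 0" using zero dV by blast
    then consider "f y > 0" | "f y < 0" by linarith
    then show "sgn (f' y) = cp * sgn (f y)"
      using pos[of y] neg[of y] y cm by cases (auto simp: cp_def cm_def)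
  qed (use t c1 in auto)
qed

text \<open>Moving along the normal leaves the surface: the centre of a small touching ball is off
  \<open>S\<close>.\<close>

lemma closed_surface_empty_interior:
  assumes "closed_surface S" "e > 0"
  shows "\<exists>y \<in> ball x e. y \<notin> (S :: (real^3) set)"
proof (cases "x \<in> S")
  case True
  obtain U f G where U: "x \<in> U" "local_defining S U f G" using closed_surface_local_defining[OF assms(1) True] .
  obtain n t d where n: "norm n = 1" and t: "t > 0" "t < e" and b: "ball (x + t *\<^sub>R n) t \<subseteq> {y \<in> U. f y > 0}"
    by (rule local_defining_sides[OF U(2) True U(1) assms(2)]) blast
  have "x + t *\<^sub>R n \<in> {y \<in> U. f y > 0}" using subsetD[OF b, of "x + t *\<^sub>R n"] t by simp
  then have "x + t *\<^sub>R n \<notin> S" using U(2) unfolding local_defining_def by force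
  then show ?thesis using n t by (intro bexI[of _ "x + t *\<^sub>R n"]) (auto simp: dist_norm)
qed (use assms in auto)

text \<open>A sign section is a \<open>\<plusminus>1\<close>-valued function that is locally constant off \<open>S\<close> and changes sign
  across \<open>S\<close>.  Sections exist locally and are unique up to sign on connected sets, so they can be
  glued along boxes; a global one makes \<open>S\<close> separate its two sides.\<close>

definition local_sign :: "(real^3) set \<Rightarrow> (real^3 \<Rightarrow> real) \<Rightarrow> real^3 \<Rightarrow> bool" where
  "local_sign S g x \<longleftrightarrow> (x \<notin> S \<and> g = (\<lambda>_. 1)) \<or> (x \<in> S \<and> (\<exists>U G. x \<in> U \<and> local_defining S U g G))"

definition sign_section :: "(real^3) set \<Rightarrow> (real^3) set \<Rightarrow> (real^3 \<Rightarrow> real) \<Rightarrow> bool" where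
  "sign_section S V s \<longleftrightarrow> (\<forall>x\<in>V. \<exists>g e c. e > 0 \<and> (c = 1 \<or> c = -1) \<and> local_sign S g x \<and>
     (\<forall>y\<in>ball x e - S. s y = c * sgn (g y)))"

lemma local_sign_compat:
  assumes "local_sign S g x" "local_sign S g' x"
  obtains e c where "e > 0" "c = 1 \<or> c = (-1::real)" "\<And>y. y \<in> ball x e - S \<Longrightarrow> sgn (g' y) = c * sgn (g y)"
proof (cases "x \<in> S")
  case True
  obtain U G U' G' where "x \<in> U" "local_defining S U g G" "x \<in> U'" "local_defining S U' g' G'"
    using assms True unfolding local_sign_def by blast
  then show ?thesis using local_defining_sgn[of S U g G U' g' G' x] True that by blast
next
  case False
  then show ?thesis using assms that[of 1 1] unfolding local_sign_def by auto
qed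

text \<open>The points near which s = s' and those near which s = -s' form open sets that cover
  \<open>V\<close>. They are disjoint because \<open>S\<close> has empty interior, so connectedness
  leaves only one of them.\<close>

lemma sign_section_unique:
  assumes S: "closed_surface S" and V: "open V" "connected V"
    and s: "sign_section S V s" "sign_section S V s'"
  obtains c where "c = 1 \<or> c = (-1::real)" "\<And>y. y \<in> V - S \<Longrightarrow> s y = c * s' y"
proof -
  define A where "A c = {x \<in> V. \<exists>e>0. \<forall>y\<in>ball x e - S. s y = c * s' y}" for c :: real
  have inA: "s y = c * s' y" if yA: "y \<in> A c" "y \<notin> S" for y c
  proof -
    obtain e where "e > 0" "\<forall>z\<in>ball y e - S. s z = c * s' z" using yA(1) by (auto simp: A_def)
    then show ?thesis using yA(2) by simp
  qed
  have op: "open (A c)" for c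
    unfolding open_contains_ball
  proof
    fix x assume "x \<in> A c"
    then obtain e where e: "e > 0" "\<forall>y\<in>ball x e - S. s y = c * s' y" and x: "x \<in> V" by (auto simp: A_def)
    obtain e' where e': "e' > 0" "ball x e' \<subseteq> V" using V(1) x open_contains_ball by blast
    have "ball x (min (e/2) e') \<subseteq> A c"
    proof
      fix z assume z: "z \<in> ball x (min (e/2) e')"
      have "ball z (e/2) \<subseteq> ball x e"
      proof
        fix y assume "y \<in> ball z (e/2)"
        then show "y \<in> ball x e" using z dist_triangle[of x y z] by simp
      qed
      then show "z \<in> A c" using z e e' by (auto simp: A_def intro!: exI[of _ "e/2"])
    qed
    then show "\<exists>e>0. ball x e \<subseteq> A c" using e e' by (intro exI[of _ "min (e/2) e'"]) auto
  qed
  have cover: "V \<subseteq> A 1 \<union> A (-1)"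
  proof
    fix x assume x: "x \<in> V"
    obtain g e c where g: "e > 0" "c = 1 \<or> c = -1" "local_sign S g x" "\<forall>y\<in>ball x e - S. s y = c * sgn (g y)"
      using s(1) x unfolding sign_section_def by blast
    obtain g' e' c' where g': "e' > 0" "c' = 1 \<or> c' = -1" "local_sign S g' x" "\<forall>y\<in>ball x e' - S. s' y = c' * sgn (g' y)"
      using s(2) x unfolding sign_section_def by blast
    obtain e'' c'' where k: "e'' > 0" "c'' = 1 \<or> c'' = (-1::real)" "\<And>y. y \<in> ball x e'' - S \<Longrightarrow> sgn (g' y) = c'' * sgn (g y)"
      using local_sign_compat[OF g(3) g'(3)] by blast
    have eq: "s y = (c * c' * c'') * s' y" if "y \<in> ball x (min e (min e' e'')) - S" for y
      using that g(2,4) g'(2,4) k(2) k(3)[of y] by auto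
    have "c * c' * c'' = 1 \<or> c * c' * c'' = -1" using g(2) g'(2) k(2) by auto
    then show "x \<in> A 1 \<union> A (-1)"
    proof
      assume "c * c' * c'' = 1"
      then have "x \<in> A 1" unfolding A_def using x eq g(1) g'(1) k(1)
        by (intro CollectI conjI exI[of _ "min e (min e' e'')"]) auto
      then show ?thesis by blast
    next
      assume "c * c' * c'' = -1"
      then have "x \<in> A (-1)" unfolding A_def using x eq g(1) g'(1) k(1)
        by (intro CollectI conjI exI[of _ "min e (min e' e'')"]) auto
      then show ?thesis by blast
    qed
  qed
  have pm: "s' y \<noteq> 0" if "y \<in> V - S" for y
  proof -
    obtain g e c where "e > 0" "c = 1 \<or> c = -1" "local_sign S g y" "\<forall>z\<in>ball y e - S. s' z = c * sgn (g z)"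
      using s(2) \<open>y \<in> V - S\<close> unfolding sign_section_def by blast
    then show ?thesis using that by (auto simp: local_sign_def)
  qed
  have disj: "A 1 \<inter> A (-1) \<inter> V = {}"
  proof (rule ccontr)
    assume "\<not> ?thesis"
    then obtain x e e' where x: "x \<in> V" "e > 0" "\<forall>y\<in>ball x e - S. s y = 1 * s' y"
       "e' > 0" "\<forall>y\<in>ball x e' - S. s y = -1 * s' y" unfolding A_def by blast
    obtain e'' where e'': "e'' > 0" "ball x e'' \<subseteq> V" using V(1) x open_contains_ball by blast
    obtain y where "y \<in> ball x (min e (min e' e''))" "y \<notin> S"
      using closed_surface_empty_interior[OF S, of "min e (min e' e'')" x] x e'' by auto
    then have y: "y \<in> ball x e - S" "y \<in> ball x e' - S" "y \<in> V - S" using e''(2) by auto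
    have "s y = 1 * s' y" "s y = -1 * s' y" using x(3,5) y(1,2) by blast+
    then show False using pm[OF y(3)] by simp
  qed
  have "A 1 \<inter> V = {} \<or> A (-1) \<inter> V = {}"
    using connectedD[OF V(2) op op disj cover] .
  then have "V \<subseteq> A (-1) \<or> V \<subseteq> A 1" using cover by blast
  then show ?thesis
  proof
    assume "V \<subseteq> A (-1)"
    then have "s y = -1 * s' y" if "y \<in> V - S" for y using that inA[of y "-1"] by blast
    then show ?thesis using that[of "-1"] by blast
  next
    assume "V \<subseteq> A 1"
    then have "s y = 1 * s' y" if "y \<in> V - S" for y using that inA[of y 1] by blast
    then show ?thesis using that[of 1] by blast
  qed
qed

lemma sign_section_cong:
  assumes "sign_section S V s" "open W" "W \<subseteq> V" "c = 1 \<or> c = (-1::real)" "\<And>y. y \<in> W - S \<Longrightarrow> s' y = c * s y"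
  shows "sign_section S W s'"
  unfolding sign_section_def
proof
  fix x assume x: "x \<in> W"
  then obtain g e k where g: "e > 0" "k = 1 \<or> k = (-1::real)" "local_sign S g x" "\<forall>y\<in>ball x e - S. s y = k * sgn (g y)"
    using assms(1,3) unfolding sign_section_def by blast
  obtain d where d: "d > 0" "ball x d \<subseteq> W" using assms(2) x open_contains_ball by blast
  have "\<forall>y\<in>ball x (min e d) - S. s' y = (c * k) * sgn (g y)"
    using assms(5) g(4) d(2) by auto
  moreover have "c * k = 1 \<or> c * k = -1" using g(2) assms(4) by auto
  ultimately show "\<exists>g e c. e > 0 \<and> (c = 1 \<or> c = -1) \<and> local_sign S g x \<and> (\<forall>y\<in>ball x e - S. s' y = c * sgn (g y))"
    using g(1,3) d(1) by (intro exI[of _ g] exI[of _ "min e d"] exI[of _ "c * k"]) auto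
qed

lemma sign_section_Un:
  assumes "sign_section S V s" "sign_section S W s"
  shows "sign_section S (V \<union> W) s"
  using assms unfolding sign_section_def by blast

text \<open>On the connected overlap the two sections differ by a constant sign, which is corrected
  before pasting.\<close>

lemma sign_section_glue:
  assumes S: "closed_surface S" and V: "open V" "open W" "connected (V \<inter> W)"
    and s: "sign_section S V s" "sign_section S W s'"
  shows "\<exists>s. sign_section S (V \<union> W) s"
proof -
  have "sign_section S (V \<inter> W) s" "sign_section S (V \<inter> W) s'"
    by (rule sign_section_cong[OF s(1), where c=1] sign_section_cong[OF s(2), where c=1]; use V in auto)+
  then obtain c where c: "c = 1 \<or> c = (-1::real)" "\<And>y. y \<in> V \<inter> W - S \<Longrightarrow> s y = c * s' y"
    using sign_section_unique[OF S open_Int[OF V(1,2)] V(3)] by metis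
  define r where "r y = (if y \<in> V then s y else c * s' y)" for y
  have "sign_section S V r"
    by (rule sign_section_cong[OF s(1) V(1), where c=1]) (auto simp: r_def)
  moreover have "sign_section S W r"
    by (rule sign_section_cong[OF s(2) V(2), where c=c]) (use c in \<open>auto simp: r_def\<close>)
  ultimately show ?thesis using sign_section_Un by blast
qed

lemma sign_section_local:
  assumes S: "closed_surface S"
  shows "\<exists>V s. open V \<and> x \<in> V \<and> sign_section S V s"
proof (cases "x \<in> S")
  case True
  obtain U f G where U: "x \<in> U" "local_defining S U f G" using closed_surface_local_defining[OF S True] .
  have opU: "open U" and zero: "S \<inter> U = {x \<in> U. f x = 0}" using U(2) by (auto simp: local_defining_def)
  have "sign_section S U (\<lambda>y. sgn (f y))"
    unfolding sign_section_def
  proof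
    fix y assume y: "y \<in> U"
    show "\<exists>g e c. e > 0 \<and> (c = 1 \<or> c = -1) \<and> local_sign S g y \<and> (\<forall>z\<in>ball y e - S. sgn (f z) = c * sgn (g z))"
    proof (cases "y \<in> S")
      case True
      then have "local_sign S f y" using U y unfolding local_sign_def by blast
      then show ?thesis by (intro exI[of _ f] exI[of _ 1]) auto
    next
      case False
      then have fy: "f y \<noteq> 0" using zero y by blast
      have "isCont f y" using U(2) y unfolding local_defining_def by (meson has_derivative_continuous)
      then obtain e where e: "e > 0" "\<And>z. dist z y < e \<Longrightarrow> dist (f z) (f y) < \<bar>f y\<bar>"
        using fy unfolding continuous_at_eps_delta by (meson zero_less_abs_iff)
      have near: "sgn (f z) = sgn (f y)" if "z \<in> ball y e" for z
        using e(2)[of z] that by (auto simp: dist_commute dist_real_def sgn_if abs_if split: if_splits)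
      show ?thesis
      proof (rule exI[of _ "\<lambda>_. 1"], rule exI[of _ e], rule exI[of _ "sgn (f y)"], intro conjI ballI)
        show "sgn (f y) = 1 \<or> sgn (f y) = -1" using fy by (auto simp: sgn_if)
        show "local_sign S (\<lambda>_. 1) y" using False by (simp add: local_sign_def)
        show "sgn (f z) = sgn (f y) * sgn 1" if "z \<in> ball y e - S" for z using near that by simp
      qed (rule e(1))
    qed
  qed
  then show ?thesis using opU U(1) by blast
next
  case False
  have "closed S" using S by (simp add: closed_surface_def compact_imp_closed)
  have "sign_section S (- S) (\<lambda>_. 1)"
    unfolding sign_section_def
    by (intro ballI exI[of _ "\<lambda>_. 1"] exI[of _ 1]) (auto simp: local_sign_def)
  then show ?thesis using False \<open>closed S\<close> by (intro exI[of _ "- S"]) auto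
qed

text \<open>Boxes smaller than a Lebesgue number of the cover by domains of local sections carry a
  section. The directions in which a box may be long, collected in \<open>J\<close>, are released
  one at a time, and in such a direction the box is built up from overlapping pieces. Gluing applies
  because two boxes meet in a convex set.\<close>

lemma sign_section_boxes:
  fixes N :: real
  assumes S: "closed_surface S"
  obtains s where "sign_section S (box (- N *\<^sub>R One) (N *\<^sub>R One)) s"
proof -
  define Q where "Q = cbox (- N *\<^sub>R One) (N *\<^sub>R One :: real^3)"
  define C where "C = {V. open V \<and> (\<exists>s. sign_section S V s)}"
  have "C \<noteq> {}" "Q \<subseteq> \<Union>C" "\<And>B. B \<in> C \<Longrightarrow> open B"
    using sign_section_local[OF S] unfolding C_def by blast+
  then obtain \<delta> where \<delta>: "\<delta> > 0" "\<And>T. T \<subseteq> Q \<Longrightarrow> diameter T < \<delta> \<Longrightarrow> \<exists>B\<in>C. T \<subseteq> B"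
    using Lebesgue_number_lemma[of Q C] unfolding Q_def by (metis compact_cbox)
  \<comment> \<open>Three sides of length at most \<eta> give diameter at most 3 \<eta> =
    \<delta>/2.\<close>
  define \<eta> where "\<eta> = \<delta> / 6"
  have \<eta>: "\<eta> > 0" using \<delta> by (simp add: \<eta>_def)
  have restr: "\<exists>s. sign_section S W s" if W: "W \<subseteq> V" "open W" "V \<in> C" for V W
  proof -
    obtain s where "sign_section S V s" using W(3) unfolding C_def by blast
    from sign_section_cong[OF this W(2,1), of 1 s] show ?thesis by auto
  qed
  have main: "\<exists>s. sign_section S (box a b) s"
    if "J \<subseteq> Basis" "box a b \<subseteq> Q" "\<And>i. i \<in> Basis - J \<Longrightarrow> (b - a) \<bullet> i \<le> \<eta>" for J :: "(real^3) set" and a b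
  proof -
    have "finite J" by (rule finite_subset[OF that(1) finite_Basis])
    then show ?thesis using that
    proof (induction J arbitrary: a b)
      case empty
      have "norm (x - y) \<le> 3 * \<eta>" if "x \<in> box a b" "y \<in> box a b" for x y
      proof -
        have "norm (x - y) \<le> (\<Sum>i\<in>Basis. \<bar>(x - y) \<bullet> i\<bar>)" by (rule norm_le_l1)
        also have "\<dots> \<le> (\<Sum>i\<in>(Basis :: (real^3) set). \<eta>)"
        proof (rule sum_mono)
          fix i :: "real^3" assume i: "i \<in> Basis"
          have "a \<bullet> i < x \<bullet> i" "x \<bullet> i < b \<bullet> i" "a \<bullet> i < y \<bullet> i" "y \<bullet> i < b \<bullet> i"
            using that i by (auto simp: mem_box)
          then show "\<bar>(x - y) \<bullet> i\<bar> \<le> \<eta>"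
            using empty(3)[of i] i by (simp add: inner_diff_left)
        qed
        finally show ?thesis by simp
      qed
      then have "diameter (box a b) \<le> 3 * \<eta>" using \<eta> by (intro diameter_le) auto
      then have "diameter (box a b) < \<delta>" using \<delta> by (simp add: \<eta>_def)
      then show ?case using \<delta>(2)[OF empty(2)] restr open_box by blast
    next
      case (insert k J)
      have k: "k \<in> Basis" using insert by auto
      \<comment> \<open>\<open>n\<close> counts the half steps of length \<eta>/2 by which the box
        may exceed \<eta> in direction \<open>k\<close>.\<close>
      have step: "\<exists>s. sign_section S (box a b) s"
        if "box a b \<subseteq> Q" "\<And>i. i \<in> Basis - insert k J \<Longrightarrow> (b - a) \<bullet> i \<le> \<eta>" "(b - a) \<bullet> k \<le> \<eta> + real n * (\<eta> / 2)" for n a b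
        using that
      proof (induction n arbitrary: a b)
        case 0
        show ?case by (rule insert.IH) (use 0 insert in auto)
      next
        case (Suc n)
        \<comment> \<open>The two boxes overlap in a slab of width \<eta>/2. The first is shorter by
          one half step and falls under the inner induction; the second has length \<eta> in
          direction \<open>k\<close> and falls under the outer one.\<close>
        define b1 where "b1 = b - (\<eta> / 2) *\<^sub>R k"
        define a2 where "a2 = a + ((b - a) \<bullet> k - \<eta>) *\<^sub>R k"
        have kk: "k \<bullet> i = (if i = k then 1 else 0)" if "i \<in> Basis" for i
          using that k by (simp add: inner_Basis inner_commute)
        show ?case
        proof (cases "(b - a) \<bullet> k \<le> \<eta>")
          case True
          show ?thesis by (rule insert.IH) (use Suc True insert in auto)
        next
          case False
          have b1i: "b1 \<bullet> i = (if i = k then b \<bullet> k - \<eta> / 2 else b \<bullet> i)" if "i \<in> Basis" for i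
            using kk[OF that] by (simp add: b1_def inner_diff_left)
          have a2i: "a2 \<bullet> i = (if i = k then b \<bullet> k - \<eta> else a \<bullet> i)" if "i \<in> Basis" for i
            using kk[OF that] by (simp add: a2_def inner_diff_left inner_add_left)
          have un: "box a b1 \<union> box a2 b = box a b"
          proof (rule set_eqI)
            fix x
            show "x \<in> box a b1 \<union> box a2 b \<longleftrightarrow> x \<in> box a b"
            proof
              assume "x \<in> box a b1 \<union> box a2 b"
              then show "x \<in> box a b"
              proof
                assume x: "x \<in> box a b1"
                show ?thesis unfolding mem_box
                proof
                  fix i :: "real^3" assume i: "i \<in> Basis"
                  then show "a \<bullet> i < x \<bullet> i \<and> x \<bullet> i < b \<bullet> i"
                    using x \<eta> unfolding mem_box by (force simp: b1i split: if_splits)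
                qed
              next
                assume x: "x \<in> box a2 b"
                show ?thesis unfolding mem_box
                proof
                  fix i :: "real^3" assume i: "i \<in> Basis"
                  then show "a \<bullet> i < x \<bullet> i \<and> x \<bullet> i < b \<bullet> i"
                    using x False unfolding mem_box by (force simp: a2i inner_diff_left split: if_splits)
                qed
              qed
            next
              assume x: "x \<in> box a b"
              show "x \<in> box a b1 \<union> box a2 b"
              proof (cases "x \<bullet> k < b \<bullet> k - \<eta> / 2")
                case True
                then have "x \<in> box a b1" using x unfolding mem_box by (simp add: b1i)
                then show ?thesis by blast
              next
                case False
                then have "x \<in> box a2 b" using x \<eta> unfolding mem_box by (simp add: a2i)
                then show ?thesis by blast
              qed
            qed
          qed
          have "\<exists>s. sign_section S (box a b1) s"
          proof (rule Suc.IH)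
            show "box a b1 \<subseteq> Q" using un Suc by blast
            show "(b1 - a) \<bullet> i \<le> \<eta>" if "i \<in> Basis - insert k J" for i
              using Suc(3)[OF that] that by (auto simp: inner_diff_left b1i)
            show "(b1 - a) \<bullet> k \<le> \<eta> + real n * (\<eta> / 2)"
              using Suc(4) k by (simp add: inner_diff_left b1i field_simps)
          qed
          moreover have "\<exists>s. sign_section S (box a2 b) s"
          proof (rule insert.IH)
            show "J \<subseteq> Basis" using insert by auto
            show "box a2 b \<subseteq> Q" using un Suc by blast
            show "(b - a2) \<bullet> i \<le> \<eta>" if "i \<in> Basis - J" for i
              using Suc(3)[of i] that by (cases "i = k") (auto simp: inner_diff_left a2i)
          qed
          moreover have "connected (box a b1 \<inter> box a2 b)"
            by (intro convex_connected convex_Int convex_box)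
          ultimately show ?thesis
            using sign_section_glue[OF S open_box open_box] un by metis
        qed
      qed
      obtain n where "(b - a) \<bullet> k \<le> real n * (\<eta> / 2)"
        using \<eta> real_arch_simple[of "(b - a) \<bullet> k / (\<eta> / 2)"] by (auto simp: pos_divide_le_eq)
      then show ?case using step[of a b n] insert.prems \<eta> by auto
    qed
  qed
  have "\<exists>s. sign_section S (box (- N *\<^sub>R One) (N *\<^sub>R One)) s"
    by (rule main[of Basis]) (auto simp: Q_def box_subset_cbox)
  then show ?thesis using that by blast
qed

text \<open>The part of the Jordan--Brouwer theorem needed here: a connected open set cannot lie on
  both sides of a closed surface.\<close>

theorem closed_surface_not_both_sides:
  assumes S: "closed_surface S" and \<Omega>: "open \<Omega>" "connected \<Omega>" "bounded \<Omega>" "\<Omega> \<inter> S = {}"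
    and p: "p \<in> S" "e > 0"
  shows "\<not> ball p e - S \<subseteq> (\<Omega> :: (real^3) set)"
proof
  assume sub: "ball p e - S \<subseteq> \<Omega>"
  have "bounded (insert p \<Omega>)" using \<Omega>(3) by simp
  then obtain N where N: "\<And>x. x \<in> insert p \<Omega> \<Longrightarrow> norm x < N" using bounded_pos_less by metis
  have inbox: "insert p \<Omega> \<subseteq> box (- N *\<^sub>R One) (N *\<^sub>R One)"
  proof
    fix x assume "x \<in> insert p \<Omega>"
    then have "\<bar>x \<bullet> i\<bar> < N" if "i \<in> Basis" for i
      using N[of x] Basis_le_norm[OF that, of x] by linarith
    then show "x \<in> box (- N *\<^sub>R One) (N *\<^sub>R One)"
      by (auto simp: mem_box abs_less_iff minus_less_iff)
  qed
  obtain s where s: "sign_section S (box (- N *\<^sub>R One) (N *\<^sub>R One)) s"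
    using sign_section_boxes[OF S] by blast
  \<comment> \<open>Since \<open>\<Omega>\<close> is connected and misses \<open>S\<close>, the
    global section is constant on it; but at \<open>p\<close> it changes sign across
    \<open>S\<close>, and both sides belong to \<open>\<Omega>\<close>.\<close>
  have "sign_section S \<Omega> s"
    by (rule sign_section_cong[OF s \<Omega>(1), where c=1]) (use inbox in auto)
  moreover have "sign_section S \<Omega> (\<lambda>_. 1)"
    unfolding sign_section_def
    by (intro ballI exI[of _ "\<lambda>_. 1"] exI[of _ 1]) (use \<Omega>(4) in \<open>auto simp: local_sign_def\<close>)
  ultimately obtain c where c: "\<And>y. y \<in> \<Omega> - S \<Longrightarrow> s y = c * 1"
    using sign_section_unique[OF S \<Omega>(1,2)] by metis
  obtain g d k where g: "d > 0" "k = 1 \<or> k = (-1::real)" "local_sign S g p" "\<forall>y\<in>ball p d - S. s y = k * sgn (g y)"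
    using s inbox unfolding sign_section_def by blast
  obtain U G where U: "p \<in> U" "local_defining S U g G" using g(3) p unfolding local_sign_def by blast
  define e' where "e' = min d e"
  have e': "e' > 0" using g p by (simp add: e'_def)
  obtain n t where n: "norm n = 1" and t: "t > 0" "t < e'"
    and b: "ball (p + t *\<^sub>R n) t \<subseteq> {y \<in> U. g y > 0}" "ball (p - t *\<^sub>R n) t \<subseteq> {y \<in> U. g y < 0}"
    by (rule local_defining_sides[OF U(2) p(1) U(1) e']) blast
  have z: "p + t *\<^sub>R n \<in> {y \<in> U. g y > 0}" "p - t *\<^sub>R n \<in> {y \<in> U. g y < 0}"
    using subsetD[OF b(1), of "p + t *\<^sub>R n"] subsetD[OF b(2), of "p - t *\<^sub>R n"] t by simp_all
  then have "p + t *\<^sub>R n \<notin> S" "p - t *\<^sub>R n \<notin> S" using U(2) unfolding local_defining_def by force+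
  moreover have "p + t *\<^sub>R n \<in> ball p e'" "p - t *\<^sub>R n \<in> ball p e'" using n t by (auto simp: dist_norm)
  ultimately have off: "p + t *\<^sub>R n \<in> ball p e' - S" "p - t *\<^sub>R n \<in> ball p e' - S" by blast+
  have balls: "ball p e' \<subseteq> ball p d" "ball p e' \<subseteq> ball p e" by (auto simp: e'_def)
  have "s (p + t *\<^sub>R n) = k * sgn (g (p + t *\<^sub>R n))" "s (p - t *\<^sub>R n) = k * sgn (g (p - t *\<^sub>R n))"
    using g(4) off balls(1) by blast+
  moreover have "s (p + t *\<^sub>R n) = c * 1" "s (p - t *\<^sub>R n) = c * 1"
    using c sub off balls(2) by blast+
  ultimately have "k = - k" using z by simp
  then show False using g(2) by auto
qed

section \<open>The Schwarzschild metric\<close>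

text \<open>The gradient and Hessian fields are explicit arguments, so that the product and quotient
  rules produce Hessians whose traces can be computed.\<close>

definition C2_at :: "('a::euclidean_space \<Rightarrow> real) \<Rightarrow> ('a \<Rightarrow> 'a) \<Rightarrow> ('a \<Rightarrow> 'a \<Rightarrow> 'a) \<Rightarrow> 'a \<Rightarrow> bool" where
  "C2_at f G H x \<longleftrightarrow> (f has_derivative (\<lambda>h. G x \<bullet> h)) (at x) \<and> (G has_derivative H x) (at x) \<and>
     (\<forall>h. isCont (\<lambda>z. H z h) x)"

lemma harmonic_at_iff_C2:
  "harmonic_at f x \<longleftrightarrow> (\<exists>e>0. \<exists>G H. \<forall>y\<in>ball x e. C2_at f G H y \<and> trace_op (H y) = 0)"
  unfolding harmonic_at_def C2_at_def by meson

lemma C2_at_isCont: "C2_at f G H x \<Longrightarrow> isCont f x" "C2_at f G H x \<Longrightarrow> isCont G x"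
  unfolding C2_at_def using has_derivative_continuous by blast+

lemma C2_at_add:
  assumes "C2_at f G H x" "C2_at f' G' H' x"
  shows "C2_at (\<lambda>x. f x + f' x) (\<lambda>x. G x + G' x) (\<lambda>x h. H x h + H' x h) x"
  using assms unfolding C2_at_def inner_add_left
  by (auto intro!: has_derivative_add continuous_intros)

lemma C2_at_mult:
  assumes "C2_at f G H x" "C2_at f' G' H' x"
  shows "C2_at (\<lambda>x. f x * f' x) (\<lambda>x. f x *\<^sub>R G' x + f' x *\<^sub>R G x)
    (\<lambda>x h. f x *\<^sub>R H' x h + (G x \<bullet> h) *\<^sub>R G' x + (f' x *\<^sub>R H x h + (G' x \<bullet> h) *\<^sub>R G x)) x"
proof -
  have f: "(f has_derivative (\<lambda>h. G x \<bullet> h)) (at x)" "(G has_derivative H x) (at x)" "\<And>h. isCont (\<lambda>z. H z h) x"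
    and f': "(f' has_derivative (\<lambda>h. G' x \<bullet> h)) (at x)" "(G' has_derivative H' x) (at x)" "\<And>h. isCont (\<lambda>z. H' z h) x"
    using assms unfolding C2_at_def by auto
  have "((\<lambda>x. f x * f' x) has_derivative (\<lambda>h. (f x *\<^sub>R G' x + f' x *\<^sub>R G x) \<bullet> h)) (at x)"
    by (rule has_derivative_eq_rhs[OF has_derivative_mult[OF f(1) f'(1)]]) (simp add: fun_eq_iff inner_add_left mult.commute)
  moreover have "((\<lambda>x. f x *\<^sub>R G' x + f' x *\<^sub>R G x) has_derivative
     (\<lambda>h. f x *\<^sub>R H' x h + (G x \<bullet> h) *\<^sub>R G' x + (f' x *\<^sub>R H x h + (G' x \<bullet> h) *\<^sub>R G x))) (at x)"
    by (intro has_derivative_add has_derivative_scaleR f f')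
  moreover have "isCont (\<lambda>x. f x *\<^sub>R H' x h + (G x \<bullet> h) *\<^sub>R G' x + (f' x *\<^sub>R H x h + (G' x \<bullet> h) *\<^sub>R G x)) x" for h
    by (intro continuous_intros f(3) f'(3) C2_at_isCont[OF assms(1)] C2_at_isCont[OF assms(2)])
  ultimately show ?thesis
    unfolding C2_at_def by blast
qed

lemma C2_at_inverse:
  assumes "C2_at f G H x" "f x \<noteq> 0"
  shows "C2_at (\<lambda>x. inverse (f x)) (\<lambda>x. (- (inverse (f x) ^ 2)) *\<^sub>R G x)
    (\<lambda>x h. (- (inverse (f x) ^ 2)) *\<^sub>R H x h + (2 * inverse (f x) ^ 3 * (G x \<bullet> h)) *\<^sub>R G x) x"
proof -
  have f: "(f has_derivative (\<lambda>h. G x \<bullet> h)) (at x)" "(G has_derivative H x) (at x)" "\<And>h. isCont (\<lambda>z. H z h) x"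
    using assms unfolding C2_at_def by auto
  have a: "((\<lambda>x. inverse (f x)) has_derivative (\<lambda>h. ((- (inverse (f x) ^ 2)) *\<^sub>R G x) \<bullet> h)) (at x)"
    by (rule has_derivative_eq_rhs[OF Deriv.has_derivative_inverse[OF assms(2) f(1)]])
      (simp add: fun_eq_iff power2_eq_square)
  have "((\<lambda>x. - (inverse (f x) ^ 2)) has_derivative (\<lambda>h. 2 * inverse (f x) ^ 3 * (G x \<bullet> h))) (at x)"
    unfolding power2_eq_square
    by (rule has_derivative_eq_rhs[OF has_derivative_minus[OF has_derivative_mult[OF a a]]])
      (simp add: fun_eq_iff power2_eq_square power3_eq_cube)
  from has_derivative_scaleR[OF this f(2)]
  have "((\<lambda>x. (- (inverse (f x) ^ 2)) *\<^sub>R G x) has_derivative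
    (\<lambda>h. (- (inverse (f x) ^ 2)) *\<^sub>R H x h + (2 * inverse (f x) ^ 3 * (G x \<bullet> h)) *\<^sub>R G x)) (at x)" .
  moreover have "isCont (\<lambda>x. (- (inverse (f x) ^ 2)) *\<^sub>R H x h + (2 * inverse (f x) ^ 3 * (G x \<bullet> h)) *\<^sub>R G x) x" for h
    by (intro continuous_intros f(3) C2_at_isCont[OF assms(1)] assms(2))
  ultimately show ?thesis
    unfolding C2_at_def using a by blast
qed

lemma trace_op_vec: "trace_op L = (\<Sum>i\<in>UNIV. L (axis i 1) $ i)" for L :: "real^'n \<Rightarrow> real^'n"
proof -
  have B: "(Basis :: (real^'n) set) = (\<lambda>i. axis i 1) ` UNIV" by (auto simp: Basis_vec_def)
  have inj: "inj (\<lambda>i::'n. axis i (1::real))" by (auto simp: inj_def axis_eq_axis)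
  show ?thesis
    unfolding trace_op_def B sum.reindex[OF inj] by (simp add: inner_axis)
qed

lemma partial_has_derivative:
  assumes "(f has_derivative f') (at x)"
  shows "partial i f x = f' (axis i 1)"
  using frechet_derivative_at[OF assms] by (simp add: partial_def)

lemma has_derivative_vec_nth:
  "(G has_derivative G') F \<Longrightarrow> ((\<lambda>y. G y $ i) has_derivative (\<lambda>h. G' h $ i)) F"
  by (rule bounded_linear.has_derivative[OF bounded_linear_vec_nth])

text \<open>Passes from gradient and Hessian fields to iterated partial derivatives. The fields are
  only asked for near each point, which is the form in which harmonicity supplies them.\<close>

lemma Ck_on_2I:
  fixes f :: "real^'n \<Rightarrow> real"
  assumes U: "open U" and f: "\<And>x. x \<in> U \<Longrightarrow> \<exists>e>0. \<exists>G H. \<forall>y\<in>ball x e. C2_at f G H y"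
  shows "Ck_on 2 U f"
proof -
  have key: "f differentiable (at x) \<and> partial i f differentiable (at x) \<and> isCont (partial j (partial i f)) x" if x: "x \<in> U" for x i j
  proof -
    obtain e G H where e: "e > 0" and C: "\<And>y. y \<in> ball x e \<Longrightarrow> C2_at f G H y" using f[OF x] by blast
    have p1: "partial i f y = G y $ i" if "y \<in> ball x e" for y
      using partial_eq[of f "G y" y] C[OF that] unfolding C2_at_def by blast
    have d2: "(partial i f has_derivative (\<lambda>h. H y h $ i)) (at y)" if "y \<in> ball x e" for y
    proof -
      have "((\<lambda>y. G y $ i) has_derivative (\<lambda>h. H y h $ i)) (at y)"
        using C[OF that] unfolding C2_at_def by (intro has_derivative_vec_nth) blast
      then show ?thesis
        by (rule has_derivative_transform_within_open[OF _ open_ball that]) (simp add: p1)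
    qed
    have p2: "partial j (partial i f) y = H y (axis j 1) $ i" if "y \<in> ball x e" for y
      using partial_has_derivative[OF d2[OF that]] by simp
    have "isCont (\<lambda>y. H y (axis j 1) $ i) x"
      using C[of x] e unfolding C2_at_def by (auto intro!: continuous_intros)
    moreover have "\<forall>\<^sub>F y in nhds x. partial j (partial i f) y = H y (axis j 1) $ i"
    proof -
      have "\<forall>\<^sub>F y in nhds x. y \<in> ball x e" using e by (intro eventually_nhds_in_open) auto
      then show ?thesis by eventually_elim (rule p2)
    qed
    ultimately have "isCont (partial j (partial i f)) x"
      using isCont_cong[of "partial j (partial i f)" "\<lambda>y. H y (axis j 1) $ i" x] by blast
    then show ?thesis
      using d2[of x] C[of x] e unfolding C2_at_def differentiable_def by auto
  qed
  then show ?thesis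
    using U by (auto simp: numeral_2_eq_2 differentiable_on_eq_differentiable_at intro!: continuous_at_imp_continuous_on)
qed

lemma Ck_on_2D:
  fixes f :: "real^'n \<Rightarrow> real"
  assumes "Ck_on 2 U f" "open U" "x \<in> U"
  shows "C2_at f (grad_vec f) (\<lambda>x h. \<chi> i. grad_vec (partial i f) x \<bullet> h) x"
proof -
  have d: "f differentiable (at x)" "\<And>i. partial i f differentiable (at x)"
    and c: "\<And>i j. isCont (partial j (partial i f)) x"
    using assms by (auto simp: numeral_2_eq_2 differentiable_on_eq_differentiable_at continuous_on_eq_continuous_at)
  have "(grad_vec f has_derivative (\<lambda>h. \<chi> i. grad_vec (partial i f) x \<bullet> h)) (at x)"
    unfolding has_derivative_componentwise_within[of "grad_vec f"]
    using has_derivative_grad_vec[OF d(2)] by (auto simp: Basis_vec_def inner_axis grad_vec_def)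
  moreover have "isCont (\<lambda>z. \<chi> i. grad_vec (partial i f) z \<bullet> h) x" for h
    unfolding isCont_def using c
    by (intro vec_tendstoI) (auto simp: grad_vec_def inner_vec_def isCont_def intro!: tendsto_intros)
  ultimately show ?thesis
    unfolding C2_at_def using has_derivative_grad_vec[OF d(1)] by auto
qed

definition sch_factor :: "real \<Rightarrow> real^3 \<Rightarrow> real" where
  "sch_factor b x = 1 + b * inv_dist 0 x"

definition sch_factor_grad :: "real \<Rightarrow> real^3 \<Rightarrow> real^3" where
  "sch_factor_grad b x = b *\<^sub>R (- (inv_dist 0 x ^ 3) *\<^sub>R (x - 0))"

definition sch_factor_hess :: "real \<Rightarrow> real^3 \<Rightarrow> real^3 \<Rightarrow> real^3" where
  "sch_factor_hess b x h = b *\<^sub>R inv_dist_hess 0 x h"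

lemma sch_factor_eq: "sch_factor b x = 1 + b / norm x"
  by (simp add: sch_factor_def inv_dist_def divide_inverse)

lemma sch_factor_ge_1: "b > 0 \<Longrightarrow> 1 \<le> sch_factor b x"
  by (simp add: sch_factor_eq)

lemma C2_at_sch_factor:
  assumes "x \<noteq> 0"
  shows "C2_at (sch_factor b) (sch_factor_grad b) (sch_factor_hess b) x" "trace_op (sch_factor_hess b x) = 0"
proof -
  have "(sch_factor b has_derivative (\<lambda>h. sch_factor_grad b x \<bullet> h)) (at x)"
    using has_derivative_add[OF has_derivative_const[of 1] has_derivative_mult_right[OF has_derivative_inv_dist(1)[OF assms], of b]]
    unfolding sch_factor_def[abs_def] sch_factor_grad_def by (simp add: mult.assoc)
  moreover have "(sch_factor_grad b has_derivative sch_factor_hess b x) (at x)"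
    unfolding sch_factor_grad_def[abs_def] sch_factor_hess_def[abs_def]
    by (intro has_derivative_scaleR_right has_derivative_inv_dist(2) assms)
  moreover have "isCont (\<lambda>z. sch_factor_hess b z h) x" for h
    unfolding sch_factor_hess_def inv_dist_hess_def by (intro continuous_intros isCont_inv_dist assms)
  ultimately show "C2_at (sch_factor b) (sch_factor_grad b) (sch_factor_hess b) x"
    unfolding C2_at_def by blast
  show "trace_op (sch_factor_hess b x) = 0"
    unfolding sch_factor_hess_def[abs_def] by (simp add: trace_op_scale has_derivative_inv_dist(3)[OF assms])
qed

text \<open>\<open>matrix_inv\<close> is a choice, so its value follows from uniqueness of the
  two-sided inverse.\<close>

lemma matrix_inv_scaled_id:
  assumes "c \<noteq> 0"
  shows "matrix_inv (c *\<^sub>R mat 1 :: real^'n^'n) = inverse c *\<^sub>R mat 1"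
  unfolding matrix_inv_def
proof (rule some_equality)
  have l: "(a *\<^sub>R mat 1 :: real^'n^'n) ** B = a *\<^sub>R B" for a and B :: "real^'n^'n"
    by (simp add: scalar_matrix_assoc[symmetric])
  have r: "B ** (a *\<^sub>R mat 1 :: real^'n^'n) = a *\<^sub>R B" for a and B :: "real^'n^'n"
    by (simp add: matrix_scalar_ac scalar_matrix_assoc[symmetric])
  note * = l r
  show "(c *\<^sub>R mat 1 :: real^'n^'n) ** (inverse c *\<^sub>R mat 1) = mat 1 \<and> (inverse c *\<^sub>R mat 1) ** (c *\<^sub>R mat 1 :: real^'n^'n) = mat 1"
    using assms by (simp add: *)
  fix B :: "real^'n^'n"
  assume "c *\<^sub>R mat 1 ** B = mat 1 \<and> B ** (c *\<^sub>R mat 1) = mat 1"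
  then have "c *\<^sub>R B = mat 1" by (simp add: *)
  then have "inverse c *\<^sub>R (c *\<^sub>R B) = inverse c *\<^sub>R mat 1" by simp
  then show "B = inverse c *\<^sub>R mat 1" using assms by simp
qed

lemma schwarzschild_metric_eq: "schwarzschild_metric m x = (sch_factor (m / 2) x) ^ 4 *\<^sub>R mat 1"
  by (simp add: schwarzschild_metric_def sch_factor_eq)

lemma vol_density_schwarzschild:
  assumes "m > 0"
  shows "vol_density (schwarzschild_metric m) x = sch_factor (m / 2) x ^ 6"
proof -
  have u: "sch_factor (m / 2) x \<ge> 0" using sch_factor_ge_1[of "m/2" x] assms by simp
  have "det (schwarzschild_metric m x) = (sch_factor (m / 2) x ^ 6) ^ 2"
  proof -
    have "det (c *\<^sub>R mat 1 :: real^3^3) = c ^ 3" for c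
      by (simp add: det_3 mat_def power3_eq_cube)
    then show ?thesis by (simp add: schwarzschild_metric_eq flip: power_mult)
  qed
  then have "vol_density (schwarzschild_metric m) x = \<bar>sch_factor (m / 2) x ^ 6\<bar>"
    unfolding vol_density_def by (simp only: real_sqrt_abs)
  then show ?thesis using u by simp
qed

lemma grad_norm_sq_schwarzschild:
  assumes "m > 0"
  shows "grad_norm_sq (schwarzschild_metric m) \<phi> x = (norm (grad_vec \<phi> x))\<^sup>2 / sch_factor (m / 2) x ^ 4"
proof -
  have u: "sch_factor (m / 2) x ^ 4 \<noteq> 0" using sch_factor_ge_1[of "m/2" x] assms by simp
  have "grad_norm_sq (schwarzschild_metric m) \<phi> x =
     (\<Sum>i\<in>UNIV. inverse (sch_factor (m / 2) x ^ 4) * (partial i \<phi> x * partial i \<phi> x))"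
    unfolding grad_norm_sq_def schwarzschild_metric_eq matrix_inv_scaled_id[OF u]
    by (simp add: mat_def if_distrib if_distribR mult.assoc cong: if_cong)
  also have "\<dots> = (norm (grad_vec \<phi> x))\<^sup>2 / sch_factor (m / 2) x ^ 4"
  proof -
    have "(norm (grad_vec \<phi> x))\<^sup>2 = (\<Sum>i\<in>UNIV. partial i \<phi> x * partial i \<phi> x)"
      by (simp add: power2_norm_eq_inner inner_vec_def grad_vec_def)
    then show ?thesis by (simp only: sum_distrib_left[symmetric] divide_inverse) (rule mult.commute)
  qed
  finally show ?thesis .
qed

text \<open>The density u^6 times the inverse metric u^(-4) leaves the field u^2 grad \<phi>, whose
  divergence is the trace of its derivative. \<open>F\<close> may be any expression for this field
  that is convenient to differentiate.\<close>

lemma laplace_beltrami_schwarzschild: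
  assumes m: "m > 0" and D: "open D" "x \<in> D" and \<phi>: "\<And>y. y \<in> D \<Longrightarrow> (\<phi> has_derivative (\<lambda>h. G y \<bullet> h)) (at y)"
    and F: "\<And>y. y \<in> D \<Longrightarrow> F y = (sch_factor (m / 2) y)\<^sup>2 *\<^sub>R G y" and F': "(F has_derivative F') (at x)"
  shows "laplace_beltrami (schwarzschild_metric m) \<phi> x = 1 / sch_factor (m / 2) x ^ 6 * trace_op F'"
proof -
  have u: "sch_factor (m / 2) y \<noteq> 0" for y using sch_factor_ge_1[of "m/2" y] m by simp
  have "partial i (\<lambda>y. vol_density (schwarzschild_metric m) y *
      (\<Sum>j\<in>UNIV. matrix_inv (schwarzschild_metric m y) $ i $ j * partial j \<phi> y)) x = F' (axis i 1) $ i" for i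
  proof (rule partial_has_derivative)
    have "((\<lambda>y. F y $ i) has_derivative (\<lambda>h. F' h $ i)) (at x)"
      by (rule has_derivative_vec_nth[OF F'])
    then show "((\<lambda>y. vol_density (schwarzschild_metric m) y *
      (\<Sum>j\<in>UNIV. matrix_inv (schwarzschild_metric m y) $ i $ j * partial j \<phi> y)) has_derivative (\<lambda>h. F' h $ i)) (at x)"
    proof (rule has_derivative_transform_within_open[OF _ D])
      fix y assume y: "y \<in> D"
      have u4: "sch_factor (m / 2) y ^ 4 \<noteq> 0" using u by simp
      have "(\<Sum>j\<in>UNIV. matrix_inv (schwarzschild_metric m y) $ i $ j * partial j \<phi> y) = inverse (sch_factor (m / 2) y ^ 4) * G y $ i"
        unfolding schwarzschild_metric_eq matrix_inv_scaled_id[OF u4]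
        using partial_eq[OF \<phi>[OF y]] by (simp add: mat_def if_distrib if_distribR cong: if_cong)
      moreover have "sch_factor (m / 2) y ^ 6 * inverse (sch_factor (m / 2) y ^ 4) = (sch_factor (m / 2) y)\<^sup>2"
      proof -
        have "sch_factor (m / 2) y ^ 6 = (sch_factor (m / 2) y)\<^sup>2 * sch_factor (m / 2) y ^ 4"
          by (simp flip: power_add)
        moreover have "c * d * inverse d = c" if "d \<noteq> 0" for c d :: real using that by simp
        ultimately show ?thesis using u4 by (simp only:)
      qed
      ultimately show "F y $ i = vol_density (schwarzschild_metric m) y *
        (\<Sum>j\<in>UNIV. matrix_inv (schwarzschild_metric m y) $ i $ j * partial j \<phi> y)"
        using F[OF y] by (simp add: vol_density_schwarzschild[OF m] mult.assoc[symmetric])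
    qed
  qed
  then show ?thesis
    unfolding laplace_beltrami_def trace_op_vec vol_density_schwarzschild[OF m] by simp
qed

text \<open>Multiplication by the conformal factor turns harmonic functions of the Schwarzschild metric into
  Euclidean ones: \<open>u\<^sup>2 \<nabla>\<phi> = u \<nabla>\<psi> - \<psi> \<nabla>u\<close> for \<open>\<psi> = u \<phi>\<close>.\<close>

lemma schwarzschild_harmonic_quotient:
  assumes m: "m > 0" and D: "open D" "0 \<notin> D" and \<psi>: "\<And>x. x \<in> D \<Longrightarrow> harmonic_at \<psi> x"
    and \<phi>: "\<And>x. x \<in> D \<Longrightarrow> \<phi> x = \<psi> x / sch_factor (m / 2) x"
  shows "Ck_on 2 D \<phi>" "\<And>x. x \<in> D \<Longrightarrow> laplace_beltrami (schwarzschild_metric m) \<phi> x = 0"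
proof -
  let ?u = "sch_factor (m / 2)" and ?Gu = "sch_factor_grad (m / 2)" and ?Hu = "sch_factor_hess (m / 2)"
  have u: "?u y \<noteq> 0" for y using sch_factor_ge_1[of "m/2" y] m by simp
  have key: "\<exists>e>0. ball x e \<subseteq> D \<and> (\<exists>G H G\<psi> H\<psi>. \<forall>y\<in>ball x e. C2_at \<phi> G H y \<and> C2_at \<psi> G\<psi> H\<psi> y \<and> trace_op (H\<psi> y) = 0 \<and>
     G y = \<psi> y *\<^sub>R ((- (inverse (?u y) ^ 2)) *\<^sub>R ?Gu y) + inverse (?u y) *\<^sub>R G\<psi> y)" if x: "x \<in> D" for x
  proof -
    obtain e G\<psi> H\<psi> where e: "e > 0" and C: "\<And>y. y \<in> ball x e \<Longrightarrow> C2_at \<psi> G\<psi> H\<psi> y \<and> trace_op (H\<psi> y) = 0"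
      using \<psi>[OF x] unfolding harmonic_at_iff_C2 by blast
    obtain d where d: "d > 0" "ball x d \<subseteq> D" using D x open_contains_ball by blast
    define G where "G y = \<psi> y *\<^sub>R ((- (inverse (?u y) ^ 2)) *\<^sub>R ?Gu y) + inverse (?u y) *\<^sub>R G\<psi> y" for y
    have "0 \<notin> ball x d" using D d by blast
    then have "\<exists>H. \<forall>y\<in>ball x (min e d). C2_at (\<lambda>x. \<psi> x * inverse (?u x)) G H y"
      unfolding G_def
      by - (rule exI, intro ballI, rule C2_at_mult[OF _ C2_at_inverse[OF C2_at_sch_factor(1)]], rule conjunct1[OF C], use u in auto)
    then obtain H where H: "\<And>y. y \<in> ball x (min e d) \<Longrightarrow> C2_at (\<lambda>x. \<psi> x * inverse (?u x)) G H y" by blast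
    have C\<phi>: "C2_at \<phi> G H y" if y: "y \<in> ball x (min e d)" for y
    proof -
      have "(\<phi> has_derivative (\<lambda>h. G y \<bullet> h)) (at y)"
      proof (rule has_derivative_transform_within_open[OF _ D(1)])
        show "((\<lambda>x. \<psi> x * inverse (?u x)) has_derivative (\<lambda>h. G y \<bullet> h)) (at y)"
          using H[OF y] unfolding C2_at_def by blast
        show "y \<in> D" using d y by auto
        show "\<psi> z * inverse (?u z) = \<phi> z" if "z \<in> D" for z
          using \<phi>[OF that] by (simp only: divide_inverse)
      qed
      then show ?thesis using H[OF y] unfolding C2_at_def by blast
    qed
    have "min e d > 0" "ball x (min e d) \<subseteq> D" using e d by auto
    moreover have "C2_at \<phi> G H y \<and> C2_at \<psi> G\<psi> H\<psi> y \<and> trace_op (H\<psi> y) = 0 \<and>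
      G y = \<psi> y *\<^sub>R ((- (inverse (?u y) ^ 2)) *\<^sub>R ?Gu y) + inverse (?u y) *\<^sub>R G\<psi> y" if y: "y \<in> ball x (min e d)" for y
    proof -
      have "y \<in> ball x e" using y by simp
      then show ?thesis using C\<phi>[OF y] C[of y] G_def[of y] by blast
    qed
    ultimately show ?thesis by blast
  qed
  show "Ck_on 2 D \<phi>"
    by (rule Ck_on_2I[OF D(1)]) (use key in meson)
  fix x assume x: "x \<in> D"
  obtain e G H G\<psi> H\<psi> where e: "e > 0" "ball x e \<subseteq> D" and C: "\<And>y. y \<in> ball x e \<Longrightarrow> C2_at \<phi> G H y"
    "\<And>y. y \<in> ball x e \<Longrightarrow> C2_at \<psi> G\<psi> H\<psi> y" "\<And>y. y \<in> ball x e \<Longrightarrow> trace_op (H\<psi> y) = 0"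
    and G: "\<And>y. y \<in> ball x e \<Longrightarrow> G y = \<psi> y *\<^sub>R ((- (inverse (?u y) ^ 2)) *\<^sub>R ?Gu y) + inverse (?u y) *\<^sub>R G\<psi> y"
    using key[OF x] by blast
  have x0: "x \<noteq> 0" using D x by auto
  define F where "F y = ?u y *\<^sub>R G\<psi> y - \<psi> y *\<^sub>R ?Gu y" for y
  define F' where "F' h = (?u x *\<^sub>R H\<psi> x h + (?Gu x \<bullet> h) *\<^sub>R G\<psi> x) - (\<psi> x *\<^sub>R ?Hu x h + (G\<psi> x \<bullet> h) *\<^sub>R ?Gu x)" for h
  have "(F has_derivative F') (at x)"
    unfolding F_def[abs_def] F'_def[abs_def]
    using C(2)[of x] e C2_at_sch_factor(1)[OF x0] unfolding C2_at_def
    by (intro has_derivative_diff has_derivative_scaleR) auto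
  moreover have "F y = (?u y)\<^sup>2 *\<^sub>R G y" if "y \<in> ball x e" for y
  proof -
    have "c\<^sup>2 * (inverse c)\<^sup>2 = 1" if "c \<noteq> 0" for c :: real
      using that by (simp add: field_simps)
    from this[OF u[of y]] have a: "(?u y)\<^sup>2 * (\<psi> y * (- (inverse (?u y) ^ 2))) = - \<psi> y"
      by (simp only: mult_minus_right mult.left_commute[of "(?u y)\<^sup>2"] mult_1_right)
    have b: "(?u y)\<^sup>2 * inverse (?u y) = ?u y"
      using u[of y] by (simp add: power2_eq_square)
    show ?thesis
      unfolding F_def G[OF that] scaleR_add_right scaleR_scaleR a b by simp
  qed
  moreover have "trace_op F' = 0"
    unfolding F'_def trace_op_diff trace_op_add trace_op_scale trace_op_outer
    using C(3)[of x] e C2_at_sch_factor(2)[OF x0] by (simp add: inner_commute)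
  ultimately show "laplace_beltrami (schwarzschild_metric m) \<phi> x = 0"
    using laplace_beltrami_schwarzschild[OF m open_ball, of x x e \<phi> G F F'] C(1) e unfolding C2_at_def by simp
qed

text \<open>The converse direction, for identifying an unknown potential. The equation amounts to u
  \<Delta>\<phi> + 2 grad u . grad \<phi> = 0, and the left side is the Euclidean Laplacian of u
  \<phi> because u is harmonic.\<close>

lemma schwarzschild_harmonic_product:
  assumes m: "m > 0" and D: "open D" "0 \<notin> D" and \<phi>: "Ck_on 2 D \<phi>"
    and L: "\<And>x. x \<in> D \<Longrightarrow> laplace_beltrami (schwarzschild_metric m) \<phi> x = 0" and x: "x \<in> D"
  shows "harmonic_at (\<lambda>x. sch_factor (m / 2) x * \<phi> x) x"
proof -
  let ?u = "sch_factor (m / 2)" and ?Gu = "sch_factor_grad (m / 2)" and ?Hu = "sch_factor_hess (m / 2)"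
  have u: "?u y > 0" for y using sch_factor_ge_1[of "m/2" y] m by simp
  define G where "G = grad_vec \<phi>"
  define H where "H x h = (\<chi> i. grad_vec (partial i \<phi>) x \<bullet> h)" for x h
  have C: "C2_at \<phi> G H y" if "y \<in> D" for y
    unfolding G_def H_def using Ck_on_2D[OF \<phi> D(1) that] .
  have Cu: "C2_at ?u ?Gu ?Hu y" "trace_op (?Hu y) = 0" if "y \<in> D" for y
    using C2_at_sch_factor[of y] D that by auto
  have tr: "?u y * trace_op (H y) + 2 * (?Gu y \<bullet> G y) = 0" if y: "y \<in> D" for y
  proof -
    define F' where "F' h = (?u y)\<^sup>2 *\<^sub>R H y h + (2 * ?u y) *\<^sub>R ((?Gu y \<bullet> h) *\<^sub>R G y)" for h
    have d: "(?u has_derivative (\<lambda>h. ?Gu y \<bullet> h)) (at y)" using Cu(1)[OF y] unfolding C2_at_def by blast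
    have "((\<lambda>y. (?u y)\<^sup>2) has_derivative (\<lambda>h. 2 * ?u y * (?Gu y \<bullet> h))) (at y)"
      unfolding power2_eq_square
      by (rule has_derivative_eq_rhs[OF has_derivative_mult[OF d d]]) (simp add: fun_eq_iff)
    moreover have "(G has_derivative H y) (at y)" using C[OF y] unfolding C2_at_def by blast
    ultimately have "((\<lambda>y. (?u y)\<^sup>2 *\<^sub>R G y) has_derivative F') (at y)"
      unfolding F'_def[abs_def] scaleR_scaleR by (rule has_derivative_scaleR)
    then have "laplace_beltrami (schwarzschild_metric m) \<phi> y = 1 / ?u y ^ 6 * trace_op F'"
      by (intro laplace_beltrami_schwarzschild[OF m D(1) y]) (use C in \<open>auto simp: C2_at_def\<close>)
    then have "trace_op F' = 0" using L[OF y] u[of y] by simp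
    then have "?u y * (?u y * trace_op (H y) + 2 * (?Gu y \<bullet> G y)) = 0"
      unfolding F'_def trace_op_add trace_op_scale trace_op_outer by (simp add: power2_eq_square algebra_simps)
    then show ?thesis using u[of y] by simp
  qed
  obtain e where e: "e > 0" "ball x e \<subseteq> D" using D(1) x open_contains_ball by blast
  have "C2_at (\<lambda>x. ?u x * \<phi> x) (\<lambda>x. ?u x *\<^sub>R G x + \<phi> x *\<^sub>R ?Gu x)
    (\<lambda>x h. ?u x *\<^sub>R H x h + (?Gu x \<bullet> h) *\<^sub>R G x + (\<phi> x *\<^sub>R ?Hu x h + (G x \<bullet> h) *\<^sub>R ?Gu x)) y \<and>
    trace_op (\<lambda>h. ?u y *\<^sub>R H y h + (?Gu y \<bullet> h) *\<^sub>R G y + (\<phi> y *\<^sub>R ?Hu y h + (G y \<bullet> h) *\<^sub>R ?Gu y)) = 0"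
    if "y \<in> ball x e" for y
  proof
    have y: "y \<in> D" using that e by auto
    show "C2_at (\<lambda>x. ?u x * \<phi> x) (\<lambda>x. ?u x *\<^sub>R G x + \<phi> x *\<^sub>R ?Gu x)
      (\<lambda>x h. ?u x *\<^sub>R H x h + (?Gu x \<bullet> h) *\<^sub>R G x + (\<phi> x *\<^sub>R ?Hu x h + (G x \<bullet> h) *\<^sub>R ?Gu x)) y"
      by (rule C2_at_mult[OF Cu(1)[OF y] C[OF y]])
    show "trace_op (\<lambda>h. ?u y *\<^sub>R H y h + (?Gu y \<bullet> h) *\<^sub>R G y + (\<phi> y *\<^sub>R ?Hu y h + (G y \<bullet> h) *\<^sub>R ?Gu y)) = 0"
      unfolding trace_op_add trace_op_scale trace_op_outer using tr[OF y] Cu(2)[OF y]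
      by (simp add: inner_commute)
  qed
  then show ?thesis unfolding harmonic_at_iff_C2 using e(1) by blast
qed

section \<open>Capacity potentials and their energy\<close>

lemma exterior_eq: "0 \<in> \<Omega> \<Longrightarrow> exterior \<Omega> = - \<Omega>"
  by (auto simp: exterior_def schwarzschild_space_def)

lemma exterior_minus_frontier:
  assumes "open \<Omega>" "0 \<in> \<Omega>"
  shows "exterior \<Omega> - frontier \<Omega> = - closure \<Omega>"
  using assms closure_subset[of \<Omega>] by (auto simp: exterior_eq frontier_def interior_open)

text \<open>For the Euclidean exterior function \<open>w\<close>, put \<psi> = w + b/|x| and \<phi>
  = \<psi>/u. Then u (1 - \<phi>) = 1 - w, so |\<phi> - 1| <= 1 - w, and continuity of \<phi> at the
  boundary reduces to \<open>w\<close> tending to 1 there.\<close>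

theorem capacity_potential_exists:
  assumes m: "m > 0" and S: "closed_surface \<Sigma>" and \<Omega>: "open \<Omega>" "bounded \<Omega>" "0 \<in> \<Omega>" and \<Sigma>: "\<Sigma> = frontier \<Omega>"
  shows "\<exists>\<phi>. is_capacity_potential (schwarzschild_metric m) \<Sigma> (exterior \<Omega>) \<phi>"
proof -
  define b where "b = m / 2"
  have b: "b > 0" using m by (simp add: b_def)
  let ?K = "closure \<Omega>" and ?u = "sch_factor (m / 2)"
  have K: "compact ?K" using \<Omega> by simp
  obtain R where R: "R > 0" "?K \<subseteq> cball 0 R"
    using compact_imp_bounded[OF K] unfolding bounded_pos by (auto simp: subset_iff)
  obtain w where w: "\<And>x. x \<notin> ?K \<Longrightarrow> harmonic_at w x" "\<And>x. 0 \<le> w x" "\<And>x. w x \<le> 1"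
    "\<And>x. w x \<le> R / max R (norm x)"
    "\<And>c \<rho> x. 0 < \<rho> \<Longrightarrow> ball c \<rho> \<subseteq> ?K \<Longrightarrow> x \<notin> ?K \<Longrightarrow> \<rho> / norm (x - c) \<le> w x"
    using exterior_harmonic_exists[OF K R] by blast
  have zero: "0 \<notin> - ?K" using \<Omega>(3) closure_subset by blast
  have openD: "open (- ?K)" by (rule open_Compl) simp
  have u1: "1 \<le> ?u x" for x using sch_factor_ge_1[of "m/2" x] m by simp
  have ueq: "?u x = 1 + b / norm x" for x by (simp add: sch_factor_eq b_def)
  define \<psi> where "\<psi> x = w x + b * inv_dist 0 x" for x
  define \<phi> where "\<phi> x = (if x \<in> ?K then 1 else \<psi> x / ?u x)" for x
  have h\<psi>: "harmonic_at \<psi> x" if x: "x \<in> - ?K" for x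
  proof -
    have x0: "x \<noteq> 0" using zero x by auto
    obtain e G H where e: "e > 0" and C: "\<And>y. y \<in> ball x e \<Longrightarrow> C2_at w G H y \<and> trace_op (H y) = 0"
    proof -
      have "harmonic_at w x" using w(1) x by simp
      then show ?thesis using that unfolding harmonic_at_iff_C2 by blast
    qed
    obtain e' G' H' where e': "e' > 0" and C': "\<And>y. y \<in> ball x e' \<Longrightarrow> C2_at (\<lambda>x. b * inv_dist 0 x) G' H' y \<and> trace_op (H' y) = 0"
      using harmonic_at_inv_dist[OF x0, of b] unfolding harmonic_at_iff_C2 by blast
    have "C2_at \<psi> (\<lambda>y. G y + G' y) (\<lambda>y h. H y h + H' y h) y \<and> trace_op (\<lambda>h. H y h + H' y h) = 0"
      if "y \<in> ball x (min e e')" for y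
    proof -
      have y: "y \<in> ball x e" "y \<in> ball x e'" using that by auto
      show ?thesis
        unfolding \<psi>_def[abs_def]
        by (intro conjI C2_at_add[OF conjunct1[OF C[OF y(1)]] conjunct1[OF C'[OF y(2)]]])
          (use C[OF y(1)] C'[OF y(2)] in \<open>simp add: trace_op_add\<close>)
    qed
    then show ?thesis unfolding harmonic_at_iff_C2 using e e'
      by (intro exI[of _ "min e e'"] conjI exI[of _ "\<lambda>y. G y + G' y"] exI[of _ "\<lambda>y h. H y h + H' y h"]) auto
  qed
  have \<phi>q: "\<phi> x = \<psi> x / ?u x" if "x \<in> - ?K" for x using that by (simp add: \<phi>_def)
  note Ck = schwarzschild_harmonic_quotient(1)[OF m openD zero h\<psi> \<phi>q]
    and lap = schwarzschild_harmonic_quotient(2)[OF m openD zero h\<psi> \<phi>q]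
  have one_minus: "\<bar>\<phi> x - 1\<bar> \<le> 1 - w x" if "x \<notin> ?K" for x
  proof -
    have ux: "?u x > 0" using u1[of x] by simp
    have "\<phi> x = \<psi> x / ?u x" using \<phi>q that by simp
    then have "\<phi> x * ?u x = \<psi> x" using ux by simp
    also have "\<psi> x = w x + ?u x - 1" by (simp add: \<psi>_def sch_factor_def b_def)
    finally have "(1 - \<phi> x) * ?u x = 1 - w x" by (simp add: left_diff_distrib)
    then have "\<bar>1 - \<phi> x\<bar> * \<bar>?u x\<bar> = \<bar>1 - w x\<bar>" by (simp only: abs_mult[symmetric])
    then have "\<bar>1 - \<phi> x\<bar> * ?u x = 1 - w x" using ux w(3)[of x] by simp
    moreover have "\<bar>1 - \<phi> x\<bar> * 1 \<le> \<bar>1 - \<phi> x\<bar> * ?u x" by (intro mult_left_mono u1) simp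
    ultimately show ?thesis by (simp add: abs_minus_commute)
  qed
  have cont: "continuous_on (exterior \<Omega>) \<phi>"
    unfolding continuous_on_eq_continuous_within
  proof
    fix p assume p: "p \<in> exterior \<Omega>"
    show "continuous (at p within exterior \<Omega>) \<phi>"
    proof (cases "p \<in> ?K")
      case False
      have "isCont \<phi> p"
        using C2_at_isCont(1)[OF Ck_on_2D[OF Ck openD, of p]] False by simp
      then show ?thesis by (rule continuous_at_imp_continuous_at_within)
    next
      case True
      then have "p \<in> \<Sigma>" using p \<Omega> by (auto simp: \<Sigma> frontier_def interior_open exterior_eq)
      then obtain c t where c: "t > 0" "ball c t \<subseteq> \<Omega>" "norm (p - c) = t"
        using touching_ball[OF S \<Sigma> \<Omega>(1)] by blast
      \<comment> \<open>The barrier of the interior ball equals 1 at \<open>p\<close>, where the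
        ball touches the surface; as w <= 1, it forces \<open>w\<close> to tend to 1 at
        \<open>p\<close> from outside.\<close>
      have "((\<lambda>y. t / norm (y - c)) \<longlongrightarrow> t / norm (p - c)) (at p)"
        using c by (intro tendsto_intros) auto
      then have lim: "((\<lambda>y. t / norm (y - c)) \<longlongrightarrow> 1) (at p within exterior \<Omega>)"
        using c by (auto intro: tendsto_within_subset)
      have \<phi>p: "\<phi> p = 1" using True by (simp add: \<phi>_def)
      show ?thesis
        unfolding continuous_within \<phi>p
      proof (rule tendstoI)
        fix e :: real assume "e > 0"
        then have "\<forall>\<^sub>F y in at p within exterior \<Omega>. dist (t / norm (y - c)) 1 < e"
          using lim by (simp add: tendstoD)
        then show "\<forall>\<^sub>F y in at p within exterior \<Omega>. dist (\<phi> y) 1 < e"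
        proof eventually_elim
          case (elim y)
          show ?case
          proof (cases "y \<in> ?K")
            case False
            have "t / norm (y - c) \<le> w y" by (rule w(5)[OF c(1) _ False]) (use c(2) closure_subset in blast)
            then show ?thesis using one_minus[OF False] elim by (simp add: dist_real_def)
          qed (use \<open>e > 0\<close> in \<open>simp add: \<phi>_def\<close>)
        qed
      qed
    qed
  qed
  have lim: "(\<phi> \<longlongrightarrow> 0) at_infinity"
  proof (rule Lim_null_comparison)
    have nlim: "((\<lambda>x::real^3. c / norm x) \<longlongrightarrow> 0) at_infinity" for c
      by (intro tendsto_divide_0[OF tendsto_const] filterlim_at_infinity_imp_norm_at_top[THEN filterlim_at_top_imp_at_infinity] filterlim_ident)
    show "((\<lambda>x::real^3. (R + b) / norm x) \<longlongrightarrow> 0) at_infinity" by (rule nlim)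
    show "\<forall>\<^sub>F x in at_infinity. norm (\<phi> x) \<le> (R + b) / norm x"
      unfolding eventually_at_infinity
    proof (intro exI[of _ "R + 1"] allI impI)
      fix x :: "real^3" assume x: "R + 1 \<le> norm x"
      then have xK: "x \<notin> ?K" using R by (auto simp: subset_iff)
      have nx: "norm x > 0" "max R (norm x) = norm x" using x R by auto
      have "0 \<le> \<psi> x" using w(2)[of x] b by (simp add: \<psi>_def inv_dist_def)
      moreover have "\<psi> x \<le> (R + b) / norm x"
        using w(4)[of x] nx by (simp add: \<psi>_def inv_dist_def divide_inverse algebra_simps)
      moreover have "\<psi> x / ?u x \<le> \<psi> x / 1" using u1[of x] \<open>0 \<le> \<psi> x\<close> by (intro divide_left_mono) auto
      ultimately show "norm (\<phi> x) \<le> (R + b) / norm x"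
        using xK u1[of x] by (simp add: \<phi>_def)
    qed
  qed
  have "\<phi> x = 1" if "x \<in> frontier \<Omega>" for x using that by (simp add: \<phi>_def frontier_def)
  then have "is_capacity_potential (schwarzschild_metric m) \<Sigma> (exterior \<Omega>) \<phi>"
    unfolding is_capacity_potential_def \<Sigma> exterior_minus_frontier[OF \<Omega>(1,3)]
    using cont Ck lap lim by blast
  then show ?thesis by blast
qed

lemma borel_measurable_sch_factor [measurable]: "sch_factor b \<in> borel_measurable borel"
  unfolding sch_factor_eq[abs_def] by measurable

lemma vol_measure_schwarzschild:
  assumes "m > 0"
  shows "vol_measure (schwarzschild_metric m) = density lborel (\<lambda>x. ennreal (sch_factor (m / 2) x ^ 6))"
  unfolding vol_measure_def vol_density_schwarzschild[OF assms] ..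

lemma energy_schwarzschild:
  assumes m: "m > 0" and D: "D \<in> sets borel" "continuous_on D (grad_vec \<phi>)"
  shows "(\<integral>\<^sup>+x. ennreal (grad_norm_sq (schwarzschild_metric m) \<phi> x) * indicator D x \<partial>vol_measure (schwarzschild_metric m))
    = (\<integral>\<^sup>+x. indicator D x * ennreal ((1 + m / 2 / norm x)\<^sup>2 * (norm (grad_vec \<phi> x))\<^sup>2) \<partial>lborel)"
proof -
  let ?u = "sch_factor (m / 2)"
  have u: "?u x > 0" for x using sch_factor_ge_1[of "m/2" x] m by simp
  have [measurable]: "(\<lambda>x. indicator D x *\<^sub>R grad_vec \<phi> x) \<in> borel_measurable borel"
    by (rule borel_measurable_continuous_on_indicator[OF D])
  have eq: "ennreal (grad_norm_sq (schwarzschild_metric m) \<phi> x) * indicator D x =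
      ennreal ((norm (indicat_real D x *\<^sub>R grad_vec \<phi> x))\<^sup>2 / ?u x ^ 4)" for x
    by (simp add: grad_norm_sq_schwarzschild[OF m] split: split_indicator)
  have "(\<integral>\<^sup>+x. ennreal (grad_norm_sq (schwarzschild_metric m) \<phi> x) * indicator D x \<partial>vol_measure (schwarzschild_metric m)) =
     (\<integral>\<^sup>+x. ennreal (?u x ^ 6) * ennreal ((norm (indicat_real D x *\<^sub>R grad_vec \<phi> x))\<^sup>2 / ?u x ^ 4) \<partial>lborel)"
    unfolding vol_measure_schwarzschild[OF m] eq by (rule nn_integral_density) measurable
  also have "\<dots> = (\<integral>\<^sup>+x. indicator D x * ennreal ((1 + m / 2 / norm x)\<^sup>2 * (norm (grad_vec \<phi> x))\<^sup>2) \<partial>lborel)"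
  proof (intro nn_integral_cong)
    fix x
    have "?u x ^ 6 * ((norm (grad_vec \<phi> x))\<^sup>2 / ?u x ^ 4) = (?u x)\<^sup>2 * (norm (grad_vec \<phi> x))\<^sup>2"
    proof -
      have "?u x ^ 6 = (?u x)\<^sup>2 * ?u x ^ 4" by (simp flip: power_add)
      moreover have "c * d * (e / d) = c * e" if "d \<noteq> 0" for c d e :: real using that by simp
      moreover have "?u x ^ 4 \<noteq> 0" using u[of x] by simp
      ultimately show ?thesis by (simp only:)
    qed
    then have "ennreal (?u x ^ 6 * ((norm (grad_vec \<phi> x))\<^sup>2 / ?u x ^ 4)) = ennreal ((?u x)\<^sup>2 * (norm (grad_vec \<phi> x))\<^sup>2)"
      by (rule arg_cong)
    moreover have "ennreal (?u x ^ 6 * ((norm (grad_vec \<phi> x))\<^sup>2 / ?u x ^ 4)) =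
        ennreal (?u x ^ 6) * ennreal ((norm (grad_vec \<phi> x))\<^sup>2 / ?u x ^ 4)"
      by (rule ennreal_mult') (use u[of x] in simp)
    ultimately have "ennreal (?u x ^ 6) * ennreal ((norm (grad_vec \<phi> x))\<^sup>2 / ?u x ^ 4) = ennreal ((?u x)\<^sup>2 * (norm (grad_vec \<phi> x))\<^sup>2)"
      by (simp only:)
    then show "ennreal (?u x ^ 6) * ennreal ((norm (indicat_real D x *\<^sub>R grad_vec \<phi> x))\<^sup>2 / ?u x ^ 4) =
       indicator D x * ennreal ((1 + m / 2 / norm x)\<^sup>2 * (norm (grad_vec \<phi> x))\<^sup>2)"
      by (cases "x \<in> D") (simp_all only: indicator_simps scaleR_one scaleR_zero_left norm_zero mult_1_left sch_factor_eq, simp)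
  qed
  finally show ?thesis .
qed

lemma continuous_grad_vec:
  assumes "Ck_on 2 U f" "open U"
  shows "continuous_on U (grad_vec f)"
  using C2_at_isCont(2)[OF Ck_on_2D[OF assms]] by (intro continuous_at_imp_continuous_on) auto

text \<open>Existence turns the defining properties into facts about the chosen potential, which is
  then a competitor for the weighted bound. The contribution of the surface itself is nonnegative
  and is discarded.\<close>

theorem capacity_lower_bound:
  assumes m: "m > 0" and S: "closed_surface \<Sigma>" and \<Omega>: "open \<Omega>" "bounded \<Omega>" "0 \<in> \<Omega>" and \<Sigma>: "\<Sigma> = frontier \<Omega>"
    and R: "0 < R" "ennreal (4/3*pi * R^3) \<le> emeasure lborel \<Omega>"
  shows "ennreal (R + m / 2) \<le> capacity (schwarzschild_metric m) \<Sigma> (exterior \<Omega>)"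
proof -
  let ?g = "schwarzschild_metric m" and ?D = "- closure \<Omega>"
  define \<phi> where "\<phi> = capacity_potential ?g \<Sigma> (exterior \<Omega>)"
  have "is_capacity_potential ?g \<Sigma> (exterior \<Omega>) \<phi>"
    unfolding \<phi>_def capacity_potential_def using capacity_potential_exists[OF m S \<Omega> \<Sigma>] by (rule someI_ex)
  then have \<phi>: "continuous_on (- \<Omega>) \<phi>" "Ck_on 2 ?D \<phi>" "\<And>x. x \<in> \<Sigma> \<Longrightarrow> \<phi> x = 1" "(\<phi> \<longlongrightarrow> 0) at_infinity"
    unfolding is_capacity_potential_def using exterior_minus_frontier[OF \<Omega>(1,3)] exterior_eq[OF \<Omega>(3)] \<Sigma> by auto
  have D: "open ?D" by (rule open_Compl) simp
  interpret exterior_function "m / 2" \<Omega> \<phi> "grad_vec \<phi>"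
  proof
    show "(\<phi> has_derivative (\<lambda>h. grad_vec \<phi> x \<bullet> h)) (at x)" if "x \<notin> closure \<Omega>" for x
      using Ck_on_2D[OF \<phi>(2) D, of x] that unfolding C2_at_def by auto
    show "continuous_on (- closure \<Omega>) (grad_vec \<phi>)" by (rule continuous_grad_vec[OF \<phi>(2) D])
  qed (use m \<Omega> \<phi> \<Sigma> in auto)
  have "ennreal (R + m / 2) = ennreal (1 / (4 * pi)) * ennreal (4 * pi * (R + m / 2))"
    using R m by (simp flip: ennreal_mult)
  also have "\<dots> \<le> ennreal (1 / (4 * pi)) *
     (\<integral>\<^sup>+x. indicator ?D x * ennreal ((1 + m / 2 / norm x)\<^sup>2 * (norm (grad_vec \<phi> x))\<^sup>2) \<partial>lborel)"
    by (intro mult_left_mono weighted_energy_lower_bound R) auto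
  also have "\<dots> = ennreal (1 / (4 * pi)) *
     (\<integral>\<^sup>+x. ennreal (grad_norm_sq ?g \<phi> x) * indicator ?D x \<partial>vol_measure ?g)"
    using energy_schwarzschild[OF m borel_open[OF D] continuous_grad_vec[OF \<phi>(2) D]] by simp
  also have "\<dots> \<le> ennreal (1 / (4 * pi)) *
     (\<integral>\<^sup>+x. ennreal (grad_norm_sq ?g \<phi> x) * indicator (exterior \<Omega>) x \<partial>vol_measure ?g)"
    using exterior_minus_frontier[OF \<Omega>(1,3)]
    by (intro mult_left_mono nn_integral_mono) (auto split: split_indicator)
  finally show ?thesis unfolding capacity_def \<phi>_def .
qed

text \<open>Makes the existence theorem available for the comparison sphere.\<close>

lemma closed_surface_sphere:
  assumes "r > 0" shows "closed_surface (sphere (0::real^3) r)"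
proof -
  define f where "f x = x \<bullet> x - r\<^sup>2" for x :: "real^3"
  have df: "(f has_derivative (\<lambda>h. (2 *\<^sub>R x) \<bullet> h)) (at x)" for x
    unfolding f_def[abs_def]
    by (rule has_derivative_eq_rhs[OF has_derivative_diff[OF has_derivative_inner[OF has_derivative_ident has_derivative_ident] has_derivative_const]])
      (simp add: fun_eq_iff inner_commute)
  have pf: "partial i f = (\<lambda>x. 2 * x $ i)" for i
    using partial_eq[OF df] by (simp add: fun_eq_iff)
  have cst: "Ck_on k U (\<lambda>_. c)" for k and U :: "(real^3) set" and c :: real
  proof (induction k arbitrary: c)
    case (Suc k)
    have "partial i (\<lambda>_::real^3. c) = (\<lambda>_. 0)" for i
      by (rule ext) (rule partial_has_derivative[OF has_derivative_const])
    then show ?case using Suc by simp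
  qed simp
  have lin: "Ck_on k U (\<lambda>x. 2 * x $ i)" for k and U :: "(real^3) set" and i :: 3
  proof (cases k)
    case 0
    then show ?thesis by (auto intro!: continuous_intros)
  next
    case (Suc j)
    have d: "((\<lambda>x. 2 * x $ i) has_derivative (\<lambda>h. 2 * h $ i)) (at x)" for x :: "real^3"
      by (intro has_derivative_mult_right has_derivative_vec_nth has_derivative_ident)
    have "partial l (\<lambda>x. 2 * x $ i) = (\<lambda>_. 2 * axis l 1 $ i)" for l
      using partial_has_derivative[OF d] by (simp add: fun_eq_iff)
    moreover have "(\<lambda>x. 2 * x $ i) differentiable_on U"
      using d unfolding differentiable_on_def differentiable_def by (meson has_derivative_at_withinI)
    ultimately show ?thesis using Suc cst by simp
  qed
  have "Ck_on k UNIV f" for k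
  proof (cases k)
    case 0
    have "continuous_on UNIV f" unfolding f_def by (intro continuous_intros)
    then show ?thesis using 0 by simp
  next
    case (Suc j)
    have "f differentiable_on UNIV"
      using df unfolding differentiable_on_def differentiable_def by blast
    then show ?thesis using Suc lin by (simp add: pf)
  qed
  then have sm: "Ck_on k (- {0}) f" for k
  proof -
    have mono: "Ck_on k U h \<Longrightarrow> Ck_on k (V \<inter> U) h" for U V and h :: "real^3 \<Rightarrow> real"
      by (induction k arbitrary: h) (auto intro: continuous_on_subset differentiable_on_subset)
    from mono[OF \<open>\<And>k. Ck_on k UNIV f\<close>] show ?thesis by simp
  qed
  have "sphere (0::real^3) r \<noteq> {}" using assms by simp
  moreover have "\<exists>U f. open U \<and> p \<in> U \<and> smooth_on U f \<and> (\<forall>x\<in>U. \<exists>i. partial i f x \<noteq> 0) \<and>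
     sphere (0::real^3) r \<inter> U = {x \<in> U. f x = 0}" if "p \<in> sphere 0 r" for p
  proof (intro exI[of _ "- {0}"] exI[of _ f] conjI ballI)
    show "p \<in> - {0}" using that assms by auto
    show "smooth_on (- {0}) f" using sm by (simp add: smooth_on_def)
    show "\<exists>i. partial i f x \<noteq> 0" if "x \<in> - {0}" for x
      using that by (simp add: pf vec_eq_iff)
    have "f x = 0 \<longleftrightarrow> norm x = r" for x
    proof -
      have "f x = 0 \<longleftrightarrow> (norm x)\<^sup>2 = r\<^sup>2" by (simp add: f_def power2_norm_eq_inner)
      then show ?thesis using assms by (simp add: power2_eq_iff_nonneg)
    qed
    then show "sphere 0 r \<inter> - {0} = {x \<in> - {0}. f x = 0}"
      by (simp only: set_eq_iff Int_iff mem_Collect_eq mem_sphere_0) blast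
  qed auto
  moreover have "compact (sphere (0::real^3) r)" by simp
  ultimately show ?thesis unfolding closed_surface_def by blast
qed

text \<open>The potential is an unknown choice, so uniqueness comes first: u \<phi> is Euclidean
  harmonic and is compared with (r + b)/|x| on large annuli, up to an arbitrary error
  \<open>\<epsilon>\<close>. Hence \<phi> = (r + b)/(|x| + b), and the energy is 4 pi (r + b)^2
  times the integral of 1/(s + b)^2 over s > r.\<close>

theorem capacity_sphere:
  assumes m: "m > 0" and r: "r > 0"
  shows "capacity (schwarzschild_metric m) (sphere 0 r) (exterior (ball 0 r)) \<le> ennreal (r + m / 2)"
proof -
  let ?g = "schwarzschild_metric m" and ?D = "- cball (0::real^3) r" and ?E = "exterior (ball 0 r)"
  define b where "b = m / 2"
  have b: "b > 0" using m by (simp add: b_def)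
  have fr: "frontier (ball (0::real^3) r) = sphere 0 r" "closure (ball (0::real^3) r) = cball 0 r" using r by auto
  define \<phi> where "\<phi> = capacity_potential ?g (sphere 0 r) ?E"
  have "\<exists>\<phi>. is_capacity_potential ?g (sphere 0 r) ?E \<phi>"
    using capacity_potential_exists[OF m closed_surface_sphere[OF r], of "ball 0 r"] r by simp
  then have "is_capacity_potential ?g (sphere 0 r) ?E \<phi>"
    unfolding \<phi>_def capacity_potential_def by (rule someI_ex)
  moreover have E: "?E = - ball 0 r" "?E - sphere 0 r = ?D"
    using exterior_eq[of "ball 0 r"] exterior_minus_frontier[of "ball 0 r"] fr r by auto
  ultimately have \<phi>: "continuous_on (- ball 0 r) \<phi>" "Ck_on 2 ?D \<phi>" "\<And>x. norm x = r \<Longrightarrow> \<phi> x = 1" "(\<phi> \<longlongrightarrow> 0) at_infinity"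
    "\<And>x. x \<in> ?D \<Longrightarrow> laplace_beltrami ?g \<phi> x = 0"
    unfolding is_capacity_potential_def by auto
  have D: "open ?D" "0 \<notin> ?D" using r by (auto intro: open_Compl)
  let ?u = "sch_factor (m / 2)"
  have u1: "1 \<le> ?u x" for x using sch_factor_ge_1[of "m/2" x] m by simp
  define \<psi> where "\<psi> x = ?u x * \<phi> x" for x
  have h\<psi>: "harmonic_at \<psi> x" if "x \<in> ?D" for x
    unfolding \<psi>_def[abs_def] by (rule schwarzschild_harmonic_product[OF m D \<phi>(2) \<phi>(5) that])
  have nlim: "((\<lambda>x::real^3. c / norm x) \<longlongrightarrow> 0) at_infinity" for c
    by (intro tendsto_divide_0[OF tendsto_const] filterlim_at_infinity_imp_norm_at_top[THEN filterlim_at_top_imp_at_infinity] filterlim_ident)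
  have diff_lim: "((\<lambda>x. \<psi> x - (r + b) / norm x) \<longlongrightarrow> 0) at_infinity"
  proof -
    have "((\<lambda>x. (1 + m / 2 / norm x) * \<phi> x - (r + b) / norm x) \<longlongrightarrow> (1 + 0) * 0 - 0) at_infinity"
      by (intro tendsto_intros \<phi>(4) nlim)
    then show ?thesis by (simp add: \<psi>_def sch_factor_eq)
  qed
  have hq: "harmonic_at (\<lambda>x. (r + b) * inv_dist 0 x + c) x" if "x \<in> ?D" for x c
  proof -
    have x0: "x \<noteq> 0" using D that by auto
    obtain e G H where e: "e > 0" and C: "\<And>y. y \<in> ball x e \<Longrightarrow> C2_at (\<lambda>x. (r + b) * inv_dist 0 x) G H y \<and> trace_op (H y) = 0"
      using harmonic_at_inv_dist[OF x0, of "r + b"] unfolding harmonic_at_iff_C2 by blast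
    have "C2_at (\<lambda>x. (r + b) * inv_dist 0 x + c) G H y" if "y \<in> ball x e" for y
      using C[OF that] has_derivative_add_const unfolding C2_at_def by blast
    then show ?thesis unfolding harmonic_at_iff_C2 using e C by blast
  qed
  have cont\<psi>: "continuous_on (- ball 0 r) \<psi>"
    unfolding \<psi>_def sch_factor_eq using r by (intro continuous_intros \<phi>(1)) auto
  have contq: "continuous_on (- ball 0 r) (\<lambda>x::real^3. (r + b) * inv_dist 0 x + c)" for c
    unfolding inv_dist_def using r by (intro continuous_intros) auto
  have \<psi>_eq: "\<psi> x = (r + b) / norm x" if x: "x \<in> ?D" for x
  proof -
    have q: "(r + b) * inv_dist 0 y = (r + b) / norm y" for y :: "real^3" by (simp add: inv_dist_def divide_inverse)
    have bound: "\<bar>\<psi> x - (r + b) / norm x\<bar> \<le> \<epsilon>" if \<epsilon>: "\<epsilon> > 0" for \<epsilon>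
    proof -
      have "\<forall>\<^sub>F x in at_infinity. dist (\<psi> x - (r + b) / norm x) 0 < \<epsilon>" using diff_lim \<epsilon> by (rule tendstoD)
      then obtain N0 where N0: "\<And>x. N0 \<le> norm x \<Longrightarrow> \<bar>\<psi> x - (r + b) / norm x\<bar> < \<epsilon>"
        unfolding eventually_at_infinity by auto
      \<comment> \<open>Large enough for the annulus to reach \<open>x\<close> and for the decay at
        infinity to give the bound \<open>\<epsilon>\<close> on the outer sphere.\<close>
      define N where "N = max N0 (norm x + 1)"
      let ?C = "cball 0 N - ball 0 r :: (real^3) set" and ?U = "ball 0 N - cball 0 r :: (real^3) set"
      have C: "compact ?C" by (intro compact_diff) auto
      have U: "open ?U" "?U \<subseteq> ?C" by (auto intro: open_Diff)
      have sub: "?C \<subseteq> - ball 0 r" "?U \<subseteq> ?D" by auto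
      have xC: "x \<in> ?C" using x by (auto simp: N_def)
      have bd: "\<bar>\<psi> y - (r + b) / norm y\<bar> \<le> \<epsilon>" if "y \<in> ?C - ?U" for y
      proof (cases "norm y = r")
        case True
        then have "\<psi> y = (r + b) / norm y"
          using \<phi>(3)[OF True] r by (simp add: \<psi>_def sch_factor_eq b_def field_simps)
        then show ?thesis using \<epsilon> by simp
      next
        case False
        then have "norm y = N" using that by auto
        then show ?thesis using N0[of y] by (simp add: N_def)
      qed
      have "(r + b) * inv_dist 0 x + (- \<epsilon>) \<le> \<psi> x"
      proof (rule superharmonic_comparison[OF C U _ _ _ _ _ xC])
        show "superharmonic_at \<psi> y" if "y \<in> ?U" for y using h\<psi> sub that by (intro harmonic_at_superharmonic_at) blast
        show "(r + b) * inv_dist 0 y + - \<epsilon> \<le> \<psi> y" if "y \<in> ?C - ?U" for y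
          using bd[OF that] unfolding q by linarith
      qed (use cont\<psi> contq hq sub in \<open>blast intro: continuous_on_subset\<close>)+
      moreover have "\<psi> x \<le> (r + b) * inv_dist 0 x + \<epsilon>"
      proof (rule superharmonic_comparison[OF C U _ _ _ _ _ xC])
        show "superharmonic_at (\<lambda>x. (r + b) * inv_dist 0 x + \<epsilon>) y" if "y \<in> ?U" for y
          using hq sub that by (intro harmonic_at_superharmonic_at) blast
        show "\<psi> y \<le> (r + b) * inv_dist 0 y + \<epsilon>" if "y \<in> ?C - ?U" for y
          using bd[OF that] unfolding q by linarith
      qed (use cont\<psi> contq h\<psi> sub in \<open>blast intro: continuous_on_subset\<close>)+
      ultimately show ?thesis unfolding q by linarith
    qed
    have "\<bar>\<psi> x - (r + b) / norm x\<bar> \<le> 0" by (rule field_le_epsilon) (use bound in simp)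
    then show ?thesis by simp
  qed
  have \<phi>_eq: "\<phi> x = (r + b) / (norm x + b)" if "x \<in> ?D" for x
  proof -
    have nx: "norm x > 0" "norm x + b > 0" using that r b by auto
    have "(1 + b / norm x) * \<phi> x = (r + b) / norm x" using \<psi>_eq[OF that] by (simp add: \<psi>_def sch_factor_eq b_def)
    moreover have "1 + b / norm x = (norm x + b) / norm x" using nx by (simp add: field_simps)
    ultimately have "(norm x + b) * \<phi> x = r + b" using nx by (simp add: field_simps)
    then show ?thesis using nx by (simp add: field_simps)
  qed
  have grad: "grad_vec \<phi> x = (- (r + b) / (norm x + b)\<^sup>2 / norm x) *\<^sub>R x" if x: "x \<in> ?D" for x
  proof -
    have nx: "x \<noteq> 0" "norm x + b \<noteq> 0" using x D b by (auto simp: add_nonneg_eq_0_iff)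
    have "((\<lambda>s. (r + b) / (s + b)) has_real_derivative - (r + b) / (norm x + b)\<^sup>2) (at (norm x))"
      using nx by (auto intro!: derivative_eq_intros simp: power2_eq_square)
    from has_derivative_radial[OF nx(1) this]
    have "(\<phi> has_derivative (\<lambda>h. - (r + b) / (norm x + b)\<^sup>2 / norm x * (x \<bullet> h))) (at x)"
      by (rule has_derivative_transform_within_open[OF _ D(1) x]) (simp add: \<phi>_eq)
    then have "(\<phi> has_derivative (\<lambda>h. ((- (r + b) / (norm x + b)\<^sup>2 / norm x) *\<^sub>R x) \<bullet> h)) (at x)" by simp
    from partial_eq[OF this] show ?thesis by (simp add: grad_vec_def vec_eq_iff)
  qed
  \<comment> \<open>For an upper bound the sphere must be discarded as a null set: the derivatives
    of the potential are not controlled on it.\<close>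
  have "AE x in vol_measure ?g. x \<notin> sphere 0 r"
  proof -
    have "sphere (0::real^3) r \<in> null_sets lborel"
      using negligible_sphere[of "0::real^3" r] by (auto simp: null_sets_completion_iff negligible_iff_null_sets)
    then have "AE x in lborel. x \<notin> sphere (0::real^3) r" by (rule AE_not_in)
    then show ?thesis unfolding vol_measure_schwarzschild[OF m] by (subst AE_density) auto
  qed
  then have "(\<integral>\<^sup>+x. ennreal (grad_norm_sq ?g \<phi> x) * indicator ?E x \<partial>vol_measure ?g) =
     (\<integral>\<^sup>+x. ennreal (grad_norm_sq ?g \<phi> x) * indicator ?D x \<partial>vol_measure ?g)"
    unfolding E(1) by (intro nn_integral_cong_AE) (auto split: split_indicator elim!: eventually_mono)
  also have "\<dots> = (\<integral>\<^sup>+x. indicator ?D x * ennreal ((1 + m / 2 / norm x)\<^sup>2 * (norm (grad_vec \<phi> x))\<^sup>2) \<partial>lborel)"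
    by (rule energy_schwarzschild[OF m borel_open[OF D(1)] continuous_grad_vec[OF \<phi>(2) D(1)]])
  also have "\<dots> = (\<integral>\<^sup>+x. indicator {r<..} (norm x) * ennreal ((r + b)\<^sup>2 / ((norm x)\<^sup>2 * (norm x + b)\<^sup>2)) \<partial>(lborel :: (real^3) measure))"
  proof (intro nn_integral_cong)
    fix x :: "real^3"
    show "indicator ?D x * ennreal ((1 + m / 2 / norm x)\<^sup>2 * (norm (grad_vec \<phi> x))\<^sup>2) =
       indicator {r<..} (norm x) * ennreal ((r + b)\<^sup>2 / ((norm x)\<^sup>2 * (norm x + b)\<^sup>2))"
    proof (cases "x \<in> ?D")
      case True
      have nx: "norm x > 0" "norm x + b > 0" using True r b by auto
      have "(norm (grad_vec \<phi> x))\<^sup>2 = ((r + b) / (norm x + b)\<^sup>2)\<^sup>2"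
        using nx r b by (simp add: grad[OF True] abs_mult)
      moreover have "1 + m / 2 / norm x = (norm x + b) / norm x" using nx by (simp add: b_def field_simps)
      ultimately have "(1 + m / 2 / norm x)\<^sup>2 * (norm (grad_vec \<phi> x))\<^sup>2 = ((norm x + b) / norm x)\<^sup>2 * ((r + b) / (norm x + b)\<^sup>2)\<^sup>2"
        by simp
      also have "\<dots> = (r + b)\<^sup>2 / ((norm x)\<^sup>2 * (norm x + b)\<^sup>2)"
        using nx by (simp add: divide_simps power2_eq_square)
      finally show ?thesis using True by simp
    qed simp
  qed
  also have "\<dots> = (\<integral>\<^sup>+s. ennreal (4 * pi * s\<^sup>2) * indicator {0..} s * (indicator {r<..} s * ennreal ((r + b)\<^sup>2 / (s\<^sup>2 * (s + b)\<^sup>2))) \<partial>lborel)"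
    by (rule nn_integral_radial) measurable
  also have "\<dots> \<le> (\<integral>\<^sup>+s. ennreal (4 * pi * (r + b)\<^sup>2 / (s + b)\<^sup>2) * indicator {r..} s \<partial>lborel)"
  proof (intro nn_integral_mono)
    fix s :: real
    have "4 * pi * s\<^sup>2 * ((r + b)\<^sup>2 / (s\<^sup>2 * (s + b)\<^sup>2)) = 4 * pi * (r + b)\<^sup>2 / (s + b)\<^sup>2" if "s > 0"
      using that by simp
    then show "ennreal (4 * pi * s\<^sup>2) * indicator {0..} s * (indicator {r<..} s * ennreal ((r + b)\<^sup>2 / (s\<^sup>2 * (s + b)\<^sup>2)))
      \<le> ennreal (4 * pi * (r + b)\<^sup>2 / (s + b)\<^sup>2) * indicator {r..} s"
      using r by (auto split: split_indicator simp: ennreal_mult'[symmetric])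
  qed
  also have "\<dots> = ennreal (0 - (- 4 * pi * (r + b)\<^sup>2 / (r + b)))"
  proof (rule nn_integral_FTC_atLeast[where F = "\<lambda>s. - 4 * pi * (r + b)\<^sup>2 / (s + b)" and T = 0])
    show "((\<lambda>s. - 4 * pi * (r + b)\<^sup>2 / (s + b)) has_real_derivative 4 * pi * (r + b)\<^sup>2 / (s + b)\<^sup>2) (at s)" if "r \<le> s" for s
      using that r b by (auto intro!: derivative_eq_intros simp: power2_eq_square)
    show "((\<lambda>s. - 4 * pi * (r + b)\<^sup>2 / (s + b)) \<longlongrightarrow> 0) at_top" by real_asymp
  qed auto
  also have "0 - (- 4 * pi * (r + b)\<^sup>2 / (r + b)) = 4 * pi * (r + b)"
    using r b by (simp add: power2_eq_square)
  finally have "capacity ?g (sphere 0 r) ?E \<le> ennreal (1 / (4 * pi)) * ennreal (4 * pi * (r + b))"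
    unfolding capacity_def \<phi>_def[symmetric] by (intro mult_left_mono) auto
  also have "\<dots> = ennreal (r + m / 2)"
    using r b by (simp add: b_def flip: ennreal_mult)
  finally show ?thesis .
qed

section \<open>Volumes in the Schwarzschild metric\<close>

text \<open>An antiderivative of the radial density 4 pi t^2 (1 + b/t)^6, expanded binomially. It is
  not the volume of a ball, which is infinite; only its differences are volumes, those of
  annuli.\<close>

definition sch_volume :: "real \<Rightarrow> real \<Rightarrow> real" where
  "sch_volume b t = 4 * pi * (t ^ 3 / 3 + 3 * b * t\<^sup>2 + 15 * b\<^sup>2 * t + 20 * b ^ 3 * ln t
     - 15 * b ^ 4 * inverse t - 3 * b ^ 5 * inverse t ^ 2 - b ^ 6 * inverse t ^ 3 / 3)"

lemma has_real_derivative_sch_volume: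
  assumes "t > 0"
  shows "(sch_volume b has_real_derivative 4 * pi * t\<^sup>2 * (1 + b / t) ^ 6) (at t)"
proof -
  define i where "i = inverse t"
  have ti: "t * i = 1" using assms by (simp add: i_def)
  have di: "(inverse has_real_derivative - (i * i)) (at t)"
    using DERIV_inverse[of t UNIV] assms by (simp add: i_def power2_eq_square)
  have dl: "(ln has_real_derivative i) (at t)"
    using DERIV_ln[OF assms] by (simp add: i_def)
  have di2: "((\<lambda>t. inverse t ^ 2) has_real_derivative - 2 * i ^ 3) (at t)"
    by (rule DERIV_cong[OF DERIV_power[OF di, of 2]]) (simp add: i_def power2_eq_square power3_eq_cube)
  have di3: "((\<lambda>t. inverse t ^ 3) has_real_derivative - 3 * i ^ 4) (at t)"
    by (rule DERIV_cong[OF DERIV_power[OF di, of 3]]) (simp add: i_def power2_eq_square power4_eq_xxxx)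
  have d2: "((\<lambda>t::real. t\<^sup>2) has_real_derivative 2 * t) (at t)"
    by (rule DERIV_cong[OF DERIV_power[OF DERIV_ident, of 2]]) simp
  have d3: "((\<lambda>t::real. t ^ 3) has_real_derivative 3 * t\<^sup>2) (at t)"
    by (rule DERIV_cong[OF DERIV_power[OF DERIV_ident, of 3]]) (simp add: power2_eq_square)
  have D: "(sch_volume b has_real_derivative 4 * pi * (3 * t\<^sup>2 / 3 + 3 * b * (2 * t) + 15 * b\<^sup>2 * 1 + 20 * b ^ 3 * i
     - 15 * b ^ 4 * (- (i * i)) - 3 * b ^ 5 * (- 2 * i ^ 3) - b ^ 6 * (- 3 * i ^ 4) / 3)) (at t)"
    unfolding sch_volume_def[abs_def]
    by (intro DERIV_cmult DERIV_add DERIV_diff DERIV_cdivide di dl di2 di3 d2 d3 DERIV_ident)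
  \<comment> \<open>With i = 1/t the identity is polynomial, and t i = 1 is the only relation
    used.\<close>
  have E: "t\<^sup>2 * (1 + b * i) ^ 6 = t\<^sup>2 + 6 * b * t + 15 * b\<^sup>2 + 20 * b ^ 3 * i + 15 * b ^ 4 * i\<^sup>2 + 6 * b ^ 5 * i ^ 3 + b ^ 6 * i ^ 4"
    using ti by algebra
  have "4 * pi * t\<^sup>2 * (1 + b / t) ^ 6 = 4 * pi * (t\<^sup>2 * (1 + b * i) ^ 6)"
    by (simp add: i_def divide_inverse)
  then have F: "4 * pi * t\<^sup>2 * (1 + b / t) ^ 6 = 4 * pi * (t\<^sup>2 + 6 * b * t + 15 * b\<^sup>2 + 20 * b ^ 3 * i + 15 * b ^ 4 * i\<^sup>2 + 6 * b ^ 5 * i ^ 3 + b ^ 6 * i ^ 4)"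
    unfolding E .
  show ?thesis
    unfolding F by (rule DERIV_cong[OF D]) (simp add: power2_eq_square algebra_simps)
qed

lemma sch_volume_strict_mono:
  assumes "b > 0" "0 < s" "s < t"
  shows "sch_volume b s < sch_volume b t"
proof (rule DERIV_pos_imp_increasing[OF assms(3)])
  fix x assume "s \<le> x" "x \<le> t"
  then have x: "x > 0" "1 + b / x > 0" using assms by (auto intro: add_pos_pos)
  then have "0 < 4 * pi * x\<^sup>2 * (1 + b / x) ^ 6" by simp
  then show "\<exists>y. (sch_volume b has_real_derivative y) (at x) \<and> 0 < y"
    using has_real_derivative_sch_volume[OF x(1), of b] by blast
qed

lemma continuous_on_sch_volume: "0 < s \<Longrightarrow> continuous_on {s..t} (sch_volume b)"
  by (intro continuous_at_imp_continuous_on ballI DERIV_isCont[OF has_real_derivative_sch_volume]) auto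

abbreviation sch_measure :: "real \<Rightarrow> (real^3) measure" where
  "sch_measure m \<equiv> vol_measure (schwarzschild_metric m)"

lemma sets_sch_measure [measurable_cong, simp]: "sets (sch_measure m) = sets borel"
  by (simp add: vol_measure_def)

lemma emeasure_sch_measure:
  assumes "m > 0" "A \<in> sets borel"
  shows "emeasure (sch_measure m) A = (\<integral>\<^sup>+x. ennreal (sch_factor (m / 2) x ^ 6) * indicator A x \<partial>lborel)"
  unfolding vol_measure_schwarzschild[OF assms(1)] using assms(2) by (intro emeasure_density) auto

lemma emeasure_annulus:
  assumes m: "m > 0" and s: "0 < s" "s \<le> r"
  shows "emeasure (sch_measure m) (ball 0 r - ball 0 s) = ennreal (sch_volume (m / 2) r - sch_volume (m / 2) s)"
proof -
  define b where "b = m / 2"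
  have b: "b > 0" using m by (simp add: b_def)
  have "emeasure (sch_measure m) (ball 0 r - ball 0 s) =
     (\<integral>\<^sup>+x. ennreal ((1 + b / norm (x::real^3)) ^ 6) * indicator {s..<r} (norm x) \<partial>lborel)"
    by (subst emeasure_sch_measure[OF m]) (auto simp: sch_factor_eq b_def intro!: nn_integral_cong split: split_indicator)
  also have "\<dots> = (\<integral>\<^sup>+t. ennreal (4 * pi * t\<^sup>2) * indicator {0..} t * (ennreal ((1 + b / t) ^ 6) * indicator {s..<r} t) \<partial>lborel)"
    by (rule nn_integral_radial) measurable
  also have "\<dots> = (\<integral>\<^sup>+t. ennreal (4 * pi * t\<^sup>2 * (1 + b / t) ^ 6) * indicator {s..r} t \<partial>lborel)"
  \<comment> \<open>The annulus is half-open and the interval of integration closed; they differ in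
    the single radius \<open>r\<close>.\<close>
  proof (rule nn_integral_cong_AE)
    show "AE t in lborel. ennreal (4 * pi * t\<^sup>2) * indicator {0..} t * (ennreal ((1 + b / t) ^ 6) * indicator {s..<r} t) =
       ennreal (4 * pi * t\<^sup>2 * (1 + b / t) ^ 6) * indicator {s..r} t"
      using AE_lborel_singleton[of r]
    proof eventually_elim
      case (elim t)
      have "ennreal (4 * pi * t\<^sup>2) * ennreal ((1 + b / t) ^ 6) = ennreal (4 * pi * t\<^sup>2 * (1 + b / t) ^ 6)"
        by (rule ennreal_mult'[symmetric]) simp
      then show ?case using elim s by (simp split: split_indicator)
    qed
  qed
  also have "\<dots> = ennreal (sch_volume b r - sch_volume b s)"
    by (rule nn_integral_FTC_Icc[where F = "sch_volume b"])
      (use s in \<open>auto intro!: has_real_derivative_sch_volume\<close>)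
  finally show ?thesis by (simp add: b_def)
qed

lemma measure_annulus:
  assumes "m > 0" "0 < s" "s \<le> r"
  shows "measure (sch_measure m) (ball 0 r - ball 0 s) = sch_volume (m / 2) r - sch_volume (m / 2) s"
proof -
  have "sch_volume (m / 2) s \<le> sch_volume (m / 2) r"
    using sch_volume_strict_mono[of "m / 2" s r] assms by (cases "s = r") auto
  then show ?thesis using emeasure_annulus[OF assms] by (intro measure_eq_emeasure_eq_ennreal) auto
qed

lemma signed_volume_ball:
  assumes m: "m > 0" and r: "r > 0"
  shows "signed_volume m (ball 0 r) = sch_volume (m / 2) r - sch_volume (m / 2) (m / 2)"
proof (cases "m / 2 \<le> r")
  case True
  then have e: "ball 0 (m / 2) - ball 0 r = ({} :: (real^3) set)" by (auto simp: subset_ball)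
  show ?thesis unfolding signed_volume_def e using measure_annulus[OF m _ True] m by simp
next
  case False
  then have e: "ball 0 r - ball 0 (m / 2) = ({} :: (real^3) set)" by (auto simp: subset_ball)
  show ?thesis unfolding signed_volume_def e using measure_annulus[OF m r, of "m / 2"] False by simp
qed

lemma measure_minus_measure:
  assumes "A \<in> sets M" "B \<in> sets M" "emeasure M A \<noteq> \<infinity>" "emeasure M B \<noteq> \<infinity>"
  shows "measure M A - measure M B = measure M (A - B) - measure M (B - A)"
proof -
  have split: "measure M A = measure M (A - B) + measure M (A \<inter> B)"
    if "A \<in> sets M" "B \<in> sets M" "emeasure M A \<noteq> \<infinity>" for A B
  proof -
    have "emeasure M (A - B) \<le> emeasure M A" "emeasure M (A \<inter> B) \<le> emeasure M A"
      using that by (auto intro!: emeasure_mono)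
    then have "emeasure M (A - B) \<noteq> \<infinity>" "emeasure M (A \<inter> B) \<noteq> \<infinity>"
      using that(3) by (auto simp: top_unique)
    then have "measure M ((A - B) \<union> (A \<inter> B)) = measure M (A - B) + measure M (A \<inter> B)"
      using that by (intro measure_Union) auto
    moreover have "(A - B) \<union> (A \<inter> B) = A" by blast
    ultimately show ?thesis by simp
  qed
  show ?thesis
    using split[OF assms(1,2,3)] split[OF assms(2,1,4)] by (simp add: Int_commute)
qed

lemma emeasure_sch_finite:
  assumes "m > 0" "0 < s" "s \<le> T" "A \<subseteq> ball 0 T - ball 0 s" "A \<in> sets borel"
  shows "emeasure (sch_measure m) A \<noteq> \<infinity>"
proof -
  have "emeasure (sch_measure m) A \<le> emeasure (sch_measure m) (ball 0 T - ball 0 s)"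
    using assms by (intro emeasure_mono) auto
  then show ?thesis using emeasure_annulus[OF assms(1-3)] by (auto simp: top_unique)
qed

text \<open>\<open>measure\<close> assigns 0 to a set of infinite volume, so a small ball contained
  in both sets is removed before volumes are subtracted.\<close>

lemma measure_punctured_diff:
  assumes m: "m > 0" and s: "0 < s" "s \<le> T" and A: "ball 0 s \<subseteq> A" "A \<subseteq> ball 0 T" "A \<in> sets borel"
    and B: "ball 0 s \<subseteq> B" "B \<subseteq> ball 0 T" "B \<in> sets borel"
  shows "measure (sch_measure m) (A - ball 0 s) - measure (sch_measure m) (B - ball 0 s) =
    measure (sch_measure m) (A - B) - measure (sch_measure m) (B - A)"
proof -
  have *: "(A - ball 0 s) - (B - ball 0 s) = A - B" "(B - ball 0 s) - (A - ball 0 s) = B - A"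
    using A B by auto
  have fin: "emeasure (sch_measure m) (A - ball 0 s) \<noteq> \<infinity>" "emeasure (sch_measure m) (B - ball 0 s) \<noteq> \<infinity>"
    by (rule emeasure_sch_finite[OF m s]; use A B in auto)+
  show ?thesis
    using measure_minus_measure[OF _ _ fin] A B unfolding * by auto
qed

text \<open>Telescopes through the horizon ball, with all three sets punctured by the same small
  ball.\<close>

lemma signed_volume_diff:
  assumes m: "m > 0" and s: "0 < s" "s \<le> m / 2" "m / 2 \<le> T"
    and A: "ball 0 s \<subseteq> A" "A \<subseteq> ball 0 T" "A \<in> sets borel"
    and B: "ball 0 s \<subseteq> B" "B \<subseteq> ball 0 T" "B \<in> sets borel"
  shows "signed_volume m A - signed_volume m B = measure (sch_measure m) (A - B) - measure (sch_measure m) (B - A)"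
proof -
  have sT: "s \<le> T" using s by simp
  have H: "ball 0 s \<subseteq> ball (0::real^3) (m / 2)" "ball (0::real^3) (m / 2) \<subseteq> ball 0 T" "ball (0::real^3) (m / 2) \<in> sets borel"
    using s by (auto simp: subset_ball)
  show ?thesis
    using measure_punctured_diff[OF m s(1) sT A H] measure_punctured_diff[OF m s(1) sT B H]
      measure_punctured_diff[OF m s(1) sT A B]
    unfolding signed_volume_def by linarith
qed

lemma ball_bounds:
  fixes \<Omega> :: "(real^3) set"
  assumes "open \<Omega>" "bounded \<Omega>" "0 \<in> \<Omega>" "c > 0"
  obtains s T where "0 < s" "s \<le> c" "c \<le> T" "ball 0 s \<subseteq> \<Omega>" "\<Omega> \<subseteq> ball 0 T"
proof -
  obtain e where e: "e > 0" "ball 0 e \<subseteq> \<Omega>" using assms open_contains_ball by blast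
  obtain N where N: "\<And>x. x \<in> \<Omega> \<Longrightarrow> norm x < N" using assms(2) bounded_pos_less by metis
  show thesis
  proof (rule that)
    show "ball 0 (min e c) \<subseteq> \<Omega>" using e by auto
    show "\<Omega> \<subseteq> ball 0 (max N c)" using N by fastforce
  qed (use e assms in auto)
qed

text \<open>A ball inside \<open>\<Omega>\<close> and one around it bracket the signed volume; the
  radial volume function is continuous and strictly increasing.\<close>

lemma signed_volume_ex1:
  assumes m: "m > 0" and \<Omega>: "open \<Omega>" "bounded \<Omega>" "0 \<in> \<Omega>"
  shows "\<exists>!r. r > 0 \<and> signed_volume m (ball 0 r) = signed_volume m \<Omega>"
proof -
  obtain s T where s: "0 < s" "s \<le> m / 2" "m / 2 \<le> T" "ball 0 s \<subseteq> \<Omega>" "\<Omega> \<subseteq> ball 0 T"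
    using ball_bounds[OF \<Omega>, of "m / 2"] m by auto
  have sT: "s \<le> T" using s by simp
  then have sub: "ball 0 s \<subseteq> ball (0::real^3) T" by (rule subset_ball)
  have d1: "signed_volume m \<Omega> - signed_volume m (ball 0 s) = measure (sch_measure m) (\<Omega> - ball 0 s) - measure (sch_measure m) (ball 0 s - \<Omega>)"
    using s sub \<Omega> by (intro signed_volume_diff[OF m s(1-3)]) auto
  have e1: "ball 0 s - \<Omega> = {}" using s by auto
  have lo: "signed_volume m (ball 0 s) \<le> signed_volume m \<Omega>"
    using d1[unfolded e1 measure_empty] measure_nonneg[of "sch_measure m" "\<Omega> - ball 0 s"] by linarith
  have d2: "signed_volume m (ball 0 T) - signed_volume m \<Omega> = measure (sch_measure m) (ball 0 T - \<Omega>) - measure (sch_measure m) (\<Omega> - ball 0 T)"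
    using s sub \<Omega> by (intro signed_volume_diff[OF m s(1-3)]) auto
  have e2: "\<Omega> - ball 0 T = {}" using s by auto
  have hi: "signed_volume m \<Omega> \<le> signed_volume m (ball 0 T)"
    using d2[unfolded e2 measure_empty] measure_nonneg[of "sch_measure m" "ball 0 T - \<Omega>"] by linarith
  define v where "v = signed_volume m \<Omega> + sch_volume (m / 2) (m / 2)"
  have v: "signed_volume m (ball 0 r) = signed_volume m \<Omega> \<longleftrightarrow> sch_volume (m / 2) r = v" if "r > 0" for r
    using signed_volume_ball[OF m that] by (auto simp: v_def)
  have "sch_volume (m / 2) s \<le> v" "v \<le> sch_volume (m / 2) T"
    using lo hi signed_volume_ball[OF m] s(1) sT by (auto simp: v_def)
  from IVT'[OF this sT continuous_on_sch_volume[OF s(1)]]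
  obtain r where r: "s \<le> r" "sch_volume (m / 2) r = v" by auto
  show ?thesis
  proof (rule ex1I[of _ r])
    show "r > 0 \<and> signed_volume m (ball 0 r) = signed_volume m \<Omega>" using v r s by simp
    fix t assume t: "t > 0 \<and> signed_volume m (ball 0 t) = signed_volume m \<Omega>"
    then have "sch_volume (m / 2) t = v" using v[of t] by blast
    then have "sch_volume (m / 2) t = sch_volume (m / 2) r" using r(2) by simp
    then show "t = r"
      using sch_volume_strict_mono[of "m / 2" t r] sch_volume_strict_mono[of "m / 2" r t] t r s m
      by (cases t r rule: linorder_cases) auto
  qed
qed

lemma open_emeasure_0_imp_empty:
  fixes S :: "'a::euclidean_space set"
  assumes "open S" "emeasure lborel S = 0"
  shows "S = {}"
proof -
  have "S \<in> null_sets lborel" using assms by (auto simp: null_sets_def)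
  then have "negligible S" by (simp add: negligible_iff_null_sets null_sets_completionI)
  then show ?thesis using assms(1) open_not_negligible by blast
qed

text \<open>Bathtub principle: the density of the Schwarzschild volume decreases in \<open>r\<close>.\<close>

lemma same_volume_imp_larger_or_ball:
  assumes m: "m > 0" and \<Omega>: "open \<Omega>" "bounded \<Omega>" "0 \<in> \<Omega>" and r: "r > 0"
    and eq: "signed_volume m (ball 0 r) = signed_volume m \<Omega>"
  shows "emeasure lborel (ball (0::real^3) r) < emeasure lborel \<Omega> \<or> \<Omega> \<subseteq> ball 0 r \<and> ball 0 r \<subseteq> closure \<Omega>"
proof (rule ccontr)
  let ?B = "ball (0::real^3) r" and ?\<mu> = "sch_measure m" and ?u = "sch_factor (m / 2)"
  define b where "b = m / 2"
  have b: "b > 0" using m by (simp add: b_def)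
  assume neg: "\<not> (emeasure lborel ?B < emeasure lborel \<Omega> \<or> \<Omega> \<subseteq> ?B \<and> ?B \<subseteq> closure \<Omega>)"
  \<comment> \<open>One small ball inside \<open>\<Omega>\<close>, the horizon ball and the
    comparison ball, and one large ball around all three.\<close>
  obtain s T where s: "0 < s" "s \<le> min (m / 2) r" "max (m / 2) r \<le> T" "ball 0 s \<subseteq> \<Omega>" "\<Omega> \<subseteq> ball 0 T"
  proof -
    obtain s T where *: "0 < s" "s \<le> min (m / 2) r" "min (m / 2) r \<le> T" "ball 0 s \<subseteq> \<Omega>" "\<Omega> \<subseteq> ball 0 T"
      using ball_bounds[OF \<Omega>, of "min (m / 2) r"] m r by auto
    have "\<Omega> \<subseteq> ball 0 (max T (max (m / 2) r))"
      using *(5) by (rule order_trans) (simp add: subset_ball)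
    with * show thesis by (intro that[of s "max T (max (m / 2) r)"]) auto
  qed
  have s': "s \<le> m / 2" "m / 2 \<le> T" "s \<le> T" using s by auto
  have B: "ball 0 s \<subseteq> ?B" "?B \<subseteq> ball 0 T" using s by (auto intro: subset_ball)
  have [measurable]: "\<Omega> \<in> sets borel" using \<Omega> by simp
  have [measurable]: "ball (0::real^3) r \<in> sets borel" by simp
  have "measure ?\<mu> (\<Omega> - ?B) = measure ?\<mu> (?B - \<Omega>)"
    using signed_volume_diff[OF m s(1) s'(1,2) s(4,5) _ B] eq by simp
  moreover have "emeasure ?\<mu> (\<Omega> - ?B) \<noteq> \<infinity>" "emeasure ?\<mu> (?B - \<Omega>) \<noteq> \<infinity>"
    by (rule emeasure_sch_finite[OF m s(1) s'(3)]; use s B \<Omega> in auto)+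
  ultimately have \<mu>: "emeasure ?\<mu> (\<Omega> - ?B) = emeasure ?\<mu> (?B - \<Omega>)"
    by (simp add: emeasure_eq_ennreal_measure)
  have L: "emeasure lborel A \<noteq> \<infinity>" if "A \<subseteq> ball (0::real^3) T" "A \<in> sets borel" for A
  proof -
    have "emeasure lborel A \<le> emeasure lborel (ball (0::real^3) T)" using that by (intro emeasure_mono) auto
    then show ?thesis using emeasure_lborel_ball_finite[of "0::real^3" T] by (auto simp: top_unique)
  qed
  have fin: "emeasure lborel (\<Omega> - ?B) \<noteq> \<infinity>" "emeasure lborel (?B - \<Omega>) \<noteq> \<infinity>"
     "emeasure lborel \<Omega> \<noteq> \<infinity>" "emeasure lborel ?B \<noteq> \<infinity>"
    by (rule L; use s B \<Omega> in auto)+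
  have le: "emeasure lborel (\<Omega> - ?B) \<le> emeasure lborel (?B - \<Omega>)"
  proof -
    have "measure lborel \<Omega> \<le> measure lborel ?B"
      using neg fin by (auto simp: emeasure_eq_ennreal_measure not_less)
    then have "measure lborel (\<Omega> - ?B) \<le> measure lborel (?B - \<Omega>)"
      using measure_minus_measure[of \<Omega> lborel ?B] fin by simp
    then show ?thesis using fin by (simp add: emeasure_eq_ennreal_measure)
  qed
  \<comment> \<open>The density on the sphere of radius \<open>r\<close>: it bounds the density from
    below on the part of the ball outside \<open>\<Omega>\<close>, and from above on the part of
    \<open>\<Omega>\<close> outside the ball.\<close>
  define k where "k = (1 + b / r) ^ 6"
  have "1 + b / r > 0" using b r by (intro add_pos_pos) auto
  then have k: "k > 0" by (simp add: k_def)
  have u: "?u x > 0" for x using sch_factor_ge_1[of "m/2" x] m by simp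
  have inner: "k \<le> ?u x ^ 6" if "x \<in> ?B - \<Omega>" for x
  proof -
    have nx: "0 < norm x" "norm x \<le> r" using that \<Omega>(3) by auto
    then have "b / r \<le> b / norm x" using b r by (intro divide_left_mono) auto
    then have "1 + b / r \<le> ?u x" by (simp add: sch_factor_eq b_def)
    then show ?thesis unfolding k_def using b r by (intro power_mono) auto
  qed
  have outer: "?u x ^ 6 < k" if "r < norm x" for x
  proof -
    have "0 < norm x * r" using that r by (intro mult_pos_pos) auto
    then have "b / norm x < b / r" using that b r by (intro divide_strict_left_mono) auto
    then have "?u x < 1 + b / r" by (simp add: sch_factor_eq b_def)
    then show ?thesis unfolding k_def using u[of x] by (intro power_strict_mono) auto
  qed
  have outer': "?u x ^ 6 \<le> k" if "x \<in> \<Omega> - ?B" for x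
  proof (cases "norm x = r")
    case True then show ?thesis by (simp add: sch_factor_eq b_def k_def)
  next
    case False then show ?thesis using outer[of x] that by auto
  qed
  \<comment> \<open>The deficit of the density below \<open>k\<close> on the part of
    \<open>\<Omega>\<close> outside the ball. Its integrand is positive beyond the closed ball, so
    the vanishing of the integral confines \<open>\<Omega>\<close> to that ball up to a null
    set.\<close>
  define I where "I = (\<integral>\<^sup>+x. ennreal (k - ?u x ^ 6) * indicator (\<Omega> - ?B) x \<partial>lborel)"
  have mm: "emeasure ?\<mu> (\<Omega> - ?B) = (\<integral>\<^sup>+x. ennreal (?u x ^ 6) * indicator (\<Omega> - ?B) x \<partial>lborel)"
    by (rule emeasure_sch_measure[OF m]) simp
  have "I + emeasure ?\<mu> (\<Omega> - ?B) = (\<integral>\<^sup>+x. ennreal (k - ?u x ^ 6) * indicator (\<Omega> - ?B) x + ennreal (?u x ^ 6) * indicator (\<Omega> - ?B) x \<partial>lborel)"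
    unfolding I_def mm by (rule nn_integral_add[symmetric]; measurable)
  also have "\<dots> = (\<integral>\<^sup>+x. ennreal k * indicator (\<Omega> - ?B) x \<partial>lborel)"
  proof (intro nn_integral_cong)
    fix x
    show "ennreal (k - ?u x ^ 6) * indicator (\<Omega> - ?B) x + ennreal (?u x ^ 6) * indicator (\<Omega> - ?B) x = ennreal k * indicator (\<Omega> - ?B) x"
    proof (cases "x \<in> \<Omega> - ?B")
      case True
      have "ennreal (k - ?u x ^ 6) + ennreal (?u x ^ 6) = ennreal (k - ?u x ^ 6 + ?u x ^ 6)"
        using outer'[OF True] u[of x] by (intro ennreal_plus[symmetric]) auto
      then show ?thesis using True by simp
    qed simp
  qed
  also have "\<dots> = ennreal k * emeasure lborel (\<Omega> - ?B)"
    by (rule nn_integral_cmult_indicator) simp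
  also have "\<dots> \<le> ennreal k * emeasure lborel (?B - \<Omega>)"
    by (intro mult_left_mono le) simp
  finally have I1: "I + emeasure ?\<mu> (\<Omega> - ?B) \<le> ennreal k * emeasure lborel (?B - \<Omega>)" .
  have kB: "ennreal k * emeasure lborel (?B - \<Omega>) \<le> emeasure ?\<mu> (?B - \<Omega>)"
  proof -
    have "ennreal k * emeasure lborel (?B - \<Omega>) = (\<integral>\<^sup>+x. ennreal k * indicator (?B - \<Omega>) x \<partial>lborel)"
      by (rule nn_integral_cmult_indicator[symmetric]) simp
    also have "\<dots> \<le> (\<integral>\<^sup>+x. ennreal (?u x ^ 6) * indicator (?B - \<Omega>) x \<partial>lborel)"
      by (intro nn_integral_mono) (use inner in \<open>auto intro!: ennreal_leI split: split_indicator\<close>)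
    also have "\<dots> = emeasure ?\<mu> (?B - \<Omega>)"
      by (rule emeasure_sch_measure[OF m, symmetric]) simp
    finally show ?thesis .
  qed
  \<comment> \<open>Equal Schwarzschild volumes of the two difference sets, and the reverse
    inequality of their Euclidean volumes, leave no room for \<open>I\<close>.\<close>
  have "emeasure ?\<mu> (?B - \<Omega>) + I \<le> emeasure ?\<mu> (?B - \<Omega>) + 0"
    using order_trans[OF I1 kB] unfolding \<mu> add_0_right by (simp only: add.commute)
  then have "I = 0"
    using \<open>emeasure ?\<mu> (?B - \<Omega>) \<noteq> \<infinity>\<close> unfolding ennreal_add_left_cancel_le by simp
  moreover have "(\<lambda>x. ennreal (k - ?u x ^ 6) * indicator (\<Omega> - ?B) x) \<in> borel_measurable lborel"
    by measurable
  ultimately have "AE x in lborel. ennreal (k - ?u x ^ 6) * indicator (\<Omega> - ?B) x = 0"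
    using nn_integral_0_iff_AE unfolding I_def by blast
  then have A: "AE x in lborel. x \<notin> \<Omega> - cball 0 r"
  proof eventually_elim
    case (elim x)
    show ?case
    proof
      assume x: "x \<in> \<Omega> - cball 0 r"
      then have "indicator (\<Omega> - ?B) x = (1 :: ennreal)" by simp
      then have "ennreal (k - ?u x ^ 6) = 0" using elim by (simp only: mult_1_right)
      moreover have "0 < k - ?u x ^ 6" using outer[of x] x by auto
      ultimately show False by (simp add: ennreal_eq_0_iff)
    qed
  qed
  have N: "\<Omega> - cball 0 r \<in> sets lborel" using \<Omega> by auto
  have N': "{x \<in> space lborel. \<not> x \<notin> \<Omega> - cball 0 r} = \<Omega> - cball 0 r" by auto
  have "emeasure lborel (\<Omega> - cball 0 r) = 0"
    by (rule iffD1[OF AE_iff_measurable[OF N N'] A])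
  then have "\<Omega> - cball 0 r = {}"
    by (intro open_emeasure_0_imp_empty open_Diff \<Omega>) auto
  then have "\<Omega> \<subseteq> interior (cball 0 r)" using \<Omega>(1) by (intro interior_maximal) auto
  then have sub: "\<Omega> \<subseteq> ?B" by simp
  then have e: "\<Omega> - ?B = {}" by blast
  have "emeasure ?\<mu> (?B - \<Omega>) = 0" using \<mu> unfolding e by simp
  then have "ennreal k * emeasure lborel (?B - \<Omega>) = 0" using kB by simp
  then have null: "emeasure lborel (?B - \<Omega>) = 0" using k by (auto simp: ennreal_eq_0_iff)
  \<comment> \<open>Equality of the sets does not follow yet: \<open>\<Omega>\<close> may still omit
    a relatively closed null set of the ball.\<close>
  have "emeasure lborel (?B - closure \<Omega>) \<le> emeasure lborel (?B - \<Omega>)"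
    using closure_subset[of \<Omega>] by (intro emeasure_mono) auto
  then have "?B - closure \<Omega> = {}"
    using null by (intro open_emeasure_0_imp_empty open_Diff) auto
  then show False using neg sub by blast
qed

section \<open>The equality case and the conclusion\<close>

text \<open>A point of the ball missing from \<open>\<Omega>\<close> would lie on
  \<open>\<Sigma>\<close>, and near it \<open>\<Omega>\<close> would contain everything off
  \<open>\<Sigma>\<close>, which puts \<open>\<Omega>\<close> on both sides of the surface.\<close>

lemma almost_ball_eq_ball:
  fixes \<Omega> :: "(real^3) set"
  assumes S: "closed_surface \<Sigma>" and \<Omega>: "open \<Omega>" "connected \<Omega>" "bounded \<Omega>" and \<Sigma>: "\<Sigma> = frontier \<Omega>"
    and B: "\<Omega> \<subseteq> ball 0 r" "ball 0 r \<subseteq> closure \<Omega>"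
  shows "\<Omega> = ball 0 r"
proof (rule ccontr)
  assume "\<Omega> \<noteq> ball 0 r"
  then obtain p where p: "p \<in> ball 0 r" "p \<notin> \<Omega>" using B by blast
  have fr: "frontier \<Omega> = closure \<Omega> - \<Omega>" using \<Omega>(1) by (simp add: frontier_def interior_open)
  obtain e where e: "e > 0" "ball p e \<subseteq> ball 0 r" using p(1) open_ball open_contains_ball by blast
  have "p \<in> \<Sigma>" "\<Omega> \<inter> \<Sigma> = {}" "ball p e - \<Sigma> \<subseteq> \<Omega>" using p e B by (auto simp: \<Sigma> fr)
  then show False using closed_surface_not_both_sides[OF S \<Omega> _ _ e(1), of p] by blast
qed

text \<open>\<open>\<Omega>\<close> and the ball are both connected, contain 0 and miss the common
  frontier, so each lies in the other.\<close>

lemma frontier_sphere_imp_ball: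
  fixes \<Omega> :: "(real^3) set"
  assumes \<Omega>: "open \<Omega>" "connected \<Omega>" "0 \<in> \<Omega>" and r: "r > 0" and fr: "frontier \<Omega> = sphere 0 r"
  shows "\<Omega> = ball 0 r"
proof
  have "0 \<in> ball 0 r \<inter> \<Omega>" using \<Omega> r by simp
  then have ne: "ball 0 r \<inter> \<Omega> \<noteq> {}" "\<Omega> \<inter> ball 0 r \<noteq> {}" by blast+
  show "ball 0 r \<subseteq> \<Omega>"
    by (rule connected_side[OF connected_ball _ ne(1)]) (auto simp: fr)
  have "\<Omega> \<inter> frontier \<Omega> = {}" using \<Omega>(1) by (simp add: frontier_def interior_open)
  then show "\<Omega> \<subseteq> ball 0 r"
    using fr r by (intro connected_side[OF \<Omega>(2) _ ne(2)]) simp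
qed

theorem theorem1p10:
  fixes m :: real and \<Sigma> \<Omega> :: "(real ^ 3) set"
  assumes "m > 0"
    and "closed_surface \<Sigma>"
    and "open \<Omega>" and "connected \<Omega>" and "bounded \<Omega>" and "0 \<in> \<Omega>"
    and "\<Sigma> = frontier \<Omega>"
  shows "(\<exists>!r. r > 0 \<and> signed_volume m (ball 0 r) = signed_volume m \<Omega>) \<and>
    (\<forall>r \<Sigma>'. r > 0 \<longrightarrow> signed_volume m (ball 0 r) = signed_volume m \<Omega> \<longrightarrow> \<Sigma>' = sphere 0 r \<longrightarrow>
      capacity (schwarzschild_metric m) \<Sigma> (exterior \<Omega>)
        \<ge> capacity (schwarzschild_metric m) \<Sigma>' (exterior (ball 0 r)) \<and>
      (capacity (schwarzschild_metric m) \<Sigma> (exterior \<Omega>)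
        = capacity (schwarzschild_metric m) \<Sigma>' (exterior (ball 0 r)) \<longleftrightarrow> \<Sigma> = \<Sigma>'))"
proof (intro conjI allI impI)
  show "\<exists>!r. r > 0 \<and> signed_volume m (ball 0 r) = signed_volume m \<Omega>"
    using assms by (intro signed_volume_ex1)
next
  fix r and \<Sigma>' :: "(real^3) set"
  assume r: "0 < r" and eq: "signed_volume m (ball 0 r) = signed_volume m \<Omega>" and \<Sigma>': "\<Sigma>' = sphere 0 r"
  let ?c = "capacity (schwarzschild_metric m) \<Sigma> (exterior \<Omega>)" and ?c' = "capacity (schwarzschild_metric m) \<Sigma>' (exterior (ball 0 r))"
  have "?c' \<le> ?c \<and> (?c = ?c' \<longleftrightarrow> \<Sigma> = \<Sigma>')"
  \<comment> \<open>For the ball both capacities are the same expression. In the other case strict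
    inequality is proved, so that both sides of the equivalence are false.\<close>
  proof (cases "\<Omega> = ball 0 r")
    case True
    then show ?thesis using r assms(7) \<Sigma>' by simp
  next
    case False
    then have "emeasure lborel (ball (0::real^3) r) < emeasure lborel \<Omega>"
      using same_volume_imp_larger_or_ball[OF assms(1,3,5,6) r eq] almost_ball_eq_ball[OF assms(2,3,4,5,7), of r] by blast
    moreover have fin: "emeasure lborel \<Omega> \<noteq> top" and fin': "emeasure lborel (ball (0::real^3) r) \<noteq> top"
      using emeasure_bounded_finite[OF assms(5)] emeasure_bounded_finite[OF bounded_ball, of "0::real^3" r] by auto
    ultimately have "measure lborel (ball (0::real^3) r) < measure lborel \<Omega>"
      unfolding emeasure_eq_ennreal_measure[OF fin] emeasure_eq_ennreal_measure[OF fin'] by (simp add: ennreal_less_iff)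
    moreover have "measure lborel (ball (0::real^3) r) = 4 / 3 * pi * r ^ 3"
      using content_ball[of r "0::real^3"] r by (simp add: unit_ball_vol_3)
    ultimately have vol: "4 / 3 * pi * r ^ 3 < measure lborel \<Omega>" by (simp only:)
    \<comment> \<open>The volume radius of \<open>\<Omega>\<close>, which exceeds \<open>r\<close>
      because the Euclidean volume of \<open>\<Omega>\<close> is strictly larger.\<close>
    define R where "R = root 3 (measure lborel \<Omega> / (4 / 3 * pi))"
    have R3: "4 / 3 * pi * R ^ 3 = measure lborel \<Omega>"
      unfolding R_def by (simp add: odd_real_root_pow)
    have "0 < 4 / 3 * pi * r ^ 3" using r by simp
    then have "0 < measure lborel \<Omega>" using vol by (rule less_trans)
    then have "R > 0" unfolding R_def by (intro real_root_gt_zero divide_pos_pos) auto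
    have "4 / 3 * pi * r ^ 3 < 4 / 3 * pi * R ^ 3" using vol unfolding R3 .
    then have "r ^ 3 < R ^ 3" using mult_less_cancel_left_pos[of "4 / 3 * pi" "r ^ 3" "R ^ 3"] by simp
    then have rR: "r < R" by (rule power_less_imp_less_base[of r 3 R]) (use \<open>R > 0\<close> in simp)
    have "?c' \<le> ennreal (r + m / 2)" unfolding \<Sigma>' by (rule capacity_sphere[OF assms(1) r])
    also have "\<dots> < ennreal (R + m / 2)" using rR r assms(1) by (intro ennreal_lessI) auto
    also have "\<dots> \<le> ?c"
      using \<open>R > 0\<close> R3 fin by (intro capacity_lower_bound assms) (auto simp: emeasure_eq_ennreal_measure)
    finally have "?c' < ?c" .
    \<comment> \<open>Equal surfaces would make \<open>\<Omega>\<close> the ball.\<close>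
    moreover have "\<Sigma> \<noteq> \<Sigma>'"
      using frontier_sphere_imp_ball[OF assms(3,4,6) r] False assms(7) \<Sigma>' by auto
    ultimately show ?thesis by auto
  qed
  then show "?c' \<le> ?c" "(?c = ?c') = (\<Sigma> = \<Sigma>')" by auto
qed

end
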